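(* Let $G$ be a finite connected undirected graph. The proper-walk connection number of $G$ (the minimum number $k$ of colours such that some colouring $c:E(G)\to\{1,\dots,k\}$ makes $G$ properly connected) is given by the first of the following cases that applies: (1) it is $1$ if $G$ is complete; (2) it is the maximum degree $\Delta(G)$ if $G$ is a tree; (3) it is $2$ if $G$ is bipartite and can be made 2-edge-connected by adding at most one edge; (4) it is $2$ if $G$ is non-bipartite and has an $\mathscr S$-free component $\mathcal K$ such that $G\setminus\mathcal K$ is empty or can be made 2-edge-connected by adding at most one edge; (5) it is $3$ otherwise. Furthermore, in every case an optimal connecting edge-colouring of $G$ can be computed in time polynomial in the size of $G$.
   Context: An edge-colouring of $G=(V,E)$ is a function $c:E\to\{1,\dots,k\}$. A walk is a sequence of vertices $v_0,\dots,v_l$ with $v_{j-1}v_j\in E$; it may repeat vertices and edges; its length is $l$; it is closed if $v_0=v_l$, and odd/even according to the parity of $l$. A walk is properly coloured if no two consecutive edges of the walk have the same colour. The coloured graph is properly connected (and $c$ is a connecting edge-colouring) if for every two vertices $u,v$ there is a properly coloured walk between $u$ and $v$. An edge is stubborn if it belongs to every closed walk of odd length in $G$ (so in a bipartite graph every edge is stubborn); $\mathscr S$ denotes the set of stubborn edges. An $\mathscr S$-free component is (the vertex set of) a connected component of the graph $G\setminus\mathscr S$ obtained by deleting all stubborn edges. For a vertex set $\mathcal K$, $G\setminus\mathcal K$ is the subgraph induced by $V\setminus\mathcal K$. A graph is 2-edge-connected if it is connected and has no bridge (a single vertex counts as 2-edge-connected); a graph "can be made 2-edge-connected by adding at most one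 edge" if it is 2-edge-connected or there is an edge $e$ (possibly parallel to an existing edge) such that the graph plus $e$ is 2-edge-connected. *)

theory Defs
  imports Main "HOL-Library.FuncSet" "HOL-Library.Multiset"
    "HOL-Computational_Algebra.Polynomial"
begin

section \<open>Graphs\<close>

definition finite_simple_graph :: "'a set \<Rightarrow> 'a set set \<Rightarrow> bool" where
  "finite_simple_graph V E \<longleftrightarrow>
     finite V \<and> E \<subseteq> {{u, v} | u v. u \<in> V \<and> v \<in> V \<and> u \<noteq> v}"

text \<open>A walk is its nonempty list of vertices; \<open>[v]\<close> is the walk of length 0 at \<open>v\<close>.\<close>

definition is_walk :: "'a set \<Rightarrow> 'a set set \<Rightarrow> 'a list \<Rightarrow> bool" where
  "is_walk V E p \<longleftrightarrow>
     p \<noteq> [] \<and> set p \<subseteq> V \<and> (\<forall>i. Suc i < length p \<longrightarrow> {p ! i, p ! Suc i} \<in> E)"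

definition walk_length :: "'a list \<Rightarrow> nat" where
  "walk_length p = length p - 1"

definition walk_edges :: "'a list \<Rightarrow> 'a set set" where
  "walk_edges p = {{p ! i, p ! Suc i} | i. Suc i < length p}"

definition closed_walk :: "'a set \<Rightarrow> 'a set set \<Rightarrow> 'a list \<Rightarrow> bool" where
  "closed_walk V E p \<longleftrightarrow> is_walk V E p \<and> hd p = last p"

definition walk_between :: "'a set \<Rightarrow> 'a set set \<Rightarrow> 'a \<Rightarrow> 'a list \<Rightarrow> 'a \<Rightarrow> bool" where
  "walk_between V E u p v \<longleftrightarrow> is_walk V E p \<and> hd p = u \<and> last p = v"

definition connected_graph :: "'a set \<Rightarrow> 'a set set \<Rightarrow> bool" where
  "connected_graph V E \<longleftrightarrow> V \<noteq> {} \<and> (\<forall>u\<in>V. \<forall>v\<in>V. \<exists>p. walk_between V E u p v)"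

definition components :: "'a set \<Rightarrow> 'a set set \<Rightarrow> 'a set set" where
  "components V E = {{v \<in> V. \<exists>p. walk_between V E u p v} | u. u \<in> V}"

definition complete_graph :: "'a set \<Rightarrow> 'a set set \<Rightarrow> bool" where
  "complete_graph V E \<longleftrightarrow> (\<forall>u\<in>V. \<forall>v\<in>V. u \<noteq> v \<longrightarrow> {u, v} \<in> E)"

definition bipartite_graph :: "'a set \<Rightarrow> 'a set set \<Rightarrow> bool" where
  "bipartite_graph V E \<longleftrightarrow>
     (\<exists>A B. A \<union> B = V \<and> A \<inter> B = {} \<and> (\<forall>e\<in>E. \<exists>a\<in>A. \<exists>b\<in>B. e = {a, b}))"

definition is_cycle :: "'a set \<Rightarrow> 'a set set \<Rightarrow> 'a list \<Rightarrow> bool" where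
  "is_cycle V E p \<longleftrightarrow> closed_walk V E p \<and> walk_length p \<ge> 3 \<and> distinct (tl p)"

definition is_tree :: "'a set \<Rightarrow> 'a set set \<Rightarrow> bool" where
  "is_tree V E \<longleftrightarrow> connected_graph V E \<and> (\<nexists>p. is_cycle V E p)"

definition degree_of :: "'a set set \<Rightarrow> 'a \<Rightarrow> nat" where
  "degree_of E v = card {e \<in> E. v \<in> e}"

definition max_degree :: "'a set \<Rightarrow> 'a set set \<Rightarrow> nat" where
  "max_degree V E = Max (degree_of E ` V)"

definition induced_edges :: "'a set \<Rightarrow> 'a set set \<Rightarrow> 'a set set" where
  "induced_edges W E = {e \<in> E. e \<subseteq> W}"


section \<open>Bridges and 2-edge-connectivity\<close>

text \<open>Edges form a multiset here, because the edge added in \<open>almost_two_edge_connected\<close>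
  may be parallel to an existing one; deleting an edge deletes a single copy of it.\<close>

definition is_bridge :: "'a set \<Rightarrow> 'a set multiset \<Rightarrow> 'a set \<Rightarrow> bool" where
  "is_bridge V M e \<longleftrightarrow>
     e \<in># M \<and> card (components V (set_mset M)) < card (components V (set_mset (M - {#e#})))"

definition two_edge_connected :: "'a set \<Rightarrow> 'a set multiset \<Rightarrow> bool" where
  "two_edge_connected V M \<longleftrightarrow> connected_graph V (set_mset M) \<and> (\<nexists>e. is_bridge V M e)"

definition almost_two_edge_connected :: "'a set \<Rightarrow> 'a set set \<Rightarrow> bool" where
  "almost_two_edge_connected V E \<longleftrightarrow>
     two_edge_connected V (mset_set E) \<or>
     (\<exists>u\<in>V. \<exists>v\<in>V. u \<noteq> v \<and> two_edge_connected V (add_mset {u, v} (mset_set E)))"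


section \<open>Stubborn edges\<close>

definition stubborn_edges :: "'a set \<Rightarrow> 'a set set \<Rightarrow> 'a set set" where
  "stubborn_edges V E =
     {e \<in> E. \<forall>p. closed_walk V E p \<and> odd (walk_length p) \<longrightarrow> e \<in> walk_edges p}"

definition stubborn_free_components :: "'a set \<Rightarrow> 'a set set \<Rightarrow> 'a set set" where
  "stubborn_free_components V E = components V (E - stubborn_edges V E)"


section \<open>Edge-colourings and the proper-walk connection number\<close>

definition properly_coloured :: "('a set \<Rightarrow> nat) \<Rightarrow> 'a list \<Rightarrow> bool" where
  "properly_coloured c p \<longleftrightarrow>
     (\<forall>i. Suc (Suc i) < length p \<longrightarrow>
        c {p ! i, p ! Suc i} \<noteq> c {p ! Suc i, p ! Suc (Suc i)})"

definition connecting_colouring ::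
    "'a set \<Rightarrow> 'a set set \<Rightarrow> nat \<Rightarrow> ('a set \<Rightarrow> nat) \<Rightarrow> bool" where
  "connecting_colouring V E k c \<longleftrightarrow>
     c \<in> E \<rightarrow> {1..k} \<and>
     (\<forall>u\<in>V. \<forall>v\<in>V. \<exists>p. walk_between V E u p v \<and> properly_coloured c p)"

text \<open>The condition \<open>1 \<le> k\<close> matters only for graphs without edges, where the empty
  colouring would otherwise be a colouring with 0 colours.\<close>

definition proper_walk_connection_number :: "'a set \<Rightarrow> 'a set set \<Rightarrow> nat" where
  "proper_walk_connection_number V E =
     (LEAST k. 1 \<le> k \<and> (\<exists>c. connecting_colouring V E k c))"

definition optimal_connecting_colouring ::
    "'a set \<Rightarrow> 'a set set \<Rightarrow> ('a set \<Rightarrow> nat) \<Rightarrow> bool" where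
  "optimal_connecting_colouring V E c \<longleftrightarrow>
     connecting_colouring V E (proper_walk_connection_number V E) c"


section \<open>Time-bounded computation\<close>

text \<open>The model of computation is the WHILE language over binary trees (N. D. Jones,
  Computability and Complexity from a Programming Perspective, 1997). Every evaluation of a
  subexpression is charged the size of the tree it yields, so no exponentially large tree can
  be built by sharing at unit cost; hence running times agree with those of Turing machines up
  to a polynomial.\<close>

datatype dtree = Leaf | Node dtree dtree

datatype expr = Var nat | Empty | Join expr expr | Hd expr | Tl expr

datatype com =
    Assign nat expr
  | Seq com com
  | Cond expr com com
  | While expr com

type_synonym state = "nat \<Rightarrow> dtree"

fun left :: "dtree \<Rightarrow> dtree" where
  "left Leaf = Leaf"
| "left (Node l r) = l"

fun right :: "dtree \<Rightarrow> dtree" where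
  "right Leaf = Leaf"
| "right (Node l r) = r"

fun val :: "expr \<Rightarrow> state \<Rightarrow> dtree" where
  "val (Var x) s = s x"
| "val Empty s = Leaf"
| "val (Join a b) s = Node (val a s) (val b s)"
| "val (Hd a) s = left (val a s)"
| "val (Tl a) s = right (val a s)"

fun cost :: "expr \<Rightarrow> state \<Rightarrow> nat" where
  "cost (Var x) s = Suc (size (s x))"
| "cost Empty s = 1"
| "cost (Join a b) s = cost a s + cost b s + Suc (size (val (Join a b) s))"
| "cost (Hd a) s = cost a s + Suc (size (val (Hd a) s))"
| "cost (Tl a) s = cost a s + Suc (size (val (Tl a) s))"

text \<open>\<open>exec c s t s'\<close>: started in state \<open>s\<close>, the command \<open>c\<close> terminates in state \<open>s'\<close> after
  exactly \<open>t\<close> time units. A test succeeds iff the value is not \<open>Leaf\<close>.\<close>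

inductive exec :: "com \<Rightarrow> state \<Rightarrow> nat \<Rightarrow> state \<Rightarrow> bool" where
  Assign: "exec (Assign x e) s (Suc (cost e s)) (s(x := val e s))"
| Seq: "exec c1 s t1 s' \<Longrightarrow> exec c2 s' t2 s'' \<Longrightarrow> exec (Seq c1 c2) s (Suc (t1 + t2)) s''"
| CondTrue: "val e s \<noteq> Leaf \<Longrightarrow> exec c1 s t s' \<Longrightarrow> exec (Cond e c1 c2) s (Suc (cost e s + t)) s'"
| CondFalse: "val e s = Leaf \<Longrightarrow> exec c2 s t s' \<Longrightarrow> exec (Cond e c1 c2) s (Suc (cost e s + t)) s'"
| WhileFalse: "val e s = Leaf \<Longrightarrow> exec (While e c) s (Suc (cost e s)) s"
| WhileTrue: "val e s \<noteq> Leaf \<Longrightarrow> exec c s t1 s' \<Longrightarrow> exec (While e c) s' t2 s'' \<Longrightarrow>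
    exec (While e c) s (Suc (cost e s + t1 + t2)) s''"

text \<open>Input and output are passed in variable 0; all other variables initially hold \<open>Leaf\<close>.\<close>

definition computes_in_time :: "com \<Rightarrow> dtree \<Rightarrow> nat \<Rightarrow> dtree \<Rightarrow> bool" where
  "computes_in_time c x t y \<longleftrightarrow> (\<exists>s. exec c ((\<lambda>_. Leaf)(0 := x)) t s \<and> s 0 = y)"


section \<open>Encoding of graphs and colourings\<close>

text \<open>A graph on the vertices \<open>0, \<dots>, n - 1\<close> is given by its adjacency matrix, and a colouring by
  the matrix of its colours, with 0 for non-edges. Matrix entries are written in unary.\<close>

fun enc_nat :: "nat \<Rightarrow> dtree" where
  "enc_nat 0 = Leaf"
| "enc_nat (Suc n) = Node Leaf (enc_nat n)"

fun enc_list :: "dtree list \<Rightarrow> dtree" where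
  "enc_list [] = Leaf"
| "enc_list (x # xs) = Node x (enc_list xs)"

definition enc_matrix :: "nat \<Rightarrow> (nat \<Rightarrow> nat \<Rightarrow> nat) \<Rightarrow> dtree" where
  "enc_matrix n a = enc_list (map (\<lambda>u. enc_list (map (\<lambda>v. enc_nat (a u v)) [0..<n])) [0..<n])"

definition enc_graph :: "nat \<Rightarrow> nat set set \<Rightarrow> dtree" where
  "enc_graph n E = enc_matrix n (\<lambda>u v. if {u, v} \<in> E then 1 else 0)"

definition enc_colouring :: "nat \<Rightarrow> nat set set \<Rightarrow> (nat set \<Rightarrow> nat) \<Rightarrow> dtree" where
  "enc_colouring n E c = enc_matrix n (\<lambda>u v. if {u, v} \<in> E then c {u, v} else 0)"

end

theory Submission imports Defs "HOL-Library.Transitive_Closure_Table" begin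

text \<open>A colouring with two colours orients both lifts of every edge in the bipartite double cover such
  that properly coloured walks become directed paths, and the orientation is invariant under reversing
  all arcs and swapping the sheets. If every two vertices are connected by such a path in some sheets,
  the condensation is nearly linear: in the bipartite case joining the two extreme classes yields a
  graph without bridges; in the other case, the stubborn edges leave a component \<open>K\<close> whose one lift is a
  source and whose other lift is a sink, and the rest of the graph has to be connected by itself.

  Conversely, start from the graph in which every edge may have both colours and discard permissions
  as long as reachability is preserved. An edge that still permits both colours lifts to bridges of
  the double cover; these are oriented away from one or two roots by breadth-first search, which only
  costs paths that cross a bridge towards a root. Three colours suffice as soon as there is a
  cycle: colour it properly and attach the rest of the graph in trees, alternating from the colour
  missing at the attaching vertex.

  Permissions can be discarded greedily, so a colouring is found in polynomial time by trying all
  roots and all cycle edges, and testing by reachability whether the colouring connects the graph.\<close>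

section \<open>Polynomial-time computability on encoded data\<close>

text \<open>The obstacle is a stubborn edge \<open>e\<close> of a non-bipartite graph. Without
  \<open>e\<close> the graph is bipartite and its double cover falls into two copies; the ends of
  \<open>e\<close> lie on the same side, so both lifts of \<open>e\<close> run between the copies,
  and a single colour directs both the same way. Saturation would therefore keep both colours on
  \<open>e\<close> although its lifts are no bridges. Hence stubborn edges meeting \<open>K\<close>
  are taken out before permissions are discarded, and are coloured by hand. Any two stubborn edges
  form a cut, so \<open>K\<close> has at most two boundary edges: walks leave the source lift of
  \<open>K\<close> through one, pass the rest of the graph and enter the sink lift through the
  other. When there is a rest, it gets a root of its own besides the one in \<open>K\<close>, and a
  bit \<open>i\<close> decides which lift of the rest continues which lift of \<open>K\<close>. In a
  bipartite graph the root is an end of the edge whose addition destroys the bridges: all bridges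
  lie on the way to its other end, so their far sides are nested and any two vertices stay
  comparable.\<close>

definition poly_bounded :: "'x set \<Rightarrow> ('x \<Rightarrow> nat) \<Rightarrow> ('x \<Rightarrow> nat) \<Rightarrow> bool" where
  "poly_bounded X m f \<longleftrightarrow> (\<exists>b. \<forall>x\<in>X. f x \<le> (m x + 2) ^ b)"

lemma poly_boundedE:
  assumes "poly_bounded X m f"
  obtains b where "b \<ge> 1" "\<And>x. x \<in> X \<Longrightarrow> f x \<le> (m x + 2) ^ b"
proof -
  obtain b where b: "\<And>x. x \<in> X \<Longrightarrow> f x \<le> (m x + 2) ^ b"
    using assms by (auto simp: poly_bounded_def)
  have "f x \<le> (m x + 2) ^ Suc b" if "x \<in> X" for x
    using b[OF that] by simp
  then show ?thesis using that[of "Suc b"] by auto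
qed

lemma poly_bounded_mono:
  assumes "poly_bounded X m g" "\<And>x. x \<in> X \<Longrightarrow> f x \<le> g x"
  shows "poly_bounded X m f"
  using assms unfolding poly_bounded_def by (meson order_trans)

lemma poly_bounded_reindex:
  "poly_bounded Y m f \<Longrightarrow> (\<And>x. x \<in> X \<Longrightarrow> h x \<in> Y) \<Longrightarrow> poly_bounded X (\<lambda>x. m (h x)) (\<lambda>x. f (h x))"
  unfolding poly_bounded_def by blast

lemma poly_bounded_self: "poly_bounded X m m"
  unfolding poly_bounded_def by (rule exI[of _ 1]) simp

text \<open>The offset 2 in \<open>poly_bounded\<close> keeps the base at least 2. Constants, sums
  and products are therefore absorbed by a larger exponent, without a separate leading
  coefficient.\<close>

lemma poly_bounded_const: "poly_bounded X m (\<lambda>_. c)"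
proof -
  have "c \<le> (m x + 2) ^ c" for x
  proof -
    have "c \<le> 2 ^ c" by (simp add: less_imp_le)
    also have "\<dots> \<le> (m x + 2) ^ c" by (rule power_mono) auto
    finally show ?thesis .
  qed
  then show ?thesis unfolding poly_bounded_def by blast
qed

lemma poly_bounded_mult:
  assumes "poly_bounded X m f" "poly_bounded X m g"
  shows "poly_bounded X m (\<lambda>x. f x * g x)"
proof -
  obtain b where b: "\<And>x. x \<in> X \<Longrightarrow> f x \<le> (m x + 2) ^ b" using assms(1) by (auto simp: poly_bounded_def)
  obtain b' where b': "\<And>x. x \<in> X \<Longrightarrow> g x \<le> (m x + 2) ^ b'" using assms(2) by (auto simp: poly_bounded_def)
  have "f x * g x \<le> (m x + 2) ^ (b + b')" if "x \<in> X" for x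
    unfolding power_add by (rule mult_mono[OF b b']) (use that in auto)
  then show ?thesis unfolding poly_bounded_def by blast
qed

lemma poly_bounded_add:
  assumes "poly_bounded X m f" "poly_bounded X m g"
  shows "poly_bounded X m (\<lambda>x. f x + g x)"
proof -
  obtain b where b: "\<And>x. x \<in> X \<Longrightarrow> f x \<le> (m x + 2) ^ b" using assms(1) by (auto simp: poly_bounded_def)
  obtain b' where b': "\<And>x. x \<in> X \<Longrightarrow> g x \<le> (m x + 2) ^ b'" using assms(2) by (auto simp: poly_bounded_def)
  have "f x + g x \<le> (m x + 2) ^ Suc (b + b')" if "x \<in> X" for x
  proof -
    have "f x \<le> (m x + 2) ^ (b + b')"
      by (rule order_trans[OF b[OF that]]) (simp add: power_increasing)
    moreover have "g x \<le> (m x + 2) ^ (b + b')"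
      by (rule order_trans[OF b'[OF that]]) (simp add: power_increasing)
    ultimately have "f x + g x \<le> 2 * (m x + 2) ^ (b + b')" by simp
    also have "\<dots> \<le> (m x + 2) * (m x + 2) ^ (b + b')" by (rule mult_right_mono) auto
    finally show ?thesis by simp
  qed
  then show ?thesis unfolding poly_bounded_def by blast
qed

lemma poly_bounded_trans:
  assumes "poly_bounded X m g" "poly_bounded X g f"
  shows "poly_bounded X m f"
proof -
  obtain b where "b \<ge> 1" and b: "\<And>x. x \<in> X \<Longrightarrow> g x \<le> (m x + 2) ^ b"
    using assms(1) by (rule poly_boundedE) blast
  obtain b' where b': "\<And>x. x \<in> X \<Longrightarrow> f x \<le> (g x + 2) ^ b'" using assms(2) by (auto simp: poly_bounded_def)
  have "f x \<le> (m x + 2) ^ (Suc b * b')" if "x \<in> X" for x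
  proof -
    \<comment> \<open>This is why \<open>poly_boundedE\<close> delivers a positive exponent: the
      offset 2 of the outer base has to be absorbed as well.\<close>
    have "2 \<le> (m x + 2) ^ b" using \<open>b \<ge> 1\<close> self_le_power[of "m x + 2" b] by linarith
    then have "g x + 2 \<le> 2 * (m x + 2) ^ b" using b[OF that] by simp
    also have "\<dots> \<le> (m x + 2) ^ Suc b" by (simp add: mult_right_mono)
    finally have "(g x + 2) ^ b' \<le> ((m x + 2) ^ Suc b) ^ b'" by (rule power_mono) simp
    with b'[OF that] show ?thesis unfolding power_mult by (rule order_trans)
  qed
  then show ?thesis unfolding poly_bounded_def by blast
qed

lemmas poly_bounded_intros = poly_bounded_self poly_bounded_const poly_bounded_add poly_bounded_mult

section \<open>Programs on trees and their running times\<close>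

text \<open>The final state agrees with the initial one outside variable 0. Scratch variables below
  \<open>N\<close> have to be cleared again and those from \<open>N\<close> on keep their values, so
  programs can be chained without renaming, and data can be parked beyond \<open>N\<close> while
  another program runs.\<close>

definition computes ::
    "com \<Rightarrow> nat \<Rightarrow> 'x set \<Rightarrow> ('x \<Rightarrow> dtree) \<Rightarrow> ('x \<Rightarrow> dtree) \<Rightarrow> ('x \<Rightarrow> nat) \<Rightarrow> bool" where
  "computes c N X a g T \<longleftrightarrow>
     (\<forall>x\<in>X. \<forall>s. s 0 = a x \<and> (\<forall>i. 0 < i \<and> i < N \<longrightarrow> s i = Leaf) \<longrightarrow>
        (\<exists>t\<le>T x. exec c s t (s(0 := g x))))"

lemma computesI:
  assumes "\<And>x s. x \<in> X \<Longrightarrow> s 0 = a x \<Longrightarrow> (\<And>i. 0 < i \<Longrightarrow> i < N \<Longrightarrow> s i = Leaf) \<Longrightarrow>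
    \<exists>t\<le>T x. exec c s t (s(0 := g x))"
  shows "computes c N X a g T"
  using assms unfolding computes_def by blast

lemma computesD:
  assumes "computes c N X a g T" "x \<in> X" "s 0 = a x" "\<And>i. 0 < i \<Longrightarrow> i < N \<Longrightarrow> s i = Leaf"
  obtains t where "t \<le> T x" "exec c s t (s(0 := g x))"
  using assms unfolding computes_def by blast

text \<open>Both sides are families of trees indexed by an abstract \<open>x\<close>, so that one
  notion covers maps between encodings as well as loop states indexed by an input and a counter.
  Bounding the output size lets the time of a second program be measured against the first
  input.\<close>

definition computable_from :: "'x set \<Rightarrow> ('x \<Rightarrow> dtree) \<Rightarrow> ('x \<Rightarrow> dtree) \<Rightarrow> bool" where
  "computable_from X a g \<longleftrightarrow>
     poly_bounded X (\<lambda>x. size (a x)) (\<lambda>x. size (g x)) \<and>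
     (\<exists>c N T. poly_bounded X (\<lambda>x. size (a x)) T \<and> computes c N X a g T)"

lemma computable_fromI:
  assumes "poly_bounded X (\<lambda>x. size (a x)) (\<lambda>x. size (g x))"
    and "poly_bounded X (\<lambda>x. size (a x)) T" and "computes c N X a g T"
  shows "computable_from X a g"
  using assms unfolding computable_from_def by blast

lemma computable_from_size:
  "computable_from X a g \<Longrightarrow> poly_bounded X (\<lambda>x. size (a x)) (\<lambda>x. size (g x))"
  unfolding computable_from_def by blast

lemma computable_from_reindex:
  assumes "computable_from Y a g" "\<And>x. x \<in> X \<Longrightarrow> h x \<in> Y"
  shows "computable_from X (\<lambda>x. a (h x)) (\<lambda>x. g (h x))"
proof -
  obtain c N T where *: "poly_bounded Y (\<lambda>x. size (g x)) (\<lambda>x. 0)"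
      "poly_bounded Y (\<lambda>x. size (a x)) (\<lambda>x. size (g x))"
      "poly_bounded Y (\<lambda>x. size (a x)) T" "computes c N Y a g T"
    using assms(1) by (auto simp: computable_from_def intro: poly_bounded_const)
  have "computes c N X (\<lambda>x. a (h x)) (\<lambda>x. g (h x)) (\<lambda>x. T (h x))"
    using *(4) assms(2) unfolding computes_def by blast
  then show ?thesis
    using *(2,3)[THEN poly_bounded_reindex, of X h] assms(2)
    by (intro computable_fromI) auto
qed

lemma computable_from_cong:
  assumes "computable_from X a g" "\<And>x. x \<in> X \<Longrightarrow> a x = a' x" "\<And>x. x \<in> X \<Longrightarrow> g x = g' x"
  shows "computable_from X a' g'"
  using assms unfolding computable_from_def computes_def poly_bounded_def by auto


lemma computable_from_expr:
  assumes "\<And>s. val e s = f (s 0)" "\<And>s. cost e s \<le> C * size (s 0) + C" "\<And>d. size (f d) \<le> C * size d + C"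
  shows "computable_from X a (\<lambda>x. f (a x))"
proof (rule computable_fromI)
  show "poly_bounded X (\<lambda>x. size (a x)) (\<lambda>x. size (f (a x)))"
    by (rule poly_bounded_mono[of _ _ "\<lambda>x. C * size (a x) + C"])
      (intro poly_bounded_intros, rule assms(3))
  show "poly_bounded X (\<lambda>x. size (a x)) (\<lambda>x. Suc (C * size (a x) + C))"
    by (subst Suc_eq_plus1) (intro poly_bounded_intros)
  show "computes (Assign 0 e) 0 X a (\<lambda>x. f (a x)) (\<lambda>x. Suc (C * size (a x) + C))"
  proof (rule computesI)
    fix x and s :: state assume "x \<in> X" "s 0 = a x"
    then show "\<exists>t\<le>Suc (C * size (a x) + C). exec (Assign 0 e) s t (s(0 := f (a x)))"
      using exec.Assign[of 0 e s] assms(1)[of s] assms(2)[of s] by auto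
  qed
qed

lemma size_left: "size (left d) \<le> size d" by (cases d) auto
lemma size_right: "size (right d) \<le> size d" by (cases d) auto

lemma computable_from_id: "computable_from X a a"
  using computable_from_expr[of "Var 0" "\<lambda>d. d" 1 X a] by simp

lemma computable_from_Leaf: "computable_from X a (\<lambda>_. Leaf)"
  using computable_from_expr[of "Empty" "\<lambda>d. Leaf" 1 X a] by simp

lemma computable_from_left0: "computable_from X a (\<lambda>x. left (a x))"
proof (rule computable_from_expr[of "Hd (Var 0)" left 2 X a])
  show "cost (Hd (Var 0)) s \<le> 2 * size (s 0) + 2" for s using size_left[of "s 0"] by simp
  show "size (left d) \<le> 2 * size d + 2" for d using size_left[of d] by simp
qed simp

lemma computable_from_right0: "computable_from X a (\<lambda>x. right (a x))"
proof (rule computable_from_expr[of "Tl (Var 0)" right 2 X a])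
  show "cost (Tl (Var 0)) s \<le> 2 * size (s 0) + 2" for s using size_right[of "s 0"] by simp
  show "size (right d) \<le> 2 * size d + 2" for d using size_right[of d] by simp
qed simp

lemma computable_from_trans:
  assumes "computable_from X a g" "computable_from X g h"
  shows "computable_from X a h"
proof -
  from assms(1) obtain c1 N1 T1 where 1: "poly_bounded X (\<lambda>x. size (a x)) (\<lambda>x. size (g x))"
      "poly_bounded X (\<lambda>x. size (a x)) T1" "computes c1 N1 X a g T1"
    unfolding computable_from_def by blast
  from assms(2) obtain c2 N2 T2 where 2: "poly_bounded X (\<lambda>x. size (g x)) (\<lambda>x. size (h x))"
      "poly_bounded X (\<lambda>x. size (g x)) T2" "computes c2 N2 X g h T2"
    unfolding computable_from_def by blast
  show ?thesis
  proof (rule computable_fromI)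
    show "poly_bounded X (\<lambda>x. size (a x)) (\<lambda>x. size (h x))"
      by (rule poly_bounded_trans[OF 1(1) 2(1)])
    show "poly_bounded X (\<lambda>x. size (a x)) (\<lambda>x. T1 x + T2 x + 1)"
      by (intro poly_bounded_intros 1(2) poly_bounded_trans[OF 1(1) 2(2)])
    show "computes (Seq c1 c2) (max N1 N2) X a h (\<lambda>x. T1 x + T2 x + 1)"
    proof (rule computesI)
      fix x s assume x: "x \<in> X" and s: "s 0 = a x" "\<And>i. 0 < i \<Longrightarrow> i < max N1 N2 \<Longrightarrow> s i = Leaf"
      obtain t1 where t1: "t1 \<le> T1 x" "exec c1 s t1 (s(0 := g x))"
        by (rule computesD[OF 1(3) x, of s]) (use s in auto)
      obtain t2 where t2: "t2 \<le> T2 x" "exec c2 (s(0 := g x)) t2 (s(0 := g x, 0 := h x))"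
        by (rule computesD[OF 2(3) x, of "s(0 := g x)"]) (use s(2) in auto)
      have "exec (Seq c1 c2) s (Suc (t1 + t2)) (s(0 := h x))"
        using exec.Seq[OF t1(2) t2(2)] by simp
      then show "\<exists>t\<le>T1 x + T2 x + 1. exec (Seq c1 c2) s t (s(0 := h x))"
        using t1(1) t2(1) by (intro exI[of _ "Suc (t1 + t2)"]) auto
    qed
  qed
qed

lemma computable_from_left: "computable_from X a g \<Longrightarrow> computable_from X a (\<lambda>x. left (g x))"
  using computable_from_trans computable_from_left0 by blast

lemma computable_from_right: "computable_from X a g \<Longrightarrow> computable_from X a (\<lambda>x. right (g x))"
  using computable_from_trans computable_from_right0 by blast

lemma computable_from_Node:
  assumes "computable_from X a g" "computable_from X a h"
  shows "computable_from X a (\<lambda>x. Node (g x) (h x))"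
proof -
  from assms(1) obtain c1 N1 T1 where 1: "poly_bounded X (\<lambda>x. size (a x)) (\<lambda>x. size (g x))"
      "poly_bounded X (\<lambda>x. size (a x)) T1" "computes c1 N1 X a g T1"
    unfolding computable_from_def by blast
  from assms(2) obtain c2 N2 T2 where 2: "poly_bounded X (\<lambda>x. size (a x)) (\<lambda>x. size (h x))"
      "poly_bounded X (\<lambda>x. size (a x)) T2" "computes c2 N2 X a h T2"
    unfolding computable_from_def by blast
  define N where "N = Suc (max N1 N2)"
  \<comment> \<open>Variable \<open>N\<close> holds a copy of the input during the first program,
    \<open>Suc N\<close> the first result during the second. Both lie above the scratch space of the
    two programs and are cleared afterwards.\<close>
  define p where "p = Seq (Assign N (Var 0)) (Seq c1 (Seq (Assign (Suc N) (Var 0))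
    (Seq (Assign 0 (Var N)) (Seq (Assign N Empty) (Seq c2
    (Seq (Assign 0 (Join (Var (Suc N)) (Var 0))) (Assign (Suc N) Empty)))))))"
  let ?T = "\<lambda>x. T1 x + T2 x + 2 * size (a x) + 4 * size (g x) + 2 * size (h x) + 100"
  show ?thesis
  proof (rule computable_fromI)
    have "poly_bounded X (\<lambda>x. size (a x)) (\<lambda>x. size (g x) + size (h x) + 1)"
      by (intro poly_bounded_intros 1 2)
    then show "poly_bounded X (\<lambda>x. size (a x)) (\<lambda>x. size (Node (g x) (h x)))" by simp
    show "poly_bounded X (\<lambda>x. size (a x)) ?T"
      by (intro poly_bounded_intros 1 2)
    show "computes p (Suc (Suc N)) X a (\<lambda>x. Node (g x) (h x)) ?T"
    proof (rule computesI)
      fix x s assume x: "x \<in> X" and s: "s 0 = a x" "\<And>i. 0 < i \<Longrightarrow> i < Suc (Suc N) \<Longrightarrow> s i = Leaf"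
      have N: "N > 0" "N1 < N" "N2 < N" by (auto simp: N_def)
      define s1 where "s1 = s(N := a x)"
      define s2 where "s2 = s1(0 := g x)"
      define s3 where "s3 = s2(Suc N := g x)"
      define s4 where "s4 = s3(0 := a x)"
      define s5 where "s5 = s4(N := Leaf)"
      define s6 where "s6 = s5(0 := h x)"
      define s7 where "s7 = s6(0 := Node (g x) (h x))"
      define s8 where "s8 = s7(Suc N := Leaf)"
      note defs = s1_def s2_def s3_def s4_def s5_def s6_def s7_def s8_def
      obtain t1 where t1: "t1 \<le> T1 x" "exec c1 s1 t1 s2"
        unfolding s2_def by (rule computesD[OF 1(3) x, of s1]) (use s N in \<open>auto simp: defs\<close>)
      obtain t2 where t2: "t2 \<le> T2 x" "exec c2 s5 t2 s6"
        unfolding s6_def by (rule computesD[OF 2(3) x, of s5]) (use s N in \<open>auto simp: defs\<close>)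
      have e1: "exec (Assign N (Var 0)) s (Suc (cost (Var 0) s)) s1"
        using exec.Assign[of N "Var 0" s] s by (simp add: defs)
      have e3: "exec (Assign (Suc N) (Var 0)) s2 (Suc (cost (Var 0) s2)) s3"
        using exec.Assign[of "Suc N" "Var 0" s2] by (simp add: defs)
      have e4: "exec (Assign 0 (Var N)) s3 (Suc (cost (Var N) s3)) s4"
        using exec.Assign[of 0 "Var N" s3] N by (simp add: defs)
      have e5: "exec (Assign N Empty) s4 (Suc (cost Empty s4)) s5"
        using exec.Assign[of N "Empty" s4] by (simp add: defs)
      have e7: "exec (Assign 0 (Join (Var (Suc N)) (Var 0))) s6 (Suc (cost (Join (Var (Suc N)) (Var 0)) s6)) s7"
        using exec.Assign[of 0 "Join (Var (Suc N)) (Var 0)" s6] by (simp add: defs)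
      have e8: "exec (Assign (Suc N) Empty) s7 (Suc (cost Empty s7)) s8"
        using exec.Assign[of "Suc N" "Empty" s7] by (simp add: defs)
      have s8: "s8 = s(0 := Node (g x) (h x))"
        using s N by (auto simp: defs fun_eq_iff)
      note e = exec.Seq[OF e1 exec.Seq[OF t1(2) exec.Seq[OF e3 exec.Seq[OF e4 exec.Seq[OF e5
            exec.Seq[OF t2(2) exec.Seq[OF e7 e8]]]]]]]
      have "s6 (Suc N) = g x" "s3 N = a x" using N by (auto simp: defs)
      then show "\<exists>t\<le>?T x. exec p s t (s(0 := Node (g x) (h x)))"
        unfolding p_def s8[symmetric]
        by (intro exI conjI, rule_tac[2] e) (use t1(1) t2(1) s N in \<open>auto simp: defs\<close>)
    qed
  qed
qed

text \<open>The test travels as the left half of the input tree and each branch receives the right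
  half alone. A branch has to be correct and fast only on the inputs that take it.\<close>

lemma computable_from_Cond:
  assumes "computable_from {x \<in> X. P x} (\<lambda>x. right (a x)) g"
    and "computable_from {x \<in> X. \<not> P x} (\<lambda>x. right (a x)) h"
    and P: "\<And>x. x \<in> X \<Longrightarrow> P x \<longleftrightarrow> left (a x) \<noteq> Leaf"
  shows "computable_from X a (\<lambda>x. if P x then g x else h x)"
proof -
  let ?X1 = "{x \<in> X. P x}" and ?X2 = "{x \<in> X. \<not> P x}"
  have glue: "poly_bounded X (\<lambda>x. size (a x)) (\<lambda>x. if P x then f1 x else f2 x)"
    if 1: "poly_bounded ?X1 (\<lambda>x. size (right (a x))) f1"
      and 2: "poly_bounded ?X2 (\<lambda>x. size (right (a x))) f2" for f1 f2
  proof -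
    obtain b1 where b1: "\<And>x. x \<in> ?X1 \<Longrightarrow> f1 x \<le> (size (right (a x)) + 2) ^ b1"
      using 1 by (auto simp: poly_bounded_def)
    obtain b2 where b2: "\<And>x. x \<in> ?X2 \<Longrightarrow> f2 x \<le> (size (right (a x)) + 2) ^ b2"
      using 2 by (auto simp: poly_bounded_def)
    have le: "(size (right d) + 2) ^ b \<le> (size d + 2) ^ (b + b')"
      "(size (right d) + 2) ^ b \<le> (size d + 2) ^ (b' + b)" for d :: dtree and b b'
    proof -
      have "(size (right d) + 2) ^ b \<le> (size d + 2) ^ b"
        by (rule power_mono) (use size_right[of d] in auto)
      also have "\<dots> \<le> (size d + 2) ^ (b + b')" by (rule power_increasing) auto
      finally show "(size (right d) + 2) ^ b \<le> (size d + 2) ^ (b + b')" .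
      then show "(size (right d) + 2) ^ b \<le> (size d + 2) ^ (b' + b)" by (simp add: add.commute)
    qed
    have "(if P x then f1 x else f2 x) \<le> (size (a x) + 2) ^ (b1 + b2)" if "x \<in> X" for x
      using b1[of x] b2[of x] le(1)[of "a x" b1 b2] le(2)[of "a x" b2 b1] that by auto
    then show ?thesis unfolding poly_bounded_def by blast
  qed
  from assms(1) obtain c1 N1 T1 where 1: "poly_bounded ?X1 (\<lambda>x. size (right (a x))) (\<lambda>x. size (g x))"
      "poly_bounded ?X1 (\<lambda>x. size (right (a x))) T1" "computes c1 N1 ?X1 (\<lambda>x. right (a x)) g T1"
    unfolding computable_from_def by blast
  from assms(2) obtain c2 N2 T2 where 2: "poly_bounded ?X2 (\<lambda>x. size (right (a x))) (\<lambda>x. size (h x))"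
      "poly_bounded ?X2 (\<lambda>x. size (right (a x))) T2" "computes c2 N2 ?X2 (\<lambda>x. right (a x)) h T2"
    unfolding computable_from_def by blast
  let ?c = "Cond (Hd (Var 0)) (Seq (Assign 0 (Tl (Var 0))) c1) (Seq (Assign 0 (Tl (Var 0))) c2)"
  let ?T = "\<lambda>x. (if P x then T1 x else T2 x) + 4 * size (a x) + 100"
  show ?thesis
  proof (rule computable_fromI)
    show "poly_bounded X (\<lambda>x. size (a x)) (\<lambda>x. size (if P x then g x else h x))"
      using glue[OF 1(1) 2(1)] by (rule poly_bounded_mono) auto
    show "poly_bounded X (\<lambda>x. size (a x)) ?T"
      by (intro poly_bounded_intros glue 1 2)
    show "computes ?c (max N1 N2) X a (\<lambda>x. if P x then g x else h x) ?T"
    proof (rule computesI)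
      fix x s assume x: "x \<in> X" and s: "s 0 = a x" "\<And>i. 0 < i \<Longrightarrow> i < max N1 N2 \<Longrightarrow> s i = Leaf"
      let ?s1 = "s(0 := right (a x))"
      have e1: "exec (Assign 0 (Tl (Var 0))) s (Suc (cost (Tl (Var 0)) s)) ?s1"
        using exec.Assign[of 0 "Tl (Var 0)" s] s by simp
      have sz: "size (left (a x)) \<le> size (a x)" "size (right (a x)) \<le> size (a x)"
        by (auto simp: size_left size_right)
      show "\<exists>t\<le>?T x. exec ?c s t (s(0 := if P x then g x else h x))"
      proof (cases "P x")
        case True
        obtain t where t: "t \<le> T1 x" "exec c1 ?s1 t (?s1(0 := g x))"
          by (rule computesD[OF 1(3), of x ?s1]) (use s x True in auto)
        have v: "val (Hd (Var 0)) s \<noteq> Leaf" using P[OF x] True s by simp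
        have "exec c1 ?s1 t (s(0 := g x))" using t(2) by simp
        note exec.CondTrue[OF v exec.Seq[OF e1 this], of "Seq (Assign 0 (Tl (Var 0))) c2"]
        then show ?thesis using True t(1) s sz
          by (intro exI conjI) auto
      next
        case False
        obtain t where t: "t \<le> T2 x" "exec c2 ?s1 t (?s1(0 := h x))"
          by (rule computesD[OF 2(3), of x ?s1]) (use s x False in auto)
        have v: "val (Hd (Var 0)) s = Leaf" using P[OF x] False s by simp
        have "exec c2 ?s1 t (s(0 := h x))" using t(2) by simp
        note exec.CondFalse[OF v exec.Seq[OF e1 this], of "Seq (Assign 0 (Tl (Var 0))) c1"]
        then show ?thesis using False t(1) s sz
          by (intro exI conjI) auto
      qed
    qed
  qed
qed

lemma poly_bounded_power: "poly_bounded X m f \<Longrightarrow> poly_bounded X m (\<lambda>x. f x ^ b)"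
  by (induction b) (auto intro: poly_bounded_intros simp del: One_nat_def)

lemma poly_bounded_base_mono:
  assumes "poly_bounded X m f" "\<And>x. x \<in> X \<Longrightarrow> m x \<le> m' x"
  shows "poly_bounded X m' f"
proof -
  obtain b where b: "\<And>x. x \<in> X \<Longrightarrow> f x \<le> (m x + 2) ^ b" using assms(1) by (auto simp: poly_bounded_def)
  have "f x \<le> (m' x + 2) ^ b" if "x \<in> X" for x
    using b[OF that] assms(2)[OF that] by (meson add_le_mono1 order_trans power_mono zero_le)
  then show ?thesis unfolding poly_bounded_def by blast
qed

text \<open>Polynomial time per round would not suffice, since the size might square in every round.
  The bound \<open>B\<close> controls all states in terms of the initial one, and then each round
  costs at most \<open>C x\<close>.\<close>

lemma computable_from_While:
  assumes step: "computable_from {(x, j). x \<in> X \<and> j < k x} (\<lambda>(x, j). st x j) (\<lambda>(x, j). st x (Suc j))"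
    and run: "\<And>x j. x \<in> X \<Longrightarrow> j < k x \<Longrightarrow> left (st x j) \<noteq> Leaf"
    and stop: "\<And>x. x \<in> X \<Longrightarrow> left (st x (k x)) = Leaf"
    and k: "poly_bounded X (\<lambda>x. size (st x 0)) k"
    and B: "poly_bounded X (\<lambda>x. size (st x 0)) B" "\<And>x j. x \<in> X \<Longrightarrow> j \<le> k x \<Longrightarrow> size (st x j) \<le> B x"
  shows "computable_from X (\<lambda>x. st x 0) (\<lambda>x. st x (k x))"
proof -
  let ?I = "{(x, j). x \<in> X \<and> j < k x}"
  from step obtain c N T where T: "poly_bounded ?I (\<lambda>x. size (case x of (x, j) \<Rightarrow> st x j)) T"
      and c: "computes c N ?I (\<lambda>(x, j). st x j) (\<lambda>(x, j). st x (Suc j)) T"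
    unfolding computable_from_def by blast
  from T obtain b where b: "\<And>x j. x \<in> X \<Longrightarrow> j < k x \<Longrightarrow> T (x, j) \<le> (size (st x j) + 2) ^ b"
    unfolding poly_bounded_def by fastforce
  define C where "C x = (B x + 2) ^ b + 2 * B x + 10" for x
  let ?w = "While (Hd (Var 0)) c"
  show ?thesis
  proof (rule computable_fromI)
    show "poly_bounded X (\<lambda>x. size (st x 0)) (\<lambda>x. size (st x (k x)))"
      by (rule poly_bounded_mono[OF B(1)]) (simp add: B(2))
    show "poly_bounded X (\<lambda>x. size (st x 0)) (\<lambda>x. (k x + 1) * C x)"
      unfolding C_def by (intro poly_bounded_intros poly_bounded_power k B)
    show "computes ?w N X (\<lambda>x. st x 0) (\<lambda>x. st x (k x)) (\<lambda>x. (k x + 1) * C x)"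
    proof (rule computesI)
      fix x and s :: state assume x: "x \<in> X" and s: "s 0 = st x 0" "\<And>i. 0 < i \<Longrightarrow> i < N \<Longrightarrow> s i = Leaf"
      \<comment> \<open>Induction on the number \<open>d\<close> of remaining rounds; the summand 1
        pays for the final failing test.\<close>
      have "\<exists>t\<le>(d + 1) * C x. exec ?w s' t (s'(0 := st x (k x)))"
        if "j + d = k x" "s' 0 = st x j" "\<And>i. 0 < i \<Longrightarrow> i < N \<Longrightarrow> s' i = Leaf" for d j s'
        using that
      proof (induction d arbitrary: j s')
        case 0
        then have e: "exec ?w s' (Suc (cost (Hd (Var 0)) s')) s'"
          using stop[OF x] by (intro exec.WhileFalse) auto
        have "s'(0 := st x (k x)) = s'" using 0 by (auto simp: fun_eq_iff)
        moreover have "Suc (cost (Hd (Var 0)) s') \<le> C x"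
          using 0 B(2)[OF x, of j] size_left[of "st x j"] by (simp add: C_def)
        ultimately show ?case using e by auto
      next
        case (Suc d)
        have j: "j < k x" using Suc.prems(1) by simp
        let ?s = "s'(0 := st x (Suc j))"
        obtain t1 where t1: "t1 \<le> T (x, j)" "exec c s' t1 ?s"
          by (rule computesD[OF c, of "(x, j)" s']) (use x j Suc.prems in auto)
        have "\<exists>t\<le>(d + 1) * C x. exec ?w ?s t (?s(0 := st x (k x)))"
          by (rule Suc.IH[of "Suc j" ?s]) (use Suc.prems in auto)
        then obtain t2 where t2: "t2 \<le> (d + 1) * C x" "exec ?w ?s t2 (s'(0 := st x (k x)))"
          by (auto simp del: fun_upd_apply)
        have v: "val (Hd (Var 0)) s' \<noteq> Leaf" using Suc.prems run[OF x j] by simp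
        note e = exec.WhileTrue[OF v t1(2) t2(2)]
        have "T (x, j) \<le> (B x + 2) ^ b"
          by (rule order_trans[OF b[OF x j]]) (use B(2)[OF x, of j] j in \<open>auto intro: power_mono\<close>)
        then have "Suc (cost (Hd (Var 0)) s' + t1 + t2) \<le> (Suc d + 1) * C x"
          using Suc.prems B(2)[OF x, of j] size_left[of "st x j"] t1(1) t2(1) j by (simp add: C_def)
        with e show ?case by blast
      qed
      from this[of 0 "k x" s] s show "\<exists>t\<le>(k x + 1) * C x. exec ?w s t (s(0 := st x (k x)))" by simp
    qed
  qed
qed

lemma length_le_size_enc_list: "length xs \<le> size (enc_list xs)"
  by (induction xs) auto

lemma size_enc_list_drop: "size (enc_list (drop j xs)) \<le> size (enc_list xs)"
  by (induction xs arbitrary: j) (auto simp: drop_Cons le_SucI trans_le_add2 split: nat.splits)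

text \<open>The loop state consists of the remaining list, the input and the accumulator. The empty
  list is encoded as \<open>Leaf\<close>, so the list itself serves as the loop test.\<close>

lemma computable_from_fold:
  assumes l: "computable_from X a (\<lambda>x. enc_list (l x))"
    and i: "computable_from X a (\<lambda>x. acc x 0)"
    and step: "computable_from {(x, j). x \<in> X \<and> j < length (l x)}
      (\<lambda>(x, j). Node (a x) (Node (l x ! j) (acc x j))) (\<lambda>(x, j). acc x (Suc j))"
    and B: "poly_bounded X (\<lambda>x. size (a x)) B" "\<And>x j. x \<in> X \<Longrightarrow> j \<le> length (l x) \<Longrightarrow> size (acc x j) \<le> B x"
  shows "computable_from X a (\<lambda>x. acc x (length (l x)))"
proof -
  define st where "st x j = Node (enc_list (drop j (l x))) (Node (a x) (acc x j))" for x j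
  let ?I = "{(x, j). x \<in> X \<and> j < length (l x)}"
  let ?st = "\<lambda>(x, j). st x j"
  have init: "computable_from X a (\<lambda>x. st x 0)"
    unfolding st_def drop_0 by (intro computable_from_Node computable_from_id l i)
  have sz: "size (a x) \<le> size (st x 0)" for x by (simp add: st_def)
  have drop: "enc_list (drop j xs) = Node (xs ! j) (enc_list (drop (Suc j) xs))" if "j < length xs" for xs j
    using that by (simp add: Cons_nth_drop_Suc[symmetric])
  have a: "computable_from ?I ?st (\<lambda>(x, j). a x)"
    by (rule computable_from_cong[OF computable_from_left[OF computable_from_right[OF computable_from_id]]])
      (auto simp: st_def)
  have e: "computable_from ?I ?st (\<lambda>(x, j). l x ! j)"
    by (rule computable_from_cong[OF computable_from_left[OF computable_from_left[OF computable_from_id]]])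
      (auto simp: st_def drop)
  have r: "computable_from ?I ?st (\<lambda>(x, j). enc_list (drop (Suc j) (l x)))"
    by (rule computable_from_cong[OF computable_from_right[OF computable_from_left[OF computable_from_id]]])
      (auto simp: st_def drop)
  have acc: "computable_from ?I ?st (\<lambda>(x, j). acc x j)"
    by (rule computable_from_cong[OF computable_from_right[OF computable_from_right[OF computable_from_id]]])
      (auto simp: st_def)
  have "computable_from ?I ?st (\<lambda>p. Node (case p of (x, j) \<Rightarrow> a x)
      (Node (case p of (x, j) \<Rightarrow> l x ! j) (case p of (x, j) \<Rightarrow> acc x j)))"
    by (intro computable_from_Node a e acc)
  then have "computable_from ?I ?st (\<lambda>(x, j). Node (a x) (Node (l x ! j) (acc x j)))"
    by (rule computable_from_cong) auto
  note acc' = computable_from_trans[OF this step]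
  have "computable_from ?I ?st (\<lambda>p. Node (case p of (x, j) \<Rightarrow> enc_list (drop (Suc j) (l x)))
      (Node (case p of (x, j) \<Rightarrow> a x) (case p of (x, j) \<Rightarrow> acc x (Suc j))))"
    by (intro computable_from_Node a r acc')
  then have step': "computable_from ?I ?st (\<lambda>(x, j). st x (Suc j))"
    by (rule computable_from_cong) (auto simp: st_def)
  have lb: "poly_bounded X (\<lambda>x. size (st x 0)) (\<lambda>x. size (enc_list (l x)))"
    by (rule poly_bounded_base_mono[OF computable_from_size[OF l] sz])
  have Bb: "poly_bounded X (\<lambda>x. size (st x 0)) B"
    by (rule poly_bounded_base_mono[OF B(1) sz])
  have ab: "poly_bounded X (\<lambda>x. size (st x 0)) (\<lambda>x. size (a x))"
    by (rule poly_bounded_base_mono[OF poly_bounded_self sz])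
  have "computable_from X (\<lambda>x. st x 0) (\<lambda>x. st x (length (l x)))"
  proof (rule computable_from_While[OF step'])
    show "poly_bounded X (\<lambda>x. size (st x 0)) (\<lambda>x. length (l x))"
      by (rule poly_bounded_mono[OF lb]) (rule length_le_size_enc_list)
    show "poly_bounded X (\<lambda>x. size (st x 0)) (\<lambda>x. size (enc_list (l x)) + size (a x) + B x + 2)"
      by (intro poly_bounded_intros lb Bb ab)
    fix x j assume "x \<in> X" "j \<le> length (l x)"
    then show "size (st x j) \<le> size (enc_list (l x)) + size (a x) + B x + 2"
      using B(2)[of x j] size_enc_list_drop[of j "l x"] by (simp add: st_def)
  qed (auto simp: st_def drop)
  from computable_from_right[OF computable_from_right[OF computable_from_trans[OF init this]]]
  show ?thesis by (rule computable_from_cong) (auto simp: st_def)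
qed

lemma computable_from_subset: "computable_from Y a g \<Longrightarrow> X \<subseteq> Y \<Longrightarrow> computable_from X a g"
  by (rule computable_from_reindex[of Y a g X "\<lambda>x. x"]) auto

lemma computable_from_if:
  assumes "computable_from X a t" "computable_from X a g" "computable_from X a h"
    and P: "\<And>x. x \<in> X \<Longrightarrow> P x \<longleftrightarrow> t x \<noteq> Leaf"
  shows "computable_from X a (\<lambda>x. if P x then g x else h x)"
proof -
  let ?a = "\<lambda>x. Node (t x) (a x)"
  have "computable_from X ?a (\<lambda>x. if P x then g x else h x)"
    by (rule computable_from_Cond) (auto simp: P intro: computable_from_subset assms(2,3))
  then show ?thesis
    using computable_from_trans[OF computable_from_Node[OF assms(1) computable_from_id]] by blast
qed

lemma computable_from_const: "computable_from X a (\<lambda>_. d)"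
  by (induction d) (auto intro: computable_from_Leaf computable_from_Node)

section \<open>Deciding equality of trees\<close>

text \<open>The left half is a stack of pairs of trees still to be compared, the right half a flag
  that is \<open>Leaf\<close> as long as no difference was met. Two inner nodes are replaced by the
  pairs of their children; a mismatch empties the stack and sets the flag.\<close>

definition eq_step :: "dtree \<Rightarrow> dtree" where
  "eq_step S = (if left (left (left S)) \<noteq> Leaf then
      if right (left (left S)) \<noteq> Leaf then
        Node (Node (Node (left (left (left (left S)))) (left (right (left (left S)))))
          (Node (Node (right (left (left (left S)))) (right (right (left (left S))))) (right (left S)))) (right S)
      else Node Leaf (Node Leaf Leaf)
    else if right (left (left S)) \<noteq> Leaf then Node Leaf (Node Leaf Leaf)
    else Node (right (left S)) (right S))"

definition eq_state :: "(dtree \<times> dtree) list \<Rightarrow> dtree \<Rightarrow> dtree" where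
  "eq_state s r = Node (enc_list (map (\<lambda>(p, q). Node p q) s)) r"

text \<open>Splitting a pair with left tree \<open>Node a b\<close> lowers the measure from
  \<open>2 * size a + 2 * size b + 3\<close> to \<open>2 * size a + 2 * size b + 2\<close> and
  leaves the size of the state unchanged. The slack 2 is the size of the state left by a
  mismatch.\<close>

lemma eq_loop:
  "\<exists>k\<le>(\<Sum>(p, q)\<leftarrow>s. 2 * size p + 1). left ((eq_step ^^ k) (eq_state s r)) = Leaf
     \<and> (\<forall>j<k. left ((eq_step ^^ j) (eq_state s r)) \<noteq> Leaf)
     \<and> (\<forall>j\<le>k. size ((eq_step ^^ j) (eq_state s r)) \<le> size (eq_state s r) + 2)
     \<and> (right ((eq_step ^^ k) (eq_state s r)) = Leaf \<longleftrightarrow> r = Leaf \<and> (\<forall>(p, q)\<in>set s. p = q))"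
proof (induction "\<Sum>(p, q)\<leftarrow>s. 2 * size p + 1" arbitrary: s r rule: less_induct)
  case less
  show ?case
  proof (cases s)
    case Nil
    then show ?thesis by (intro exI[of _ 0]) (auto simp: eq_state_def)
  next
    case (Cons pq s')
    obtain p q where pq: "pq = (p, q)" by (cases pq)
    have ne: "left (eq_state s r) \<noteq> Leaf" by (simp add: Cons pq eq_state_def)
    have *: ?thesis if st: "eq_step (eq_state s r) = eq_state s2 r2"
      and m: "(\<Sum>(p, q)\<leftarrow>s2. 2 * size p + 1) < (\<Sum>(p, q)\<leftarrow>s. 2 * size p + 1)"
      and sz: "size (eq_state s2 r2) \<le> size (eq_state s r) \<or> s2 = [] \<and> r2 = Node Leaf Leaf"
      and iff: "r2 = Leaf \<and> (\<forall>(p, q)\<in>set s2. p = q) \<longleftrightarrow> r = Leaf \<and> (\<forall>(p, q)\<in>set s. p = q)" for s2 r2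
    proof (cases "s2 = [] \<and> r2 = Node Leaf Leaf")
      case True
      have "(\<Sum>(p, q)\<leftarrow>s. 2 * size p + 1) \<ge> 1" by (simp add: Cons pq)
      moreover have "j = 0 \<or> j = 1" if "j \<le> 1" for j :: nat using that by arith
      then have "size ((eq_step ^^ j) (eq_state s r)) \<le> size (eq_state s r) + 2" if "j \<le> 1" for j
        using that st True by (fastforce simp: eq_state_def)
      ultimately show ?thesis
        using st ne iff True by (intro exI[of _ 1]) (simp add: eq_state_def)
    next
      case False
      obtain k where k: "k \<le> (\<Sum>(p, q)\<leftarrow>s2. 2 * size p + 1)" "left ((eq_step ^^ k) (eq_state s2 r2)) = Leaf"
        "\<And>j. j < k \<Longrightarrow> left ((eq_step ^^ j) (eq_state s2 r2)) \<noteq> Leaf"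
        "\<And>j. j \<le> k \<Longrightarrow> size ((eq_step ^^ j) (eq_state s2 r2)) \<le> size (eq_state s2 r2) + 2"
        "right ((eq_step ^^ k) (eq_state s2 r2)) = Leaf \<longleftrightarrow> r2 = Leaf \<and> (\<forall>(p, q)\<in>set s2. p = q)"
        using less[OF m, of r2] by (elim exE conjE) (rule that, blast+)
      have sw: "(eq_step ^^ Suc j) (eq_state s r) = (eq_step ^^ j) (eq_state s2 r2)" for j
        by (simp only: funpow_Suc_right o_apply st)
      show ?thesis
      proof (intro exI[of _ "Suc k"] conjI allI impI)
        show "Suc k \<le> (\<Sum>(p, q)\<leftarrow>s. 2 * size p + 1)" using k(1) m by simp
        show "left ((eq_step ^^ Suc k) (eq_state s r)) = Leaf" unfolding sw by (rule k)
        show "left ((eq_step ^^ j) (eq_state s r)) \<noteq> Leaf" if "j < Suc k" for j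
        proof (cases j)
          case 0
          then show ?thesis using ne by simp
        next
          case (Suc i)
          show ?thesis unfolding Suc sw by (rule k(3)) (use that Suc in simp)
        qed
        show "size ((eq_step ^^ j) (eq_state s r)) \<le> size (eq_state s r) + 2" if "j \<le> Suc k" for j
        proof (cases j)
          case (Suc i)
          have "size ((eq_step ^^ i) (eq_state s2 r2)) \<le> size (eq_state s2 r2) + 2"
            by (rule k(4)) (use that Suc in simp)
          also have "\<dots> \<le> size (eq_state s r) + 2" using sz False by auto
          finally show ?thesis unfolding Suc sw .
        qed simp
        show "right ((eq_step ^^ Suc k) (eq_state s r)) = Leaf \<longleftrightarrow> r = Leaf \<and> (\<forall>(p, q)\<in>set s. p = q)"
          unfolding sw k(5) by (rule iff)
      qed
    qed
    show ?thesis
    proof (cases p)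
      case p: Leaf
      show ?thesis
      proof (cases q)
        case Leaf
        show ?thesis
          by (rule *[of s' r]) (simp_all add: Cons pq p Leaf eq_step_def eq_state_def, auto?)
      next
        case (Node c d)
        show ?thesis
          by (rule *[of "[]" "Node Leaf Leaf"]) (simp_all add: Cons pq p Node eq_step_def eq_state_def, auto?)
      qed
    next
      case p: (Node a b)
      show ?thesis
      proof (cases q)
        case Leaf
        show ?thesis
          by (rule *[of "[]" "Node Leaf Leaf"]) (simp_all add: Cons pq p Leaf eq_step_def eq_state_def, auto?)
      next
        case (Node c d)
        show ?thesis
          by (rule *[of "(a, c) # (b, d) # s'" r]) (simp_all add: Cons pq p Node eq_step_def eq_state_def, auto?)
      qed
    qed
  qed
qed

lemma computable_from_eq_step: "computable_from X a (\<lambda>x. eq_step (a x))"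
  unfolding eq_step_def
  by (intro computable_from_if[where t = "\<lambda>x. left (left (left (a x)))"]
      computable_from_if[where t = "\<lambda>x. right (left (left (a x)))"]
      computable_from_Node computable_from_left computable_from_right computable_from_id computable_from_Leaf) auto

lemma computable_from_eq:
  assumes "computable_from X a g" "computable_from X a h"
  shows "computable_from X a (\<lambda>x. if g x = h x then Node Leaf Leaf else Leaf)"
proof -
  let ?S = "\<lambda>x. eq_state [(g x, h x)] Leaf"
  have "\<exists>k. \<forall>x. k x \<le> 2 * size (g x) + 1 \<and> left ((eq_step ^^ k x) (?S x)) = Leaf
     \<and> (\<forall>j<k x. left ((eq_step ^^ j) (?S x)) \<noteq> Leaf)
     \<and> (\<forall>j\<le>k x. size ((eq_step ^^ j) (?S x)) \<le> size (?S x) + 2)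
     \<and> (right ((eq_step ^^ k x) (?S x)) = Leaf \<longleftrightarrow> g x = h x)"
  proof (rule choice, rule allI)
    fix x
    show "\<exists>k. k \<le> 2 * size (g x) + 1 \<and> left ((eq_step ^^ k) (?S x)) = Leaf
     \<and> (\<forall>j<k. left ((eq_step ^^ j) (?S x)) \<noteq> Leaf)
     \<and> (\<forall>j\<le>k. size ((eq_step ^^ j) (?S x)) \<le> size (?S x) + 2)
     \<and> (right ((eq_step ^^ k) (?S x)) = Leaf \<longleftrightarrow> g x = h x)"
      using eq_loop[of "[(g x, h x)]" Leaf] by simp
  qed
  then obtain k where k: "\<And>x. k x \<le> 2 * size (g x) + 1" "\<And>x. left ((eq_step ^^ k x) (?S x)) = Leaf"
     "\<And>x j. j < k x \<Longrightarrow> left ((eq_step ^^ j) (?S x)) \<noteq> Leaf"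
     "\<And>x j. j \<le> k x \<Longrightarrow> size ((eq_step ^^ j) (?S x)) \<le> size (?S x) + 2"
     "\<And>x. right ((eq_step ^^ k x) (?S x)) = Leaf \<longleftrightarrow> g x = h x"
    by blast
  have 1: "computable_from X a ?S"
    unfolding eq_state_def by (auto intro!: computable_from_Node computable_from_Leaf assms)
  have "computable_from X (\<lambda>x. (eq_step ^^ 0) (?S x)) (\<lambda>x. (eq_step ^^ k x) (?S x))"
  proof (rule computable_from_While)
    show "computable_from {(x, j). x \<in> X \<and> j < k x} (\<lambda>(x, j). (eq_step ^^ j) (?S x)) (\<lambda>(x, j). (eq_step ^^ Suc j) (?S x))"
      by (rule computable_from_cong[OF computable_from_eq_step[of _ "\<lambda>(x, j). (eq_step ^^ j) (?S x)"]]) auto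
    show "poly_bounded X (\<lambda>x. size ((eq_step ^^ 0) (?S x))) k"
      by (unfold funpow_0, rule poly_bounded_mono[of _ _ "\<lambda>x. 2 * size (?S x) + 1"], intro poly_bounded_intros)
        (rule order_trans[OF k(1)], simp add: eq_state_def)
    show "poly_bounded X (\<lambda>x. size ((eq_step ^^ 0) (?S x))) (\<lambda>x. size (?S x) + 2)"
      by (unfold funpow_0, intro poly_bounded_intros)
  qed (rule k(3) k(2) k(4), assumption?)+
  then have "computable_from X ?S (\<lambda>x. (eq_step ^^ k x) (?S x))" unfolding funpow_0 .
  from computable_from_right[OF computable_from_trans[OF 1 this]]
  have r: "computable_from X a (\<lambda>x. right ((eq_step ^^ k x) (?S x)))" .
  have "computable_from X a (\<lambda>x. if g x \<noteq> h x then Leaf else Node Leaf Leaf)"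
    by (rule computable_from_if[OF r]) (auto intro: computable_from_const simp: k(5))
  then show ?thesis by (rule computable_from_cong) auto
qed

section \<open>Polynomial-time functions between encoded types\<close>

text \<open>Injectivity turns equality of values into equality of trees, which the loop above
  decides.\<close>

class enc =
  fixes enc :: "'a \<Rightarrow> dtree"
  assumes enc_inject: "enc x = enc y \<longleftrightarrow> x = y"

instantiation nat :: enc
begin
definition "enc = Defs.enc_nat"
instance
proof
  fix x y :: nat
  show "enc x = enc y \<longleftrightarrow> x = y"
    unfolding enc_nat_def
  proof (induction x arbitrary: y)
    case 0
    then show ?case by (cases y) auto
  next
    case (Suc x)
    then show ?case by (cases y) auto
  qed
qed
end

instantiation bool :: enc
begin
definition "enc b = (if b then Node Leaf Leaf else Leaf)"
instance by standard (auto simp: enc_bool_def)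
end

instantiation prod :: (enc, enc) enc
begin
definition "enc p = Node (enc (fst p)) (enc (snd p))"
instance by standard (auto simp: enc_prod_def enc_inject prod_eq_iff)
end

instantiation list :: (enc) enc
begin
definition "enc xs = Defs.enc_list (map enc xs)"
instance
proof
  fix xs ys :: "'a list"
  show "enc xs = enc ys \<longleftrightarrow> xs = ys"
    unfolding enc_list_def
  proof (induction xs arbitrary: ys)
    case Nil
    then show ?case by (cases ys) auto
  next
    case (Cons x xs)
    then show ?case by (cases ys) (auto simp: enc_inject)
  qed
qed
end

definition ptime :: "('x::enc \<Rightarrow> 'y::enc) \<Rightarrow> bool" where
  "ptime f \<longleftrightarrow> computable_from UNIV enc (\<lambda>x. enc (f x))"

named_theorems ptime_intros

lemma ptime_id [ptime_intros]: "ptime (\<lambda>x. x)"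
  by (simp add: ptime_def computable_from_id)

lemma ptime_const [ptime_intros]: "ptime (\<lambda>_. c)"
  by (simp add: ptime_def computable_from_const)

lemma ptime_comp: "ptime f \<Longrightarrow> ptime g \<Longrightarrow> ptime (\<lambda>x. g (f x))"
  unfolding ptime_def
  by (rule computable_from_trans[of UNIV enc "\<lambda>x. enc (f x)" "\<lambda>x. enc (g (f x))"], assumption)
    (rule computable_from_reindex[of UNIV enc "\<lambda>x. enc (g x)" UNIV f], auto)

lemma ptime_Pair [ptime_intros]: "ptime f \<Longrightarrow> ptime g \<Longrightarrow> ptime (\<lambda>x. (f x, g x))"
  by (simp add: ptime_def enc_prod_def computable_from_Node)

lemma ptime_fst [ptime_intros]: "ptime f \<Longrightarrow> ptime (\<lambda>x. fst (f x))"
  unfolding ptime_def by (rule computable_from_cong[OF computable_from_left]) (auto simp: enc_prod_def)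

lemma ptime_snd [ptime_intros]: "ptime f \<Longrightarrow> ptime (\<lambda>x. snd (f x))"
  unfolding ptime_def by (rule computable_from_cong[OF computable_from_right]) (auto simp: enc_prod_def)

lemma ptime_if [ptime_intros]:
  assumes "ptime b" "ptime f" "ptime g"
  shows "ptime (\<lambda>x. if b x then f x else g x)"
  unfolding ptime_def
  by (rule computable_from_cong[OF computable_from_if[of UNIV enc "\<lambda>x. enc (b x)" "\<lambda>x. enc (f x)" "\<lambda>x. enc (g x)" b]])
    (use assms in \<open>auto simp: ptime_def enc_bool_def\<close>)

lemma ptime_eq [ptime_intros]: "ptime f \<Longrightarrow> ptime g \<Longrightarrow> ptime (\<lambda>x. f x = g x)"
  unfolding ptime_def
  by (rule computable_from_cong[OF computable_from_eq[of UNIV enc "\<lambda>x. enc (f x)" "\<lambda>x. enc (g x)"]])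
    (auto simp: enc_bool_def enc_inject)

lemma ptime_not [ptime_intros]: "ptime f \<Longrightarrow> ptime (\<lambda>x. \<not> f x)"
  by (rule back_subst[of ptime, OF ptime_if[of f "\<lambda>_. False" "\<lambda>_. True"]]) (auto intro: ptime_const)

lemma ptime_conj [ptime_intros]: "ptime f \<Longrightarrow> ptime g \<Longrightarrow> ptime (\<lambda>x. f x \<and> g x)"
  by (rule back_subst[of ptime, OF ptime_if[of f g "\<lambda>_. False"]]) (auto intro: ptime_const)

lemma ptime_disj [ptime_intros]: "ptime f \<Longrightarrow> ptime g \<Longrightarrow> ptime (\<lambda>x. f x \<or> g x)"
  by (rule back_subst[of ptime, OF ptime_if[of f "\<lambda>_. True" g]]) (auto intro: ptime_const)

lemma ptime_Cons [ptime_intros]: "ptime f \<Longrightarrow> ptime g \<Longrightarrow> ptime (\<lambda>x. f x # g x)"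
  by (simp add: ptime_def enc_list_def computable_from_Node)

lemma ptime_Suc [ptime_intros]: "ptime f \<Longrightarrow> ptime (\<lambda>x. Suc (f x))"
  by (simp add: ptime_def enc_nat_def computable_from_Node computable_from_Leaf)

lemma ptime_diff1:
  fixes f :: "'x::enc \<Rightarrow> nat"
  assumes "ptime f"
  shows "ptime (\<lambda>x. f x - 1)"
proof -
  have "right (enc n) = enc (n - 1)" for n :: nat
    by (cases n) (auto simp: enc_nat_def)
  moreover have "computable_from UNIV enc (\<lambda>x. right (enc (f x)))"
    using assms by (simp add: ptime_def computable_from_right)
  ultimately show ?thesis by (simp add: ptime_def del: One_nat_def)
qed

abbreviation bsize :: "'a::enc \<Rightarrow> nat" where "bsize x \<equiv> size (enc x)"

abbreviation pbound :: "('x::enc \<Rightarrow> nat) \<Rightarrow> bool" where "pbound \<equiv> poly_bounded UNIV bsize"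

lemma ptime_size: "ptime f \<Longrightarrow> pbound (\<lambda>x. bsize (f x))"
  unfolding ptime_def by (rule computable_from_size)

lemma ptime_fold_bounded:
  fixes F :: "'x::enc \<Rightarrow> 'e::enc \<Rightarrow> 'acc::enc \<Rightarrow> 'acc"
  assumes l: "ptime l" and i: "ptime i"
    and step: "ptime (\<lambda>p. F (fst p) (fst (snd p)) (snd (snd p)))"
    and B: "pbound B" "\<And>x j. j \<le> length (l x) \<Longrightarrow> bsize (fold (F x) (take j (l x)) (i x)) \<le> B x"
  shows "ptime (\<lambda>x. fold (F x) (l x) (i x))"
proof -
  let ?acc = "\<lambda>x j. enc (fold (F x) (take j (l x)) (i x))"
  let ?I = "{(x, j). x \<in> UNIV \<and> j < length (map enc (l x))}"
  let ?h = "\<lambda>(x, j). (x, l x ! j, fold (F x) (take j (l x)) (i x))"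
  have "computable_from ?I (\<lambda>p. enc (?h p)) (\<lambda>p. enc (F (fst (?h p)) (fst (snd (?h p))) (snd (snd (?h p)))))"
    using step unfolding ptime_def by (rule computable_from_reindex) simp
  then have *: "computable_from ?I (\<lambda>(x, j). Node (enc x) (Node (map enc (l x) ! j) (?acc x j))) (\<lambda>(x, j). ?acc x (Suc j))"
    by (rule computable_from_cong) (auto simp: enc_prod_def take_Suc_conv_app_nth)
  have "computable_from UNIV enc (\<lambda>x. ?acc x (length (map enc (l x))))"
  proof (rule computable_from_fold[OF _ _ * B(1)])
    show "computable_from UNIV enc (\<lambda>x. enc_list (map enc (l x)))"
      using l by (simp add: ptime_def enc_list_def)
    show "computable_from UNIV enc (\<lambda>x. ?acc x 0)" using i by (simp add: ptime_def)
  qed (use B(2) in auto)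
  then show ?thesis unfolding ptime_def by simp
qed

lemma bsize_le_list: "e \<in> set xs \<Longrightarrow> bsize e \<le> bsize xs"
  by (induction xs) (auto simp: enc_list_def)

lemma length_le_bsize: "length xs \<le> bsize xs"
  using length_le_size_enc_list[of "map enc xs"] by (simp add: enc_list_def)

text \<open>Each round may add at most \<open>Q x\<close>, whatever the accumulator, so the size
  grows linearly in the number of rounds and repeated doubling is excluded.\<close>

lemma ptime_fold:
  fixes F :: "'x::enc \<Rightarrow> 'e::enc \<Rightarrow> 'acc::enc \<Rightarrow> 'acc"
  assumes l: "ptime l" and i: "ptime i"
    and step: "ptime (\<lambda>p. F (fst p) (fst (snd p)) (snd (snd p)))"
    and Q: "pbound Q" "\<And>x e acc. e \<in> set (l x) \<Longrightarrow> bsize (F x e acc) \<le> bsize acc + Q x"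
  shows "ptime (\<lambda>x. fold (F x) (l x) (i x))"
proof (rule ptime_fold_bounded[OF l i step])
  show "pbound (\<lambda>x. bsize (i x) + bsize (l x) * Q x)"
    by (intro poly_bounded_intros Q(1) ptime_size i l)
  fix x j assume "j \<le> length (l x)"
  then have "bsize (fold (F x) (take j (l x)) (i x)) \<le> bsize (i x) + j * Q x"
  proof (induction j)
    case (Suc j)
    have "bsize (F x (l x ! j) (fold (F x) (take j (l x)) (i x))) \<le> bsize (fold (F x) (take j (l x)) (i x)) + Q x"
      by (rule Q(2)) (use Suc.prems in simp)
    then show ?case using Suc by (simp add: take_Suc_conv_app_nth)
  qed simp
  moreover have "j * Q x \<le> bsize (l x) * Q x"
    using \<open>j \<le> length (l x)\<close> length_le_bsize[of "l x"] by (intro mult_right_mono) auto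
  ultimately show "bsize (fold (F x) (take j (l x)) (i x)) \<le> bsize (i x) + bsize (l x) * Q x" by linarith
qed

text \<open>An element is no larger than the list containing it, so one polynomial in the size of
  \<open>x\<close> bounds the results for all elements.\<close>

lemma ptime_element_bound:
  assumes f: "ptime (\<lambda>p. f (fst p) (snd p))" and l: "ptime l"
  obtains Q where "pbound Q" "\<And>x e. e \<in> set (l x) \<Longrightarrow> bsize (f x e) \<le> Q x"
proof -
  obtain b where b: "\<And>p. bsize (f (fst p) (snd p)) \<le> (bsize p + 2) ^ b"
    using ptime_size[OF f] unfolding poly_bounded_def by blast
  let ?Q = "\<lambda>x. (bsize x + bsize (l x) + 3) ^ b"
  show thesis
  proof (rule that[of ?Q])
    show "pbound ?Q" by (intro poly_bounded_power poly_bounded_intros ptime_size l)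
    fix x e assume "e \<in> set (l x)"
    then have "bsize (x, e) + 2 \<le> bsize x + bsize (l x) + 3"
      using bsize_le_list[of e "l x"] by (simp add: enc_prod_def)
    then have "(bsize (x, e) + 2) ^ b \<le> ?Q x" by (rule power_mono) simp
    then show "bsize (f x e) \<le> ?Q x" using b[of "(x, e)"] by simp
  qed
qed

lemma bsize_Nil [simp]: "bsize [] = 0" by (simp add: enc_list_def)
lemma bsize_Cons [simp]: "bsize (x # xs) = bsize x + bsize xs + 1" by (simp add: enc_list_def)
lemma bsize_Pair [simp]: "bsize (x, y) = bsize x + bsize y + 1" by (simp add: enc_prod_def)
lemma bsize_nat [simp]: "bsize (n :: nat) = n" by (induction n) (auto simp: enc_nat_def)
lemma bsize_append [simp]: "bsize (xs @ ys) = bsize xs + bsize ys" by (induction xs) auto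
lemma bsize_filter: "bsize (filter P xs) \<le> bsize xs" by (induction xs) auto

section \<open>List operations and arithmetic\<close>

lemma ptime_rev [ptime_intros]: assumes "ptime f" shows "ptime (\<lambda>x. rev (f x))"
proof -
  have "ptime (\<lambda>x. fold Cons (f x) [])"
  proof (rule ptime_fold[of f "\<lambda>_. []" "\<lambda>_. Cons"])
    show "pbound (\<lambda>x. bsize (f x) + 1)" by (intro poly_bounded_intros ptime_size assms)
    fix x e acc assume "e \<in> set (f x)"
    then show "bsize (e # acc) \<le> bsize acc + (bsize (f x) + 1)"
      using bsize_le_list[of e "f x"] by simp
  qed (intro ptime_intros assms)+
  then show ?thesis by (simp add: rev_conv_fold)
qed

lemma ptime_append [ptime_intros]:
  fixes f g :: "'x::enc \<Rightarrow> 'e::enc list"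
  assumes "ptime f" "ptime g" shows "ptime (\<lambda>x. f x @ g x)"
proof -
  have "ptime (\<lambda>x. fold Cons (rev (f x)) (g x))"
  proof (rule ptime_fold[of "\<lambda>x. rev (f x)" g "\<lambda>_. Cons"])
    show "pbound (\<lambda>x. bsize (f x) + 1)" by (intro poly_bounded_intros ptime_size assms)
    fix x e acc assume "e \<in> set (rev (f x))"
    then show "bsize (e # acc) \<le> bsize acc + (bsize (f x) + 1)"
      using bsize_le_list[of e "f x"] by simp
  qed (intro ptime_intros assms)+
  moreover have "fold Cons (rev xs) ys = xs @ ys" for xs ys :: "'e list"
    by (simp add: fold_Cons_rev)
  ultimately show ?thesis by simp
qed

lemma ptime_map [ptime_intros]:
  fixes f :: "'x::enc \<Rightarrow> 'e::enc \<Rightarrow> 'b::enc"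
  assumes "ptime l" "ptime (\<lambda>p. f (fst p) (snd p))"
  shows "ptime (\<lambda>x. map (f x) (l x))"
proof -
  obtain Q where Q: "pbound Q" "\<And>x e. e \<in> set (l x) \<Longrightarrow> bsize (f x e) \<le> Q x"
    using ptime_element_bound[OF assms(2,1)] by blast
  have c: "ptime (\<lambda>p. f (fst p) (fst (snd p)))"
    using ptime_comp[OF _ assms(2), of "\<lambda>p. (fst p, fst (snd p))"] by (simp add: ptime_intros)
  have "ptime (\<lambda>x. fold (\<lambda>e acc. f x e # acc) (l x) [])"
  proof (rule ptime_fold)
    show "pbound (\<lambda>x. Q x + 1)" by (intro poly_bounded_intros Q)
  qed (use Q(2) in \<open>auto intro!: ptime_intros assms c\<close>)
  then have "ptime (\<lambda>x. rev (fold (\<lambda>e acc. f x e # acc) (l x) []))" by (rule ptime_rev)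
  moreover have "fold (\<lambda>e acc. h e # acc) xs ys = rev (map h xs) @ ys" for h :: "'e \<Rightarrow> 'b" and xs ys
    by (induction xs arbitrary: ys) auto
  ultimately show ?thesis by simp
qed

lemma ptime_filter [ptime_intros]:
  fixes l :: "'x::enc \<Rightarrow> 'b::enc list"
  assumes "ptime l" "ptime (\<lambda>p. P (fst p) (snd p))"
  shows "ptime (\<lambda>x. filter (P x) (l x))"
proof -
  have c: "ptime (\<lambda>p. P (fst p) (fst (snd p)))"
    using ptime_comp[OF _ assms(2), of "\<lambda>p. (fst p, fst (snd p))"] by (simp add: ptime_intros)
  have "ptime (\<lambda>x. fold (\<lambda>e acc. if P x e then e # acc else acc) (l x) [])"
  proof (rule ptime_fold)
    show "pbound (\<lambda>x. bsize (l x) + 1)" by (intro poly_bounded_intros ptime_size assms)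
    fix x e acc assume "e \<in> set (l x)"
    then show "bsize (if P x e then e # acc else acc) \<le> bsize acc + (bsize (l x) + 1)"
      using bsize_le_list[of e "l x"] by simp
  qed (auto intro!: ptime_intros assms c)
  then have "ptime (\<lambda>x. rev (fold (\<lambda>e acc. if P x e then e # acc else acc) (l x) []))" by (rule ptime_rev)
  moreover have "fold (\<lambda>e acc. if h e then e # acc else acc) xs ys = rev (filter h xs) @ ys" for h :: "'b \<Rightarrow> bool" and xs ys
    by (induction xs arbitrary: ys) auto
  ultimately show ?thesis by simp
qed

lemma ptime_Bex [ptime_intros]:
  assumes "ptime l" "ptime (\<lambda>p. P (fst p) (snd p))"
  shows "ptime (\<lambda>x. \<exists>e\<in>set (l x). P x e)"
proof -
  have "ptime (\<lambda>x. filter (P x) (l x) \<noteq> [])" by (intro ptime_intros assms)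
  then show ?thesis by (simp add: filter_empty_conv)
qed

lemma ptime_Ball [ptime_intros]:
  assumes "ptime l" "ptime (\<lambda>p. P (fst p) (snd p))"
  shows "ptime (\<lambda>x. \<forall>e\<in>set (l x). P x e)"
proof -
  have "ptime (\<lambda>x. \<not> (\<exists>e\<in>set (l x). \<not> P x e))" by (intro ptime_intros assms)
  then show ?thesis by simp
qed

lemma ptime_member [ptime_intros]:
  assumes "ptime f" "ptime l" shows "ptime (\<lambda>x. f x \<in> set (l x))"
proof -
  have "ptime (\<lambda>x. \<exists>e\<in>set (l x). e = f x)"
    by (intro ptime_intros assms ptime_comp[OF _ assms(1)])
  then show ?thesis by simp
qed

text \<open>\<open>False\<close> is encoded as \<open>Leaf\<close>, so a unary number and the list
  of that many \<open>False\<close> are the same tree. This turns a number into a list to fold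
  over.\<close>

lemma ptime_replicate: "ptime f \<Longrightarrow> ptime (\<lambda>x. replicate (f x) False)"
proof -
  have "enc (replicate n False) = enc n" for n
    by (induction n) (auto simp: enc_nat_def enc_list_def enc_bool_def)
  then show "ptime f \<Longrightarrow> ptime (\<lambda>x. replicate (f x) False)" for f :: "'a \<Rightarrow> nat"
    by (simp add: ptime_def)
qed

lemma ptime_funpow_bounded:
  fixes F :: "'x::enc \<Rightarrow> 'acc::enc \<Rightarrow> 'acc"
  assumes n: "ptime n" and i: "ptime i" and F: "ptime (\<lambda>p. F (fst p) (snd p))"
    and B: "pbound B" "\<And>x j. j \<le> n x \<Longrightarrow> bsize ((F x ^^ j) (i x)) \<le> B x"
  shows "ptime (\<lambda>x. (F x ^^ n x) (i x))"
proof -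
  have c: "ptime (\<lambda>p. F (fst p) (snd (snd p)))"
    using ptime_comp[OF _ F, of "\<lambda>p. (fst p, snd (snd p))"] by (simp add: ptime_intros)
  have "ptime (\<lambda>x. fold (\<lambda>_. F x) (replicate (n x) False) (i x))"
    by (rule ptime_fold_bounded[OF ptime_replicate[OF n] i _ B(1)])
      (auto simp: B(2) min_def intro!: c)
  then show ?thesis by simp
qed

lemma ptime_funpow:
  fixes F :: "'x::enc \<Rightarrow> 'acc::enc \<Rightarrow> 'acc"
  assumes n: "ptime n" and i: "ptime i" and F: "ptime (\<lambda>p. F (fst p) (snd p))"
    and Q: "pbound Q" "\<And>x acc. bsize (F x acc) \<le> bsize acc + Q x"
  shows "ptime (\<lambda>x. (F x ^^ n x) (i x))"
proof -
  have c: "ptime (\<lambda>p. F (fst p) (snd (snd p)))"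
    using ptime_comp[OF _ F, of "\<lambda>p. (fst p, snd (snd p))"] by (simp add: ptime_intros)
  have "ptime (\<lambda>x. fold (\<lambda>_. F x) (replicate (n x) False) (i x))"
    by (rule ptime_fold[OF ptime_replicate[OF n] i _ Q(1)]) (auto simp: Q(2) intro!: c)
  then show ?thesis by simp
qed

lemma ptime_upt [ptime_intros]:
  fixes n :: "'x::enc \<Rightarrow> nat"
  assumes "ptime n" shows "ptime (\<lambda>x. [0..<n x])"
proof -
  \<comment> \<open>Each round conses the current length: the list under construction is its own
    counter.\<close>
  have eq: "((\<lambda>l. length l # l) ^^ j) [] = rev [0..<j]" for j by (induction j) auto
  have len: "ptime (\<lambda>p :: 'x \<times> nat list. length (snd p))"
  proof -
    have "ptime (\<lambda>p :: 'x \<times> nat list. fold (\<lambda>_. Suc) (snd p) 0)"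
      by (rule ptime_fold[OF _ _ _ poly_bounded_const[of _ _ 1]]) (auto intro!: ptime_intros)
    moreover have "fold (\<lambda>_. Suc) xs k = k + length xs" for xs :: "nat list" and k
      by (induction xs arbitrary: k) auto
    ultimately show ?thesis by simp
  qed
  have sz: "bsize (rev [0..<j]) \<le> j * j" for j by (induction j) auto
  have "ptime (\<lambda>x. ((\<lambda>l. length l # l) ^^ n x) ([] :: nat list))"
  proof (rule ptime_funpow_bounded[OF assms ptime_const _ , of "\<lambda>_ l. length l # l" "\<lambda>x. n x * n x" ])
    show "pbound (\<lambda>x. n x * n x)"
      using ptime_size[OF assms] by (intro poly_bounded_intros) simp_all
    show "ptime (\<lambda>p :: 'x \<times> nat list. length (snd p) # snd p)"
      by (rule ptime_Cons[OF len ptime_snd[OF ptime_id]])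
    fix x j assume "j \<le> n x"
    then show "bsize (((\<lambda>l. length l # l) ^^ j) ([] :: nat list)) \<le> n x * n x"
      unfolding eq using sz[of j] mult_le_mono[of j "n x" j "n x"] by linarith
  qed
  then have "ptime (\<lambda>x. rev (rev [0..<n x]))" unfolding eq by (rule ptime_rev)
  then show ?thesis by simp
qed

lemma ptime_length [ptime_intros]:
  fixes l :: "'x::enc \<Rightarrow> 'b::enc list"
  assumes "ptime l" shows "ptime (\<lambda>x. length (l x))"
proof -
  have "ptime (\<lambda>x. fold (\<lambda>_. Suc) (l x) 0)"
    by (rule ptime_fold[OF _ _ _ poly_bounded_const[of _ _ 1]]) (auto intro!: ptime_intros assms)
  moreover have "fold (\<lambda>_. Suc) xs k = k + length xs" for xs :: "'b list" and k
    by (induction xs arbitrary: k) auto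
  ultimately show ?thesis by simp
qed

lemma ptime_concat [ptime_intros]:
  fixes l :: "'x::enc \<Rightarrow> 'b::enc list list"
  assumes "ptime l" shows "ptime (\<lambda>x. concat (l x))"
proof -
  have "ptime (\<lambda>x. fold (\<lambda>e acc. acc @ e) (l x) [])"
    by (rule ptime_fold[OF _ _ _ ptime_size[OF assms]]) (auto intro!: ptime_intros assms bsize_le_list)
  moreover have "fold (\<lambda>e acc. acc @ e) xs ys = ys @ concat xs" for xs :: "'b list list" and ys
    by (induction xs arbitrary: ys) auto
  ultimately show ?thesis by simp
qed

lemma ptime_minus [ptime_intros]:
  assumes "ptime f" "ptime g" shows "ptime (\<lambda>x. f x - g x :: nat)"
proof -
  have "ptime (\<lambda>x. ((\<lambda>n. n - 1) ^^ g x) (f x))"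
    by (rule ptime_funpow[OF _ _ _ poly_bounded_const[of _ _ 1]]) (auto intro!: ptime_intros ptime_diff1[unfolded One_nat_def] assms)
  moreover have "((\<lambda>n. n - 1) ^^ a) b = b - a" for a b :: nat by (induction a) auto
  ultimately show ?thesis by simp
qed

lemma ptime_le [ptime_intros]:
  assumes "ptime f" "ptime g" shows "ptime (\<lambda>x. (f x :: nat) \<le> g x)"
proof -
  have "ptime (\<lambda>x. f x - g x = 0)" by (intro ptime_intros assms)
  then show ?thesis by simp
qed

lemma ptime_less [ptime_intros]:
  assumes "ptime f" "ptime g" shows "ptime (\<lambda>x. (f x :: nat) < g x)"
proof -
  have "ptime (\<lambda>x. \<not> g x \<le> f x)" by (intro ptime_intros assms)
  then show ?thesis by (simp add: not_le)
qed

text \<open>A counter that wraps round at \<open>g x\<close> is advanced \<open>f x\<close> times.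
  For modulus 0 it never wraps, in accordance with \<open>a mod 0 = a\<close>.\<close>

lemma ptime_mod [ptime_intros]:
  assumes "ptime f" "ptime g" shows "ptime (\<lambda>x. (f x :: nat) mod g x)"
proof -
  have "ptime (\<lambda>x. ((\<lambda>r. if Suc r = g x then 0 else Suc r) ^^ f x) 0)"
    by (rule ptime_funpow[OF _ _ _ poly_bounded_const[of _ _ 1]])
      (auto intro!: ptime_intros assms ptime_comp[OF _ assms(2)])
  moreover have "((\<lambda>r. if Suc r = m then 0 else Suc r) ^^ a) 0 = a mod m" for a m :: nat
    by (induction a) (auto simp: mod_Suc)
  ultimately show ?thesis by simp
qed

lemma ptime_odd [ptime_intros]: "ptime f \<Longrightarrow> ptime (\<lambda>x. odd (f x :: nat))"
proof -
  assume "ptime f"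
  then have "ptime (\<lambda>x. f x mod 2 = 1)" by (intro ptime_intros)
  then show ?thesis by (simp add: odd_iff_mod_2_eq_one)
qed

section \<open>Alternating walks in the bipartite double cover\<close>

definition adj :: "'a set set \<Rightarrow> ('a \<times> 'a) set" where
  "adj A = {(u, v). {u, v} \<in> A}"

text \<open>A triple \<open>(u, v, k)\<close> permits the colour \<open>k\<close> on the edge \<open>uv\<close>. The state \<open>(v, k)\<close> stands for
  having reached \<open>v\<close> along an edge of colour \<open>k\<close>, so paths of arcs are alternating walks.\<close>

definition arcs :: "('a \<times> 'a \<times> bool) set \<Rightarrow> (('a \<times> bool) \<times> ('a \<times> bool)) set" where
  "arcs G = {((u, \<not> k), (v, k)) | u v k. (u, v, k) \<in> G}"

definition free :: "'a set set \<Rightarrow> ('a \<times> 'a \<times> bool) set" where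
  "free A = {(u, v, k). {u, v} \<in> A}"

text \<open>With both colours permitted on every edge each arc has its reverse, so this is
  connectivity in the double cover.\<close>

definition linked :: "'a set set \<Rightarrow> (('a \<times> bool) \<times> ('a \<times> bool)) set" where
  "linked A = (arcs (free A))\<^sup>*"

text \<open>Every arc switches the bit, so linking the two lifts of one vertex amounts to a closed
  walk of odd length.\<close>

definition has_odd :: "'a set set \<Rightarrow> bool" where
  "has_odd A \<longleftrightarrow> (\<exists>u. ((u, False), (u, True)) \<in> linked A)"

fun flip :: "'a \<times> bool \<Rightarrow> 'a \<times> bool" where
  "flip (v, k) = (v, \<not> k)"

definition sym_perms :: "('a \<times> 'a \<times> bool) set \<Rightarrow> bool" where
  "sym_perms G \<longleftrightarrow> (\<forall>u v k. (u, v, k) \<in> G \<longrightarrow> (v, u, k) \<in> G)"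

lemma arcs_iff: "((u, i), (v, k)) \<in> arcs G \<longleftrightarrow> i = (\<not> k) \<and> (u, v, k) \<in> G"
  by (auto simp: arcs_def)

lemma arcs_mono: "G \<subseteq> G' \<Longrightarrow> arcs G \<subseteq> arcs G'"
  by (auto simp: arcs_def)

lemma free_mono: "A \<subseteq> B \<Longrightarrow> free A \<subseteq> free B"
  by (auto simp: free_def)

lemma free_iff [simp]: "(u, v, k) \<in> free A \<longleftrightarrow> {u, v} \<in> A"
  by (simp add: free_def)

lemma sym_perms_free: "sym_perms (free A)"
  by (simp add: sym_perms_def insert_commute)

lemma arcs_flip: "sym_perms G \<Longrightarrow> (p, q) \<in> arcs G \<Longrightarrow> (flip q, flip p) \<in> arcs G"
  by (auto simp: arcs_def sym_perms_def)

lemma rtrancl_arcs_flip: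
  assumes "sym_perms G" "(p, q) \<in> (arcs G)\<^sup>*"
  shows "(flip q, flip p) \<in> (arcs G)\<^sup>*"
  using assms(2) by (induction rule: rtrancl_induct) (auto dest: arcs_flip[OF assms(1)] intro: converse_rtrancl_into_rtrancl)

lemma arcs_free_sym: "(p, q) \<in> arcs (free A) \<Longrightarrow> (q, p) \<in> arcs (free A)"
  by (auto simp: arcs_def insert_commute)

lemma linked_refl [simp]: "(p, p) \<in> linked A"
  by (simp add: linked_def)

lemma linked_trans: "(p, q) \<in> linked A \<Longrightarrow> (q, r) \<in> linked A \<Longrightarrow> (p, r) \<in> linked A"
  unfolding linked_def by (rule rtrancl_trans)

lemma linked_sym: "(p, q) \<in> linked A \<Longrightarrow> (q, p) \<in> linked A"
  unfolding linked_def by (meson arcs_free_sym sym_def sym_rtrancl symI)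

lemma linked_mono: "A \<subseteq> B \<Longrightarrow> (p, q) \<in> linked A \<Longrightarrow> (p, q) \<in> linked B"
  unfolding linked_def using rtrancl_mono[OF arcs_mono[OF free_mono]] by blast

lemma linked_flip: "(p, q) \<in> linked A \<Longrightarrow> (flip p, flip q) \<in> linked A"
  using rtrancl_arcs_flip[OF sym_perms_free] linked_sym unfolding linked_def by blast

lemma linked_edge: "{u, v} \<in> A \<Longrightarrow> ((u, i), (v, \<not> i)) \<in> linked A"
  unfolding linked_def by (rule r_into_rtrancl) (auto simp: arcs_iff)

lemma adj_sym: "sym (adj A)" by (auto simp: adj_def sym_def insert_commute)

lemma adj_rtrancl_sym: "(u, v) \<in> (adj A)\<^sup>* \<Longrightarrow> (v, u) \<in> (adj A)\<^sup>*"
  using adj_sym by (meson symD sym_rtrancl)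

lemma adj_mono: "A \<subseteq> B \<Longrightarrow> (u, v) \<in> (adj A)\<^sup>* \<Longrightarrow> (u, v) \<in> (adj B)\<^sup>*"
  using rtrancl_mono[of "adj A" "adj B"] by (auto simp: adj_def)

lemma linked_imp_adj: "(p, q) \<in> linked A \<Longrightarrow> (fst p, fst q) \<in> (adj A)\<^sup>*"
  unfolding linked_def
proof (induction rule: rtrancl_induct)
  case (step q r)
  then have "(fst q, fst r) \<in> adj A" by (auto simp: arcs_def adj_def)
  with step.IH show ?case by (rule rtrancl_into_rtrancl)
qed simp

lemma adj_imp_linked: "(u, v) \<in> (adj A)\<^sup>* \<Longrightarrow> \<exists>j. ((u, i), (v, j)) \<in> linked A"
proof (induction rule: rtrancl_induct)
  case base
  show ?case using linked_refl by blast
next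
  case (step v w)
  then obtain j where "((u, i), (v, j)) \<in> linked A" by blast
  moreover have "((v, j), (w, \<not> j)) \<in> linked A"
    using step(2) by (intro linked_edge) (auto simp: adj_def)
  ultimately show ?case using linked_trans by blast
qed

lemma has_odd_mono: "A \<subseteq> B \<Longrightarrow> has_odd A \<Longrightarrow> has_odd B"
  unfolding has_odd_def using linked_mono by blast

lemma linked_unique:
  assumes "\<not> has_odd A" "((u, i), (v, j)) \<in> linked A" "((u, i), (v, j')) \<in> linked A"
  shows "j = j'"
proof (rule ccontr)
  assume "j \<noteq> j'"
  have *: "((v, j), (v, j')) \<in> linked A"
    using assms(2,3) linked_sym linked_trans by blast
  then have "((v, False), (v, True)) \<in> linked A"
    using \<open>j \<noteq> j'\<close> linked_sym[OF *] by (cases j; cases j') auto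
  then show False using assms(1) by (auto simp: has_odd_def)
qed

lemma has_oddI: "((u, i), (u, \<not> i)) \<in> linked A \<Longrightarrow> has_odd A"
  using linked_unique[of A u i u i "\<not> i"] by auto

text \<open>Go to a vertex of the odd closed walk, round it once, and back along the mirrored way;
  the parities of the two trips cancel.\<close>

lemma has_odd_odd_reach:
  assumes "has_odd A" "\<And>v. \<exists>e\<in>A. v \<in> e \<Longrightarrow> (u, v) \<in> (adj A)\<^sup>*"
  shows "((u, i), (u, \<not> i)) \<in> linked A"
proof -
  obtain z where z: "((z, False), (z, True)) \<in> linked A" using assms(1) by (auto simp: has_odd_def)
  then have "\<exists>e\<in>A. z \<in> e"
    unfolding linked_def by (cases rule: converse_rtranclE) (auto simp: arcs_def)
  then obtain j where j: "((u, i), (z, j)) \<in> linked A"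
    using adj_imp_linked[OF assms(2)] by blast
  have "((z, j), (z, \<not> j)) \<in> linked A" using z linked_sym[OF z] by (cases j) auto
  moreover have "((z, \<not> j), (u, \<not> i)) \<in> linked A" using linked_flip[OF linked_sym[OF j]] by simp
  ultimately show ?thesis using j linked_trans by blast
qed

text \<open>The edge joins two components without odd closed walks, whose lifts can be matched along
  it: the lift of one component through \<open>(u, i0)\<close> and the lift of the other through
  \<open>(w, \<not> i0)\<close> form a set that is closed under the new arcs and holds at most one
  lift of every vertex.\<close>

lemma has_odd_insert_bridge:
  assumes A: "\<not> has_odd A" and uw: "(u, w) \<notin> (adj A)\<^sup>*"
  shows "\<not> has_odd (insert {u, w} A)"
proof
  let ?B = "insert {u, w} A"
  assume "has_odd ?B"
  then obtain z where z: "((z, False), (z, True)) \<in> linked ?B" by (auto simp: has_odd_def)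
  define M where "M i0 = {q. ((u, i0), q) \<in> linked A \<or> ((w, \<not> i0), q) \<in> linked A}" for i0
  have closed: "q' \<in> M i0" if "q \<in> M i0" "(q, q') \<in> arcs (free ?B)" for i0 q q'
  proof (cases "(q, q') \<in> arcs (free A)")
    case True
    then have "(q, q') \<in> linked A" by (auto simp: linked_def)
    then show ?thesis using that(1) linked_trans unfolding M_def by blast
  next
    case False
    with that(2) obtain j where "q = (u, j) \<and> q' = (w, \<not> j) \<or> q = (w, j) \<and> q' = (u, \<not> j)"
      by (auto simp: arcs_def doubleton_eq_iff)
    then show ?thesis
    proof (elim disjE conjE)
      assume q: "q = (u, j)" "q' = (w, \<not> j)"
      have "((w, \<not> i0), q) \<notin> linked A"
        using uw linked_imp_adj[of "(w, \<not> i0)" q A] q adj_rtrancl_sym[of w u A] by auto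
      then have "((u, i0), (u, j)) \<in> linked A" using that(1) q by (auto simp: M_def)
      then have "j = i0" using linked_unique[OF A _ linked_refl] by blast
      then show ?thesis using q by (auto simp: M_def)
    next
      assume q: "q = (w, j)" "q' = (u, \<not> j)"
      have "((u, i0), q) \<notin> linked A"
        using uw linked_imp_adj[of "(u, i0)" q A] q by auto
      then have "((w, \<not> i0), (w, j)) \<in> linked A" using that(1) q by (auto simp: M_def)
      then have "j = (\<not> i0)" using linked_unique[OF A _ linked_refl] by blast
      then show ?thesis using q by (auto simp: M_def)
    qed
  qed
  have closed': "q' \<in> M i0" if "(q, q') \<in> linked ?B" "q \<in> M i0" for i0 q q'
    using that unfolding linked_def by (induction rule: rtrancl_induct) (auto intro: closed)
  \<comment> \<open>A walk either stays in \<open>A\<close> or visits a lift of \<open>u\<close>,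
    from where \<open>M\<close> confines it.\<close>
  have "((z, False), (z, True)) \<in> linked A \<or> (\<exists>i0. ((z, False), (u, i0)) \<in> linked ?B)"
  proof -
    have "((z, False), q) \<in> linked A \<or> (\<exists>i0. ((z, False), (u, i0)) \<in> linked ?B)"
      if "((z, False), q) \<in> linked ?B" for q
      using that unfolding linked_def[of ?B]
    proof (induction rule: rtrancl_induct)
      case (step q q')
      show ?case
      proof (cases "(q, q') \<in> arcs (free A)")
        case True
        then have "(q, q') \<in> linked A" by (auto simp: linked_def)
        then show ?thesis using step.IH linked_trans by blast
      next
        case False
        with step(2) have "fst q = u \<or> fst q' = u" by (auto simp: arcs_def doubleton_eq_iff)
        then show ?thesis using step(1,2) by (metis prod.collapse rtrancl_into_rtrancl)
      qed
    qed simp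
    then show ?thesis using z by blast
  qed
  moreover have "((z, False), (z, True)) \<notin> linked A" using A by (auto simp: has_odd_def)
  ultimately obtain i0 where "((z, False), (u, i0)) \<in> linked ?B" by blast
  then have "((u, i0), (z, False)) \<in> linked ?B" "((u, i0), (z, True)) \<in> linked ?B"
    using z linked_sym linked_trans by blast+
  moreover have "(u, i0) \<in> M i0" by (auto simp: M_def)
  ultimately have zM: "(z, False) \<in> M i0" "(z, True) \<in> M i0" using closed' by blast+
  have no: False if "((u, i0), (z, i)) \<in> linked A" "((w, \<not> i0), (z, j)) \<in> linked A" for i j
    using that[THEN linked_imp_adj] uw by simp (meson adj_rtrancl_sym rtrancl_trans)
  have no': "False" if "((p), (z, False)) \<in> linked A" "(p, (z, True)) \<in> linked A" for p
    using linked_unique[OF A, of "fst p" "snd p" z False True] that by auto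
  show False using zM no no' unfolding M_def by blast
qed

subsection \<open>Deleting arcs across one-edge cuts\<close>

text \<open>Only the arcs \<open>y -> x\<close> and \<open>x -> y\<close> cross the boundary of
  \<open>B\<close>. An excursion out of \<open>B\<close> leaves by the first and returns by the
  second, so it can be skipped; only a path that starts in \<open>B\<close> and ends outside needs
  the deleted arc.\<close>

lemma rtrancl_delete_cut_arc:
  assumes "(p, q) \<in> D\<^sup>*" "\<not> (p \<in> B \<and> q \<notin> B)" "y \<in> B" "x \<notin> B"
    and out: "\<And>a b. (a, b) \<in> D \<Longrightarrow> a \<in> B \<Longrightarrow> b \<notin> B \<Longrightarrow> (a, b) = (y, x)"
    and into: "\<And>a b. (a, b) \<in> D \<Longrightarrow> a \<notin> B \<Longrightarrow> b \<in> B \<Longrightarrow> (a, b) = (x, y)"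
  shows "(p, q) \<in> (D - {(y, x)})\<^sup>*"
proof -
  define R where "R = (D - {(y, x)})\<^sup>*"
  have ext: "(p, r) \<in> R" if "(p, q) \<in> R" "(q, r) \<in> D" "(q, r) \<noteq> (y, x)" for q r
    using that unfolding R_def by (simp add: rtrancl_into_rtrancl)
  \<comment> \<open>While the path is outside \<open>B\<close>, the invariant remembers that
    \<open>y\<close> is still reachable.\<close>
  have 1: "(q \<in> B \<longrightarrow> (p, q) \<in> R) \<and> (q \<notin> B \<longrightarrow> (p, y) \<in> R)" if "p \<in> B"
    using assms(1)
  proof (induction rule: rtrancl_induct)
    case base
    then show ?case using that by (simp add: R_def)
  next
    case (step q r)
    show ?case
    proof (cases "q \<in> B")
      case q: True
      show ?thesis
      proof (cases "r \<in> B")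
        case True
        then show ?thesis using ext[of q r] step q assms(4) by auto
      next
        case False
        then have "q = y" using out[OF step(2) q] by simp
        then show ?thesis using step.IH q False by simp
      qed
    next
      case False
      then show ?thesis using into[OF step(2)] step.IH by auto
    qed
  qed
  \<comment> \<open>\<open>B\<close> is entered through \<open>x\<close>, so while the path is
    inside, \<open>x\<close> stays known as reachable without the deleted arc.\<close>
  have 2: "(p, q) \<in> R \<and> (q \<in> B \<longrightarrow> (p, x) \<in> R)" if "p \<notin> B"
    using assms(1)
  proof (induction rule: rtrancl_induct)
    case base
    then show ?case using that by (simp add: R_def)
  next
    case (step q r)
    show ?case
    proof (cases "(q, r) = (y, x)")
      case True
      then show ?thesis using step.IH assms(3,4) by simp
    next
      case False
      then have "(p, r) \<in> R" using ext step by blast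
      moreover have "(p, x) \<in> R" if "r \<in> B"
        using into[OF step(2) _ that] step.IH by (cases "q \<in> B") auto
      ultimately show ?thesis by blast
    qed
  qed
  show ?thesis using 1 2 assms(2) unfolding R_def by blast
qed

definition is_cut :: "('s \<times> 's) set \<Rightarrow> 's \<Rightarrow> 's \<Rightarrow> 's set \<Rightarrow> bool" where
  "is_cut D y x B \<longleftrightarrow> y \<in> B \<and> x \<notin> B \<and>
     (\<forall>a b. (a, b) \<in> D \<and> a \<in> B \<and> b \<notin> B \<longrightarrow> a = y \<and> b = x) \<and>
     (\<forall>a b. (a, b) \<in> D \<and> a \<notin> B \<and> b \<in> B \<longrightarrow> a = x \<and> b = y)"

text \<open>A cut of \<open>D\<close> is still a cut once arcs have been deleted, so the arcs can go
  one at a time.\<close>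

lemma rtrancl_delete_cut_arcs:
  assumes "finite L" "(p, q) \<in> D\<^sup>*"
    and "\<And>y x. (y, x) \<in> L \<Longrightarrow> \<exists>B. is_cut D y x B \<and> \<not> (p \<in> B \<and> q \<notin> B)"
  shows "(p, q) \<in> (D - L)\<^sup>*"
  using assms(1,3)
proof (induction L rule: finite_induct)
  case empty
  then show ?case using assms(2) by simp
next
  case (insert l L)
  obtain y x where l: "l = (y, x)" by (cases l)
  obtain B where B: "is_cut D y x B" "\<not> (p \<in> B \<and> q \<notin> B)"
    using insert.prems[of y x] l by blast
  have "(p, q) \<in> (D - L)\<^sup>*" by (rule insert.IH) (rule insert.prems, simp)
  then have "(p, q) \<in> (D - L - {(y, x)})\<^sup>*"
  proof (rule rtrancl_delete_cut_arc[OF _ B(2)])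
    show "y \<in> B" "x \<notin> B" using B(1) by (simp_all add: is_cut_def)
    fix a b assume "(a, b) \<in> D - L"
    then show "a \<in> B \<Longrightarrow> b \<notin> B \<Longrightarrow> (a, b) = (y, x)" "a \<notin> B \<Longrightarrow> b \<in> B \<Longrightarrow> (a, b) = (x, y)"
      using B(1) unfolding is_cut_def by blast+
  qed
  moreover have "D - L - {(y, x)} = D - insert l L" using l by auto
  ultimately show ?case by simp
qed

subsection \<open>Saturated permissions\<close>

text \<open>Arcs outside \<open>D'\<close> start in \<open>T\<close>, so the path up to its first
  visit to \<open>T\<close> uses \<open>D'\<close> only.\<close>

lemma rtrancl_first_in:
  assumes "(p, t) \<in> D\<^sup>*" "t \<in> T" "\<And>a b. (a, b) \<in> D \<Longrightarrow> (a, b) \<in> D' \<or> a \<in> T"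
  shows "\<exists>t'\<in>T. (p, t') \<in> D'\<^sup>*"
  using assms(1)
proof (induction rule: converse_rtrancl_induct)
  case base
  show ?case using assms(2) by blast
next
  case (step a b)
  from assms(3)[OF step(1)] show ?case
  proof
    assume "(a, b) \<in> D'"
    with step.IH show ?thesis using converse_rtrancl_into_rtrancl[of a b D'] by blast
  qed blast
qed

lemma rtrancl_last_in:
  assumes "(t, p) \<in> D\<^sup>*" "t \<in> T" "\<And>a b. (a, b) \<in> D \<Longrightarrow> (a, b) \<in> D' \<or> b \<in> T"
  shows "\<exists>t'\<in>T. (t', p) \<in> D'\<^sup>*"
  using rtrancl_first_in[of p t "D\<inverse>" T "D'\<inverse>"] assms by (auto simp: rtrancl_converse)

text \<open>The edge \<open>uw\<close> still permits both colours although neither permission is redundant. Then each of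
  its two lifts is a bridge of the double cover: among the four ends of the lifts, the relation of
  reachability avoiding both lifts is symmetric, so it coincides with connectivity in \<open>F - {uw}\<close>.\<close>

lemma saturated_bridge:
  assumes sym: "sym_perms G" and sub: "G \<subseteq> free F"
    and full: "\<And>a b. {a, b} \<in> F \<Longrightarrow> \<exists>k. (a, b, k) \<in> G"
    and reach: "(arcs G)\<^sup>* = linked F"
    and e: "(u, w, k) \<in> G" "(u, w, \<not> k) \<in> G" "u \<noteq> w"
    and m1: "((u, \<not> k), (w, k)) \<notin> (arcs (G - {(u, w, k), (w, u, k)}))\<^sup>*"
    and m2: "((u, k), (w, \<not> k)) \<notin> (arcs (G - {(u, w, \<not> k), (w, u, \<not> k)}))\<^sup>*"
    and nostub: "((w, k), (u, k)) \<in> linked (F - {{u, w}}) \<Longrightarrow> ((w, k), (u, \<not> k)) \<in> linked (F - {{u, w}})"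
  shows "((u, \<not> k), (w, k)) \<notin> (arcs (free F) - {((u, \<not> k), (w, k)), ((w, k), (u, \<not> k))})\<^sup>*"
proof -
  define x y x' y' where xy: "x = (u, \<not> k)" "y = (w, k)" "x' = (u, k)" "y' = (w, \<not> k)"
  define G' where "G' = G - {(u, w, k), (w, u, k), (u, w, \<not> k), (w, u, \<not> k)}"
  define R where "R = (arcs G')\<^sup>*"
  define T where "T = {x, y, x', y'}"
  have e': "(w, u, k) \<in> G" "(w, u, \<not> k) \<in> G" using sym e by (auto simp: sym_perms_def)
  have symG': "sym_perms G'" using sym by (auto simp: sym_perms_def G'_def)
  \<comment> \<open>The four arcs are the two directions of the lifts \<open>xy\<close> and
    \<open>x'y'\<close>. The colour \<open>k\<close> owns \<open>x -> y\<close> and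
    \<open>y' -> x'\<close>, the other colour owns the reverse arcs.\<close>
  have D: "arcs G = arcs G' \<union> {(x, y), (y, x), (x', y'), (y', x')}"
    using e e' by (auto simp: arcs_def G'_def xy)
  have D1: "arcs (G - {(u, w, k), (w, u, k)}) = arcs G' \<union> {(y, x), (x', y')}"
    using e e' by (auto simp: arcs_def G'_def xy)
  have D2: "arcs (G - {(u, w, \<not> k), (w, u, \<not> k)}) = arcs G' \<union> {(x, y), (y', x')}"
    using e e' by (auto simp: arcs_def G'_def xy)
  have trans: "(p, r) \<in> R" if "(p, q) \<in> R" "(q, r) \<in> R" for p q r
    using that unfolding R_def by (rule rtrancl_trans)
  have Rflip: "(flip q, flip p) \<in> R" if "(p, q) \<in> R" for p q
    using rtrancl_arcs_flip[OF symG'] that by (simp add: R_def)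
  have fl: "flip x = x'" "flip x' = x" "flip y = y'" "flip y' = y" by (auto simp: xy)
  have up: "(p, q) \<in> (arcs G' \<union> X)\<^sup>*" if "(p, q) \<in> R" for p q X
    using that unfolding R_def by (rule rtrancl_mono[OF Un_upper1, THEN subsetD])
  have f1: "(x, y) \<notin> R"
    using m1 up unfolding D1 xy by blast
  have f2: "(x', y') \<notin> R"
    using m2 up unfolding D2 xy by blast
  \<comment> \<open>Otherwise \<open>x -> x' -> y' -> y\<close> would bypass the colour
    \<open>k\<close>, since the middle arc belongs to the other colour.\<close>
  have f1': "\<not> ((x, x') \<in> R \<and> (y', y) \<in> R)"
  proof
    assume *: "(x, x') \<in> R \<and> (y', y) \<in> R"
    let ?D = "arcs G' \<union> {(y, x), (x', y')}"
    have "(x, x') \<in> ?D\<^sup>*" "(y', y) \<in> ?D\<^sup>*" "(x', y') \<in> ?D"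
      using * up by blast+
    then have "(x, y) \<in> ?D\<^sup>*" by (rule_tac rtrancl_trans[OF rtrancl_into_rtrancl])
    then show False using m1 unfolding D1 xy by blast
  qed
  have f2': "\<not> ((x', x) \<in> R \<and> (y, y') \<in> R)"
  proof
    assume *: "(x', x) \<in> R \<and> (y, y') \<in> R"
    let ?D = "arcs G' \<union> {(x, y), (y', x')}"
    have "(x', x) \<in> ?D\<^sup>*" "(y, y') \<in> ?D\<^sup>*" "(x, y) \<in> ?D"
      using * up by blast+
    then have "(x', y') \<in> ?D\<^sup>*" by (rule_tac rtrancl_trans[OF rtrancl_into_rtrancl])
    then show False using m2 unfolding D2 xy by blast
  qed
  note Rf = Rflip[of x y', unfolded fl] Rflip[of y x', unfolded fl] Rflip[of x' y, unfolded fl]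
    Rflip[of y' x, unfolded fl]
  have f3: "(y', x') \<notin> R" "(y, x) \<notin> R"
    using Rflip[of y' x', unfolded fl] Rflip[of y x, unfolded fl] f1 f2 by blast+
  have c2: "(x, y') \<in> R \<longleftrightarrow> (y, x') \<in> R" "(x', y) \<in> R \<longleftrightarrow> (y', x) \<in> R"
    using Rf by blast+
  have conn: "(p, q) \<in> (arcs G)\<^sup>* \<Longrightarrow> (q, p) \<in> (arcs G)\<^sup>*" for p q
    using linked_sym unfolding reach by blast
  \<comment> \<open>Reachability in \<open>G\<close> is symmetric, so some path leads back. The arcs
    of the two lifts stay inside \<open>X\<close> or inside \<open>X'\<close>, so a stretch of it
    from \<open>X'\<close> to \<open>X\<close> uses \<open>R\<close> only.\<close>
  have cross: "\<exists>s'\<in>X'. \<exists>s\<in>X. (s', s) \<in> R"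
    if X: "X = {x, y} \<and> X' = {x', y'} \<or> X = {x', y'} \<and> X' = {x, y}" and t: "t \<in> X" "t' \<in> X'" "(t, t') \<in> R"
    for X X' t t'
  proof (rule ccontr)
    assume no: "\<not> ?thesis"
    have "(t, t') \<in> (arcs G)\<^sup>*"
      using up[OF t(3)] unfolding D .
    from conn[OF this] have "(t', t) \<in> (arcs G)\<^sup>*" .
    then have "\<exists>s'\<in>X'. (s', t) \<in> R"
    proof (induction rule: rtrancl_induct)
      case base
      then show ?case using t(2) by (auto simp: R_def)
    next
      case (step q r)
      then obtain s' where s': "s' \<in> X'" "(s', q) \<in> R" by blast
      show ?case
      proof (cases "(q, r) \<in> arcs G'")
        case True
        then show ?thesis using s' rtrancl_into_rtrancl[of s' q "arcs G'" r] unfolding R_def by blast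
      next
        case False
        then have "(q, r) \<in> {(x, y), (y, x), (x', y'), (y', x')}" using step(2) D by blast
        moreover have "q \<notin> X" using no s' by blast
        ultimately have "r \<in> X'" using X by auto
        then show ?thesis by (auto simp: R_def)
      qed
    qed
    then show False using no t(1) by blast
  qed
  have cr1: "(x, x') \<in> R \<or> (y, y') \<in> R \<or> (x, y') \<in> R \<or> (y, x') \<in> R \<longrightarrow>
      (x', x) \<in> R \<or> (y', y) \<in> R \<or> (x', y) \<in> R \<or> (y', x) \<in> R"
    using cross[of "{x, y}" "{x', y'}"] by blast
  have cr2: "(x', x) \<in> R \<or> (y', y) \<in> R \<or> (x', y) \<in> R \<or> (y', x) \<in> R \<longrightarrow>
      (x, x') \<in> R \<or> (y, y') \<in> R \<or> (x, y') \<in> R \<or> (y, x') \<in> R"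
    using cross[of "{x', y'}" "{x, y}"] by blast
  \<comment> \<open>A propositional consequence: minimality excludes links between the ends of one
    lift, flipping pairs up the diagonal links, and \<open>cross\<close> returns every crossing from
    one lift to the other.\<close>
  have bal: "(s, t) \<in> R \<longleftrightarrow> (t, s) \<in> R" if "s \<in> T" "t \<in> T" for s t
  proof -
    have tr: "(p, q) \<in> R \<and> (q, r) \<in> R \<longrightarrow> (p, r) \<in> R" for p q r using trans by blast
    have A: "(x, x') \<in> R \<longleftrightarrow> (x', x) \<in> R"
      using cr1 cr2 f1 f2 f3 f1' f2' c2 tr[of x x' y] tr[of x' x y'] tr[of y x' x] tr[of y' x x'] tr[of x y' y] by argo
    have B: "(y, y') \<in> R \<longleftrightarrow> (y', y) \<in> R"
      using cr1 cr2 f1 f2 f3 f1' f2' c2 tr[of y y' x] tr[of y' y x'] tr[of x y' y] tr[of x' y y'] by argo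
    have C: "(x, y') \<in> R \<longleftrightarrow> (y', x) \<in> R"
      using cr1 cr2 f1 f2 f3 f1' f2' c2 A B tr[of y x' x] tr[of x y' y] tr[of x x' y] tr[of y y' x] by argo
    show ?thesis using that A B C c2 f1 f2 f3 unfolding T_def by (elim insertE) auto
  qed
  have H: "arcs (free F) \<subseteq> (arcs G)\<^sup>*" unfolding reach linked_def by auto
  have adjG: "(p, q) \<in> arcs G' \<or> (q, p) \<in> arcs G'" if "(p, q) \<in> arcs (free (F - {{u, w}}))" for p q
  proof -
    from that obtain a b i where ab: "p = (a, \<not> i)" "q = (b, i)" "{a, b} \<in> F" "{a, b} \<noteq> {u, w}"
      by (auto simp: arcs_def)
    obtain j where "(a, b, j) \<in> G" using full ab(3) by blast
    then have "(a, b, j) \<in> G'" "(b, a, j) \<in> G'"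
      using ab(4) symG' by (auto simp: G'_def sym_perms_def doubleton_eq_iff)
    then show ?thesis using ab(1,2) by (cases "j = i") (auto simp: arcs_iff)
  qed
  \<comment> \<open>Every other edge keeps a colour, so each of its lifts has an arc in at least one
    direction. If it is the wrong one, \<open>q\<close> is reached from some end \<open>t\<close>
    and leads through \<open>p\<close> to some end \<open>t'\<close>; by symmetry among the ends,
    \<open>s\<close> reaches \<open>t\<close> and hence \<open>q\<close>.\<close>
  have linkR: "(s, q) \<in> R" if sq0: "(s, q) \<in> linked (F - {{u, w}})" and sT: "s \<in> T" for s q
    using sq0 unfolding linked_def
  proof (induction rule: rtrancl_induct)
    case base
    show ?case by (simp add: R_def)
  next
    case (step p q)
    from adjG[OF step(2)] show ?case
    proof
      assume "(p, q) \<in> arcs G'"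
      then show ?thesis using step.IH rtrancl_into_rtrancl[of s p "arcs G'" q] unfolding R_def by blast
    next
      assume qp: "(q, p) \<in> arcs G'"
      have "(s, p) \<in> (arcs G)\<^sup>*"
        using up[OF step.IH] unfolding D .
      moreover have "(p, q) \<in> (arcs G)\<^sup>*"
        using step(2) H arcs_mono[OF free_mono[of "F - {{u, w}}" F]] by blast
      ultimately have sq: "(s, q) \<in> (arcs G)\<^sup>*" by (rule rtrancl_trans)
      obtain t where t: "t \<in> T" "(t, q) \<in> R"
        using rtrancl_last_in[OF sq sT, of "arcs G'"] D unfolding R_def T_def by blast
      obtain t' where t': "t' \<in> T" "(p, t') \<in> R"
        using rtrancl_first_in[OF conn[OF \<open>(s, p) \<in> (arcs G)\<^sup>*\<close>] sT, of "arcs G'"] D unfolding R_def T_def by blast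
      have "(q, p) \<in> R" using qp by (auto simp: R_def)
      have "(t', s) \<in> R" using bal[OF sT t'(1)] trans[OF step.IH[folded R_def] t'(2)] by blast
      then have "(t, s) \<in> R" using trans t(2) \<open>(q, p) \<in> R\<close> t'(2) by blast
      then show ?thesis using bal[OF sT t(1)] trans t(2) unfolding R_def by blast
    qed
  qed
  have xT: "x \<in> T" "y \<in> T" "x' \<in> T" "y' \<in> T" by (auto simp: T_def)
  let ?L = "linked (F - {{u, w}})"
  have n1: "(y, x) \<notin> ?L" "(x, y) \<notin> ?L" using linkR xT f1 f3 by blast+
  then have n2: "(y, x') \<notin> ?L" using nostub by (auto simp: xy)
  then have n3: "(x, y') \<notin> ?L" using linked_flip[of x y'] linked_sym fl by metis
  have n4: "(y, y') \<notin> ?L \<or> (x, x') \<notin> ?L"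
    using f2' linkR xT linked_sym[of x x'] by blast
  \<comment> \<open>If \<open>s\<close> is linked to neither end of the other lift while both lifts
    are absent, the other lift cannot enlarge its component, so deleting the lift \<open>xy\<close>
    alone already separates \<open>s\<close> from \<open>t\<close>.\<close>
  have cutlem: "(x, y) \<notin> (arcs (free F) - {(x, y), (y, x)})\<^sup>*"
    if st: "(s, t) = (x, y) \<or> (s, t) = (y, x)" and iso: "(s, t) \<notin> ?L" "(s, x') \<notin> ?L" "(s, y') \<notin> ?L" for s t
  proof -
    have "(s, q) \<in> ?L" if "(s, q) \<in> (arcs (free F) - {(x, y), (y, x)})\<^sup>*" for q
      using that
    proof (induction rule: rtrancl_induct)
      case (step q r)
      have "(q, r) \<in> arcs (free (F - {{u, w}}))"
      proof (rule ccontr)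
        assume "\<not> ?thesis"
        then obtain a b i where ab: "q = (a, \<not> i)" "r = (b, i)" "{a, b} = {u, w}"
          using step(2) by (auto simp: arcs_def)
        then have "q \<in> {x', y'}" using step(2) by (auto simp: xy doubleton_eq_iff)
        then show False using step.IH iso by auto
      qed
      then have "(q, r) \<in> ?L" by (auto simp: linked_def)
      then show ?case using step.IH linked_trans by blast
    qed simp
    moreover have "(y, x) \<in> (arcs (free F) - {(x, y), (y, x)})\<^sup>*"
      if "(x, y) \<in> (arcs (free F) - {(x, y), (y, x)})\<^sup>*"
    proof -
      have "sym (arcs (free F) - {(x, y), (y, x)})"
        using arcs_free_sym by (auto simp: sym_def)
      then show ?thesis using that by (meson symD sym_rtrancl)
    qed
    ultimately show ?thesis using st iso(1) by blast
  qed
  have "(x, y) \<notin> (arcs (free F) - {(x, y), (y, x)})\<^sup>*"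
    using n4
  proof
    assume "(y, y') \<notin> ?L"
    then show ?thesis using cutlem[of y x] n1 n2 by blast
  next
    assume "(x, x') \<notin> ?L"
    then show ?thesis using cutlem[of x y] n1 n3 by blast
  qed
  then show ?thesis by (simp add: xy)
qed

section \<open>Walks as reachability\<close>

lemma all_nat_split: "(\<forall>i :: nat. P i) \<longleftrightarrow> P 0 \<and> (\<forall>i. P (Suc i))"
  by (metis not0_implies_Suc)

lemma is_walk_single [simp]: "is_walk V E [x] \<longleftrightarrow> x \<in> V"
  by (simp add: is_walk_def)

lemma is_walk_Cons_Cons [simp]:
  "is_walk V E (x # y # q) \<longleftrightarrow> x \<in> V \<and> {x, y} \<in> E \<and> is_walk V E (y # q)"
  unfolding is_walk_def
  by (subst all_nat_split) auto

lemma properly_coloured_short [simp]: "properly_coloured c [x]" "properly_coloured c [x, y]"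
  by (simp_all add: properly_coloured_def)

lemma properly_coloured_Cons [simp]:
  "properly_coloured c (x # y # z # q) \<longleftrightarrow> c {x, y} \<noteq> c {y, z} \<and> properly_coloured c (y # z # q)"
  unfolding properly_coloured_def
  by (subst all_nat_split) auto

lemma walk_adj: "is_walk V E (x # q) \<Longrightarrow> (x, last (x # q)) \<in> (adj E)\<^sup>*"
proof (induction q arbitrary: x)
  case (Cons y q)
  then have "(x, y) \<in> adj E" "(y, last (y # q)) \<in> (adj E)\<^sup>*" by (auto simp: adj_def)
  then show ?case by (simp add: converse_rtrancl_into_rtrancl)
qed simp

lemma walk_linked:
  "is_walk V E (x # q) \<Longrightarrow> ((x, i), (last (x # q), i \<noteq> odd (length q))) \<in> linked E"
proof (induction q arbitrary: x i)
  case (Cons y q)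
  have "((x, i), (y, \<not> i)) \<in> linked E" using Cons.prems by (intro linked_edge) simp
  moreover have "((y, \<not> i), (last (y # q), (\<not> i) \<noteq> odd (length q))) \<in> linked E"
    by (rule Cons.IH) (use Cons.prems in simp)
  ultimately have "((x, i), (last (y # q), (\<not> i) \<noteq> odd (length q))) \<in> linked E"
    by (rule linked_trans)
  then show ?case by simp
qed simp

lemma linked_walk:
  assumes "(p, q) \<in> linked E" "fst p \<in> V" "\<And>u v. {u, v} \<in> E \<Longrightarrow> v \<in> V"
  shows "\<exists>w. is_walk V E (fst p # w) \<and> last (fst p # w) = fst q \<and> snd q = (snd p \<noteq> odd (length w))"
  using assms(1,2) unfolding linked_def
proof (induction rule: converse_rtrancl_induct)
  case base
  then show ?case by (intro exI[of _ "[]"]) auto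
next
  case (step p p')
  then have e: "{fst p, fst p'} \<in> E" "snd p' = (\<not> snd p)" by (auto simp: arcs_def)
  then have "fst p' \<in> V" using assms(3) by blast
  then obtain w where "is_walk V E (fst p' # w)" "last (fst p' # w) = fst q" "snd q = (snd p' \<noteq> odd (length w))"
    using step.IH by blast
  then show ?case using e step.prems by (intro exI[of _ "fst p' # w"]) auto
qed

lemma adj_walk:
  assumes "(u, v) \<in> (adj E)\<^sup>*" "u \<in> V" "\<And>u v. {u, v} \<in> E \<Longrightarrow> v \<in> V"
  shows "\<exists>p. walk_between V E u p v"
proof -
  obtain j where "((u, False), (v, j)) \<in> linked E" using adj_imp_linked[OF assms(1)] by blast
  then have "\<exists>w. is_walk V E (fst (u, False) # w) \<and> last (fst (u, False) # w) = fst (v, j)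
      \<and> snd (v, j) = (snd (u, False) \<noteq> odd (length w))"
    by (rule linked_walk) (use assms(2,3) in auto)
  then obtain w where "is_walk V E (u # w)" "last (u # w) = v" unfolding fst_conv by blast
  then show ?thesis by (intro exI[of _ "u # w"]) (simp add: walk_between_def)
qed

section \<open>Connectivity, stubborn edges and bipartiteness in terms of reachability\<close>

definition edges_in :: "'a set \<Rightarrow> 'a set set \<Rightarrow> bool" where
  "edges_in V E \<longleftrightarrow> (\<forall>u v. {u, v} \<in> E \<longrightarrow> u \<in> V \<and> v \<in> V)"

lemma edges_inD: "edges_in V E \<Longrightarrow> {u, v} \<in> E \<Longrightarrow> v \<in> V"
  by (auto simp: edges_in_def)

lemma edges_in_subset: "edges_in V E \<Longrightarrow> A \<subseteq> E \<Longrightarrow> edges_in V A"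
  by (auto simp: edges_in_def)

lemma walk_between_iff:
  assumes "edges_in V E" "u \<in> V"
  shows "(\<exists>p. walk_between V E u p v) \<longleftrightarrow> (u, v) \<in> (adj E)\<^sup>*"
proof
  assume "\<exists>p. walk_between V E u p v"
  then obtain p where p: "is_walk V E p" "hd p = u" "last p = v" by (auto simp: walk_between_def)
  then obtain q where "p = u # q" by (cases p) (auto simp: is_walk_def)
  then show "(u, v) \<in> (adj E)\<^sup>*" using walk_adj[of V E u q] p by simp
next
  assume "(u, v) \<in> (adj E)\<^sup>*"
  then show "\<exists>p. walk_between V E u p v" by (rule adj_walk[OF _ assms(2) edges_inD[OF assms(1)]])
qed

lemma adj_rtrancl_in:
  assumes "edges_in V E" "u \<in> V" "(u, v) \<in> (adj E)\<^sup>*"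
  shows "v \<in> V"
  using assms(3,2)
proof (induction rule: rtrancl_induct)
  case (step y z)
  then show ?case using edges_inD[OF assms(1), of y z] by (simp add: adj_def)
qed

definition joined :: "'a set \<Rightarrow> 'a set set \<Rightarrow> bool" where
  "joined V E \<longleftrightarrow> V \<noteq> {} \<and> (\<forall>u\<in>V. \<forall>v\<in>V. (u, v) \<in> (adj E)\<^sup>*)"

lemma connected_graph_iff: "edges_in V E \<Longrightarrow> connected_graph V E \<longleftrightarrow> joined V E"
  by (simp add: connected_graph_def joined_def walk_between_iff)

lemma joined_mono: "joined V A \<Longrightarrow> A \<subseteq> B \<Longrightarrow> joined V B"
  unfolding joined_def using adj_mono by metis

lemma components_eq:
  assumes "edges_in V E"
  shows "components V E = {{v \<in> V. (u, v) \<in> (adj E)\<^sup>*} | u. u \<in> V}"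
  unfolding components_def setcompr_eq_image
  by (rule image_cong) (simp_all add: walk_between_iff[OF assms])

lemma is_walk_avoiding: "is_walk V (E - {e}) p \<longleftrightarrow> is_walk V E p \<and> e \<notin> walk_edges p"
  unfolding is_walk_def walk_edges_def by auto

lemma odd_closed_walk_iff:
  assumes "edges_in V E"
  shows "(\<exists>p. closed_walk V E p \<and> odd (walk_length p)) \<longleftrightarrow> has_odd E"
proof
  assume "\<exists>p. closed_walk V E p \<and> odd (walk_length p)"
  then obtain p where p: "is_walk V E p" "hd p = last p" "odd (walk_length p)"
    by (auto simp: closed_walk_def)
  then obtain x q where "p = x # q" by (cases p) (auto simp: is_walk_def)
  then show "has_odd E"
    using walk_linked[of V E x q False] p by (intro has_oddI[of x False]) (auto simp: walk_length_def)
next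
  assume "has_odd E"
  then obtain u where u: "((u, False), (u, True)) \<in> linked E" by (auto simp: has_odd_def)
  then have "u \<in> V"
    unfolding linked_def by (cases rule: rtranclE) (use assms in \<open>auto simp: arcs_def edges_in_def\<close>)
  with linked_walk[OF u, of V] obtain w where
    "is_walk V E (u # w)" "last (u # w) = u" "odd (length w)"
    using edges_inD[OF assms] by auto
  then show "\<exists>p. closed_walk V E p \<and> odd (walk_length p)"
    by (intro exI[of _ "u # w"]) (simp add: closed_walk_def walk_length_def)
qed

text \<open>Walks that avoid \<open>e\<close> are the walks of \<open>E - {e}\<close>, so lying on
  every odd closed walk means that none survives the deletion.\<close>

lemma stubborn_edges_eq:
  assumes "edges_in V E"
  shows "stubborn_edges V E = {e \<in> E. \<not> has_odd (E - {e})}"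
proof -
  have "(\<forall>p. closed_walk V E p \<and> odd (walk_length p) \<longrightarrow> e \<in> walk_edges p) \<longleftrightarrow> \<not> has_odd (E - {e})" for e
    unfolding odd_closed_walk_iff[OF edges_in_subset[OF assms Diff_subset], of "{e}", symmetric]
    by (auto simp: closed_walk_def is_walk_avoiding)
  then show ?thesis by (simp add: stubborn_edges_def)
qed

lemma simple_graph_edges_in: "finite_simple_graph V E \<Longrightarrow> edges_in V E"
  unfolding finite_simple_graph_def edges_in_def by (fastforce simp: doubleton_eq_iff)

lemma simple_graph_edge:
  assumes "finite_simple_graph V E" "e \<in> E"
  obtains u v where "e = {u, v}" "u \<in> V" "v \<in> V" "u \<noteq> v"
  using assms unfolding finite_simple_graph_def by blast

lemma simple_graph_no_loop: "finite_simple_graph V E \<Longrightarrow> {u, v} \<in> E \<Longrightarrow> u \<noteq> v"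
  unfolding finite_simple_graph_def by (fastforce simp: doubleton_eq_iff)

lemma simple_graph_finite:
  assumes "finite_simple_graph V E"
  shows "finite V \<and> finite E"
proof -
  have "finite V" "E \<subseteq> Pow V" using assms by (auto simp: finite_simple_graph_def)
  then show ?thesis using finite_subset by blast
qed

text \<open>A bipartition forces the bit to follow the side along every walk. Conversely, the side
  of a vertex is the bit with which it is linked to a fixed lift of some root.\<close>

lemma bipartite_iff:
  assumes "finite_simple_graph V E" "joined V E"
  shows "bipartite_graph V E \<longleftrightarrow> \<not> has_odd E"
proof
  assume "bipartite_graph V E"
  then obtain A B where AB: "A \<inter> B = {}" "\<forall>e\<in>E. \<exists>a\<in>A. \<exists>b\<in>B. e = {a, b}"
    unfolding bipartite_graph_def by blast
  have "(fst q \<in> A \<longleftrightarrow> snd q) = (fst p \<in> A \<longleftrightarrow> snd p)" if "(p, q) \<in> linked E" for p q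
    using that unfolding linked_def
  proof (induction rule: rtrancl_induct)
    case (step q r)
    have "{fst q, fst r} \<in> E" "snd r = (\<not> snd q)" using step(2) by (auto simp: arcs_def)
    moreover from this AB(2) obtain a b where "a \<in> A" "b \<in> B" "{fst q, fst r} = {a, b}" by blast
    moreover from this have "fst q \<in> A \<longleftrightarrow> fst r \<notin> A" using AB(1) by (auto simp: doubleton_eq_iff)
    ultimately show ?case using step.IH by auto
  qed simp
  then show "\<not> has_odd E" unfolding has_odd_def by fastforce
next
  assume no: "\<not> has_odd E"
  obtain r where r: "r \<in> V" using assms(2) by (auto simp: joined_def)
  define A where "A = {v \<in> V. ((r, False), (v, False)) \<in> linked E}"
  have "\<exists>a\<in>A. \<exists>b\<in>V - A. e = {a, b}" if "e \<in> E" for e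
  proof -
    obtain u v where e: "e = {u, v}" "u \<in> V" "v \<in> V" by (rule simple_graph_edge[OF assms(1) \<open>e \<in> E\<close>])
    obtain j where j: "((r, False), (u, j)) \<in> linked E"
      using adj_imp_linked[of r u E] assms(2) r e(2) unfolding joined_def by blast
    have "((u, j), (v, \<not> j)) \<in> linked E" using linked_edge e \<open>e \<in> E\<close> by metis
    then have j': "((r, False), (v, \<not> j)) \<in> linked E" using j linked_trans by blast
    have "u \<in> A \<longleftrightarrow> \<not> j" "v \<in> A \<longleftrightarrow> j"
      using linked_unique[OF no] j j' e unfolding A_def by (cases j; fastforce)+
    then show ?thesis using e by (cases j) auto
  qed
  then show "bipartite_graph V E"
    unfolding bipartite_graph_def by (intro exI[of _ A] exI[of _ "V - A"]) (auto simp: A_def)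
qed

section \<open>Bridges\<close>

text \<open>A connected graph has a single component, so the number of components rises exactly when
  connectivity is lost.\<close>

lemma is_bridge_iff:
  assumes "finite V" "edges_in V (set_mset M)" "joined V (set_mset M)"
  shows "is_bridge V M e \<longleftrightarrow> e \<in># M \<and> \<not> joined V (set_mset (M - {#e#}))"
proof -
  let ?A = "set_mset M" and ?B = "set_mset (M - {#e#})"
  have inB: "edges_in V ?B" by (rule edges_in_subset[OF assms(2)]) (auto dest: in_diffD)
  have ne: "V \<noteq> {}" using assms(3) by (simp add: joined_def)
  have one: "card (components V A) = 1" if "joined V A" "edges_in V A" for A
  proof -
    have "components V A = {V}"
      unfolding components_eq[OF that(2)] using that(1) ne by (auto simp: joined_def)
    then show ?thesis by simp
  qed
  have "card (components V ?B) > 1" if "\<not> joined V ?B"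
  proof -
    from that ne have "\<exists>u\<in>V. \<exists>v\<in>V. (u, v) \<notin> (adj ?B)\<^sup>*" by (simp add: joined_def)
    then obtain u v where uv: "u \<in> V" "v \<in> V" "(u, v) \<notin> (adj ?B)\<^sup>*" by blast
    let ?C = "\<lambda>u. {v \<in> V. (u, v) \<in> (adj ?B)\<^sup>*}"
    have "?C u \<in> components V ?B" "?C v \<in> components V ?B"
      unfolding components_eq[OF inB] using uv by blast+
    moreover have "v \<in> ?C v" "v \<notin> ?C u" using uv by auto
    then have "?C u \<noteq> ?C v" by blast
    moreover have "components V ?B \<subseteq> Pow V" unfolding components_eq[OF inB] by blast
    then have "finite (components V ?B)" using assms(1) finite_subset by auto
    ultimately have "card {?C u, ?C v} \<le> card (components V ?B)" by (intro card_mono) auto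
    then show ?thesis using \<open>?C u \<noteq> ?C v\<close> by simp
  qed
  then show ?thesis unfolding is_bridge_def using one[OF assms(3,2)] one[OF _ inB] by auto
qed

text \<open>The choice \<open>s = t\<close> stands for adding no edge, because a loop does not
  affect connectivity. Deleting the added edge itself leaves \<open>E\<close>, hence the conjunct
  \<open>joined V E\<close>.\<close>

lemma almost_two_edge_connected_iff:
  assumes "finite_simple_graph V E"
  shows "almost_two_edge_connected V E \<longleftrightarrow>
    joined V E \<and> (\<exists>s\<in>V. \<exists>t\<in>V. \<forall>e\<in>E. joined V (insert {s, t} (E - {e})))"
proof -
  have fin: "finite V" "finite E" using simple_graph_finite[OF assms] by auto
  have eE: "edges_in V E" by (rule simple_graph_edges_in[OF assms])
  have 1: "two_edge_connected V (mset_set E) \<longleftrightarrow> joined V E \<and> (\<forall>e\<in>E. joined V (E - {e}))"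
  proof -
    have "set_mset (mset_set E - {#e#}) = E - {e}" if "e \<in> E" for e
      using fin that by (simp add: mset_set.remove)
    then show ?thesis
      unfolding two_edge_connected_def
      using is_bridge_iff[of V "mset_set E"] fin eE connected_graph_iff[OF eE] by auto
  qed
  have 2: "two_edge_connected V (add_mset {u, v} (mset_set E)) \<longleftrightarrow>
      joined V E \<and> (\<forall>e\<in>E. joined V (insert {u, v} (E - {e})))" if uv: "u \<in> V" "v \<in> V" "u \<noteq> v" for u v
  proof -
    let ?M = "add_mset {u, v} (mset_set E)"
    have eM: "edges_in V (set_mset ?M)" using eE uv fin by (auto simp: edges_in_def doubleton_eq_iff)
    \<comment> \<open>If \<open>e\<close> is parallel to the new edge, one copy survives the
      deletion; as sets, both cases read \<open>insert {u, v} (E - {e})\<close>.\<close>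
    have rem: "set_mset (?M - {#e#}) = insert {u, v} (E - {e})" if "e \<in> E" for e
    proof -
      have c: "count ?M e' = (if e' \<in> E then 1 else 0) + (if e' = {u, v} then 1 else 0)" for e'
        using fin by (auto simp: count_mset_set')
      have "e' \<in># ?M - {#e#} \<longleftrightarrow> e' \<in> insert {u, v} (E - {e})" for e'
        unfolding count_greater_zero_iff[symmetric] count_diff c using that by auto
      then show ?thesis by blast
    qed
    have M: "set_mset ?M = insert {u, v} E" using fin by simp
    show ?thesis
    proof
      assume t: "two_edge_connected V ?M"
      then have J: "joined V (set_mset ?M)" by (simp only: two_edge_connected_def connected_graph_iff[OF eM])
      have "joined V (set_mset (?M - {#e#}))" if "e \<in># ?M" for e
        using t that is_bridge_iff[OF fin(1) eM J] unfolding two_edge_connected_def by blast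
      from this[of "{u, v}"] this show "joined V E \<and> (\<forall>e\<in>E. joined V (insert {u, v} (E - {e})))"
        using rem fin by (metis M add_mset_remove_trivial finite_set_mset_mset_set insertI1 insertI2)
    next
      assume t: "joined V E \<and> (\<forall>e\<in>E. joined V (insert {u, v} (E - {e})))"
      then have J: "joined V (set_mset ?M)" using joined_mono[of V E "set_mset ?M"] M by blast
      have "joined V (set_mset (?M - {#e#}))" if "e \<in># ?M" for e
      proof (cases "e \<in> E")
        case True
        then show ?thesis using rem t by simp
      next
        case False
        then have "e = {u, v}" using that fin by simp
        then show ?thesis using t fin by simp
      qed
      then show "two_edge_connected V ?M"
        unfolding two_edge_connected_def connected_graph_iff[OF eM] using J is_bridge_iff[OF fin(1) eM J] by blast
    qed
  qed
  have loop: "adj (insert {s, s} A) \<subseteq> (adj A)\<^sup>=" for s A by (auto simp: adj_def)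
  have loopj: "joined V (insert {s, s} A) \<longleftrightarrow> joined V A" for s A
    using rtrancl_mono[OF loop[of s A]] adj_mono[of A "insert {s, s} A"] unfolding joined_def by (auto simp: subset_iff)
  show ?thesis
  proof
    assume "almost_two_edge_connected V E"
    then consider "two_edge_connected V (mset_set E)"
      | u v where "u \<in> V" "v \<in> V" "u \<noteq> v" "two_edge_connected V (add_mset {u, v} (mset_set E))"
      unfolding almost_two_edge_connected_def by blast
    then show "joined V E \<and> (\<exists>s\<in>V. \<exists>t\<in>V. \<forall>e\<in>E. joined V (insert {s, t} (E - {e})))"
    proof cases
      case 1
      then have J: "joined V E" "\<forall>e\<in>E. joined V (E - {e})" using \<open>two_edge_connected V (mset_set E) \<longleftrightarrow> _\<close> by auto
      then obtain s where "s \<in> V" by (auto simp: joined_def)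
      with J loopj show ?thesis by blast
    qed (use 2 in blast)
  next
    assume R: "joined V E \<and> (\<exists>s\<in>V. \<exists>t\<in>V. \<forall>e\<in>E. joined V (insert {s, t} (E - {e})))"
    then obtain s t where st: "s \<in> V" "t \<in> V" "\<forall>e\<in>E. joined V (insert {s, t} (E - {e}))" by blast
    show "almost_two_edge_connected V E"
    proof (cases "s = t")
      case True
      then have "\<forall>e\<in>E. joined V (E - {e})" using st(3) loopj by simp
      then show ?thesis unfolding almost_two_edge_connected_def 1 using R by blast
    next
      case False
      then show ?thesis unfolding almost_two_edge_connected_def using 2[OF st(1,2)] R st by blast
    qed
  qed
qed

section \<open>Proper walks as reachability\<close>

text \<open>The counterpart of \<open>arcs\<close> for any number of colours: the state keeps the
  last colour and the next edge must differ from it. With two colours, differing means being the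
  negation.\<close>

definition steps :: "('a \<times> 'a \<times> 'c) set \<Rightarrow> (('a \<times> 'c) \<times> ('a \<times> 'c)) set" where
  "steps C = {((u, k'), (v, k)) | u v k k'. (u, v, k) \<in> C \<and> k' \<noteq> k}"

definition colour_perms :: "'a set set \<Rightarrow> ('a set \<Rightarrow> 'c) \<Rightarrow> ('a \<times> 'a \<times> 'c) set" where
  "colour_perms E g = {(u, v, g {u, v}) | u v. {u, v} \<in> E}"

lemma steps_bool: "steps C = arcs C"
  unfolding steps_def arcs_def by auto

lemma proper_walk_steps:
  assumes "\<And>e e'. e \<in> E \<Longrightarrow> e' \<in> E \<Longrightarrow> g e = g e' \<Longrightarrow> c e = c e'"
    and "is_walk V E (x # q)" "properly_coloured c (x # q)" "q \<noteq> [] \<longrightarrow> k0 \<noteq> g {x, hd q}"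
  shows "\<exists>k. ((x, k0), (last (x # q), k)) \<in> (steps (colour_perms E g))\<^sup>*"
  using assms(2-4)
proof (induction q arbitrary: x k0)
  case (Cons y q)
  have E: "{x, y} \<in> E" using Cons.prems by simp
  have s: "((x, k0), (y, g {x, y})) \<in> steps (colour_perms E g)"
    using Cons.prems E by (auto simp: steps_def colour_perms_def)
  have "\<exists>k. ((y, g {x, y}), (last (y # q), k)) \<in> (steps (colour_perms E g))\<^sup>*"
  proof (rule Cons.IH)
    show "is_walk V E (y # q)" using Cons.prems by simp
    show "properly_coloured c (y # q)" using Cons.prems by (cases q) auto
    show "q \<noteq> [] \<longrightarrow> g {x, y} \<noteq> g {y, hd q}"
    proof
      assume "q \<noteq> []"
      then obtain z r where q: "q = z # r" by (cases q) auto
      then have "c {x, y} \<noteq> c {y, z}" "{y, z} \<in> E" using Cons.prems by auto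
      then show "g {x, y} \<noteq> g {y, hd q}" using assms(1)[OF E] q by auto
    qed
  qed
  then obtain k where "((y, g {x, y}), (last (y # q), k)) \<in> (steps (colour_perms E g))\<^sup>*" by blast
  from converse_rtrancl_into_rtrancl[OF s this] show ?case by auto
qed auto

lemma steps_proper_walk:
  assumes "\<And>e e'. e \<in> E \<Longrightarrow> e' \<in> E \<Longrightarrow> c e = c e' \<Longrightarrow> g e = g e'" "edges_in V E"
    and "(p, r) \<in> (steps (colour_perms E g))\<^sup>*" "fst p \<in> V"
  shows "\<exists>q. is_walk V E (fst p # q) \<and> properly_coloured c (fst p # q) \<and> last (fst p # q) = fst r
    \<and> (q \<noteq> [] \<longrightarrow> snd p \<noteq> g {fst p, hd q})"
  using assms(3,4)
proof (induction rule: converse_rtrancl_induct)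
  case base
  then show ?case by (intro exI[of _ "[]"]) simp
next
  case (step p p')
  have e: "{fst p, fst p'} \<in> E" "snd p' = g {fst p, fst p'}" "snd p \<noteq> snd p'"
    using step(1) by (auto simp: steps_def colour_perms_def)
  have "fst p' \<in> V" using e(1) edges_inD[OF assms(2)] by blast
  then obtain q where q: "is_walk V E (fst p' # q)" "properly_coloured c (fst p' # q)"
    "last (fst p' # q) = fst r" "q \<noteq> [] \<longrightarrow> snd p' \<noteq> g {fst p', hd q}"
    using step.IH by blast
  have "properly_coloured c (fst p # fst p' # q)"
  proof (cases q)
    case (Cons z t)
    then have "{fst p', z} \<in> E" using q(1) by simp
    then have "c {fst p, fst p'} \<noteq> c {fst p', z}" using q(4) Cons assms(1)[OF e(1)] e(2) by auto
    then show ?thesis using q(2) Cons by simp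
  qed simp
  then show ?case using q e step.prems by (intro exI[of _ "fst p' # q"]) auto
qed

text \<open>Only equality of colours on \<open>E\<close> matters, so \<open>c\<close> may be traded
  for any \<open>g\<close> with the same colour classes, in particular a Boolean one. The assumption
  \<open>two\<close> supplies an initial colour that does not block the first edge.\<close>

lemma proper_walk_iff:
  fixes g :: "'a set \<Rightarrow> 'c"
  assumes "\<And>e e'. e \<in> E \<Longrightarrow> e' \<in> E \<Longrightarrow> c e = c e' \<longleftrightarrow> g e = g e'" "edges_in V E" "u \<in> V"
    and two: "\<And>k :: 'c. \<exists>k'. k' \<noteq> k"
  shows "(\<exists>p. walk_between V E u p v \<and> properly_coloured c p) \<longleftrightarrow>
    (\<exists>i j. ((u, i), (v, j)) \<in> (steps (colour_perms E g))\<^sup>*)"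
proof
  assume "\<exists>p. walk_between V E u p v \<and> properly_coloured c p"
  then obtain p where p: "is_walk V E p" "hd p = u" "last p = v" "properly_coloured c p"
    by (auto simp: walk_between_def)
  then obtain q where q: "p = u # q" by (cases p) (auto simp: is_walk_def)
  obtain k0 where "k0 \<noteq> g {u, hd q}" using two by blast
  then show "\<exists>i j. ((u, i), (v, j)) \<in> (steps (colour_perms E g))\<^sup>*"
    using proper_walk_steps[of E g c V u q k0] p q assms(1) by auto
next
  assume "\<exists>i j. ((u, i), (v, j)) \<in> (steps (colour_perms E g))\<^sup>*"
  then obtain i j where "((u, i), (v, j)) \<in> (steps (colour_perms E g))\<^sup>*" by blast
  from steps_proper_walk[OF _ assms(2) this, of c] assms(1,3)
  obtain q where "is_walk V E (u # q)" "properly_coloured c (u # q)" "last (u # q) = v" by auto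
  then show "\<exists>p. walk_between V E u p v \<and> properly_coloured c p"
    by (intro exI[of _ "u # q"]) (simp add: walk_between_def)
qed

definition alternating_connected :: "'a set \<Rightarrow> ('a \<times> 'a \<times> bool) set \<Rightarrow> bool" where
  "alternating_connected V G \<longleftrightarrow> (\<forall>u\<in>V. \<forall>v\<in>V. \<exists>i j. ((u, i), (v, j)) \<in> (arcs G)\<^sup>*)"

lemma connecting_two_iff:
  assumes "edges_in V E" "c \<in> E \<rightarrow> {1..2}"
  shows "connecting_colouring V E 2 c \<longleftrightarrow> alternating_connected V (colour_perms E (\<lambda>e. c e = 2))"
proof -
  have "c e = c e' \<longleftrightarrow> (c e = 2) = (c e' = 2)" if "e \<in> E" "e' \<in> E" for e e'
  proof -
    have "c e \<in> {1..2}" "c e' \<in> {1..2}" using assms(2) that by auto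
    then show ?thesis by auto
  qed
  then show ?thesis
    using proper_walk_iff[of E c "\<lambda>e. c e = 2" V] assms
    unfolding connecting_colouring_def alternating_connected_def steps_bool by auto
qed

section \<open>Necessity of the conditions for two colours\<close>

lemma rtrancl_exit:
  assumes "(p, q) \<in> R\<^sup>*" "p \<in> X" "q \<notin> X"
  obtains a b where "a \<in> X" "b \<notin> X" "(a, b) \<in> R"
proof -
  have "q \<in> X \<or> (\<exists>a\<in>X. \<exists>b. b \<notin> X \<and> (a, b) \<in> R)"
    using assms(1)
  proof (induction rule: rtrancl_induct)
    case base
    show ?case using assms(2) by blast
  qed blast
  then show thesis using assms(3) that by blast
qed

section \<open>Replacing edges by walks, and cuts formed by stubborn edges\<close>

lemma joined_replace:
  assumes "joined V E" "e = {x, y}" "(x, y) \<in> (adj B)\<^sup>*" "E - {e} \<subseteq> B"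
  shows "joined V B"
proof -
  have "(a, b) \<in> (adj B)\<^sup>*" if "(a, b) \<in> adj E" for a b
  proof (cases "{a, b} = e")
    case True
    then have "(a, b) = (x, y) \<or> (a, b) = (y, x)" using assms(2) by (auto simp: doubleton_eq_iff)
    then show ?thesis using assms(3) adj_rtrancl_sym[OF assms(3)] by auto
  next
    case False
    then have "(a, b) \<in> adj B" using that assms(4) by (auto simp: adj_def)
    then show ?thesis by simp
  qed
  then have "(adj E)\<^sup>* \<subseteq> (adj B)\<^sup>*" by (intro rtrancl_subset_rtrancl) auto
  then show ?thesis using assms(1) unfolding joined_def by blast
qed

text \<open>A walk of odd length between the ends of an edge replaces the edge in every walk without
  changing parities.\<close>

lemma linked_redundant:
  assumes "((a, False), (b, True)) \<in> linked B" "E - {{a, b}} \<subseteq> B" "(p, q) \<in> linked E"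
  shows "(p, q) \<in> linked B"
proof -
  have 0: "((a, i), (b, \<not> i)) \<in> linked B" for i
    using assms(1) linked_flip[OF assms(1)] by (cases i) auto
  have "(p, q) \<in> (arcs (free B))\<^sup>*" if pq: "(p, q) \<in> arcs (free E)" for p q
  proof -
    from pq obtain c d k where cd: "p = (c, \<not> k)" "q = (d, k)" "{c, d} \<in> E" by (auto simp: arcs_def)
    show ?thesis
    proof (cases "{c, d} = {a, b}")
      case True
      then have "c = a \<and> d = b \<or> c = b \<and> d = a" by (auto simp: doubleton_eq_iff)
      then show ?thesis
        using cd 0[of "\<not> k"] linked_sym[OF 0[of k]] unfolding linked_def by auto
    next
      case False
      then have "(p, q) \<in> arcs (free B)" using cd assms(2) by (auto simp: arcs_def)
      then show ?thesis by simp
    qed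
  qed
  then have "(arcs (free E))\<^sup>* \<subseteq> (arcs (free B))\<^sup>*" by (intro rtrancl_subset_rtrancl) auto
  then show ?thesis using assms(3) unfolding linked_def by blast
qed

lemma has_odd_redundant:
  assumes "((a, False), (b, True)) \<in> linked B" "E - {{a, b}} \<subseteq> B" "has_odd E"
  shows "has_odd B"
  using assms(3) linked_redundant[OF assms(1,2)] unfolding has_odd_def by blast

text \<open>Inserting a bridge creates no odd closed walk.\<close>

lemma stubborn_not_bridge:
  assumes "has_odd E" "\<not> has_odd (E - {{a, b}})" "{a, b} \<in> E"
  shows "(a, b) \<in> (adj (E - {{a, b}}))\<^sup>*"
  using has_odd_insert_bridge[OF assms(2)] assms(1,3) by (metis insert_Diff)

text \<open>If the ends were linked with opposite bits without the edge, a walk of odd length could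
  replace it, and an odd closed walk would survive its deletion.\<close>

lemma stubborn_same_side:
  assumes "has_odd E" "\<not> has_odd (E - {{a, b}})" "{a, b} \<in> E"
  shows "((a, i), (b, i)) \<in> linked (E - {{a, b}})"
proof -
  obtain j where j: "((a, i), (b, j)) \<in> linked (E - {{a, b}})"
    using adj_imp_linked[OF stubborn_not_bridge[OF assms]] by blast
  have "j = i"
  proof (rule ccontr)
    assume "j \<noteq> i"
    then have "((a, False), (b, True)) \<in> linked (E - {{a, b}})"
      using j linked_flip[OF j] by (cases i; cases j) auto
    from has_odd_redundant[OF this _ assms(1)] show False using assms(2) by blast
  qed
  then show ?thesis using j by simp
qed

text \<open>A path from \<open>a\<close> to \<open>b\<close> avoiding both edges is impossible for
  either parity: an odd one could replace \<open>{a, b}\<close> in an odd closed walk, and an even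
  one closes up with \<open>{a, b}\<close> to an odd closed walk avoiding \<open>e\<close>.\<close>

lemma stubborn_pair_separates:
  assumes "has_odd E" "\<not> has_odd (E - {e})" "\<not> has_odd (E - {{a, b}})" "e \<noteq> {a, b}" "{a, b} \<in> E"
  shows "(a, b) \<notin> (adj (E - {e, {a, b}}))\<^sup>*"
proof
  let ?A = "E - {e, {a, b}}"
  assume "(a, b) \<in> (adj ?A)\<^sup>*"
  from adj_imp_linked[OF this] obtain j where j: "((a, False), (b, j)) \<in> linked ?A" by blast
  have A: "?A \<subseteq> E - {e}" "?A \<subseteq> E - {{a, b}}" by auto
  show False
  proof (cases j)
    case True
    then have "((a, False), (b, True)) \<in> linked (E - {{a, b}})" using linked_mono[OF A(2) j] by simp
    from has_odd_redundant[OF this _ assms(1)] show False using assms(3) by blast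
  next
    case False
    have "{b, a} \<in> E - {e}" using assms(4,5) by (auto simp: insert_commute)
    then have "((b, False), (a, \<not> False)) \<in> linked (E - {e})" by (rule linked_edge)
    with linked_mono[OF A(1) j] False have "((a, False), (a, \<not> False)) \<in> linked (E - {e})"
      using linked_trans by auto
    then have "has_odd (E - {e})" by (rule has_oddI)
    with assms(2) show False by simp
  qed
qed

lemma sym_perms_colour: "sym_perms (colour_perms E g)"
  by (auto simp: sym_perms_def colour_perms_def insert_commute)

lemma colour_perms_free: "colour_perms E g \<subseteq> free E"
  by (auto simp: colour_perms_def)

lemma arcs_imp_linked: "G \<subseteq> free E \<Longrightarrow> (p, q) \<in> (arcs G)\<^sup>* \<Longrightarrow> (p, q) \<in> linked E"
  unfolding linked_def using rtrancl_mono[OF arcs_mono] by blast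

lemma obtain_max_nat:
  assumes "finite V" "V \<noteq> {}"
  obtains s where "s \<in> V" "\<And>v. v \<in> V \<Longrightarrow> (f v :: nat) \<le> f s"
proof -
  have "Max (f ` V) \<in> f ` V" using assms by (intro Max_in) auto
  then obtain s where "s \<in> V" "Max (f ` V) = f s" by blast
  then show thesis using that[of s] assms Max_ge[of "f ` V"] by (metis finite_imageI imageI)
qed


section \<open>Two colours on a bipartite graph: the orientation of one sheet\<close>

text \<open>A vertex with the most successors reaches everything: a vertex it does not reach would
  reach it, and so have strictly more successors.\<close>

lemma total_preorder_ends:
  assumes "finite V" "V \<noteq> {}"
    and tot: "\<And>u v. u \<in> V \<Longrightarrow> v \<in> V \<Longrightarrow> (u, v) \<in> R\<^sup>* \<or> (v, u) \<in> R\<^sup>*"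
  obtains s where "s \<in> V" "\<And>v. v \<in> V \<Longrightarrow> (s, v) \<in> R\<^sup>*"
proof -
  let ?r = "\<lambda>u. {v \<in> V. (u, v) \<in> R\<^sup>*}"
  obtain s where s: "s \<in> V" "\<And>v. v \<in> V \<Longrightarrow> card (?r v) \<le> card (?r s)"
    using obtain_max_nat[OF assms(1,2), of "\<lambda>v. card (?r v)"] by blast
  have "(s, v) \<in> R\<^sup>*" if v: "v \<in> V" for v
  proof (rule ccontr)
    assume n: "(s, v) \<notin> R\<^sup>*"
    then have vs: "(v, s) \<in> R\<^sup>*" using tot[OF s(1) v] by blast
    have "?r s \<subseteq> ?r v" using rtrancl_trans[OF vs] by blast
    moreover have "v \<in> ?r v - ?r s" using v n by simp
    ultimately have "?r s \<subset> ?r v" by blast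
    then have "card (?r s) < card (?r v)" using assms(1) by (intro psubset_card_mono) auto
    then show False using s(2)[OF v] by simp
  qed
  then show thesis using that s(1) by blast
qed

text \<open>One sheet of the double cover is a copy of the graph, oriented by the colouring. A walk
  in the other sheet can be flipped into this one, so any two vertices are comparable; the added
  edge joins a source \<open>s\<close> to a sink \<open>t\<close>.\<close>

lemma alternating_bipartite_almost:
  assumes fg: "finite_simple_graph V E" and ne: "V \<noteq> {}" and nodd: "\<not> has_odd E"
    and alt: "alternating_connected V (colour_perms E g)"
  shows "almost_two_edge_connected V E"
proof -
  let ?G = "colour_perms E g"
  have eV: "edges_in V E" by (rule simple_graph_edges_in[OF fg])
  have finV: "finite V" using simple_graph_finite[OF fg] by simp
  have J: "joined V E" unfolding joined_def
  proof (intro conjI ballI)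
    fix u v assume "u \<in> V" "v \<in> V"
    then obtain i j where "((u, i), (v, j)) \<in> (arcs ?G)\<^sup>*" using alt unfolding alternating_connected_def by blast
    from linked_imp_adj[OF arcs_imp_linked[OF colour_perms_free this]]
    show "(u, v) \<in> (adj E)\<^sup>*" by simp
  qed (rule ne)
  obtain r where r: "r \<in> V" using ne by blast
  have "\<exists>l. \<forall>v\<in>V. ((r, False), (v, l v)) \<in> linked E"
    using J r adj_imp_linked[of r _ E False] unfolding joined_def by (intro bchoice) blast
  then obtain l where l: "\<And>v. v \<in> V \<Longrightarrow> ((r, False), (v, l v)) \<in> linked E" by blast
  have lu: "j = l v" if "((u, l u), (v, j)) \<in> linked E" "u \<in> V" "v \<in> V" for u v j
    using linked_unique[OF nodd linked_trans[OF l[OF that(2)] that(1)] l[OF that(3)]] .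
  define D where "D = {(u, v). u \<in> V \<and> v \<in> V \<and> ((u, l u), (v, l v)) \<in> arcs ?G}"
  have toD: "snd q = l (fst q) \<and> fst q \<in> V \<and> (u, fst q) \<in> D\<^sup>*"
    if "((u, l u), q) \<in> (arcs ?G)\<^sup>*" "u \<in> V" for u q
    using that(1)
  proof (induction rule: rtrancl_induct)
    case base
    then show ?case using that(2) by simp
  next
    case (step q q')
    have q': "fst q' \<in> V" using step(2) edges_inD[OF eV] by (auto simp: arcs_def colour_perms_def)
    have "(q, q') \<in> linked E" using arcs_imp_linked[OF colour_perms_free] step(2) by blast
    moreover have "q = (fst q, l (fst q))" using step.IH by (simp add: prod_eq_iff)
    ultimately have "((fst q, l (fst q)), (fst q', snd q')) \<in> linked E" by simp
    from lu[OF this _ q'] have s': "snd q' = l (fst q')" using step.IH by blast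
    then have "(fst q, fst q') \<in> D" unfolding D_def using step.IH step(2) q' by (cases q; cases q') auto
    then show ?case using s' q' step.IH by (auto intro: rtrancl_into_rtrancl)
  qed
  have tot: "(u, v) \<in> D\<^sup>* \<or> (v, u) \<in> D\<^sup>*" if uv: "u \<in> V" "v \<in> V" for u v
  proof -
    obtain i j where ij: "((u, i), (v, j)) \<in> (arcs ?G)\<^sup>*"
      using alt uv unfolding alternating_connected_def by blast
    show ?thesis
    proof (cases "i = l u")
      case True
      then show ?thesis using toD[of u "(v, j)"] ij uv by auto
    next
      case False
      have f: "((v, \<not> j), (u, l u)) \<in> (arcs ?G)\<^sup>*"
        using rtrancl_arcs_flip[OF sym_perms_colour ij] False by (cases i; cases "l u") auto
      have "((u, l u), (v, \<not> j)) \<in> linked E"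
        by (rule linked_sym[OF arcs_imp_linked[OF colour_perms_free f]])
      from lu[OF this uv] have "(\<not> j) = l v" .
      then show ?thesis using toD[of v "(u, l u)"] f uv by auto
    qed
  qed
  obtain s where s: "s \<in> V" "\<And>v. v \<in> V \<Longrightarrow> (s, v) \<in> D\<^sup>*"
    using total_preorder_ends[OF finV ne tot] by blast
  obtain t where t: "t \<in> V" "\<And>v. v \<in> V \<Longrightarrow> (v, t) \<in> D\<^sup>*"
    using total_preorder_ends[OF finV ne, of "D\<inverse>"] tot by (auto simp: rtrancl_converse)
  have "joined V (insert {s, t} (E - {e}))" if e: "e \<in> E" for e
  proof -
    obtain a b where ab: "e = {a, b}" "a \<in> V" "b \<in> V" "a \<noteq> b" by (rule simple_graph_edge[OF fg e])
    have lab: "l b = (\<not> l a)"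
      using lu[of a b "\<not> l a"] linked_edge[of a b E "l a"] e ab by auto
    \<comment> \<open>In the chosen sheet the colour directs \<open>e\<close> from \<open>x\<close>
      to \<open>y\<close>.\<close>
    obtain x y where xy: "e = {x, y}" "x \<in> V" "y \<in> V" "x \<noteq> y" "l y = g e" "l x = (\<not> g e)"
    proof (cases "l a = g e")
      case True
      then show thesis using that[of b a] ab lab by auto
    next
      case False
      then show thesis using that[of a b] ab lab by auto
    qed
    let ?B = "insert {s, t} (E - {e})"
    have sub: "(p, q) \<in> adj ?B" if "(p, q) \<in> D" "(p, q) \<noteq> (x, y)" for p q
    proof -
      have pq: "{p, q} \<in> E" "g {p, q} = l q" using that(1) by (auto simp: D_def arcs_def colour_perms_def)
      have "{p, q} \<noteq> e"
      proof
        assume "{p, q} = e"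
        then have "p = y \<and> q = x" using that(2) xy by (auto simp: doubleton_eq_iff)
        then show False using pq xy \<open>{p, q} = e\<close> by auto
      qed
      then show ?thesis using pq by (simp add: adj_def)
    qed
    \<comment> \<open>The walk from \<open>s\<close> up to its first visit to \<open>x\<close>, and
      the walk to \<open>t\<close> after its last visit to \<open>y\<close>, avoid the arc
      \<open>x -> y\<close>. Together with \<open>{s, t}\<close> they form a detour replacing
      \<open>e\<close>.\<close>
    have 1: "(s, x) \<in> (adj ?B)\<^sup>*"
      using rtrancl_first_in[OF s(2)[OF xy(2)], of "{x}" "adj ?B"] sub by blast
    have 2: "(y, t) \<in> (adj ?B)\<^sup>*"
      using rtrancl_last_in[OF t(2)[OF xy(3)], of "{y}" "adj ?B"] sub by blast
    have 3: "(s, t) \<in> adj ?B" by (simp add: adj_def)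
    have "(x, t) \<in> (adj ?B)\<^sup>*" by (rule rtrancl_into_rtrancl[OF adj_rtrancl_sym[OF 1] 3])
    then have "(x, y) \<in> (adj ?B)\<^sup>*" by (rule rtrancl_trans[OF _ adj_rtrancl_sym[OF 2]])
    then show ?thesis by (rule joined_replace[OF J xy(1)]) blast
  qed
  then show ?thesis unfolding almost_two_edge_connected_iff[OF fg] using J s(1) t(1) by blast
qed

lemma finite_simple_graph_induced:
  assumes "finite_simple_graph V E" "W \<subseteq> V"
  shows "finite_simple_graph W (induced_edges W E)"
  unfolding finite_simple_graph_def
proof (intro conjI subsetI)
  show "finite W" using assms simple_graph_finite finite_subset by blast
  fix e assume "e \<in> induced_edges W E"
  then have e: "e \<in> E" "e \<subseteq> W" by (auto simp: induced_edges_def)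
  obtain u v where "e = {u, v}" "u \<noteq> v" by (rule simple_graph_edge[OF assms(1) e(1)])
  then show "e \<in> {{u, v} |u v. u \<in> W \<and> v \<in> W \<and> u \<noteq> v}" using e(2) by blast
qed

text \<open>Fix a stubborn edge \<open>e0\<close>; without it the graph is bipartite and one sheet
  is oriented by the colouring. Every other stubborn edge forms a cut with \<open>e0\<close> and
  points to one side of it. \<open>K\<close> is the component of a vertex on the head side of the
  fewest of these cuts: every boundary edge then points out of \<open>K\<close>, so the flipped lift
  of \<open>K\<close> cannot be left.\<close>

lemma alternating_stubborn_free:
  assumes fg: "finite_simple_graph V E" and J: "joined V E" and odd: "has_odd E"
    and alt: "alternating_connected V (colour_perms E g)"
  shows "\<exists>K\<in>stubborn_free_components V E.
    V - K = {} \<or> almost_two_edge_connected (V - K) (induced_edges (V - K) E)"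
proof -
  let ?G = "colour_perms E g"
  define S where "S = {e \<in> E. \<not> has_odd (E - {e})}"
  have eV: "edges_in V E" by (rule simple_graph_edges_in[OF fg])
  have finV: "finite V" and finE: "finite E" using simple_graph_finite[OF fg] by auto
  have ne: "V \<noteq> {}" using J by (simp add: joined_def)
  have comps: "stubborn_free_components V E = {{v \<in> V. (u, v) \<in> (adj (E - S))\<^sup>*} | u. u \<in> V}"
    unfolding stubborn_free_components_def stubborn_edges_eq[OF eV] S_def[symmetric]
    by (rule components_eq[OF edges_in_subset[OF eV]]) blast
  show ?thesis
  proof (cases "S = {}")
    case True
    obtain u where u: "u \<in> V" using ne by blast
    have "{v \<in> V. (u, v) \<in> (adj (E - S))\<^sup>*} = V" using True J u by (auto simp: joined_def)
    then have "V \<in> stubborn_free_components V E" unfolding comps using u by blast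
    then show ?thesis by (intro bexI[of _ V]) simp
  next
    case False
    then obtain e0 where e0S: "e0 \<in> S" by blast
    then have e0: "e0 \<in> E" "\<not> has_odd (E - {e0})" by (auto simp: S_def)
    obtain a0 b0 where ab0: "e0 = {a0, b0}" "a0 \<in> V" "b0 \<in> V" by (rule simple_graph_edge[OF fg e0(1)])
    let ?E0 = "E - {e0}"
    have J0: "joined V ?E0"
      by (rule joined_replace[OF J ab0(1)]) (use stubborn_not_bridge[of E a0 b0] odd e0 ab0(1) in auto)
    have "\<exists>l. \<forall>v\<in>V. ((a0, \<not> g e0), (v, l v)) \<in> linked ?E0"
      using J0 ab0 adj_imp_linked[of a0 _ ?E0 "\<not> g e0"] unfolding joined_def by (intro bchoice) blast
    then obtain l where l: "\<And>v. v \<in> V \<Longrightarrow> ((a0, \<not> g e0), (v, l v)) \<in> linked ?E0" by blast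
    \<comment> \<open>Both ends of \<open>e0\<close> get the same bit, and the base state is chosen
      so that the colour of \<open>e0\<close> leads out of this sheet at either end.\<close>
    have la0: "l a0 = (\<not> g e0)"
      using linked_unique[OF e0(2) l[OF ab0(2)] linked_refl] by simp
    have lb0: "l b0 = (\<not> g e0)"
      using linked_unique[OF e0(2) l[OF ab0(3)]] stubborn_same_side[of E a0 b0 "\<not> g e0"] odd e0 ab0(1) by auto
    have lE0: "l w = (\<not> l v)" if "{v, w} \<in> E" "{v, w} \<noteq> e0" for v w
    proof -
      have vw: "v \<in> V" "w \<in> V" using that(1) eV by (auto simp: edges_in_def)
      have "((v, l v), (w, \<not> l v)) \<in> linked ?E0" using that by (intro linked_edge) simp
      from linked_unique[OF e0(2) l[OF vw(2)] linked_trans[OF l[OF vw(1)] this]] show ?thesis .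
    qed
    \<comment> \<open>The end \<open>b\<close> with \<open>l b = g f\<close> is the head of
      \<open>f\<close> in the sheet, so \<open>side f v\<close> places \<open>v\<close> on the head
      side of the cut formed by \<open>e0\<close> and \<open>f\<close>.\<close>
    define side where "side f v \<longleftrightarrow> (\<exists>b\<in>f. l b = g f \<and> (b, v) \<in> (adj (E - {e0, f}))\<^sup>*)" for f v
    define \<phi> where "\<phi> v = card {f \<in> S - {e0}. side f v}" for v
    have side_edge: "side f u \<longleftrightarrow> side f w" if "{u, w} \<in> E" "{u, w} \<noteq> e0" "{u, w} \<noteq> f" for f u w
    proof -
      have "(u, w) \<in> (adj (E - {e0, f}))\<^sup>*" using that by (intro r_into_rtrancl) (simp add: adj_def)
      then show ?thesis unfolding side_def
        using adj_rtrancl_sym by (meson rtrancl_trans)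
    qed
    have "finite V" "V \<noteq> {}" by fact+
    then obtain m where m: "m \<in> V" "\<And>v. v \<in> V \<Longrightarrow> \<phi> m \<le> \<phi> v"
      using ex_min_if_finite[of "\<phi> ` V"] by (metis (no_types, lifting) finite_imageI image_iff image_is_empty not_le_imp_less imageI)
    define K where "K = {v \<in> V. (m, v) \<in> (adj (E - S))\<^sup>*}"
    have KV: "K \<subseteq> V" and mK: "m \<in> K" using m by (auto simp: K_def)
    have Kc: "K \<in> stubborn_free_components V E" unfolding comps K_def using m by blast
    \<comment> \<open>Edges outside \<open>S\<close> cross none of these cuts, so the count is
      constant on \<open>K\<close>.\<close>
    have \<phi>K: "\<phi> v = \<phi> m" if "v \<in> K" for v
    proof -
      have "(m, v) \<in> (adj (E - S))\<^sup>*" using that by (simp add: K_def)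
      then have "\<forall>f\<in>S - {e0}. side f m \<longleftrightarrow> side f v"
      proof (induction rule: rtrancl_induct)
        case (step u w)
        then have uw: "{u, w} \<in> E" "{u, w} \<notin> S" by (auto simp: adj_def)
        have "side f u \<longleftrightarrow> side f w" if "f \<in> S - {e0}" for f
          by (rule side_edge) (use uw that e0S in auto)
        then show ?case using step.IH by blast
      qed simp
      then have "{f \<in> S - {e0}. side f v} = {f \<in> S - {e0}. side f m}" by blast
      then show ?thesis by (simp add: \<phi>_def)
    qed
    have out: "{z, v} \<in> S" if "{z, v} \<in> E" "z \<notin> K" "v \<in> K" for z v
    proof (rule ccontr)
      assume "{z, v} \<notin> S"
      then have "(v, z) \<in> adj (E - S)" using that by (simp add: adj_def insert_commute)
      moreover have "z \<in> V" using that(1) eV by (auto simp: edges_in_def)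
      ultimately show False using that(2,3) by (auto simp: K_def intro: rtrancl_into_rtrancl)
    qed
    \<comment> \<open>An edge pointing into \<open>v\<close> would put \<open>v\<close> on the head
      side of exactly one cut more than \<open>z\<close>, contradicting that \<open>\<phi>\<close>
      is minimal on \<open>K\<close>.\<close>
    have key: "g {z, v} = (\<not> l v)" if zv: "{z, v} \<in> E" "z \<notin> K" "v \<in> K" for z v
    proof (cases "{z, v} = e0")
      case True
      then have "v = a0 \<or> v = b0" using ab0(1) by (auto simp: doubleton_eq_iff)
      then show ?thesis using True la0 lb0 by auto
    next
      case False
      let ?f = "{z, v}"
      have fS: "?f \<in> S" by (rule out[OF zv])
      have zV: "z \<in> V" using zv(1) eV by (auto simp: edges_in_def)
      have lz: "l v = (\<not> l z)" by (rule lE0[OF zv(1) False])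
      show ?thesis
      proof (rule ccontr)
        assume "\<not> ?thesis"
        then have gf: "g ?f = l v" by simp
        have sv: "side ?f v" unfolding side_def using gf by (intro bexI[of _ v]) auto
        have sz: "\<not> side ?f z"
        proof
          assume "side ?f z"
          then have "(v, z) \<in> (adj (E - {e0, ?f}))\<^sup>*" unfolding side_def using gf lz by auto
          moreover have "(z, v) \<notin> (adj (E - {e0, ?f}))\<^sup>*"
            using stubborn_pair_separates[OF odd e0(2), of z v] fS False by (auto simp: S_def)
          ultimately show False using adj_rtrancl_sym[of v z "E - {e0, ?f}"] by simp
        qed
        have "side f z \<longleftrightarrow> side f v" if "f \<noteq> ?f" for f
          by (rule side_edge) (use zv False that in auto)
        then have "{f \<in> S - {e0}. side f v} = insert ?f {f \<in> S - {e0}. side f z}"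
          using sv fS False by (intro set_eqI) (metis (no_types, lifting) Diff_iff insert_iff mem_Collect_eq singletonD)
        moreover have "finite {f \<in> S - {e0}. side f z}" using finE by (simp add: S_def)
        ultimately have "\<phi> v = Suc (\<phi> z)" using sz by (simp add: \<phi>_def)
        then show False using m(2)[OF zV] \<phi>K[OF zv(3)] by simp
      qed
    qed
    \<comment> \<open>The flipped lift of \<open>K\<close>. Flipping reverses the arcs, so the
      boundary edges now point inwards and nothing leaves this set.\<close>
    define Z where "Z = {(v, \<not> l v) | v. v \<in> K}"
    let ?W = "V - K"
    let ?E' = "induced_edges ?W E"
    have Zclosed: "q \<in> Z" if "(p, q) \<in> arcs ?G" "p \<in> Z" for p q
    proof -
      from that obtain v w where vw: "p = (v, \<not> l v)" "v \<in> K" "q = (w, l v)" "{v, w} \<in> E" "g {v, w} = l v"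
        by (auto simp: Z_def arcs_def colour_perms_def)
      have "w \<in> K" using key[of w v] vw by (auto simp: insert_commute)
      moreover have "{v, w} \<noteq> e0"
      proof
        assume *: "{v, w} = e0"
        then have "v = a0 \<or> v = b0" using ab0(1) by (auto simp: doubleton_eq_iff)
        then show False using vw(5) la0 lb0 * by auto
      qed
      then have "l w = (\<not> l v)" by (rule lE0[OF vw(4)])
      ultimately show ?thesis using vw by (auto simp: Z_def)
    qed
    \<comment> \<open>A walk that starts outside \<open>K\<close> can enter \<open>K\<close> only in
      \<open>Z\<close>, from where it never returns; so walks between vertices of
      \<open>V - K\<close> do not touch \<open>K\<close>.\<close>
    have stay: "q \<in> Z \<or> fst q \<in> ?W \<and> (p, q) \<in> (arcs (colour_perms ?E' g))\<^sup>*"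
      if "(p, q) \<in> (arcs ?G)\<^sup>*" "fst p \<in> ?W" for p q
      using that(1)
    proof (induction rule: rtrancl_induct)
      case base
      then show ?case using that(2) by simp
    next
      case (step q r)
      show ?case
      proof (cases "q \<in> Z")
        case True
        then show ?thesis using Zclosed step(2) by blast
      next
        case False
        then have q: "fst q \<in> ?W" "(p, q) \<in> (arcs (colour_perms ?E' g))\<^sup>*" using step.IH by auto
        from step(2) obtain v k where vk: "r = (v, k)" "q = (fst q, \<not> k)" "{fst q, v} \<in> E" "g {fst q, v} = k"
          by (auto simp: arcs_def colour_perms_def)
        have vV: "v \<in> V" using vk(3) eV by (auto simp: edges_in_def)
        show ?thesis
        proof (cases "v \<in> K")
          case True
          then have "k = (\<not> l v)" using key[OF vk(3) _ True] q(1) vk(4) by auto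
          then show ?thesis using vk True by (auto simp: Z_def)
        next
          case False
          then have "{fst q, v} \<in> ?E'" using q(1) vk(3) vV by (simp add: induced_edges_def)
          then have "((fst q, \<not> k), (v, k)) \<in> arcs (colour_perms ?E' g)"
            using vk(4) by (auto simp: arcs_iff colour_perms_def)
          then have "(q, r) \<in> arcs (colour_perms ?E' g)" using vk by simp
          with q(2) have "(p, r) \<in> (arcs (colour_perms ?E' g))\<^sup>*" by (rule rtrancl_into_rtrancl)
          then show ?thesis using vk(1) False vV by simp
        qed
      qed
    qed
    have "V - K = {} \<or> almost_two_edge_connected ?W ?E'"
    proof (cases "?W = {}")
      case False
      then obtain z where z: "z \<in> V" "z \<notin> K" by blast
      have "(m, z) \<in> (adj E)\<^sup>*" using J m(1) z(1) by (simp add: joined_def)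
      then obtain v w where vw: "v \<in> K" "w \<notin> K" "(v, w) \<in> adj E"
        by (rule rtrancl_exit[OF _ mK z(2)])
      have fS: "{w, v} \<in> S" by (rule out) (use vw in \<open>auto simp: adj_def insert_commute\<close>)
      \<comment> \<open>A stubborn edge leaves \<open>K\<close> and is thus missing from the induced
        graph, which is therefore bipartite.\<close>
      have "?E' \<subseteq> E - {{w, v}}" using vw(1) by (auto simp: induced_edges_def)
      then have nodd: "\<not> has_odd ?E'" using has_odd_mono fS unfolding S_def by blast
      have "alternating_connected ?W (colour_perms ?E' g)"
        unfolding alternating_connected_def
      proof (intro ballI)
        fix u v assume uv: "u \<in> ?W" "v \<in> ?W"
        then obtain i j where "((u, i), (v, j)) \<in> (arcs ?G)\<^sup>*"
          using alt unfolding alternating_connected_def by blast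
        from stay[OF this] uv show "\<exists>i j. ((u, i), (v, j)) \<in> (arcs (colour_perms ?E' g))\<^sup>*"
          by (auto simp: Z_def)
      qed
      then show ?thesis
        using alternating_bipartite_almost[OF finite_simple_graph_induced[OF fg Diff_subset] False nodd] by blast
    qed simp
    then show ?thesis using Kc by blast
  qed
qed

section \<open>Sufficiency of the conditions for two colours\<close>

text \<open>Minimality is demanded where both colours remain, since every edge has to keep one of
  them.\<close>

definition saturated :: "'a set set \<Rightarrow> ('a \<times> 'a \<times> bool) set \<Rightarrow> bool" where
  "saturated F G \<longleftrightarrow> sym_perms G \<and> G \<subseteq> free F \<and> (\<forall>a b. {a, b} \<in> F \<longrightarrow> (\<exists>k. (a, b, k) \<in> G)) \<and>
     (arcs G)\<^sup>* = linked F \<and>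
     (\<forall>u w k. (u, w, k) \<in> G \<and> (u, w, \<not> k) \<in> G \<longrightarrow>
        ((u, \<not> k), (w, k)) \<notin> (arcs (G - {(u, w, k), (w, u, k)}))\<^sup>*)"

text \<open>A permission owns one arc on each lift of the edge; a path that replaces one of these
  arcs becomes, after flipping, a path that replaces the other.\<close>

lemma arcs_remove_perm:
  assumes sym: "sym_perms G" and path: "((u, \<not> k), (w, k)) \<in> (arcs (G - {(u, w, k), (w, u, k)}))\<^sup>*"
  shows "(arcs (G - {(u, w, k), (w, u, k)}))\<^sup>* = (arcs G)\<^sup>*"
proof
  let ?G = "G - {(u, w, k), (w, u, k)}"
  show "(arcs ?G)\<^sup>* \<subseteq> (arcs G)\<^sup>*" by (intro rtrancl_mono arcs_mono) blast
  have sym': "sym_perms ?G" using sym by (auto simp: sym_perms_def)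
  have path': "((w, \<not> k), (u, k)) \<in> (arcs ?G)\<^sup>*" using rtrancl_arcs_flip[OF sym' path] by simp
  have "(p, q) \<in> (arcs ?G)\<^sup>*" if pq: "(p, q) \<in> arcs G" for p q
  proof -
    obtain a b i where ab: "p = (a, \<not> i)" "q = (b, i)" "(a, b, i) \<in> G" using pq by (auto simp: arcs_def)
    show ?thesis
    proof (cases "(a, b, i) \<in> ?G")
      case True
      then show ?thesis using ab by (auto simp: arcs_iff)
    next
      case False
      then show ?thesis using ab path path' by auto
    qed
  qed
  then show "(arcs G)\<^sup>* \<subseteq> (arcs ?G)\<^sup>*" by (intro rtrancl_subset_rtrancl) auto
qed

lemma saturated_exists:
  assumes "finite F" "\<And>e. e \<in> F \<Longrightarrow> finite e"
  shows "\<exists>G. saturated F G"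
proof -
  let ?P = "\<lambda>G. sym_perms G \<and> G \<subseteq> free F \<and> (\<forall>a b. {a, b} \<in> F \<longrightarrow> (\<exists>k. (a, b, k) \<in> G)) \<and> (arcs G)\<^sup>* = linked F"
  have "free F \<subseteq> \<Union>F \<times> \<Union>F \<times> UNIV" by (auto simp: free_def)
  moreover have "finite (\<Union>F \<times> \<Union>F \<times> (UNIV :: bool set))" using assms by auto
  ultimately have fin: "finite (free F)" using finite_subset by blast
  have "?P (free F)" by (auto simp: sym_perms_free linked_def)
  then obtain G where G: "?P G" "\<And>G'. ?P G' \<Longrightarrow> card G \<le> card G'"
    using ex_has_least_nat[of ?P "free F" card] by blast
  have "((u, \<not> k), (w, k)) \<notin> (arcs (G - {(u, w, k), (w, u, k)}))\<^sup>*"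
    if uw: "(u, w, k) \<in> G" "(u, w, \<not> k) \<in> G" for u w k
  proof
    let ?G = "G - {(u, w, k), (w, u, k)}"
    assume path: "((u, \<not> k), (w, k)) \<in> (arcs ?G)\<^sup>*"
    have "(w, u, \<not> k) \<in> G" using G(1) uw by (auto simp: sym_perms_def)
    then have "\<exists>k'. (a, b, k') \<in> ?G" if "{a, b} \<in> F" for a b
    proof (cases "(a, b) = (u, w) \<or> (a, b) = (w, u)")
      case True
      then show ?thesis using uw \<open>(w, u, \<not> k) \<in> G\<close> by (intro exI[of _ "\<not> k"]) auto
    next
      case False
      then show ?thesis using G(1) that by auto
    qed
    moreover have "sym_perms ?G" using G(1) by (auto simp: sym_perms_def)
    moreover have "(arcs ?G)\<^sup>* = linked F" using arcs_remove_perm[OF _ path] G(1) by simp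
    ultimately have "card G \<le> card ?G" using G(1) by (intro G(2)) auto
    moreover have "card ?G < card G"
      using uw(1) G(1) fin by (intro psubset_card_mono) (auto intro: finite_subset)
    ultimately show False by simp
  qed
  then show ?thesis using G(1) unfolding saturated_def by blast
qed

text \<open>The form of the last assumption of \<open>saturated_bridge\<close>: an even walk between
  the ends of an edge that avoids it comes with an odd one. In a bipartite graph there is no such
  even walk; otherwise an odd closed walk surviving the deletion can be inserted.\<close>

definition no_critical :: "'a set set \<Rightarrow> bool" where
  "no_critical F \<longleftrightarrow> (\<forall>u w k. {u, w} \<in> F \<longrightarrow> ((w, k), (u, k)) \<in> linked (F - {{u, w}}) \<longrightarrow>
     ((w, k), (u, \<not> k)) \<in> linked (F - {{u, w}}))"

lemma no_critical_bipartite: "\<not> has_odd F \<Longrightarrow> no_critical F"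
  unfolding no_critical_def
proof (intro allI impI)
  fix u w k
  assume "\<not> has_odd F" "{u, w} \<in> F" and l: "((w, k), (u, k)) \<in> linked (F - {{u, w}})"
  have "((u, k), (w, \<not> k)) \<in> linked F" by (rule linked_edge) fact
  from linked_trans[OF linked_mono[OF _ l] this] have "has_odd F" by (intro has_oddI[of w k]) blast
  with \<open>\<not> has_odd F\<close> show "((w, k), (u, \<not> k)) \<in> linked (F - {{u, w}})" by simp
qed

lemma no_critical_odd:
  assumes J: "joined V F" and fg: "finite_simple_graph V F" and odd: "\<And>e. e \<in> F \<Longrightarrow> has_odd (F - {e})"
  shows "no_critical F"
  unfolding no_critical_def
proof (intro allI impI)
  fix u w k
  assume uw: "{u, w} \<in> F" and l: "((w, k), (u, k)) \<in> linked (F - {{u, w}})"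
  let ?F = "F - {{u, w}}"
  have "(w, u) \<in> (adj ?F)\<^sup>*" using linked_imp_adj[OF l] by simp
  from adj_rtrancl_sym[OF this] have J': "joined V ?F" by (rule joined_replace[OF J refl]) blast
  have uV: "u \<in> V" using uw simple_graph_edges_in[OF fg] by (auto simp: edges_in_def)
  have "((u, k), (u, \<not> k)) \<in> linked ?F"
  proof (rule has_odd_odd_reach[OF odd[OF uw]])
    fix v assume "\<exists>e\<in>?F. v \<in> e"
    then obtain e where "e \<in> F" "v \<in> e" by blast
    then have "v \<in> V" by (auto elim: simple_graph_edge[OF fg])
    then show "(u, v) \<in> (adj ?F)\<^sup>*" using J' uV by (simp add: joined_def)
  qed
  with l show "((w, k), (u, \<not> k)) \<in> linked ?F" by (rule linked_trans)
qed

section \<open>Edges that permit both colours as cuts of the double cover\<close>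

definition cutset :: "'a set set \<Rightarrow> ('a \<times> bool) \<Rightarrow> ('a \<times> bool) \<Rightarrow> ('a \<times> bool) set" where
  "cutset F y x = {z. (y, z) \<in> (arcs (free F) - {(x, y), (y, x)})\<^sup>*}"

lemma sym_arcs_free_Diff: "sym (arcs (free F) - {(x, y), (y, x)})"
  using arcs_free_sym by (auto simp: sym_def)

lemma linked_Diff_edge:
  assumes "(p, q) \<in> linked A" "A \<subseteq> F - {{u, w}}"
  shows "(p, q) \<in> (arcs (free F) - {((u, i), (w, j)), ((w, j), (u, i))})\<^sup>*"
proof -
  have "arcs (free A) \<subseteq> arcs (free F) - {((u, i), (w, j)), ((w, j), (u, i))}"
    using assms(2) by (auto simp: arcs_def insert_commute)
  then show ?thesis using assms(1) rtrancl_mono unfolding linked_def by blast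
qed

locale saturated_graph =
  fixes F :: "'a set set" and G :: "('a \<times> 'a \<times> bool) set"
  assumes sat: "saturated F G" and nocrit: "no_critical F" and finF: "finite F"
    and pairs: "\<And>e. e \<in> F \<Longrightarrow> \<exists>a b. e = {a, b} \<and> a \<noteq> b"
begin

lemma symG: "sym_perms G" and subG: "G \<subseteq> free F" and reachG: "(arcs G)\<^sup>* = linked F"
  using sat by (simp_all add: saturated_def)

lemma symGD: "(u, w, k) \<in> G \<Longrightarrow> (w, u, k) \<in> G"
  using symG unfolding sym_perms_def by blast

lemma minG: "(u, w, k) \<in> G \<Longrightarrow> (u, w, \<not> k) \<in> G \<Longrightarrow>
    ((u, \<not> k), (w, k)) \<notin> (arcs (G - {(u, w, k), (w, u, k)}))\<^sup>*"
  using sat unfolding saturated_def by blast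

lemma finite_G: "finite G"
proof -
  have "free F \<subseteq> \<Union>F \<times> \<Union>F \<times> UNIV" by (auto simp: free_def)
  moreover have "finite (\<Union>F)" using finF pairs by (metis finite_Union finite.emptyI finite.insertI)
  ultimately have "finite (free F)" by (meson finite_SigmaI finite_UNIV finite_subset)
  then show ?thesis using subG finite_subset by blast
qed

lemma wild_edge:
  assumes "(u, w, k) \<in> G"
  shows "{u, w} \<in> F" "u \<noteq> w"
proof -
  show "{u, w} \<in> F" using assms subG by auto
  from pairs[OF this] show "u \<noteq> w" by (auto simp: doubleton_eq_iff)
qed

text \<open>Wild edges are those on which both colours are still permitted. Reversing the roles of
  the two colours turns the single minimality condition into both of those needed.\<close>

lemma wild_lift_bridge:
  assumes "(u, w, k) \<in> G" "(u, w, \<not> k) \<in> G"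
  shows "((u, \<not> k), (w, k)) \<notin> (arcs (free F) - {((u, \<not> k), (w, k)), ((w, k), (u, \<not> k))})\<^sup>*"
proof (rule saturated_bridge[OF symG subG _ reachG assms])
  show "\<exists>k. (a, b, k) \<in> G" if "{a, b} \<in> F" for a b using sat that by (simp add: saturated_def)
  show "u \<noteq> w" using wild_edge[OF assms(1)] by simp
  show "((u, \<not> k), (w, k)) \<notin> (arcs (G - {(u, w, k), (w, u, k)}))\<^sup>*"
    by (rule minG[OF assms])
  show "((u, k), (w, \<not> k)) \<notin> (arcs (G - {(u, w, \<not> k), (w, u, \<not> k)}))\<^sup>*"
    using minG[of u w "\<not> k"] assms by simp
  show "((w, k), (u, \<not> k)) \<in> linked (F - {{u, w}})" if "((w, k), (u, k)) \<in> linked (F - {{u, w}})"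
    using nocrit wild_edge(1)[OF assms(1)] that unfolding no_critical_def by blast
qed

text \<open>A path from \<open>u\<close> to \<open>w\<close> avoiding the edge lifts to a walk from
  \<open>(u, \<not> k)\<close>. If it ends in \<open>(w, k)\<close>, it bypasses the lift directly;
  if it ends in \<open>(w, \<not> k)\<close>, the other lift of the edge followed by the flipped
  path completes a bypass.\<close>

lemma wild_bridge:
  assumes "(u, w, k) \<in> G" "(u, w, \<not> k) \<in> G"
  shows "(u, w) \<notin> (adj (F - {{u, w}}))\<^sup>*"
proof
  let ?L = "(arcs (free F) - {((u, \<not> k), (w, k)), ((w, k), (u, \<not> k))})"
  assume "(u, w) \<in> (adj (F - {{u, w}}))\<^sup>*"
  from adj_imp_linked[OF this] obtain j where j: "((u, \<not> k), (w, j)) \<in> linked (F - {{u, w}})" by blast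
  have 1: "((u, \<not> k), (w, j)) \<in> ?L\<^sup>*" by (rule linked_Diff_edge[OF j]) simp
  show False
  proof (cases "j = k")
    case True
    then show False using 1 wild_lift_bridge[OF assms] by simp
  next
    case False
    have j': "(\<not> j) = k" using False by auto
    have "((u, k), (w, \<not> j)) \<in> ?L\<^sup>*"
      using linked_Diff_edge[OF linked_flip[OF j]] by simp
    then have 2: "((u, k), (w, k)) \<in> ?L\<^sup>*" unfolding j' .
    have "((w, \<not> k), (u, k)) \<in> ?L"
      using wild_edge[OF assms(1)] by (auto simp: arcs_iff insert_commute)
    then have 3: "((w, \<not> k), (u, k)) \<in> ?L\<^sup>*" by blast
    have "j = (\<not> k)" using False by auto
    then have "((u, \<not> k), (w, k)) \<in> ?L\<^sup>*"
      using rtrancl_trans[OF 1[unfolded \<open>j = (\<not> k)\<close>] rtrancl_trans[OF 3 2]] by simp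
    then show False using wild_lift_bridge[OF assms] by simp
  qed
qed

lemma cutset_is_cut:
  assumes "(u, w, k) \<in> G" "(u, w, \<not> k) \<in> G"
  shows "is_cut (arcs G) (u, \<not> k) (w, k) (cutset F (u, \<not> k) (w, k))"
proof -
  let ?y = "(u, \<not> k)" and ?x = "(w, k)"
  let ?B = "cutset F ?y ?x" and ?L = "arcs (free F) - {(?x, ?y), (?y, ?x)}"
  have y: "?y \<in> ?B" by (simp add: cutset_def)
  have "?L = arcs (free F) - {(?y, ?x), (?x, ?y)}" by auto
  then have x: "?x \<notin> ?B" using wild_lift_bridge[OF assms] by (simp add: cutset_def)
  have sub: "arcs G \<subseteq> arcs (free F)" by (rule arcs_mono[OF subG])
  have step: "(a \<in> ?B) = (b \<in> ?B)" if "(a, b) \<in> ?L" for a b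
  proof -
    have ba: "(b, a) \<in> ?L" using that sym_arcs_free_Diff[of F ?x ?y] by (meson symD)
    show ?thesis unfolding cutset_def
      using rtrancl_into_rtrancl[OF _ that] rtrancl_into_rtrancl[OF _ ba] by blast
  qed
  have cr: "a = ?y \<and> b = ?x \<or> a = ?x \<and> b = ?y" if "(a, b) \<in> arcs G" "(a \<in> ?B) \<noteq> (b \<in> ?B)" for a b
    using step[of a b] that sub by auto
  show ?thesis unfolding is_cut_def using x y cr by blast
qed

text \<open>Arcs are dropped at wild edges only, and these lift to bridges of the double cover, so a
  connection survives unless it has to leave the cut set of a dropped arc.\<close>

lemma reach_kept:
  assumes "G' \<subseteq> G" and wild: "\<And>u w k. (u, w, k) \<in> G - G' \<Longrightarrow> (u, w, \<not> k) \<in> G"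
    and pq: "(p, q) \<in> linked F"
    and side: "\<And>u w k. (u, w, k) \<in> G - G' \<Longrightarrow> p \<in> cutset F (u, \<not> k) (w, k) \<Longrightarrow> q \<in> cutset F (u, \<not> k) (w, k)"
  shows "(p, q) \<in> (arcs G')\<^sup>*"
proof -
  have sub: "arcs G' \<subseteq> arcs G" by (rule arcs_mono) fact
  have "arcs G \<subseteq> (\<lambda>(u, w, k). ((u, \<not> k), (w, k))) ` G" by (force simp: arcs_def)
  then have fin: "finite (arcs G - arcs G')" using finite_G by (meson finite_Diff finite_imageI finite_subset)
  have "(p, q) \<in> (arcs G - (arcs G - arcs G'))\<^sup>*"
  proof (rule rtrancl_delete_cut_arcs[OF fin])
    show "(p, q) \<in> (arcs G)\<^sup>*" using pq by (simp add: reachG)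
    fix y x assume "(y, x) \<in> arcs G - arcs G'"
    then obtain u w k where uw: "y = (u, \<not> k)" "x = (w, k)" "(u, w, k) \<in> G - G'" by (auto simp: arcs_def)
    have "is_cut (arcs G) y x (cutset F y x)" unfolding uw(1,2)
      by (rule cutset_is_cut) (use uw(3) wild in auto)
    moreover have "\<not> (p \<in> cutset F y x \<and> q \<notin> cutset F y x)" using side[OF uw(3)] uw by blast
    ultimately show "\<exists>B. is_cut (arcs G) y x B \<and> \<not> (p \<in> B \<and> q \<notin> B)" by blast
  qed
  moreover have "arcs G - (arcs G - arcs G') = arcs G'" using sub by auto
  ultimately show ?thesis by simp
qed

lemma linked_same_cutset:
  assumes "(p, q) \<in> linked A" "A \<subseteq> F - {{u, w}}" "p \<in> cutset F (u, i) (w, j)"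
  shows "q \<in> cutset F (u, i) (w, j)"
proof -
  have "(p, q) \<in> (arcs (free F) - {((u, i), (w, j)), ((w, j), (u, i))})\<^sup>*"
    by (rule linked_Diff_edge[OF assms(1,2)])
  moreover have "{((u, i), (w, j)), ((w, j), (u, i))} = {((w, j), (u, i)), ((u, i), (w, j))}" by auto
  ultimately show ?thesis using assms(3) unfolding cutset_def
    by (metis (no_types, lifting) mem_Collect_eq rtrancl_trans)
qed

end

section \<open>Orienting wild edges away from the roots\<close>

text \<open>Breadth-first distance by local conditions, so that both an abstract minimum and the
  computed distance fit.\<close>

definition bfs_dist :: "'a set \<Rightarrow> 'a set set \<Rightarrow> 'a set \<Rightarrow> ('a \<Rightarrow> nat) \<Rightarrow> bool" where
  "bfs_dist V F R d \<longleftrightarrow> (\<forall>v\<in>R. d v = 0) \<and> (\<forall>v\<in>V - R. \<exists>u\<in>V. {u, v} \<in> F \<and> d v = Suc (d u)) \<and>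
     (\<forall>u w. {u, w} \<in> F \<longrightarrow> d w \<le> Suc (d u))"

lemma bfs_dist_exists:
  assumes "edges_in V F" "R \<subseteq> V" "\<And>v. v \<in> V \<Longrightarrow> \<exists>r\<in>R. (r, v) \<in> (adj F)\<^sup>*"
  shows "\<exists>d. bfs_dist V F R d"
proof -
  define P where "P v n \<longleftrightarrow> (\<exists>r\<in>R. (r, v) \<in> adj F ^^ n)" for v n
  define d where "d v = (LEAST n. P v n)" for v
  have ex: "\<exists>n. P v n" if "v \<in> V" for v
    using assms(3)[OF that] rtrancl_imp_relpow unfolding P_def by metis
  have Pd: "P v (d v)" if "v \<in> V" for v
    unfolding d_def using ex[OF that] by (rule LeastI_ex)
  have le: "d v \<le> n" if "P v n" for v n unfolding d_def by (rule Least_le) fact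
  have 1: "d v = 0" if "v \<in> R" for v
    using le[of v 0] that by (auto simp: P_def)
  have 3: "d w \<le> Suc (d u)" if "{u, w} \<in> F" for u w
  proof (rule le)
    have "u \<in> V" using assms(1) that by (auto simp: edges_in_def)
    from Pd[OF this] obtain r where "r \<in> R" "(r, u) \<in> adj F ^^ d u" by (auto simp: P_def)
    moreover have "(u, w) \<in> adj F" using that by (simp add: adj_def)
    ultimately show "P w (Suc (d u))" unfolding P_def by (auto intro: relcompI)
  qed
  have 2: "\<exists>u\<in>V. {u, v} \<in> F \<and> d v = Suc (d u)" if v: "v \<in> V - R" for v
  proof -
    obtain r where r: "r \<in> R" "(r, v) \<in> adj F ^^ d v" using Pd[of v] v by (auto simp: P_def)
    then obtain n where n: "d v = Suc n" using v by (cases "d v") auto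
    then obtain u where u: "(r, u) \<in> adj F ^^ n" "(u, v) \<in> adj F" using r by auto
    have "d u \<le> n" by (rule le) (use u r in \<open>auto simp: P_def\<close>)
    moreover have "{u, v} \<in> F" using u(2) by (simp add: adj_def)
    moreover have "u \<in> V" using \<open>{u, v} \<in> F\<close> assms(1) by (auto simp: edges_in_def)
    ultimately show ?thesis using 3[of u v] n by (intro bexI[of _ u]) auto
  qed
  show ?thesis unfolding bfs_dist_def using 1 2 3 by (intro exI[of _ d]) blast
qed

text \<open>The colour bit of the state in which the vertex \<open>v\<close> is reached from the roots; \<open>b\<close> is constant
  on components and swaps the two lifts of a component.\<close>

definition level_bit :: "('a \<Rightarrow> nat) \<Rightarrow> ('a \<Rightarrow> bool) \<Rightarrow> 'a \<Rightarrow> bool" where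
  "level_bit d b v \<longleftrightarrow> (odd (d v) \<noteq> b v)"

text \<open>Of the two colours of a wild edge the one is kept whose arc from the nearer to the
  farther end runs in the sheet given by \<open>level_bit\<close>.\<close>

definition oriented :: "('a \<times> 'a \<times> bool) set \<Rightarrow> ('a \<Rightarrow> nat) \<Rightarrow> ('a \<Rightarrow> bool) \<Rightarrow> ('a \<times> 'a \<times> bool) set" where
  "oriented G d b = {(u, w, k) \<in> G. (u, w, \<not> k) \<in> G \<longrightarrow>
     d w = Suc (d u) \<and> k = level_bit d b w \<or> d u = Suc (d w) \<and> k = level_bit d b u}"

lemma sym_perms_oriented: "sym_perms G \<Longrightarrow> sym_perms (oriented G d b)"
  unfolding sym_perms_def oriented_def by blast

locale rooted_graph = saturated_graph F G for F :: "'a set set" and G +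
  fixes V :: "'a set" and R :: "'a set" and d :: "'a \<Rightarrow> nat" and b :: "'a \<Rightarrow> bool"
  assumes bfs: "bfs_dist V F R d" and RV: "R \<subseteq> V" and FV: "edges_in V F"
    and b_const: "\<And>u w. {u, w} \<in> F \<Longrightarrow> b u = b w"
begin

abbreviation \<kappa> :: "'a \<Rightarrow> bool" where "\<kappa> \<equiv> level_bit d b"

abbreviation G' where "G' \<equiv> oriented G d b"

lemma G'_sub: "G' \<subseteq> G" by (auto simp: oriented_def)

lemma G'_wild: "(u, w, k) \<in> G - G' \<Longrightarrow> (u, w, \<not> k) \<in> G" by (auto simp: oriented_def)

lemma symG': "sym_perms G'" by (rule sym_perms_oriented[OF symG])

text \<open>The edge differs from every wild one, so its ends lie on the same side of each cut that
  belongs to a dropped arc.\<close>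

lemma reach_nonwild:
  assumes e: "{u, v} \<in> F" and nw: "\<And>k. (u, v, k) \<in> G \<Longrightarrow> (u, v, \<not> k) \<notin> G"
  shows "((u, i), (v, \<not> i)) \<in> (arcs G')\<^sup>*"
proof (rule reach_kept[OF G'_sub G'_wild linked_edge[OF e]])
  fix a c k assume ac: "(a, c, k) \<in> G - G'" "(u, i) \<in> cutset F (a, \<not> k) (c, k)"
  have "{u, v} \<noteq> {a, c}"
  proof
    assume "{u, v} = {a, c}"
    then consider "u = a" "v = c" | "u = c" "v = a" by (auto simp: doubleton_eq_iff)
    then show False
    proof cases
      case 1
      then show ?thesis using ac(1) G'_wild[OF ac(1)] nw[of k] by auto
    next
      case 2
      have "(c, a, k) \<in> G" "(c, a, \<not> k) \<in> G"
        using ac(1) G'_wild[OF ac(1)] symGD[of a c k] symGD[of a c "\<not> k"] by blast+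
      then show ?thesis using 2 nw[of k] by auto
    qed
  qed
  then have "((u, i), (v, \<not> i)) \<in> linked {{u, v}}" "{{u, v}} \<subseteq> F - {{a, c}}"
    using e by (auto intro: linked_edge)
  then show "(v, \<not> i) \<in> cutset F (a, \<not> k) (c, k)" using ac(2) by (rule linked_same_cutset)
qed

lemma parent:
  assumes "v \<in> V" "v \<notin> R"
  obtains u where "u \<in> V" "{u, v} \<in> F" "d v = Suc (d u)" "\<kappa> v = (\<not> \<kappa> u)"
proof -
  obtain u where u: "u \<in> V" "{u, v} \<in> F" "d v = Suc (d u)" using bfs assms unfolding bfs_dist_def by blast
  then show thesis using that b_const[OF u(2)] by (auto simp: level_bit_def)
qed

text \<open>Descend from the root along parents: wild edges are oriented this way, and the other
  edges can still be traversed in both directions.\<close>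

lemma reach_from_root:
  assumes "v \<in> V"
  shows "\<exists>r\<in>R. (r, v) \<in> (adj F)\<^sup>* \<and> ((r, \<kappa> r), (v, \<kappa> v)) \<in> (arcs G')\<^sup>*"
  using assms
proof (induction "d v" arbitrary: v rule: less_induct)
  case less
  show ?case
  proof (cases "v \<in> R")
    case True
    then show ?thesis by blast
  next
    case False
    obtain u where u: "u \<in> V" "{u, v} \<in> F" "d v = Suc (d u)" "\<kappa> v = (\<not> \<kappa> u)" by (rule parent[OF less.prems False])
    obtain r where r: "r \<in> R" "(r, u) \<in> (adj F)\<^sup>*" "((r, \<kappa> r), (u, \<kappa> u)) \<in> (arcs G')\<^sup>*"
      using less.hyps[of u] u by auto
    have "(r, v) \<in> (adj F)\<^sup>*" using r(2) u(2) by (auto simp: adj_def intro: rtrancl_into_rtrancl)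
    moreover have "((u, \<kappa> u), (v, \<kappa> v)) \<in> (arcs G')\<^sup>*"
    proof (cases "\<exists>k. (u, v, k) \<in> G \<and> (u, v, \<not> k) \<in> G")
      case True
      then obtain k where "(u, v, k) \<in> G" "(u, v, \<not> k) \<in> G" by blast
      then have "(u, v, \<kappa> v) \<in> G" by (cases k; cases "\<kappa> v") auto
      then have "(u, v, \<kappa> v) \<in> G'" using u(3) by (simp add: oriented_def)
      then have "((u, \<kappa> u), (v, \<kappa> v)) \<in> arcs G'" using u(4) by (simp add: arcs_iff)
      then show ?thesis by blast
    next
      case False
      then have "((u, \<kappa> u), (v, \<not> \<kappa> u)) \<in> (arcs G')\<^sup>*" by (intro reach_nonwild[OF u(2)]) blast
      then show ?thesis using u(4) by simp
    qed
    ultimately show ?thesis using r(1) rtrancl_trans[OF r(3)] by blast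
  qed
qed

end

section \<open>Far sides of bridges in a bipartite component\<close>

definition far :: "'a set set \<Rightarrow> 'a \<Rightarrow> 'a \<Rightarrow> 'a \<Rightarrow> 'a set" where
  "far F s u w = {v. (s, v) \<notin> (adj (F - {{u, w}}))\<^sup>*}"

text \<open>The way from \<open>p\<close> to \<open>q\<close> crosses no bridge that still permits both colours towards the
  root \<open>s\<close>.\<close>

definition outward :: "'a set set \<Rightarrow> ('a \<times> 'a \<times> bool) set \<Rightarrow> 'a set \<Rightarrow> 'a \<Rightarrow> 'a \<Rightarrow> 'a \<Rightarrow> bool" where
  "outward F G P s p q \<longleftrightarrow> (\<forall>u w k. (u, w, k) \<in> G \<longrightarrow> (u, w, \<not> k) \<in> G \<longrightarrow> u \<in> P \<longrightarrow>
     p \<in> far F s u w \<longrightarrow> q \<in> far F s u w)"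

locale bipartite_piece = rooted_graph F G V R d b
  for F :: "'a set set" and G and V :: "'a set" and R d b +
  fixes P :: "'a set" and s :: 'a
  assumes sR: "s \<in> R" and P: "P = {v \<in> V. (s, v) \<in> (adj F)\<^sup>*}" and RP: "R \<inter> P = {s}"
    and nodd: "\<not> has_odd F"
begin

lemma PV: "v \<in> P \<Longrightarrow> v \<in> V" by (simp add: P)

lemma sP: "s \<in> P" using RP by blast

lemma P_closed: "v \<in> P \<Longrightarrow> (v, w) \<in> (adj F)\<^sup>* \<Longrightarrow> w \<in> P"
  using adj_rtrancl_in[OF FV] unfolding P by (auto intro: rtrancl_trans)

lemma P_edge: "u \<in> P \<Longrightarrow> {u, w} \<in> F \<Longrightarrow> w \<in> P"
  by (rule P_closed[of u w]) (auto simp: adj_def)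

lemma lift_from_root: "v \<in> P \<Longrightarrow> ((s, \<kappa> s), (v, \<kappa> v)) \<in> linked F"
proof -
  assume v: "v \<in> P"
  obtain r where r: "r \<in> R" "(r, v) \<in> (adj F)\<^sup>*" "((r, \<kappa> r), (v, \<kappa> v)) \<in> (arcs G')\<^sup>*"
    using reach_from_root[OF PV[OF v]] by blast
  have "r = s" using P_closed[OF v adj_rtrancl_sym[OF r(2)]] r(1) RP by blast
  then show ?thesis using arcs_imp_linked[OF _ r(3), of F] G'_sub subG by auto
qed

lemma lift_unique: "u \<in> P \<Longrightarrow> v \<in> P \<Longrightarrow> ((u, \<kappa> u), (v, j)) \<in> linked F \<Longrightarrow> j = \<kappa> v"
  using linked_unique[OF nodd linked_trans[OF lift_from_root] lift_from_root] by blast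

lemma lift_path:
  assumes "u \<in> P" "(u, v) \<in> (adj A)\<^sup>*" "A \<subseteq> F"
  shows "((u, \<kappa> u), (v, \<kappa> v)) \<in> linked A"
proof -
  obtain j where j: "((u, \<kappa> u), (v, j)) \<in> linked A" using adj_imp_linked[OF assms(2)] by blast
  have "v \<in> P" by (rule P_closed[OF assms(1) adj_mono[OF assms(3,2)]])
  then have "j = \<kappa> v" using lift_unique[OF assms(1)] linked_mono[OF assms(3) j] by blast
  then show ?thesis using j by simp
qed

lemma P_edge_level:
  assumes "u \<in> P" "{u, w} \<in> F"
  shows "\<kappa> w = (\<not> \<kappa> u)" "d w = Suc (d u) \<or> d u = Suc (d w)"
proof -
  have "(\<not> \<kappa> u) = \<kappa> w" by (rule lift_unique[OF assms(1) P_edge[OF assms] linked_edge[OF assms(2)]])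
  then show 1: "\<kappa> w = (\<not> \<kappa> u)" by simp
  have "{w, u} \<in> F" using assms(2) by (simp add: insert_commute)
  then have "d w \<le> Suc (d u)" "d u \<le> Suc (d w)" using bfs assms(2) unfolding bfs_dist_def by blast+
  moreover have "d w \<noteq> d u" using 1 b_const[OF assms(2)] by (auto simp: level_bit_def)
  ultimately show "d w = Suc (d u) \<or> d u = Suc (d w)" by linarith
qed

text \<open>A shortest path from \<open>s\<close> to \<open>v\<close> visits only vertices nearer
  than \<open>u\<close>, so it avoids all edges at \<open>u\<close>.\<close>

lemma near_side:
  assumes "v \<in> P" "d v < d u"
  shows "(s, v) \<in> (adj (F - {{u, w}}))\<^sup>*"
  using assms
proof (induction "d v" arbitrary: v rule: less_induct)
  case less
  show ?case
  proof (cases "v \<in> R")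
    case True
    then have "v = s" using RP less.prems by blast
    then show ?thesis by simp
  next
    case False
    obtain u' where u': "u' \<in> V" "{u', v} \<in> F" "d v = Suc (d u')" by (rule parent[OF PV[OF less.prems(1)] False])
    have "u' \<in> P" using P_edge[OF less.prems(1)] u'(2) by (simp add: insert_commute)
    then have "(s, u') \<in> (adj (F - {{u, w}}))\<^sup>*" using less u'(3) by simp
    moreover have "{u', v} \<noteq> {u, w}" using less.prems(2) u'(3) by (auto simp: doubleton_eq_iff)
    then have "(u', v) \<in> adj (F - {{u, w}})" using u'(2) by (simp add: adj_def)
    ultimately show ?thesis by (rule rtrancl_into_rtrancl)
  qed
qed

text \<open>Without odd closed walks the component is isomorphic to its lift by
  \<open>\<kappa>\<close>, which carries a bridge and its two sides into the double cover.\<close>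

lemma cutset_iff_far:
  assumes w: "(u, w, k) \<in> G" "(u, w, \<not> k) \<in> G" and u: "u \<in> P" "d u = Suc (d w)" and v: "v \<in> P"
  shows "(v, \<kappa> v) \<in> cutset F (u, \<kappa> u) (w, \<kappa> w) \<longleftrightarrow> v \<in> far F s u w"
proof -
  have uw: "{u, w} \<in> F" by (rule wild_edge[OF w(1)])
  have wP: "w \<in> P" by (rule P_edge[OF u(1) uw])
  have \<kappa>w: "\<kappa> w = (\<not> \<kappa> u)" by (rule P_edge_level[OF u(1) uw])
  let ?A = "F - {{u, w}}" and ?y = "(u, \<kappa> u)" and ?x = "(w, \<kappa> w)"
  let ?L = "arcs (free F) - {(?x, ?y), (?y, ?x)}"
  have LA: "(p, q) \<in> ?L\<^sup>*" if "(p, q) \<in> linked ?A" for p q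
  proof -
    have "(p, q) \<in> (arcs (free F) - {(?y, ?x), (?x, ?y)})\<^sup>*" by (rule linked_Diff_edge[OF that]) simp
    then show ?thesis by (simp add: insert_commute)
  qed
  have "(u, w, \<kappa> w) \<in> G" "(u, w, \<not> \<kappa> w) \<in> G" using w by (cases k; cases "\<kappa> w"; simp)+
  from wild_lift_bridge[OF this] have br: "(?y, ?x) \<notin> ?L\<^sup>*"
    using \<kappa>w by (simp add: insert_commute)
  have sx: "(s, w) \<in> (adj ?A)\<^sup>*" by (rule near_side[OF wP]) (use u(2) in simp)
  show ?thesis
  proof
    assume c: "(v, \<kappa> v) \<in> cutset F ?y ?x"
    show "v \<in> far F s u w"
    proof (rule ccontr)
      assume "v \<notin> far F s u w"
      then have "(s, v) \<in> (adj ?A)\<^sup>*" by (simp add: far_def)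
      then have "(v, w) \<in> (adj ?A)\<^sup>*" using adj_rtrancl_sym sx by (meson rtrancl_trans)
      then have "((v, \<kappa> v), ?x) \<in> linked ?A" by (rule lift_path[OF v]) blast
      then have vx: "((v, \<kappa> v), ?x) \<in> ?L\<^sup>*" by (rule LA)
      have yv: "(?y, (v, \<kappa> v)) \<in> ?L\<^sup>*" using c by (simp add: cutset_def)
      show False using br rtrancl_trans[OF yv vx] by contradiction
    qed
  next
    assume f: "v \<in> far F s u w"
    have "(v, s) \<in> (adj F)\<^sup>*" using v adj_rtrancl_sym by (auto simp: P)
    moreover have "\<not> (v, s) \<in> (adj ?A)\<^sup>*" using f adj_rtrancl_sym[of v s ?A] by (auto simp: far_def)
    ultimately obtain a c where ac: "(v, a) \<in> (adj ?A)\<^sup>*" "(v, c) \<notin> (adj ?A)\<^sup>*" "(a, c) \<in> adj F"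
      using rtrancl_exit[of v s "adj F" "{z. (v, z) \<in> (adj ?A)\<^sup>*}"] by auto
    have "(a, c) \<notin> adj ?A" using ac(1,2) rtrancl_into_rtrancl by metis
    then have "{a, c} = {u, w}" using ac(3) by (simp add: adj_def)
    moreover have "a \<noteq> w"
    proof
      assume "a = w"
      then have "(v, w) \<in> (adj ?A)\<^sup>*" using ac(1) by simp
      from adj_rtrancl_sym[OF this] have "(s, v) \<in> (adj ?A)\<^sup>*" using sx rtrancl_trans by metis
      then show False using f by (simp add: far_def)
    qed
    ultimately have "a = u" by (auto simp: doubleton_eq_iff)
    then have "(u, v) \<in> (adj ?A)\<^sup>*" using ac(1) adj_rtrancl_sym by metis
    then have "(?y, (v, \<kappa> v)) \<in> linked ?A" by (rule lift_path[OF u(1)]) blast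
    then have "(?y, (v, \<kappa> v)) \<in> ?L\<^sup>*" by (rule LA)
    then show "(v, \<kappa> v) \<in> cutset F ?y ?x" by (simp add: cutset_def)
  qed
qed

text \<open>In the lift by \<open>\<kappa>\<close>, the dropped arcs are those towards the root; by
  \<open>cutset_iff_far\<close>, leaving their cut sets means leaving a far side.\<close>

lemma reach_outward:
  assumes p: "p \<in> P" and q: "q \<in> P" and out: "outward F G P s p q"
  shows "((p, \<kappa> p), (q, \<kappa> q)) \<in> (arcs G')\<^sup>*"
proof (rule reach_kept[OF G'_sub G'_wild])
  show "((p, \<kappa> p), (q, \<kappa> q)) \<in> linked F"
    by (rule linked_trans[OF linked_sym[OF lift_from_root[OF p]] lift_from_root[OF q]])
  fix u w k assume uw: "(u, w, k) \<in> G - G'" and c: "(p, \<kappa> p) \<in> cutset F (u, \<not> k) (w, k)"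
  have uw': "(u, w, k) \<in> G" "(u, w, \<not> k) \<in> G" using uw G'_wild[OF uw] by auto
  have "((u, \<not> k), (p, \<kappa> p)) \<in> linked F"
    using c rtrancl_mono[of "arcs (free F) - {((w, k), (u, \<not> k)), ((u, \<not> k), (w, k))}" "arcs (free F)"]
    unfolding cutset_def linked_def by blast
  then have up: "((p, \<kappa> p), (u, \<not> k)) \<in> linked F" by (rule linked_sym)
  have "u \<in> P" using P_closed[OF p] linked_imp_adj[OF up] by simp
  then have ku: "(\<not> k) = \<kappa> u" using lift_unique[OF p _ up] by simp
  have kw: "k = \<kappa> w" using P_edge_level(1)[OF \<open>u \<in> P\<close> wild_edge(1)[OF uw'(1)]] ku by auto
  have "\<not> d w = Suc (d u)" using uw kw by (auto simp: oriented_def)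
  then have du: "d u = Suc (d w)" using P_edge_level(2)[OF \<open>u \<in> P\<close> wild_edge(1)[OF uw'(1)]] by blast
  have "p \<in> far F s u w" using c cutset_iff_far[OF uw' \<open>u \<in> P\<close> du p] ku kw by simp
  then have "q \<in> far F s u w" using out uw' \<open>u \<in> P\<close> unfolding outward_def by blast
  then have "(q, \<kappa> q) \<in> cutset F (u, \<kappa> u) (w, \<kappa> w)" using cutset_iff_far[OF uw' \<open>u \<in> P\<close> du q] by simp
  then show "(q, \<kappa> q) \<in> cutset F (u, \<not> k) (w, k)" using ku kw by simp
qed

text \<open>Since the edge \<open>st\<close> replaces every bridge of the piece, each wild edge
  separates \<open>s\<close> from \<open>t\<close>. The far sides thus contain \<open>t\<close> but
  not \<open>s\<close> and are nested, so two vertices cannot be separated in both senses.\<close>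

lemma outward_total:
  assumes t: "t \<in> P" and p: "p \<in> P" and q: "q \<in> P"
    and almost: "\<And>e v. e \<in> F \<Longrightarrow> e \<subseteq> P \<Longrightarrow> v \<in> P \<Longrightarrow> (s, v) \<in> (adj (insert {s, t} (F - {e})))\<^sup>*"
  shows "outward F G P s p q \<or> outward F G P s q p"
proof (rule ccontr)
  assume "\<not> ?thesis"
  then obtain u w k u' w' k' where
    e: "(u, w, k) \<in> G" "(u, w, \<not> k) \<in> G" "u \<in> P" "p \<in> far F s u w" "q \<notin> far F s u w" and
    e': "(u', w', k') \<in> G" "(u', w', \<not> k') \<in> G" "u' \<in> P" "q \<in> far F s u' w'" "p \<notin> far F s u' w'"
    unfolding outward_def by blast
  let ?U = "far F s u w" and ?U' = "far F s u' w'"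
  have farI: "t \<in> far F s u w" if e: "(u, w, k) \<in> G" "(u, w, \<not> k) \<in> G" "u \<in> P" for u w k
  proof (rule ccontr)
    let ?A = "F - {{u, w}}"
    assume "t \<notin> far F s u w"
    then have st: "(s, t) \<in> (adj ?A)\<^sup>*" by (simp add: far_def)
    have sub: "(x, y) \<in> (adj ?A)\<^sup>*" if "(x, y) \<in> adj (insert {s, t} ?A)" for x y
      using that st adj_rtrancl_sym[OF st] by (auto simp: adj_def doubleton_eq_iff)
    then have "(adj (insert {s, t} ?A))\<^sup>* \<subseteq> (adj ?A)\<^sup>*" by (intro rtrancl_subset_rtrancl) auto
    moreover have "{u, w} \<in> F" by (rule wild_edge[OF e(1)])
    moreover have "w \<in> P" by (rule P_edge[OF e(3) \<open>{u, w} \<in> F\<close>])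
    ultimately have "(s, u) \<in> (adj ?A)\<^sup>*" "(s, w) \<in> (adj ?A)\<^sup>*"
      using almost[of "{u, w}" u] almost[of "{u, w}" w] e(3) by blast+
    then have "(u, w) \<in> (adj ?A)\<^sup>*" using adj_rtrancl_sym by (metis rtrancl_trans)
    then show False using wild_bridge[OF e(1,2)] by simp
  qed
  have tU: "t \<in> ?U" "t \<in> ?U'" using farI e(1-3) e'(1-3) by blast+
  have sU: "s \<notin> ?U" "s \<notin> ?U'" by (auto simp: far_def)
  have cross: "{x, y} = {u, w}" if "{x, y} \<in> F" "(x \<in> far F s u w) \<noteq> (y \<in> far F s u w)" for x y u w
  proof (rule ccontr)
    assume "{x, y} \<noteq> {u, w}"
    then have "(x, y) \<in> adj (F - {{u, w}})" "(y, x) \<in> adj (F - {{u, w}})"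
      using that(1) by (auto simp: adj_def insert_commute)
    then show False using that(2) unfolding far_def by (blast intro: rtrancl_into_rtrancl)
  qed
  have uwF: "{u, w} \<in> F" "{u', w'} \<in> F" using wild_edge(1) e(1) e'(1) by blast+
  have ne: "{u, w} \<noteq> {u', w'}"
  proof
    assume "{u, w} = {u', w'}"
    then have "?U = ?U'" by (simp add: far_def)
    then show False using e(4) e'(5) by simp
  qed
  have \<alpha>: "(u \<in> ?U') = (w \<in> ?U')" "(u' \<in> ?U) = (w' \<in> ?U)"
    using cross[OF uwF(1), of u' w'] cross[OF uwF(2), of u w] ne by auto
  \<comment> \<open>\<open>?U\<close> and \<open>?U'\<close> divide the vertices into four
    quadrants, and \<open>Q\<close> is one that contains no end of either bridge, so no edge leaves
    it. As \<open>p\<close>, \<open>q\<close>, \<open>s\<close> and \<open>t\<close> occupy all four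
    quadrants, \<open>Q\<close> meets the component and would contain it entirely.\<close>
  define Q where "Q = {v. (v \<in> ?U) \<noteq> (u' \<in> ?U) \<and> (v \<in> ?U') \<noteq> (u \<in> ?U')}"
  have closed: "y \<in> Q" if "x \<in> Q" "{x, y} \<in> F" for x y
  proof -
    have "{x, y} \<noteq> {u, w}" "{x, y} \<noteq> {u', w'}" using that(1) \<alpha> by (auto simp: Q_def doubleton_eq_iff)
    then show ?thesis using cross[OF that(2), of u w] cross[OF that(2), of u' w'] that(1) by (auto simp: Q_def)
  qed
  have closed': "y \<in> Q" if "(x, y) \<in> (adj F)\<^sup>*" "x \<in> Q" for x y
    using that by (induction rule: rtrancl_induct) (auto simp: adj_def intro: closed)
  have conn: "(x, y) \<in> (adj F)\<^sup>*" if "x \<in> P" "y \<in> P" for x y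
    using that adj_rtrancl_sym[of s x F] by (auto simp: P intro: rtrancl_trans)
  have "Q \<inter> {p, q, s, t} \<noteq> {}" using e(4,5) e'(4,5) sU tU by (auto simp: Q_def)
  then obtain x where "x \<in> Q" "x \<in> P" using p q sP t by blast
  then have "s \<in> Q" "t \<in> Q" using closed' conn sP t by blast+
  then show False using sU tU by (auto simp: Q_def)
qed

lemma reach_total:
  assumes "t \<in> P" "p \<in> P" "q \<in> P"
    and "\<And>e v. e \<in> F \<Longrightarrow> e \<subseteq> P \<Longrightarrow> v \<in> P \<Longrightarrow> (s, v) \<in> (adj (insert {s, t} (F - {e})))\<^sup>*"
  shows "((p, \<kappa> p), (q, \<kappa> q)) \<in> (arcs G')\<^sup>* \<or> ((q, \<kappa> q), (p, \<kappa> p)) \<in> (arcs G')\<^sup>*"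
  using outward_total[OF assms] reach_outward assms(2,3) by blast

end

section \<open>The core and the edges coloured by hand\<close>

text \<open>The stubborn edges of a non-bipartite graph. For a bipartite graph the set is empty, so
  that the whole connected graph can then be treated as the core.\<close>

definition critical :: "'a set set \<Rightarrow> 'a set set" where
  "critical E = {e \<in> E. has_odd E \<and> \<not> has_odd (E - {e})}"

definition core :: "'a set \<Rightarrow> 'a set set \<Rightarrow> 'a \<Rightarrow> 'a set" where
  "core V E r = {v \<in> V. (r, v) \<in> (adj (E - critical E))\<^sup>*}"

text \<open>What remains to be saturated: the edges between the core and the rest and the critical
  edges inside the core are coloured by hand.\<close>

definition kept :: "'a set \<Rightarrow> 'a set set \<Rightarrow> 'a \<Rightarrow> 'a set set" where
  "kept V E r = {e \<in> E - critical E. e \<subseteq> core V E r} \<union> {e \<in> E. e \<inter> core V E r = {}}"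

text \<open>A boundary edge gets the \<open>level_bit\<close> of its end in the core. This directs
  all boundary edges into the lift of the core by \<open>level_bit\<close> and out of the flipped
  lift. The bit \<open>i\<close> exchanges the two lifts of the rest, and an edge inside the core
  that is not in \<open>kept\<close> gets \<open>False\<close>.\<close>

definition matches ::
    "'a set \<Rightarrow> 'a set set \<Rightarrow> 'a \<Rightarrow> ('a \<times> 'a \<times> bool) set \<Rightarrow> ('a \<Rightarrow> nat) \<Rightarrow> bool \<Rightarrow> ('a set \<Rightarrow> bool) \<Rightarrow> bool" where
  "matches V E r G d i g \<longleftrightarrow>
     (\<forall>u w k. (u, w, k) \<in> oriented G d (\<lambda>v. i \<and> v \<notin> core V E r) \<longrightarrow> g {u, w} = k) \<and>
     (\<forall>u w. {u, w} \<in> E \<longrightarrow> {u, w} \<notin> kept V E r \<longrightarrow> u \<in> core V E r \<longrightarrow>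
        g {u, w} = (w \<notin> core V E r \<and> level_bit d (\<lambda>v. i \<and> v \<notin> core V E r) u))"

lemma reach_flip:
  assumes "sym_perms C" "((u, i), (v, j)) \<in> (arcs C)\<^sup>*"
  shows "((v, \<not> j), (u, \<not> i)) \<in> (arcs C)\<^sup>*"
  using rtrancl_arcs_flip[OF assms] by simp

lemma alternating_bipartite:
  assumes fg: "finite_simple_graph V E" and J: "joined V E" and nodd: "\<not> has_odd E"
    and s: "s \<in> V" and t: "t \<in> V" and almost: "\<And>e. e \<in> E \<Longrightarrow> joined V (insert {s, t} (E - {e}))"
    and G: "saturated E G" and d: "bfs_dist V E {s} d" and b: "\<And>u w. {u, w} \<in> E \<Longrightarrow> b u = b w"
    and C: "oriented G d b \<subseteq> C" "sym_perms C"
  shows "alternating_connected V C"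
proof -
  have eV: "edges_in V E" by (rule simple_graph_edges_in[OF fg])
  interpret bipartite_piece E G V "{s}" d b V s
  proof
    show "saturated E G" by fact
    show "no_critical E" by (rule no_critical_bipartite[OF nodd])
    show "finite E" using simple_graph_finite[OF fg] by simp
    show "\<exists>a b. e = {a, b} \<and> a \<noteq> b" if "e \<in> E" for e using simple_graph_edge[OF fg that] by metis
    show "V = {v \<in> V. (s, v) \<in> (adj E)\<^sup>*}" using J s by (auto simp: joined_def)
  qed (use s eV d b nodd in auto)
  have up: "(p, q) \<in> (arcs C)\<^sup>*" if "(p, q) \<in> (arcs (oriented G d b))\<^sup>*" for p q
    using that rtrancl_mono[OF arcs_mono[OF C(1)]] by blast
  show ?thesis unfolding alternating_connected_def
  proof (intro ballI)
    fix u v assume uv: "u \<in> V" "v \<in> V"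
    have al: "(s, v) \<in> (adj (insert {s, t} (E - {e})))\<^sup>*" if "e \<in> E" "v \<in> V" for e v
      using almost[OF that(1)] that(2) s by (simp add: joined_def)
    from reach_total[OF t uv] al
    have "((u, \<kappa> u), (v, \<kappa> v)) \<in> (arcs C)\<^sup>* \<or> ((v, \<kappa> v), (u, \<kappa> u)) \<in> (arcs C)\<^sup>*"
      using up by blast
    then show "\<exists>i j. ((u, i), (v, j)) \<in> (arcs C)\<^sup>*"
      using reach_flip[OF C(2), of v "\<kappa> v" u "\<kappa> u"] by blast
  qed
qed

text \<open>Removing one bridge destroys no odd closed walk, and the remaining bridges stay bridges
  when edges are removed.\<close>

lemma has_odd_remove_bridges:
  assumes fin: "finite W" and odd: "has_odd E"
    and br: "\<And>u w. {u, w} \<in> W \<Longrightarrow> (u, w) \<notin> (adj (E - {{u, w}}))\<^sup>*"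
    and pairs: "\<And>e. e \<in> W \<Longrightarrow> \<exists>u w. e = {u, w}"
  shows "has_odd (E - W)"
  using fin br pairs
proof (induction W rule: finite_induct)
  case empty
  then show ?case using odd by simp
next
  case (insert e W)
  obtain u w where e: "e = {u, w}" using insert.prems(2) by blast
  have IH: "has_odd (E - W)" using insert.IH insert.prems by blast
  have "(u, w) \<notin> (adj (E - insert e W))\<^sup>*"
    using insert.prems(1)[of u w] e adj_mono[of "E - insert e W" "E - {{u, w}}"] by blast
  from has_odd_insert_bridge[OF _ this] have "has_odd (insert e (E - insert e W)) \<Longrightarrow> has_odd (E - insert e W)"
    using e by blast
  moreover have "has_odd (insert e (E - insert e W))"
    by (rule has_odd_mono[OF _ IH]) blast
  ultimately show ?case by blast
qed

text \<open>The root lies on an odd closed walk without bridges, which survives the orientation.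
  From \<open>u\<close> one goes to the root in the flipped sheet, changes sheets there and goes on
  to \<open>v\<close>.\<close>

lemma alternating_no_critical:
  assumes fg: "finite_simple_graph V E" and J: "joined V E" and odd: "\<And>e. e \<in> E \<Longrightarrow> has_odd (E - {e})"
    and r: "r \<in> V" and rr: "((r, False), (r, True)) \<in> linked (E - {e \<in> E. \<forall>u w. e = {u, w} \<longrightarrow> (u, w) \<notin> (adj (E - {e}))\<^sup>*})"
    and G: "saturated E G" and d: "bfs_dist V E {r} d" and b: "\<And>u. u \<in> V \<Longrightarrow> \<not> b u"
    and C: "oriented G d b \<subseteq> C" "sym_perms C"
  shows "alternating_connected V C"
proof -
  let ?W = "{e \<in> E. \<forall>u w. e = {u, w} \<longrightarrow> (u, w) \<notin> (adj (E - {e}))\<^sup>*}"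
  have eV: "edges_in V E" by (rule simple_graph_edges_in[OF fg])
  interpret rooted_graph E G V "{r}" d b
  proof
    show "saturated E G" by fact
    show "no_critical E" by (rule no_critical_odd[OF J fg odd])
    show "finite E" using simple_graph_finite[OF fg] by simp
    show "\<exists>a b. e = {a, b} \<and> a \<noteq> b" if "e \<in> E" for e using simple_graph_edge[OF fg that] by metis
    show "b u = b w" if "{u, w} \<in> E" for u w using that eV b unfolding edges_in_def by blast
  qed (use r eV d in auto)
  have up: "(p, q) \<in> (arcs C)\<^sup>*" if "(p, q) \<in> (arcs (oriented G d b))\<^sup>*" for p q
    using that rtrancl_mono[OF arcs_mono[OF C(1)]] by blast
  have sub: "E - ?W \<subseteq> E" by blast
  \<comment> \<open>Wild edges are bridges, so the closed walk avoids them and leaves no cut set of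
    a dropped arc.\<close>
  have loop: "((r, True), (r, False)) \<in> (arcs G')\<^sup>*"
  proof (rule reach_kept[OF G'_sub G'_wild linked_sym[OF linked_mono[OF sub rr]]])
    fix u w k assume uw: "(u, w, k) \<in> G - G'" "(r, True) \<in> cutset E (u, \<not> k) (w, k)"
    have "(u, w, k) \<in> G" using uw(1) by simp
    from wild_bridge[OF this G'_wild[OF uw(1)]] have nb: "(u, w) \<notin> (adj (E - {{u, w}}))\<^sup>*" .
    have "(x, y) \<notin> (adj (E - {{u, w}}))\<^sup>*" if "{u, w} = {x, y}" for x y
    proof -
      have "x = u \<and> y = w \<or> x = w \<and> y = u" using that by (auto simp: doubleton_eq_iff)
      then show ?thesis using nb adj_rtrancl_sym[of w u "E - {{u, w}}"] by blast
    qed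
    then have "{u, w} \<in> ?W" using wild_edge(1)[OF \<open>(u, w, k) \<in> G\<close>] by blast
    then have "E - ?W \<subseteq> E - {{u, w}}" by blast
    then show "(r, False) \<in> cutset E (u, \<not> k) (w, k)"
      by (rule linked_same_cutset[OF linked_sym[OF rr] _ uw(2)])
  qed
  have kr: "\<kappa> r = False" using d b[OF r] by (simp add: level_bit_def bfs_dist_def)
  have to: "((r, False), (v, \<kappa> v)) \<in> (arcs C)\<^sup>*" if "v \<in> V" for v
    using up reach_from_root[OF that] kr by auto
  show ?thesis unfolding alternating_connected_def
  proof (intro ballI)
    fix u v assume uv: "u \<in> V" "v \<in> V"
    have "((u, \<not> \<kappa> u), (r, True)) \<in> (arcs C)\<^sup>*" using reach_flip[OF C(2) to[OF uv(1)]] by simp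
    from rtrancl_trans[OF rtrancl_trans[OF this up[OF loop]] to[OF uv(2)]]
    show "\<exists>i j. ((u, i), (v, j)) \<in> (arcs C)\<^sup>*" by blast
  qed
qed

section \<open>A component without stubborn edges and its boundary\<close>

locale critical_piece =
  fixes V :: "'a set" and E S K
  assumes fg: "finite_simple_graph V E" and J: "joined V E" and oddE: "has_odd E"
    and S: "S = {e \<in> E. \<not> has_odd (E - {e})}"
    and KV: "K \<subseteq> V" and Kconn: "\<And>u w. u \<in> K \<Longrightarrow> w \<in> K \<Longrightarrow> (u, w) \<in> (adj (E - S))\<^sup>*"
    and Kcl: "\<And>u w. u \<in> K \<Longrightarrow> (u, w) \<in> adj (E - S) \<Longrightarrow> w \<in> K" and Kne: "K \<noteq> {}"
begin

lemma eV: "edges_in V E" by (rule simple_graph_edges_in[OF fg])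

lemma boundary_critical: "{z, v} \<in> E \<Longrightarrow> z \<notin> K \<Longrightarrow> v \<in> K \<Longrightarrow> {z, v} \<in> S"
  using Kcl[of v z] by (auto simp: adj_def insert_commute)

lemma inner_path:
  assumes "u \<in> K" "(u, w) \<in> (adj (E - S))\<^sup>*"
  shows "(u, w) \<in> (adj {e \<in> E - S. e \<subseteq> K})\<^sup>* \<and> w \<in> K"
  using assms(2)
proof (induction rule: rtrancl_induct)
  case (step y z)
  then have "z \<in> K" using Kcl by blast
  then have "(y, z) \<in> adj {e \<in> E - S. e \<subseteq> K}" using step by (simp add: adj_def)
  then show ?case using step.IH \<open>z \<in> K\<close> by (meson rtrancl_into_rtrancl)
qed (use assms(1) in simp)

lemma separated:
  assumes "e \<in> S" "{a, c} \<in> S" "e \<noteq> {a, c}"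
  shows "(a, c) \<notin> (adj (E - {e, {a, c}}))\<^sup>*"
  by (rule stubborn_pair_separates[OF oddE]) (use assms in \<open>auto simp: S\<close>)

lemma K_path: "u \<in> K \<Longrightarrow> w \<in> K \<Longrightarrow> A \<subseteq> S \<Longrightarrow> (u, w) \<in> (adj (E - A))\<^sup>*"
  using adj_mono[of "E - S" "E - A"] Kconn by blast

text \<open>A second stubborn edge would, together with this one, separate its ends, which
  \<open>K\<close> connects without stubborn edges.\<close>

lemma inner_critical:
  assumes "{u, w} \<in> S" "u \<in> K" "w \<in> K"
  shows "S = {{u, w}}"
proof -
  have "e = {u, w}" if "e \<in> S" for e
    using separated[OF that assms(1)] K_path[OF assms(2,3), of "{e, {u, w}}"] that assms(1) by blast
  then show ?thesis using assms(1) by blast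
qed

lemma not_bridge: "{a, c} \<in> S \<Longrightarrow> joined V (E - {{a, c}})"
  by (rule joined_replace[OF J refl stubborn_not_bridge[OF oddE]]) (auto simp: S)

text \<open>One boundary edge is not enough, since stubborn edges are no bridges. Three contradict
  the pairwise cuts: deleting the first and third leaves \<open>a1\<close> and \<open>a3\<close>
  connected away from \<open>K\<close>, and then the third edge joins \<open>a1\<close> to
  \<open>K\<close> although the first and second are deleted.\<close>

lemma two_boundary_edges:
  assumes "V - K \<noteq> {}"
  obtains c1 a1 c2 a2 where "{c1, a1} \<in> S" "{c2, a2} \<in> S" "{c1, a1} \<noteq> {c2, a2}"
    "c1 \<in> K" "c2 \<in> K" "a1 \<in> V - K" "a2 \<in> V - K"
    "\<And>v z. v \<in> K \<Longrightarrow> z \<notin> K \<Longrightarrow> {v, z} \<in> E \<Longrightarrow> {v, z} = {c1, a1} \<or> {v, z} = {c2, a2}"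
proof -
  obtain m z where m: "m \<in> K" "m \<in> V" and z: "z \<in> V" "z \<notin> K" using Kne KV assms by blast
  have "(m, z) \<in> (adj E)\<^sup>*" using J m z by (simp add: joined_def)
  then obtain c1 a1 where 1: "c1 \<in> K" "a1 \<notin> K" "(c1, a1) \<in> adj E" by (rule rtrancl_exit[OF _ m(1) z(2)])
  have bc: "{v, y} \<in> S" if "v \<in> K" "y \<notin> K" "{v, y} \<in> E" for v y
    using boundary_critical[of y v] that by (simp add: insert_commute)
  have e1: "{c1, a1} \<in> S" using bc 1 by (simp add: adj_def)
  have "(m, z) \<in> (adj (E - {{c1, a1}}))\<^sup>*" using not_bridge[OF e1] m z by (simp add: joined_def)
  then obtain c2 a2 where 2: "c2 \<in> K" "a2 \<notin> K" "(c2, a2) \<in> adj (E - {{c1, a1}})"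
    by (rule rtrancl_exit[OF _ m(1) z(2)])
  have e2: "{c2, a2} \<in> S" "{c2, a2} \<noteq> {c1, a1}" using bc 2 by (auto simp: adj_def)
  have aV: "a \<in> V" if "{c, a} \<in> S" for c a using that eV by (auto simp: S edges_in_def)
  show thesis
  proof (rule that[OF e1 e2(1) e2(2)[symmetric] 1(1) 2(1)])
    show "a1 \<in> V - K" "a2 \<in> V - K" using 1 2 aV e1 e2 by auto
    fix c3 a3 assume 3: "c3 \<in> K" "a3 \<notin> K" "{c3, a3} \<in> E"
    show "{c3, a3} = {c1, a1} \<or> {c3, a3} = {c2, a2}"
    proof (rule ccontr)
      assume ne: "\<not> ?thesis"
      have e3: "{c3, a3} \<in> S" by (rule bc[OF 3])
      let ?A13 = "E - {{c1, a1}, {c3, a3}}" and ?A12 = "E - {{c2, a2}, {c1, a1}}"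
      let ?A = "E - {{c1, a1}, {c2, a2}, {c3, a3}}"
      have s1: "(c1, a1) \<notin> (adj ?A12)\<^sup>*" by (rule separated[OF e2(1) e1 e2(2)])
      have s3: "(c3, a3) \<notin> (adj ?A13)\<^sup>*" by (rule separated[OF e1 e3]) (use ne in auto)
      have s13: "(c1, a1) \<notin> (adj (E - {{c3, a3}, {c1, a1}}))\<^sup>*" by (rule separated[OF e3 e1]) (use ne in auto)
      have c31: "(c3, c1) \<in> (adj ?A13)\<^sup>*" by (rule K_path[OF 3(1) 1(1)]) (use e1 e3 in auto)
      have c32: "(c2, c3) \<in> (adj ?A13)\<^sup>*" by (rule K_path[OF 2(1) 3(1)]) (use e1 e3 in auto)
      have c12: "(c3, c1) \<in> (adj ?A12)\<^sup>*" by (rule K_path[OF 3(1) 1(1)]) (use e1 e2 in auto)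
      have sw: "?A13 = E - {{c3, a3}, {c1, a1}}" by auto
      \<comment> \<open>The first edge is no bridge, so without it \<open>a1\<close> is still
        connected to \<open>c1\<close>; that connection has to use the third edge, coming from
        \<open>a3\<close>.\<close>
      have 31: "(a3, a1) \<in> (adj ?A13)\<^sup>*"
      proof (rule ccontr)
        assume n: "(a3, a1) \<notin> (adj ?A13)\<^sup>*"
        have "(a1, c1) \<in> (adj (E - {{c1, a1}}))\<^sup>*"
          using not_bridge[OF e1] aV[OF e1] 1(1) KV unfolding joined_def by blast
        moreover have "a1 \<in> {y. (a1, y) \<in> (adj ?A13)\<^sup>*}" by simp
        moreover have "c1 \<notin> {y. (a1, y) \<in> (adj ?A13)\<^sup>*}"
          using s13 adj_rtrancl_sym[of a1 c1 ?A13] unfolding sw by blast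
        ultimately obtain x y where xy: "(a1, x) \<in> (adj ?A13)\<^sup>*" "(a1, y) \<notin> (adj ?A13)\<^sup>*" "(x, y) \<in> adj (E - {{c1, a1}})"
          by (rule rtrancl_exit) blast
        have "(x, y) \<notin> adj ?A13" using xy(1,2) rtrancl_into_rtrancl by metis
        then have "{x, y} = {c3, a3}" using xy(3) by (auto simp: adj_def)
        moreover have "x \<noteq> a3" using n adj_rtrancl_sym[OF xy(1)] by blast
        ultimately have "x = c3" by (auto simp: doubleton_eq_iff)
        then have "(a1, c1) \<in> (adj ?A13)\<^sup>*" using xy(1) c31 by (metis rtrancl_trans)
        then show False using \<open>c1 \<notin> _\<close> by blast
      qed
      have A13: "?A \<subseteq> ?A13" and A12: "?A \<subseteq> ?A12" by auto
      \<comment> \<open>Using the second edge would lead into \<open>K\<close> and on to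
        \<open>c3\<close>, against the cut formed by the first and third.\<close>
      have "(a3, a1) \<in> (adj ?A)\<^sup>*"
      proof (rule ccontr)
        assume n: "(a3, a1) \<notin> (adj ?A)\<^sup>*"
        have "a3 \<in> {y. (a3, y) \<in> (adj ?A)\<^sup>*}" "a1 \<notin> {y. (a3, y) \<in> (adj ?A)\<^sup>*}" using n by auto
        with 31 obtain x y where xy: "(a3, x) \<in> (adj ?A)\<^sup>*" "(a3, y) \<notin> (adj ?A)\<^sup>*" "(x, y) \<in> adj ?A13"
          by (rule rtrancl_exit) blast
        have "(x, y) \<notin> adj ?A" using xy(1,2) rtrancl_into_rtrancl by metis
        then have "{x, y} = {c2, a2}" using xy(3) by (auto simp: adj_def)
        then have "x = c2 \<or> y = c2" by (auto simp: doubleton_eq_iff)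
        moreover have "(a3, x) \<in> (adj ?A13)\<^sup>*" by (rule adj_mono[OF A13 xy(1)])
        moreover have "(a3, y) \<in> (adj ?A13)\<^sup>*" by (rule rtrancl_into_rtrancl[OF adj_mono[OF A13 xy(1)] xy(3)])
        ultimately have "(a3, c2) \<in> (adj ?A13)\<^sup>*" by blast
        then have "(a3, c3) \<in> (adj ?A13)\<^sup>*" using c32 by (rule rtrancl_trans)
        then show False using s3 adj_rtrancl_sym by metis
      qed
      then have a: "(a3, a1) \<in> (adj ?A12)\<^sup>*" by (rule adj_mono[OF A12])
      have "(c3, a3) \<in> adj ?A12" using 3(3) ne by (auto simp: adj_def)
      then have "(c3, a1) \<in> (adj ?A12)\<^sup>*" using a by (rule converse_rtrancl_into_rtrancl)
      with adj_rtrancl_sym[OF c12] have "(c1, a1) \<in> (adj ?A12)\<^sup>*" by (rule rtrancl_trans)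
      then show False using s1 by simp
    qed
  qed
qed

lemma no_odd_without: "e \<in> S \<Longrightarrow> A \<subseteq> E - {e} \<Longrightarrow> \<not> has_odd A"
  using has_odd_mono by (auto simp: S)

lemma pairsE: "e \<in> E \<Longrightarrow> \<exists>a b. e = {a, b} \<and> a \<noteq> b"
  using simple_graph_edge[OF fg] by metis

text \<open>Only the stubborn edge \<open>c1 c2\<close> links the two lifts of the bipartite graph
  \<open>F\<close>. Its colour leads from the flipped sheet at \<open>c1\<close> to the sheet of
  \<open>level_bit\<close> at \<open>c2\<close>; from there a walk returns to the root
  \<open>c1\<close> and reaches every vertex.\<close>

lemma alternating_whole:
  assumes K: "K = V" and e: "{c1, c2} \<in> S" and F: "F = E - S"
    and G: "saturated F G" and d: "bfs_dist V F {c1} d" and b: "\<And>u w. {u, w} \<in> F \<Longrightarrow> b u = b w"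
    and C: "oriented G d b \<subseteq> C" "sym_perms C" "(c1, c2, level_bit d b c1) \<in> C"
  shows "alternating_connected V C"
proof -
  have cE: "{c1, c2} \<in> E" using e by (simp add: S)
  have cV: "c1 \<in> V" "c2 \<in> V" using cE eV by (auto simp: edges_in_def)
  have S1: "S = {{c1, c2}}" by (rule inner_critical[OF e]) (use cV K in auto)
  have F1: "F = E - {{c1, c2}}" unfolding F S1 by simp
  have nodd: "\<not> has_odd F" unfolding F1 by (rule no_odd_without[OF e]) simp
  interpret bipartite_piece F G V "{c1}" d b V c1
  proof
    show "saturated F G" by fact
    show "no_critical F" by (rule no_critical_bipartite[OF nodd])
    show "finite F" using simple_graph_finite[OF fg] by (simp add: F)
    show "\<exists>a b. e = {a, b} \<and> a \<noteq> b" if "e \<in> F" for e using pairsE that by (simp add: F)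
    show "V = {v \<in> V. (c1, v) \<in> (adj F)\<^sup>*}" using Kconn cV K by (auto simp: F)
    show "edges_in V F" using eV by (rule edges_in_subset) (simp add: F)
  qed (use cV d b nodd in auto)
  have up: "(p, q) \<in> (arcs C)\<^sup>*" if "(p, q) \<in> (arcs (oriented G d b))\<^sup>*" for p q
    using that rtrancl_mono[OF arcs_mono[OF C(1)]] by blast
  have "outward F G V c1 c2 c1"
    unfolding outward_def
  proof (intro allI impI)
    fix u w k assume w: "(u, w, k) \<in> G" "c2 \<in> far F c1 u w"
    have uw: "{u, w} \<in> F" by (rule wild_edge[OF w(1)])
    then have odd: "has_odd (E - {{u, w}})" by (auto simp: F S)
    \<comment> \<open>The edge \<open>uw\<close> is not stubborn, so some odd closed walk avoids it.
      As \<open>F\<close> is bipartite, this walk relies on \<open>c1 c2\<close>, which therefore is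
      no bridge once \<open>uw\<close> is deleted.\<close>
    have "(c1, c2) \<in> (adj (F - {{u, w}}))\<^sup>*"
    proof (rule ccontr)
      assume n: "\<not> ?thesis"
      have "\<not> has_odd (F - {{u, w}})" using nodd has_odd_mono[of "F - {{u, w}}" F] by blast
      from has_odd_insert_bridge[OF this n] have "\<not> has_odd (insert {c1, c2} (F - {{u, w}}))" .
      moreover have "insert {c1, c2} (F - {{u, w}}) = E - {{u, w}}" using uw cE by (auto simp: F1)
      ultimately show False using odd by simp
    qed
    then show "c1 \<in> far F c1 u w" using w(2) by (simp add: far_def)
  qed
  from reach_outward[OF cV(2,1) this] have 21: "((c2, \<kappa> c2), (c1, \<kappa> c1)) \<in> (arcs C)\<^sup>*" by (rule up)
  have "((c1, \<kappa> c1), (c2, \<kappa> c1)) \<in> linked F"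
    unfolding F1 by (rule stubborn_same_side[OF oddE _ cE]) (use e in \<open>simp add: S\<close>)
  from lift_unique[OF cV this] have \<kappa>: "\<kappa> c2 = \<kappa> c1" by simp
  have "((c1, \<not> \<kappa> c1), (c2, \<kappa> c1)) \<in> arcs C" using C(3) by (simp add: arcs_iff)
  then have jump: "((c1, \<not> \<kappa> c1), (c2, \<kappa> c2)) \<in> (arcs C)\<^sup>*" unfolding \<kappa> by (rule r_into_rtrancl)
  have to: "((c1, \<kappa> c1), (v, \<kappa> v)) \<in> (arcs C)\<^sup>*" if "v \<in> V" for v
    using up reach_from_root[OF that] by auto
  show ?thesis unfolding alternating_connected_def
  proof (intro ballI)
    fix u v assume uv: "u \<in> V" "v \<in> V"
    from rtrancl_trans[OF rtrancl_trans[OF rtrancl_trans[OF reach_flip[OF C(2) to[OF uv(1)]] jump] 21] to[OF uv(2)]]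
    show "\<exists>i j. ((u, i), (v, j)) \<in> (arcs C)\<^sup>*" by blast
  qed
qed

text \<open>From the source lift of \<open>K\<close> a walk runs to \<open>c1\<close>, over
  \<open>a1\<close> and the rest to \<open>a2\<close>, into the sink lift at \<open>c2\<close>, and
  over \<open>c1\<close> to all of \<open>K\<close>. A vertex of the rest has a lift comparable to
  the state in which \<open>a1\<close> is entered, which connects it to \<open>K\<close> as
  well.\<close>

lemma alternating_source:
  assumes c: "{c1, a1} \<in> S" "{c2, a2} \<in> S" "{c1, a1} \<noteq> {c2, a2}" "c1 \<in> K" "c2 \<in> K" "a1 \<in> V - K" "a2 \<in> V - K"
    and boundary: "\<And>v z. v \<in> K \<Longrightarrow> z \<notin> K \<Longrightarrow> {v, z} \<in> E \<Longrightarrow> {v, z} = {c1, a1} \<or> {v, z} = {c2, a2}"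
    and F: "F = {e \<in> E - S. e \<subseteq> K} \<union> {e \<in> E. e \<inter> K = {}}"
    and PJ: "joined (V - K) {e \<in> E. e \<subseteq> V - K}"
    and st: "s \<in> V - K" "t \<in> V - K"
    and almost: "\<And>e. e \<in> E \<Longrightarrow> e \<subseteq> V - K \<Longrightarrow> joined (V - K) (insert {s, t} ({e \<in> E. e \<subseteq> V - K} - {e}))"
    and G: "saturated F G" and d: "bfs_dist V F {c1, s} d"
  shows "\<exists>i. \<forall>C. oriented G d (\<lambda>v. i \<and> v \<notin> K) \<subseteq> C \<longrightarrow> sym_perms C \<longrightarrow>
    (c1, a1, level_bit d (\<lambda>v. i \<and> v \<notin> K) c1) \<in> C \<longrightarrow> (c2, a2, level_bit d (\<lambda>v. i \<and> v \<notin> K) c2) \<in> C \<longrightarrow>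
    alternating_connected V C"
proof -
  let ?P = "V - K"
  define E' where "E' = {e \<in> E. e \<subseteq> ?P}"
  have cV: "c1 \<in> V" "c2 \<in> V" using c KV by auto
  have eqE': "{e \<in> E. e \<inter> K = {}} = E'"
  proof -
    have "e \<inter> K = {} \<longleftrightarrow> e \<subseteq> ?P" if e: "e \<in> E" for e
    proof -
      obtain a b where "e = {a, b}" "a \<in> V" "b \<in> V" by (rule simple_graph_edge[OF fg e])
      then show ?thesis by auto
    qed
    then show ?thesis by (auto simp: E'_def)
  qed
  have FE: "F \<subseteq> E" by (auto simp: F)
  have F_e: "{c1, a1} \<notin> F" "{c2, a2} \<notin> F" using c by (auto simp: F)
  have nodd: "\<not> has_odd F" by (rule no_odd_without[OF c(1)]) (use FE F_e in auto)
  have FV: "edges_in V F" by (rule edges_in_subset[OF eV FE])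
  have cross: "u \<in> K \<longleftrightarrow> w \<in> K" if "{u, w} \<in> F" for u w using that by (auto simp: F)
  have Kpath: "(u, w) \<in> (adj F)\<^sup>*" if "u \<in> K" "w \<in> K" for u w
    using inner_path[OF that(1) Kconn[OF that]] adj_mono[of "{e \<in> E - S. e \<subseteq> K}" F] by (auto simp: F)
  have Ppath: "(u, w) \<in> (adj E')\<^sup>*" if "u \<in> ?P" "w \<in> ?P" for u w
    using PJ that by (simp add: joined_def E'_def)
  have E'F: "E' \<subseteq> F" using eqE' by (auto simp: F)
  have stayK: "u \<in> K \<longleftrightarrow> w \<in> K" if "(u, w) \<in> (adj F)\<^sup>*" for u w
    using that by (induction rule: rtrancl_induct) (auto simp: adj_def dest: cross)
  have compK: "K = {v \<in> V. (c1, v) \<in> (adj F)\<^sup>*}"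
    using Kpath[OF c(4)] stayK[of c1] c(4) KV by blast
  have compP: "?P = {v \<in> V. (s, v) \<in> (adj F)\<^sup>*}"
    using adj_mono[OF E'F Ppath[OF st(1)]] stayK[of s] st(1) by blast
  have rg: "rooted_graph F G V {c1, s} d (\<lambda>v. i \<and> v \<notin> K)" for i
  proof
    show "saturated F G" by fact
    show "no_critical F" by (rule no_critical_bipartite[OF nodd])
    show "finite F" using simple_graph_finite[OF fg] FE finite_subset by blast
    show "\<exists>a b. e = {a, b} \<and> a \<noteq> b" if "e \<in> F" for e using pairsE that FE by blast
    show "(i \<and> u \<notin> K) = (i \<and> w \<notin> K)" if "{u, w} \<in> F" for u w using cross[OF that] by simp
  qed (use cV st d FV in auto)
  have pK: "bipartite_piece F G V {c1, s} d (\<lambda>v. i \<and> v \<notin> K) K c1" for i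
    by (intro bipartite_piece.intro rg bipartite_piece_axioms.intro) (use compK c st nodd in auto)
  have pP: "bipartite_piece F G V {c1, s} d (\<lambda>v. i \<and> v \<notin> K) ?P s" for i
    by (intro bipartite_piece.intro rg bipartite_piece_axioms.intro) (use compP c st nodd in auto)
  define k where "k i = level_bit d (\<lambda>v. i \<and> v \<notin> K)" for i
  have kK: "k i v = odd (d v)" if "v \<in> K" for i v using that by (simp add: k_def level_bit_def)
  have kP: "k True v = (\<not> k False v)" if "v \<in> ?P" for v using that by (simp add: k_def level_bit_def)
  \<comment> \<open>No edge \<open>uw\<close> of \<open>K\<close> separates \<open>c2\<close> from
    \<open>c1\<close>: not being stubborn, it leaves \<open>c1\<close> and \<open>a1\<close>
    connected even without \<open>{c1, a1}\<close>, and this connection has to leave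
    \<open>K\<close> at \<open>c2\<close>.\<close>
  have out21: "outward F G K c1 c2 c1"
    unfolding outward_def
  proof (intro allI impI)
    fix u w j assume w: "(u, w, j) \<in> G" "u \<in> K" "c2 \<in> far F c1 u w"
    interpret bipartite_piece F G V "{c1, s}" d "\<lambda>v. False \<and> v \<notin> K" K c1 by (rule pK)
    let ?f = "{u, w}" and ?e = "{c1, a1}"
    have uw: "?f \<in> F" by (rule wild_edge[OF w(1)])
    then have fES: "?f \<in> E - S" using w(2) by (auto simp: F)
    then have odd: "has_odd (E - {?f})" by (auto simp: S)
    have "(c1, a1) \<in> (adj (E - {?f, ?e}))\<^sup>*"
    proof (rule ccontr)
      assume n: "\<not> ?thesis"
      have "\<not> has_odd (E - {?f, ?e})" by (rule no_odd_without[OF c(1)]) blast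
      from has_odd_insert_bridge[OF this n] have "\<not> has_odd (insert ?e (E - {?f, ?e}))" .
      moreover have "insert ?e (E - {?f, ?e}) = E - {?f}" using c(1) fES by (auto simp: S)
      ultimately show False using odd by simp
    qed
    moreover have "c1 \<in> {z \<in> K. (c1, z) \<in> (adj (F - {?f}))\<^sup>*}" "a1 \<notin> {z \<in> K. (c1, z) \<in> (adj (F - {?f}))\<^sup>*}"
      using c(4,6) by auto
    ultimately obtain x y where xy: "x \<in> K" "(c1, x) \<in> (adj (F - {?f}))\<^sup>*" "\<not> (y \<in> K \<and> (c1, y) \<in> (adj (F - {?f}))\<^sup>*)"
      "(x, y) \<in> adj (E - {?f, ?e})"
      by (rule rtrancl_exit) blast
    have xyE: "{x, y} \<in> E" "{x, y} \<noteq> ?f" "{x, y} \<noteq> ?e" using xy(4) by (auto simp: adj_def)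
    have "y \<notin> K"
    proof
      assume y: "y \<in> K"
      have "{x, y} \<notin> S" using inner_critical[OF _ xy(1) y] c(1-3) by fastforce
      then have "{x, y} \<in> F - {?f}" using xyE xy(1) y by (auto simp: F)
      then have "(x, y) \<in> adj (F - {?f})" by (simp add: adj_def)
      with xy(2) have "(c1, y) \<in> (adj (F - {?f}))\<^sup>*" by (rule rtrancl_into_rtrancl)
      then show False using xy(3) y by blast
    qed
    then have "{x, y} = {c2, a2}" using boundary[OF xy(1) _ xyE(1)] xyE(3) by blast
    then have "x = c2" using xy(1) c(7) by (auto simp: doubleton_eq_iff)
    then show "c1 \<in> far F c1 u w" using w(3) xy(2) by (simp add: far_def)
  qed
  \<comment> \<open>With the other bit, the walk from \<open>c2\<close> over \<open>c1\<close> and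
    \<open>a1\<close> to \<open>a2\<close> would have odd length and could replace
    \<open>{c2, a2}\<close> in every odd closed walk.\<close>
  have par: "((a1, k i c1), (a2, \<not> k i c2)) \<in> linked F" for i
  proof -
    interpret bipartite_piece F G V "{c1, s}" d "\<lambda>v. i \<and> v \<notin> K" K c1 by (rule pK)
    obtain j where j: "((a1, k i c1), (a2, j)) \<in> linked F"
      using adj_imp_linked[OF adj_mono[OF E'F Ppath[OF c(6,7)]]] by blast
    have "j = (\<not> k i c2)"
    proof (rule ccontr)
      assume "j \<noteq> (\<not> k i c2)"
      then have j2: "((a1, \<not> k i c1), (a2, \<not> k i c2)) \<in> linked F" using linked_flip[OF j] by simp
      let ?B = "E - {{c2, a2}}"
      have FB: "F \<subseteq> ?B" using FE F_e by blast
      have "((c2, k i c2), (c1, k i c1)) \<in> linked F"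
        unfolding k_def by (rule lift_path[OF c(5)]) (use Kpath c in auto)
      moreover have "((c1, k i c1), (a1, \<not> k i c1)) \<in> linked ?B"
        by (rule linked_edge) (use c in \<open>auto simp: S\<close>)
      ultimately have B: "((c2, k i c2), (a2, \<not> k i c2)) \<in> linked ?B"
        using linked_trans[OF linked_trans[OF linked_mono[OF FB]] linked_mono[OF FB j2]] by blast
      have "((c2, False), (a2, True)) \<in> linked ?B"
        using B linked_flip[OF B] by (cases "k i c2") auto
      from has_odd_redundant[OF this _ oddE] show False using c(2) by (auto simp: S)
    qed
    then show ?thesis using j by simp
  qed
  interpret P0: bipartite_piece F G V "{c1, s}" d "\<lambda>v. False \<and> v \<notin> K" ?P s by (rule pP)
  have al: "(s, v) \<in> (adj (insert {s, t} (F - {e})))\<^sup>*" if "e \<in> F" "e \<subseteq> ?P" "v \<in> ?P" for e v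
  proof -
    have "(s, v) \<in> (adj (insert {s, t} (E' - {e})))\<^sup>*"
      using almost[of e] that FE st unfolding joined_def E'_def by blast
    then show ?thesis using E'F by (elim adj_mono[rotated]) auto
  qed
  \<comment> \<open>\<open>a1\<close> and \<open>a2\<close> are comparable in one direction or the
    other; \<open>i\<close> selects the lift of the rest for which this becomes, possibly after
    flipping, a walk from the exit at \<open>a1\<close> to the entrance at
    \<open>a2\<close>.\<close>
  obtain i where i: "((a1, k i c1), (a2, \<not> k i c2)) \<in> (arcs (oriented G d (\<lambda>v. i \<and> v \<notin> K)))\<^sup>*"
  proof -
    have ex: "\<exists>i. k i a1 = x" if "a1 \<in> ?P" for x using kP[OF that] by (cases "k False a1 = x") auto
    from P0.outward_total[OF st(2) c(6,7) al] show thesis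
    proof
      assume o: "outward F G ?P s a1 a2"
      obtain i where i: "k i a1 = odd (d c1)" using ex c(6) by blast
      interpret bipartite_piece F G V "{c1, s}" d "\<lambda>v. i \<and> v \<notin> K" ?P s by (rule pP)
      have k1: "k i c1 = k i a1" using i kK c(4) by simp
      have l: "((a1, k i a1), (a2, \<not> k i c2)) \<in> linked F" using par[of i] k1 by simp
      have "k i a2 = (\<not> k i c2)" using lift_unique[OF c(6,7) l[unfolded k_def]] by (simp add: k_def)
      then show thesis using that[of i] reach_outward[OF c(6,7) o] k1 unfolding k_def by simp
    next
      assume o: "outward F G ?P s a2 a1"
      obtain i where i: "k i a1 = (\<not> odd (d c1))" using ex c(6) by blast
      interpret bipartite_piece F G V "{c1, s}" d "\<lambda>v. i \<and> v \<notin> K" ?P s by (rule pP)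
      have k1: "k i c1 = (\<not> k i a1)" using i kK c(4) by simp
      have "((a1, k i a1), (a2, k i c2)) \<in> linked F" using linked_flip[OF par[of i]] k1 by simp
      then have "k i a2 = k i c2" using lift_unique[OF c(6,7)] unfolding k_def by metis
      then show thesis
        using that[of i] reach_flip[OF symG' reach_outward[OF c(7,6) o]] k1 unfolding k_def by simp
    qed
  qed
  show ?thesis
  proof (intro exI[of _ i] allI impI)
    fix C assume C: "oriented G d (\<lambda>v. i \<and> v \<notin> K) \<subseteq> C" "sym_perms C"
      and X: "(c1, a1, level_bit d (\<lambda>v. i \<and> v \<notin> K) c1) \<in> C" "(c2, a2, level_bit d (\<lambda>v. i \<and> v \<notin> K) c2) \<in> C"
    interpret Kp: bipartite_piece F G V "{c1, s}" d "\<lambda>v. i \<and> v \<notin> K" K c1 by (rule pK)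
    interpret Pp: bipartite_piece F G V "{c1, s}" d "\<lambda>v. i \<and> v \<notin> K" ?P s by (rule pP)
    let ?k = "k i"
    have up: "(p, q) \<in> (arcs C)\<^sup>*" if "(p, q) \<in> (arcs (oriented G d (\<lambda>v. i \<and> v \<notin> K)))\<^sup>*" for p q
      using that rtrancl_mono[OF arcs_mono[OF C(1)]] by blast
    let ?R = "(arcs C)\<^sup>*"
    have flipC: "((v, \<not> j), (u, \<not> l)) \<in> ?R" if "((u, l), (v, j)) \<in> ?R" for u v l j
      by (rule reach_flip[OF C(2) that])
    have toK: "((c1, ?k c1), (v, ?k v)) \<in> ?R" if v: "v \<in> K" for v
    proof -
      obtain r where r: "r \<in> {c1, s}" "(r, v) \<in> (adj F)\<^sup>*" "((r, ?k r), (v, ?k v)) \<in> (arcs Kp.G')\<^sup>*"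
        using Kp.reach_from_root[OF Kp.PV[OF v]] unfolding k_def by blast
      have "r = c1" using r(1) stayK[OF r(2)] v st(1) by auto
      then show ?thesis using up r(3) by blast
    qed
    have 21: "((c2, ?k c2), (c1, ?k c1)) \<in> ?R"
      unfolding k_def by (rule up[OF Kp.reach_outward[OF c(5,4) out21]])
    have e1: "((c1, \<not> ?k c1), (a1, ?k c1)) \<in> ?R"
      using X(1) unfolding k_def by (intro r_into_rtrancl) (simp add: arcs_iff)
    have "(a2, c2, ?k c2) \<in> C" using X(2) C(2) unfolding sym_perms_def k_def by blast
    then have e2: "((a2, \<not> ?k c2), (c2, ?k c2)) \<in> ?R"
      by (intro r_into_rtrancl) (simp add: arcs_iff)
    have a12: "((a1, ?k c1), (a2, \<not> ?k c2)) \<in> ?R" by (rule up[OF i])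
    have a2K: "((a2, \<not> ?k c2), (v, ?k v)) \<in> ?R" if "v \<in> K" for v
      by (rule rtrancl_trans[OF rtrancl_trans[OF e2 21] toK[OF that]])
    have Ka1: "((v, \<not> ?k v), (a1, ?k c1)) \<in> ?R" if "v \<in> K" for v
      by (rule rtrancl_trans[OF flipC[OF toK[OF that]] e1])
    have PP: "((u, ?k u), (v, ?k v)) \<in> ?R \<or> ((v, ?k v), (u, ?k u)) \<in> ?R" if "u \<in> ?P" "v \<in> ?P" for u v
      using Pp.reach_total[OF st(2) that al] up unfolding k_def by blast
    \<comment> \<open>Some lift of \<open>v\<close> is comparable to the exit state at
      \<open>a1\<close>. If it is reached from there, start in \<open>K\<close>; if it leads there,
      continue into the sink lift of \<open>K\<close> and flip the whole walk.\<close>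
    have KP: "\<exists>l j. ((u, l), (v, j)) \<in> ?R" if u: "u \<in> K" and v: "v \<in> ?P" for u v
    proof -
      have "\<exists>j. ((a1, ?k c1), (v, j)) \<in> ?R \<or> ((v, j), (a1, ?k c1)) \<in> ?R"
      proof (cases "?k c1 = ?k a1")
        case True
        then show ?thesis using PP[OF c(6) v] unfolding True by blast
      next
        case False
        then have eq: "?k c1 = (\<not> ?k a1)" by blast
        show ?thesis unfolding eq
          using PP[OF c(6) v] flipC[of a1 "?k a1" v "?k v"] flipC[of v "?k v" a1 "?k a1"] by blast
      qed
      then obtain j where "((a1, ?k c1), (v, j)) \<in> ?R \<or> ((v, j), (a1, ?k c1)) \<in> ?R" by blast
      then show ?thesis
      proof
        assume "((a1, ?k c1), (v, j)) \<in> ?R"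
        from rtrancl_trans[OF Ka1[OF u] this] show ?thesis by blast
      next
        assume "((v, j), (a1, ?k c1)) \<in> ?R"
        from flipC[OF rtrancl_trans[OF rtrancl_trans[OF this a12] a2K[OF u]]] show ?thesis by blast
      qed
    qed
    have KK: "((u, \<not> ?k u), (v, ?k v)) \<in> ?R" if "u \<in> K" "v \<in> K" for u v
      by (rule rtrancl_trans[OF rtrancl_trans[OF Ka1[OF that(1)] a12] a2K[OF that(2)]])
    show "alternating_connected V C" unfolding alternating_connected_def
    proof (intro ballI)
      fix u v assume uv: "u \<in> V" "v \<in> V"
      show "\<exists>l j. ((u, l), (v, j)) \<in> ?R"
      proof (cases "u \<in> K"; cases "v \<in> K")
        assume "u \<in> K" "v \<in> K"
        then show ?thesis using KK by blast
      next
        assume "u \<in> K" "v \<notin> K"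
        then show ?thesis using KP uv by blast
      next
        assume "u \<notin> K" "v \<in> K"
        then obtain l j where "((v, l), (u, j)) \<in> ?R" using KP uv by blast
        from flipC[OF this] show ?thesis by blast
      next
        assume "u \<notin> K" "v \<notin> K"
        then have "((u, ?k u), (v, ?k v)) \<in> ?R \<or> ((v, ?k v), (u, ?k u)) \<in> ?R" using PP uv by blast
        then show ?thesis using flipC[of v "?k v" u "?k u"] by blast
      qed
    qed
  qed
qed

end

section \<open>Assembling the two-colouring\<close>

lemma kept_subset: "kept V E r \<subseteq> E"
  by (auto simp: kept_def)

lemma core_whole:
  assumes fg: "finite_simple_graph V E" and "\<And>v. v \<in> V \<Longrightarrow> (r, v) \<in> (adj (E - critical E))\<^sup>*"
  shows "core V E r = V" "kept V E r = E - critical E"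
proof -
  show 1: "core V E r = V" using assms(2) by (auto simp: core_def)
  have "e \<subseteq> V \<and> e \<inter> V \<noteq> {}" if eE: "e \<in> E" for e
  proof -
    obtain u v where "e = {u, v}" "u \<in> V" "v \<in> V" by (rule simple_graph_edge[OF fg eE])
    then show ?thesis by auto
  qed
  then have "{e \<in> E - critical E. e \<subseteq> V} = E - critical E" "{e \<in> E. e \<inter> V = {}} = {}" by auto
  then show "kept V E r = E - critical E" unfolding kept_def 1 by (simp only: Un_empty_right)
qed

lemma matches_oriented:
  assumes "matches V E r G d i g" "saturated (kept V E r) G"
  shows "oriented G d (\<lambda>v. i \<and> v \<notin> core V E r) \<subseteq> colour_perms E g"
proof
  fix p assume p: "p \<in> oriented G d (\<lambda>v. i \<and> v \<notin> core V E r)"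
  obtain u w k where uw: "p = (u, w, k)" by (cases p)
  have "(u, w, k) \<in> G" using p uw by (simp add: oriented_def)
  moreover have "G \<subseteq> free (kept V E r)" using assms(2) by (simp add: saturated_def)
  ultimately have "{u, w} \<in> kept V E r" by auto
  then have "{u, w} \<in> E" using kept_subset by (rule subsetD[rotated])
  moreover have "g {u, w} = k" using assms(1) p uw by (simp add: matches_def)
  ultimately show "p \<in> colour_perms E g" using uw by (auto simp: colour_perms_def)
qed

lemma matches_cross:
  assumes "matches V E r G d i g" "{u, w} \<in> E" "{u, w} \<notin> kept V E r" "u \<in> core V E r" "w \<notin> core V E r"
  shows "(u, w, level_bit d (\<lambda>v. i \<and> v \<notin> core V E r) u) \<in> colour_perms E g"
  using assms unfolding matches_def colour_perms_def by auto

theorem two_colours_sufficient: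
  assumes fg: "finite_simple_graph V E" and J: "joined V E"
    and cond: "\<not> has_odd E \<and> almost_two_edge_connected V E \<or>
      has_odd E \<and> (\<exists>K\<in>stubborn_free_components V E.
        V - K = {} \<or> almost_two_edge_connected (V - K) (induced_edges (V - K) E))"
  shows "\<exists>r\<in>V. \<exists>s\<in>V. (\<forall>v\<in>V. \<exists>x\<in>{r, s}. (x, v) \<in> (adj (kept V E r))\<^sup>*) \<and>
    (\<forall>G d. saturated (kept V E r) G \<longrightarrow> bfs_dist V (kept V E r) {r, s} d \<longrightarrow>
      (\<exists>i. \<forall>g. matches V E r G d i g \<longrightarrow> alternating_connected V (colour_perms E g)))"
proof (cases "has_odd E \<and> critical E \<noteq> {}")
  case False
  have eV: "edges_in V E" by (rule simple_graph_edges_in[OF fg])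
  have crit: "critical E = {}" using False by (auto simp: critical_def)
  have whole: "core V E r = V" "kept V E r = E" if "r \<in> V" for r
    using core_whole[OF fg, of r] crit J that by (auto simp: joined_def)
  have b: "(i \<and> u \<notin> V) = (i \<and> w \<notin> V)" if "{u, w} \<in> E" for i u w
    using that eV by (auto simp: edges_in_def)
  have reach: "\<forall>v\<in>V. \<exists>x\<in>{r, r}. (x, v) \<in> (adj E)\<^sup>*" if "r \<in> V" for r
    using J that by (auto simp: joined_def)
  show ?thesis
  proof (cases "has_odd E")
    case nodd: False
    then have "almost_two_edge_connected V E" using cond by blast
    then obtain s t where st: "s \<in> V" "t \<in> V" "\<And>e. e \<in> E \<Longrightarrow> joined V (insert {s, t} (E - {e}))"
      unfolding almost_two_edge_connected_iff[OF fg] by blast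
    show ?thesis
    proof (intro bexI[of _ s] conjI allI impI exI[of _ False])
      fix G d g assume *: "saturated (kept V E s) G" "bfs_dist V (kept V E s) {s, s} d" "matches V E s G d False g"
      show "alternating_connected V (colour_perms E g)"
      proof (rule alternating_bipartite[OF fg J nodd st(1,2,3) _ _ b])
        show "saturated E G" "bfs_dist V E {s} d" using *(1,2) whole[OF st(1)] by simp_all
        show "oriented G d (\<lambda>v. False \<and> v \<notin> V) \<subseteq> colour_perms E g"
          using matches_oriented[OF *(3,1)] whole[OF st(1)] by simp
      qed (auto simp: sym_perms_colour)
    qed (use reach st whole in auto)
  next
    case odd: True
    have odd': "has_odd (E - {e})" if "e \<in> E" for e using crit odd that by (auto simp: critical_def)
    \<comment> \<open>The bridges of the graph. Removing them keeps an odd closed walk, and the root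
      is taken on it.\<close>
    let ?W = "{e \<in> E. \<forall>u w. e = {u, w} \<longrightarrow> (u, w) \<notin> (adj (E - {e}))\<^sup>*}"
    have "has_odd (E - ?W)"
    proof (rule has_odd_remove_bridges[OF _ odd])
      show "finite ?W" using simple_graph_finite[OF fg] by simp
      fix e assume "e \<in> ?W"
      then have "e \<in> E" by blast
      then obtain u w where "e = {u, w}" by (rule simple_graph_edge[OF fg])
      then show "\<exists>u w. e = {u, w}" by blast
    qed blast
    then obtain r where r: "((r, False), (r, True)) \<in> linked (E - ?W)" by (auto simp: has_odd_def)
    then have rV: "r \<in> V"
      unfolding linked_def by (cases rule: rtranclE) (use eV in \<open>auto simp: arcs_def edges_in_def\<close>)
    show ?thesis
    proof (intro bexI[of _ r] conjI allI impI exI[of _ False])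
      fix G d g assume *: "saturated (kept V E r) G" "bfs_dist V (kept V E r) {r, r} d" "matches V E r G d False g"
      show "alternating_connected V (colour_perms E g)"
      proof (rule alternating_no_critical[OF fg J odd' rV r])
        show "saturated E G" "bfs_dist V E {r} d" using *(1,2) whole[OF rV] by simp_all
        show "oriented G d (\<lambda>v. False) \<subseteq> colour_perms E g"
          using matches_oriented[OF *(3,1)] by simp
      qed (auto simp: sym_perms_colour)
    qed (use reach rV whole in auto)
  qed
next
  case True
  then have odd: "has_odd E" and crit: "critical E \<noteq> {}" by auto
  have eV: "edges_in V E" by (rule simple_graph_edges_in[OF fg])
  have SE: "critical E = {e \<in> E. \<not> has_odd (E - {e})}" using odd by (simp add: critical_def)
  have eVS: "edges_in V (E - critical E)" by (rule edges_in_subset[OF eV]) blast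
  obtain K where K: "K \<in> stubborn_free_components V E"
    "V - K = {} \<or> almost_two_edge_connected (V - K) (induced_edges (V - K) E)"
    using cond odd by blast
  then obtain m where m: "m \<in> V" "K = {v \<in> V. (m, v) \<in> (adj (E - critical E))\<^sup>*}"
    unfolding stubborn_free_components_def stubborn_edges_eq[OF eV] SE[symmetric] components_eq[OF eVS] by blast
  have Kc: "K = {v \<in> V. (c, v) \<in> (adj (E - critical E))\<^sup>*}" if "c \<in> K" for c
    using that adj_rtrancl_sym[of m c "E - critical E"] unfolding m(2) by (auto intro: rtrancl_trans)
  interpret critical_piece V E "critical E" K
  proof
    show "K \<subseteq> V" "K \<noteq> {}" using m by auto
    show "(u, w) \<in> (adj (E - critical E))\<^sup>*" if "u \<in> K" "w \<in> K" for u w using Kc[OF that(1)] that(2) by blast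
    show "w \<in> K" if "u \<in> K" "(u, w) \<in> adj (E - critical E)" for u w
    proof -
      have "w \<in> V" using that(2) eVS by (auto simp: adj_def edges_in_def)
      then show ?thesis using Kc[OF that(1)] that(2) by auto
    qed
  qed (use fg J odd SE in auto)
  have coreK: "core V E c = K" if "c \<in> K" for c using Kc[OF that] by (simp add: core_def)
  show ?thesis
  proof (cases "V - K = {}")
    case True
    then have KV: "K = V" using m by auto
    obtain e where e: "e \<in> critical E" using crit by blast
    then have "e \<in> E" by (simp add: critical_def)
    then obtain c1 c2 where c: "e = {c1, c2}" "c1 \<in> V" "c2 \<in> V" by (rule simple_graph_edge[OF fg])
    have kE: "kept V E c1 = E - critical E"
      by (rule core_whole[OF fg]) (use Kc[of c1] c KV in auto)
    have co: "core V E c1 = V" using coreK KV c by blast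
    have reach: "\<forall>v\<in>V. \<exists>x\<in>{c1, c1}. (x, v) \<in> (adj (E - critical E))\<^sup>*" using Kc[of c1] c KV by blast
    show ?thesis
    proof (intro bexI[of _ c1] conjI allI impI exI[of _ False])
      fix G d g assume *: "saturated (kept V E c1) G" "bfs_dist V (kept V E c1) {c1, c1} d" "matches V E c1 G d False g"
      show "alternating_connected V (colour_perms E g)"
      proof (rule alternating_whole[OF KV e[unfolded c(1)] refl])
        show "saturated (E - critical E) G" "bfs_dist V (E - critical E) {c1} d" using *(1,2) kE by simp_all
        show "oriented G d (\<lambda>v. False) \<subseteq> colour_perms E g"
          using matches_oriented[OF *(3,1)] by simp
        \<comment> \<open>At the root the level bit is \<open>False\<close>, the colour that
          \<open>matches\<close> prescribes inside the core.\<close>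
        show "(c1, c2, level_bit d (\<lambda>v. False) c1) \<in> colour_perms E g"
        proof -
          have "\<not> level_bit d (\<lambda>v. False) c1" using *(2) by (simp add: level_bit_def bfs_dist_def)
          moreover have "\<not> g {c1, c2}" using *(3) e c co kE \<open>e \<in> E\<close> unfolding matches_def by simp
          ultimately show ?thesis using c \<open>e \<in> E\<close> by (auto simp: colour_perms_def)
        qed
      qed (auto simp: sym_perms_colour)
    qed (use reach c kE in auto)
  next
    case ne: False
    then have al: "almost_two_edge_connected (V - K) (induced_edges (V - K) E)" using K(2) by blast
    have iE: "induced_edges (V - K) E = {e \<in> E. e \<subseteq> V - K}" by (simp add: induced_edges_def)
    have fg': "finite_simple_graph (V - K) {e \<in> E. e \<subseteq> V - K}"
      using finite_simple_graph_induced[OF fg Diff_subset, of K] unfolding iE .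
    from al[unfolded iE] obtain s t where st: "s \<in> V - K" "t \<in> V - K" "joined (V - K) {e \<in> E. e \<subseteq> V - K}"
      "\<And>e. e \<in> E \<Longrightarrow> e \<subseteq> V - K \<Longrightarrow> joined (V - K) (insert {s, t} ({e \<in> E. e \<subseteq> V - K} - {e}))"
      unfolding almost_two_edge_connected_iff[OF fg'] by blast
    obtain c1 a1 c2 a2 where c: "{c1, a1} \<in> critical E" "{c2, a2} \<in> critical E" "{c1, a1} \<noteq> {c2, a2}"
      "c1 \<in> K" "c2 \<in> K" "a1 \<in> V - K" "a2 \<in> V - K"
      "\<And>v z. v \<in> K \<Longrightarrow> z \<notin> K \<Longrightarrow> {v, z} \<in> E \<Longrightarrow> {v, z} = {c1, a1} \<or> {v, z} = {c2, a2}"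
      using two_boundary_edges[OF ne] by blast
    have co: "core V E c1 = K" by (rule coreK[OF c(4)])
    have kF: "kept V E c1 = {e \<in> E - critical E. e \<subseteq> K} \<union> {e \<in> E. e \<inter> K = {}}"
      by (simp add: kept_def co)
    have reach: "\<exists>x\<in>{c1, s}. (x, v) \<in> (adj (kept V E c1))\<^sup>*" if v: "v \<in> V" for v
    proof (cases "v \<in> K")
      case True
      have "(c1, v) \<in> (adj {e \<in> E - critical E. e \<subseteq> K})\<^sup>*"
        using inner_path[OF c(4) Kconn[OF c(4) True]] by blast
      then have "(c1, v) \<in> (adj (kept V E c1))\<^sup>*" by (rule adj_mono[rotated]) (auto simp: kF)
      then show ?thesis by blast
    next
      case False
      then have "(s, v) \<in> (adj {e \<in> E. e \<subseteq> V - K})\<^sup>*" using st(1,3) v by (simp add: joined_def)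
      then have "(s, v) \<in> (adj (kept V E c1))\<^sup>*" by (rule adj_mono[rotated]) (auto simp: kF)
      then show ?thesis by blast
    qed
    have nk: "{c1, a1} \<notin> kept V E c1" "{c2, a2} \<notin> kept V E c1" using c(1-5) by (auto simp: kF)
    have cE: "{c1, a1} \<in> E" "{c2, a2} \<in> E" using c(1,2) by (auto simp: critical_def)
    show ?thesis
    proof (rule bexI[of _ c1], rule bexI[of _ s], intro conjI allI impI)
      show "\<forall>v\<in>V. \<exists>x\<in>{c1, s}. (x, v) \<in> (adj (kept V E c1))\<^sup>*" using reach by blast
      fix G d assume *: "saturated (kept V E c1) G" "bfs_dist V (kept V E c1) {c1, s} d"
      obtain i where i: "\<And>C. oriented G d (\<lambda>v. i \<and> v \<notin> K) \<subseteq> C \<Longrightarrow> sym_perms C \<Longrightarrow>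
          (c1, a1, level_bit d (\<lambda>v. i \<and> v \<notin> K) c1) \<in> C \<Longrightarrow> (c2, a2, level_bit d (\<lambda>v. i \<and> v \<notin> K) c2) \<in> C \<Longrightarrow>
          alternating_connected V C"
        using alternating_source[OF c kF st(3,1,2,4) *] by blast
      show "\<exists>i. \<forall>g. matches V E c1 G d i g \<longrightarrow> alternating_connected V (colour_perms E g)"
      proof (intro exI[of _ i] allI impI)
        fix g assume g: "matches V E c1 G d i g"
        show "alternating_connected V (colour_perms E g)"
          by (rule i) (use matches_oriented[OF g *(1)] matches_cross[OF g cE(1) nk(1)] matches_cross[OF g cE(2) nk(2)]
              co c(4-7) sym_perms_colour in auto)
      qed
    qed (use st c(4) m in auto)
  qed
qed

text \<open>The truth value stands for the Boolean colour. A single permission decides; of two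
  permissions the choice of \<open>oriented\<close> is taken; without any permission the rule for
  edges coloured by hand in \<open>matches\<close> applies.\<close>

definition two_colour ::
    "('a \<times> 'a \<times> bool) set \<Rightarrow> ('a \<Rightarrow> nat) \<Rightarrow> 'a set \<Rightarrow> bool \<Rightarrow> 'a \<Rightarrow> 'a \<Rightarrow> bool" where
  "two_colour G d K i x y =
     (let b = level_bit d (\<lambda>v. i \<and> v \<notin> K) in
      if (x, y, True) \<in> G
      then (x, y, False) \<in> G \<longrightarrow> (if d x < d y then b y else d y < d x \<and> b x)
      else (x, y, False) \<notin> G \<and> (if x \<in> K then y \<notin> K \<and> b x else y \<in> K \<and> b y))"

lemma two_colour_commute: "sym_perms G \<Longrightarrow> two_colour G d K i x y = two_colour G d K i y x"
proof -
  assume "sym_perms G"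
  then have "(x, y, k) \<in> G \<longleftrightarrow> (y, x, k) \<in> G" for k unfolding sym_perms_def by blast
  then show ?thesis unfolding two_colour_def Let_def by auto
qed

lemma matches_two_colour:
  assumes sat: "saturated (kept V E r) G" and g: "\<And>x y. {x, y} \<in> E \<Longrightarrow> g {x, y} = two_colour G d (core V E r) i x y"
  shows "matches V E r G d i g"
  unfolding matches_def
proof (intro conjI allI impI)
  fix u w k assume o: "(u, w, k) \<in> oriented G d (\<lambda>v. i \<and> v \<notin> core V E r)"
  then have "(u, w, k) \<in> G" by (simp add: oriented_def)
  moreover have "G \<subseteq> free (kept V E r)" using sat by (simp add: saturated_def)
  ultimately have "{u, w} \<in> kept V E r" by auto
  then have uw: "{u, w} \<in> E" using kept_subset by (rule subsetD[rotated])
  show "g {u, w} = k" unfolding g[OF uw] two_colour_def Let_def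
    using o unfolding oriented_def by (cases k) auto
next
  fix u w assume uw: "{u, w} \<in> E" "{u, w} \<notin> kept V E r" "u \<in> core V E r"
  have "(u, w, k) \<notin> G" for k using sat uw(2) unfolding saturated_def by auto
  then show "g {u, w} = (w \<notin> core V E r \<and> level_bit d (\<lambda>v. i \<and> v \<notin> core V E r) u)"
    unfolding g[OF uw(1)] two_colour_def Let_def using uw(3) by simp
qed

section \<open>Trees\<close>

text \<open>A simple path between the ends of an edge that avoids it closes to a cycle. Conversely,
  the rest of a cycle joins the ends of its first edge and, having distinct vertices, does not use
  it.\<close>

lemma no_cycle_iff_bridges:
  assumes fg: "finite_simple_graph V E"
  shows "(\<nexists>p. is_cycle V E p) \<longleftrightarrow> (\<forall>u w. {u, w} \<in> E \<longrightarrow> (u, w) \<notin> (adj (E - {{u, w}}))\<^sup>*)"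
proof
  assume nc: "\<nexists>p. is_cycle V E p"
  show "\<forall>u w. {u, w} \<in> E \<longrightarrow> (u, w) \<notin> (adj (E - {{u, w}}))\<^sup>*"
  proof (intro allI impI notI)
    fix u w assume uw: "{u, w} \<in> E" and path: "(u, w) \<in> (adj (E - {{u, w}}))\<^sup>*"
    let ?E = "E - {{u, w}}" and ?r = "\<lambda>x y. (x, y) \<in> adj (E - {{u, w}})"
    have ne: "u \<noteq> w" by (rule simple_graph_no_loop[OF fg uw])
    have uV: "u \<in> V" using uw simple_graph_edges_in[OF fg] by (auto simp: edges_in_def)
    have "?r\<^sup>*\<^sup>* u w" using path by (simp add: rtranclp_rtrancl_eq)
    then obtain xs0 where "rtrancl_path ?r u xs0 w" by (auto simp: rtranclp_eq_rtrancl_path)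
    then obtain xs where xs: "rtrancl_path ?r u xs w" "distinct (u # xs)" by (rule rtrancl_path_distinct)
    have walk: "is_walk V ?E (x # xs) \<and> last (x # xs) = y" if "rtrancl_path ?r x xs y" "x \<in> V" for x xs y
      using that
    proof (induction rule: rtrancl_path.induct)
      case (step x y ys z)
      then have e: "{x, y} \<in> E" "{x, y} \<in> ?E" by (auto simp: adj_def)
      then have "y \<in> V" using simple_graph_edges_in[OF fg] by (auto simp: edges_in_def)
      then show ?case using step e by auto
    qed auto
    have w: "is_walk V ?E (u # xs)" "last (u # xs) = w" using walk[OF xs(1) uV] by auto
    obtain x1 xs' where xs': "xs = x1 # xs'" using w(2) ne by (cases xs) auto
    have "xs' \<noteq> []" using w xs' by auto
    have "is_walk V E (u # xs)" using w(1) by (auto simp: is_walk_def)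
    moreover have "w \<in> V" using w(1) last_in_set[of "u # xs"] unfolding w(2) by (auto simp: is_walk_def)
    ultimately have "is_walk V E (w # u # xs)" using uw by (simp add: insert_commute)
    then have "is_cycle V E (w # u # xs)"
      unfolding is_cycle_def closed_walk_def walk_length_def using w(2) xs(2) xs' \<open>xs' \<noteq> []\<close>
      by (cases xs') auto
    then show False using nc by blast
  qed
next
  assume br: "\<forall>u w. {u, w} \<in> E \<longrightarrow> (u, w) \<notin> (adj (E - {{u, w}}))\<^sup>*"
  show "\<nexists>p. is_cycle V E p"
  proof
    assume "\<exists>p. is_cycle V E p"
    then obtain p where p: "is_walk V E p" "hd p = last p" "length p \<ge> 4" "distinct (tl p)"
      by (auto simp: is_cycle_def closed_walk_def walk_length_def)
    obtain x p' where x: "p = x # p'" using p(3) by (cases p) auto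
    obtain y q where "p' = y # q" using p(3) x by (cases p') auto
    with x have q: "p = x # y # q" by simp
    have e: "{x, y} \<in> E" "is_walk V E (y # q)" "distinct (y # q)" "length q \<ge> 2" "last (y # q) = x"
      using p unfolding q is_walk_Cons_Cons by simp_all
    have "is_walk V (E - {{x, y}}) (y # q)"
      unfolding is_walk_def
    proof (intro conjI allI impI)
      show "set (y # q) \<subseteq> V" using e(2) by (simp add: is_walk_def)
      fix i assume i: "Suc i < length (y # q)"
      let ?l = "y # q"
      have lx: "x = ?l ! (length q)" using e(5) last_conv_nth[of ?l] by (simp del: last.simps)
      have "{?l ! i, ?l ! Suc i} \<noteq> {x, y}"
      proof
        assume eq: "{?l ! i, ?l ! Suc i} = {x, y}"
        have "Suc i = length q \<or> i = length q"
        proof -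
          have "?l ! i = x \<or> ?l ! Suc i = x" using eq by (auto simp: doubleton_eq_iff)
          then show ?thesis using i lx nth_eq_iff_index_eq[OF e(3), of i "length q"] nth_eq_iff_index_eq[OF e(3), of "Suc i" "length q"] by auto
        qed
        moreover have "i = 0"
        proof -
          have "?l ! i = ?l ! 0 \<or> ?l ! Suc i = ?l ! 0" using eq by (auto simp: doubleton_eq_iff)
          then show ?thesis using i nth_eq_iff_index_eq[OF e(3), of i 0] nth_eq_iff_index_eq[OF e(3), of "Suc i" 0] by auto
        qed
        ultimately show False using e(4) by auto
      qed
      moreover have "{?l ! i, ?l ! Suc i} \<in> E" using e(2) i by (simp add: is_walk_def)
      ultimately show "{?l ! i, ?l ! Suc i} \<in> E - {{x, y}}" by simp
    qed simp
    from walk_adj[OF this] have "(y, x) \<in> (adj (E - {{x, y}}))\<^sup>*" using e(5) by simp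
    from adj_rtrancl_sym[OF this] show False using br e(1) by blast
  qed
qed

section \<open>The lower bound for trees\<close>

lemma adj_avoid_vertex:
  assumes "(z, w) \<in> (adj A)\<^sup>*" "(z, y) \<notin> (adj A)\<^sup>*" "y \<in> e"
  shows "(z, w) \<in> (adj (A - {e}))\<^sup>*"
  using assms(1)
proof (induction rule: rtrancl_induct)
  case (step a c)
  have "{a, c} \<noteq> e"
  proof
    assume "{a, c} = e"
    then have "y = a \<or> y = c" using assms(3) by auto
    then show False using assms(2) step(1) rtrancl_into_rtrancl[OF step(1,2)] by blast
  qed
  then have "(a, c) \<in> adj (A - {e})" using step(2) by (simp add: adj_def)
  with step.IH show ?case by (rule rtrancl_into_rtrancl)
qed simp

text \<open>A properly coloured walk cannot turn back along the edge it has just used, so where all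
  edges are bridges everything after the first step stays beyond that step.\<close>

lemma proper_walk_in_tree:
  assumes br: "\<And>u w. {u, w} \<in> E \<Longrightarrow> (u, w) \<notin> (adj (E - {{u, w}}))\<^sup>*"
    and "is_walk V E (x # y # q)" "properly_coloured c (x # y # q)" "w \<in> set (y # q)"
  shows "(y, w) \<in> (adj (E - {{x, y}}))\<^sup>*"
  using assms(2-4)
proof (induction q arbitrary: x y)
  case (Cons z q)
  have E: "{x, y} \<in> E" "{y, z} \<in> E" "{y, z} \<noteq> {x, y}" using Cons.prems by auto
  show ?case
  proof (cases "w = y")
    case False
    then have "(z, w) \<in> (adj (E - {{y, z}}))\<^sup>*" using Cons by auto
    moreover have "(z, y) \<notin> (adj (E - {{y, z}}))\<^sup>*" using br[OF E(2)] adj_rtrancl_sym by metis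
    ultimately have "(z, w) \<in> (adj (E - {{y, z}} - {{x, y}}))\<^sup>*" by (rule adj_avoid_vertex) simp
    then have "(z, w) \<in> (adj (E - {{x, y}}))\<^sup>*" by (rule adj_mono[rotated]) blast
    moreover have "(y, z) \<in> adj (E - {{x, y}})" using E by (simp add: adj_def)
    ultimately show ?thesis by (rule converse_rtrancl_into_rtrancl[rotated])
  qed simp
qed simp

lemma tree_neighbour_colours:
  assumes fg: "finite_simple_graph V E"
    and br: "\<And>u w. {u, w} \<in> E \<Longrightarrow> (u, w) \<notin> (adj (E - {{u, w}}))\<^sup>*"
    and con: "connecting_colouring V E k c" and ab: "{a, v} \<in> E" "{v, b} \<in> E" "a \<noteq> b"
  shows "c {a, v} \<noteq> c {v, b}"
proof
  assume eq: "c {a, v} = c {v, b}"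
  have eV: "edges_in V E" by (rule simple_graph_edges_in[OF fg])
  have V: "a \<in> V" "b \<in> V" using ab eV by (auto simp: edges_in_def)
  have nl: "a \<noteq> v" "v \<noteq> b" using simple_graph_no_loop[OF fg] ab by auto
  obtain p where p: "is_walk V E p" "hd p = a" "last p = b" "properly_coloured c p"
    using con V unfolding connecting_colouring_def walk_between_def by blast
  then obtain q0 where q0: "p = a # q0" by (cases p) (auto simp: is_walk_def)
  then obtain y q where q: "p = a # y # q" using p(3) ab(3) by (cases q0) auto
  have bset: "b \<in> set (y # q)" using p(3) q last_in_set[of "y # q"] by simp
  show False
  proof (cases "y = v")
    case False
    have "(y, b) \<in> (adj (E - {{a, y}}))\<^sup>*"
      by (rule proper_walk_in_tree[OF br _ _ bset]) (use p q in auto)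
    moreover have "(b, v) \<in> adj (E - {{a, y}})" "(v, a) \<in> adj (E - {{a, y}})"
      using ab nl False by (auto simp: adj_def insert_commute doubleton_eq_iff)
    ultimately have "(y, a) \<in> (adj (E - {{a, y}}))\<^sup>*" by (meson rtrancl_into_rtrancl)
    from adj_rtrancl_sym[OF this] show False using br[of a y] p(1) q by simp
  next
    case True
    then obtain z q' where q': "q = z # q'" using p(3) q nl by (cases q) auto
    have w: "is_walk V E (v # z # q')" "properly_coloured c (v # z # q')" "c {a, v} \<noteq> c {v, z}"
      using p(1,4) q q' True by auto
    then have zb: "z \<noteq> b" using eq by auto
    have "b \<in> set (z # q')" using bset q' True nl by auto
    from proper_walk_in_tree[OF br w(1,2) this] have zb': "(z, b) \<in> (adj (E - {{v, z}}))\<^sup>*" .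
    have "(b, v) \<in> adj (E - {{v, z}})" using ab(2) zb by (auto simp: adj_def insert_commute doubleton_eq_iff)
    with zb' have "(z, v) \<in> (adj (E - {{v, z}}))\<^sup>*" by (rule rtrancl_into_rtrancl)
    from adj_rtrancl_sym[OF this] show False using br[of v z] w(1) by simp
  qed
qed

lemma degree_of_eq:
  assumes fg: "finite_simple_graph V E"
  shows "degree_of E v = card {w. {v, w} \<in> E}"
proof -
  have "{e \<in> E. v \<in> e} = (\<lambda>w. {v, w}) ` {w. {v, w} \<in> E}"
  proof (intro equalityI subsetI)
    fix e assume e: "e \<in> {e \<in> E. v \<in> e}"
    obtain x y where xy: "e = {x, y}" using e by (auto elim: simple_graph_edge[OF fg])
    then have "e = {v, x} \<or> e = {v, y}" using e by auto
    then show "e \<in> (\<lambda>w. {v, w}) ` {w. {v, w} \<in> E}" using e by auto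
  qed auto
  moreover have "inj_on (\<lambda>w. {v, w}) {w. {v, w} \<in> E}" by (auto simp: inj_on_def doubleton_eq_iff)
  ultimately show ?thesis by (simp add: degree_of_def card_image)
qed

lemma tree_max_degree_le:
  assumes fg: "finite_simple_graph V E" and ne: "V \<noteq> {}"
    and br: "\<And>u w. {u, w} \<in> E \<Longrightarrow> (u, w) \<notin> (adj (E - {{u, w}}))\<^sup>*"
    and con: "connecting_colouring V E k c"
  shows "max_degree V E \<le> k"
proof -
  have "degree_of E v \<le> k" for v
  proof -
    have "inj_on c {e \<in> E. v \<in> e}"
    proof (rule inj_onI)
      fix e e' assume e: "e \<in> {e \<in> E. v \<in> e}" "e' \<in> {e \<in> E. v \<in> e}" "c e = c e'"
      obtain a where a: "e = {a, v}" using e(1) by (auto elim: simple_graph_edge[OF fg])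
      obtain b where b: "e' = {v, b}" using e(2) by (auto elim: simple_graph_edge[OF fg])
      show "e = e'"
      proof (rule ccontr)
        assume "e \<noteq> e'"
        then have "a \<noteq> b" using a b by auto
        then show False using tree_neighbour_colours[OF fg br con, of a v b] e a b by simp
      qed
    qed
    moreover have "c ` {e \<in> E. v \<in> e} \<subseteq> {1..k}" using con by (auto simp: connecting_colouring_def)
    ultimately have "card {e \<in> E. v \<in> e} \<le> card {1..k}" by (intro card_inj_on_le[of c]) auto
    then show ?thesis by (simp add: degree_of_def)
  qed
  then show ?thesis unfolding max_degree_def using simple_graph_finite[OF fg] ne by simp
qed

text \<open>A proper edge-colouring connects: whenever the next edge repeats the colour of the last one,
  it is the same edge, and its other end was reached before.\<close>

lemma connecting_proper_edge_colouring:
  assumes fg: "finite_simple_graph V E" and J: "joined V E" and c: "c \<in> E \<rightarrow> {1..k}"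
    and proper: "\<And>a v b. {a, v} \<in> E \<Longrightarrow> {v, b} \<in> E \<Longrightarrow> a \<noteq> b \<Longrightarrow> c {a, v} \<noteq> c {v, b}"
  shows "connecting_colouring V E k c"
proof -
  let ?R = "steps (colour_perms E c)"
  have reach: "\<exists>j. ((u, 0), (v, j)) \<in> ?R\<^sup>*" if "(u, v) \<in> (adj E)\<^sup>*" for u v
    using that
  proof (induction rule: rtrancl_induct)
    case base
    show ?case by blast
  next
    case (step v w)
    then obtain j where j: "((u, 0), (v, j)) \<in> ?R\<^sup>*" by blast
    have vw: "{v, w} \<in> E" using step(2) by (simp add: adj_def)
    show ?case
    proof (cases "c {v, w} = j")
      case False
      then have "((v, j), (w, c {v, w})) \<in> ?R" using vw by (auto simp: steps_def colour_perms_def)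
      with j show ?thesis by (meson rtrancl_into_rtrancl)
    next
      case True
      from j show ?thesis
      proof (cases rule: rtranclE)
        case base
        then have "c {v, w} = 0" using True by simp
        moreover have "c {v, w} \<in> {1..k}" using c vw by blast
        ultimately show ?thesis by simp
      next
        case (step y)
        then obtain v' where v': "fst y = v'" "{v', v} \<in> E" "j = c {v', v}"
          by (auto simp: steps_def colour_perms_def)
        have "v' = w" using proper[OF v'(2) vw] v'(3) True by auto
        then show ?thesis using step(1) v'(1) by (cases y) auto
      qed
    qed
  qed
  show ?thesis unfolding connecting_colouring_def
  proof (intro conjI ballI)
    fix u v assume uv: "u \<in> V" "v \<in> V"
    then obtain j where "((u, 0), (v, j)) \<in> ?R\<^sup>*" using J reach unfolding joined_def by blast
    then show "\<exists>p. walk_between V E u p v \<and> properly_coloured c p"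
      using proper_walk_iff[of E c c V u v] simple_graph_edges_in[OF fg] uv by (metis nat.simps(3) zero_neq_one n_not_Suc_n)
  qed (rule c)
qed

section \<open>Colouring a tree outwards from a root\<close>

definition is_parent :: "'a set \<Rightarrow> 'a set set \<Rightarrow> 'a set \<Rightarrow> ('a \<Rightarrow> nat) \<Rightarrow> ('a \<Rightarrow> 'a) \<Rightarrow> bool" where
  "is_parent V F R d par \<longleftrightarrow> (\<forall>v\<in>V - R. par v \<in> V \<and> {par v, v} \<in> F \<and> d v = Suc (d (par v)))"

lemma mod_add_cancel_less:
  fixes i j s m :: nat
  assumes "i < m" "j < m" "(s + i) mod m = (s + j) mod m"
  shows "i = j"
proof -
  have le: "i = j" if "i \<le> j" "j < m" "(s + i) mod m = (s + j) mod m" for i j :: nat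
  proof -
    have "m dvd (s + j) - (s + i)" using that mod_eq_dvd_iff_nat[of "s + i" "s + j" m] by auto
    then have "m dvd j - i" by simp
    moreover have "j - i < m" using that by simp
    ultimately have "j - i = 0" by (metis dvd_imp_le not_le gr0I)
    then show ?thesis using that by simp
  qed
  show ?thesis using le[of i j] le[of j i] assms by (cases "i \<le> j") auto
qed

text \<open>Colours are distributed over the children of a vertex cyclically, starting behind the colour of
  the edge to its parent.\<close>

lemma tree_colouring:
  assumes fg: "finite_simple_graph V E" and J: "joined V E" and r: "r \<in> V"
    and br: "\<And>u w. {u, w} \<in> E \<Longrightarrow> (u, w) \<notin> (adj (E - {{u, w}}))\<^sup>*"
    and par: "is_parent V E {r} d par" and h: "inj_on h V"
    and idx: "\<And>v. idx v = card {w \<in> V - {r}. par w = par v \<and> h w < (h v :: nat)}"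
    and D: "D = max_degree V E"
    and sm: "\<And>v. v \<in> V \<Longrightarrow> v \<noteq> r \<Longrightarrow> sm v = (sm (par v) + Suc (idx v)) mod D" "sm r = 0"
    and c: "\<And>v. v \<in> V \<Longrightarrow> v \<noteq> r \<Longrightarrow> c {par v, v} = Suc (sm v)"
  shows "connecting_colouring V E D c"
proof (rule connecting_proper_edge_colouring[OF fg J])
  have eV: "edges_in V E" by (rule simple_graph_edges_in[OF fg])
  have fin: "finite V" "finite E" using simple_graph_finite[OF fg] by auto
  have par': "par v \<in> V" "{par v, v} \<in> E" "d v = Suc (d (par v))" if "v \<in> V" "v \<noteq> r" for v
    using par that unfolding is_parent_def by auto
  let ?T = "{{par v, v} | v. v \<in> V \<and> v \<noteq> r}"
  have up: "(v, r) \<in> (adj ?T)\<^sup>*" if "v \<in> V" for v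
    using that
  proof (induction "d v" arbitrary: v rule: less_induct)
    case less
    show ?case
    proof (cases "v = r")
      case False
      have "(par v, r) \<in> (adj ?T)\<^sup>*" using less par'[OF less.prems False] by simp
      moreover have "(v, par v) \<in> adj ?T" using less.prems False by (auto simp: adj_def insert_commute)
      ultimately show ?thesis by (rule converse_rtrancl_into_rtrancl[rotated])
    qed simp
  qed
  have TE: "?T \<subseteq> E" using par' by auto
  \<comment> \<open>The parent edges alone connect the tree, so any other edge would not be a
    bridge.\<close>
  have edge: "(w \<noteq> r \<and> par w = u) \<or> (u \<noteq> r \<and> par u = w)" if uw: "{u, w} \<in> E" for u w
  proof (rule ccontr)
    assume n: "\<not> ?thesis"
    have V: "u \<in> V" "w \<in> V" using uw eV by (auto simp: edges_in_def)
    have "{u, w} \<notin> ?T" using n by (auto simp: doubleton_eq_iff)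
    then have sub: "?T \<subseteq> E - {{u, w}}" using TE by blast
    have "(u, w) \<in> (adj ?T)\<^sup>*" using up[OF V(1)] adj_rtrancl_sym[OF up[OF V(2)]] by (rule rtrancl_trans)
    then show False using br[OF uw] adj_mono[OF sub] by blast
  qed
  have deg: "card {w. {u, w} \<in> E} \<le> D" if "u \<in> V" for u
  proof -
    have "card {w. {u, w} \<in> E} = degree_of E u" by (rule degree_of_eq[OF fg, symmetric])
    also have "\<dots> \<le> D" unfolding D max_degree_def using fin that by (intro Max_ge) auto
    finally show ?thesis .
  qed
  let ?ch = "\<lambda>u. {w \<in> V - {r}. par w = u}"
  have nb: "?ch u \<subseteq> {w. {u, w} \<in> E}" for u using par' by auto
  have finn: "finite {w. {u, w} \<in> E}" for u
    by (rule finite_subset[OF _ fin(1)]) (use eV in \<open>auto simp: edges_in_def\<close>)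
  have ch: "card (?ch u) \<le> D" if "u \<in> V" for u
    using card_mono[OF finn nb] deg[OF that] by (rule order_trans)
  \<comment> \<open>The edge to the parent takes one of the at most \<open>D\<close> places at
    \<open>u\<close>.\<close>
  have ch': "card (?ch u) < D" if u: "u \<in> V" "u \<noteq> r" for u
  proof -
    have "par u \<in> {w. {u, w} \<in> E}" using par'(2)[OF u] by (simp add: insert_commute)
    moreover have "par u \<notin> ?ch u" using par'(3)[OF u] par'(3)[of "par u"] by auto
    ultimately have "card (?ch u) < card {w. {u, w} \<in> E}" using nb finn by (intro psubset_card_mono) auto
    then show ?thesis using deg[OF u(1)] by simp
  qed
  have idx_lt: "idx v < card (?ch (par v))" if "v \<in> V" "v \<noteq> r" for v
    unfolding idx by (rule psubset_card_mono) (use fin that in auto)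
  have idx_inj: "idx v \<noteq> idx w" if "v \<in> V" "v \<noteq> r" "w \<in> V" "w \<noteq> r" "par v = par w" "v \<noteq> w" for v w
  proof -
    have lt: "idx v < idx w" if "h v < h w" "v \<in> V" "v \<noteq> r" "par v = par w" for v w
      unfolding idx using that fin by (intro psubset_card_mono) auto
    have "h v \<noteq> h w" using h that by (auto simp: inj_on_def)
    then show ?thesis using lt[of v w] lt[of w v] that by (cases "h v < h w") auto
  qed
  have smD: "sm v < D" if "v \<in> V" "D > 0" for v using sm that by (cases "v = r") auto
  show "c {a, v} \<noteq> c {v, b}" if ab: "{a, v} \<in> E" "{v, b} \<in> E" "a \<noteq> b" for a v b
  proof -
    have V: "a \<in> V" "v \<in> V" "b \<in> V" using ab eV by (auto simp: edges_in_def)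
    have Dpos: "D > 0" using deg[OF V(2)] finn[of v] ab(2) by (metis (mono_tags) card_gt_0_iff empty_iff gr0I le_zero_eq mem_Collect_eq)
    \<comment> \<open>The offset \<open>Suc (idx w)\<close> lies strictly between 0 and
      \<open>D\<close>, so the cyclic shift does not return to the colour of the parent
      edge.\<close>
    have up_down: "c {par v, v} \<noteq> c {v, w}" if "v \<noteq> r" "w \<in> V" "w \<noteq> r" "par w = v" for w
    proof -
      have "Suc (idx w) < D" using idx_lt[of w] ch'[of v] V that by simp
      then have "(sm v + Suc (idx w)) mod D \<noteq> sm v mod D"
        using mod_add_cancel_less[of "Suc (idx w)" D 0 "sm v"] by auto
      then show ?thesis using c[OF V(2) that(1)] c[OF that(2,3)] sm(1)[OF that(2,3)] that(4) smD[OF V(2) Dpos] by simp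
    qed
    consider "a \<noteq> r" "par a = v" "b \<noteq> r" "par b = v" | "v \<noteq> r" "par v = a" "b \<noteq> r" "par b = v"
      | "a \<noteq> r" "par a = v" "v \<noteq> r" "par v = b"
      using edge[OF ab(1)] edge[OF ab(2)] ab(3) by auto
    then show ?thesis
    proof cases
      case 1
      have "idx a < D" "idx b < D" using idx_lt[of a] idx_lt[of b] ch[OF V(2)] V 1 by auto
      moreover have "idx a \<noteq> idx b" using idx_inj[of a b] V 1 ab(3) by auto
      ultimately have "(sm v + Suc (idx a)) mod D \<noteq> (sm v + Suc (idx b)) mod D"
        using mod_add_cancel_less[of "idx a" D "idx b" "Suc (sm v)"] by auto
      then show ?thesis using c[of a] c[of b] sm(1)[of a] sm(1)[of b] V 1 by (simp add: insert_commute)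
    next
      case 2
      then show ?thesis using up_down[of b] V by simp
    next
      case 3
      then show ?thesis using up_down[of a] V by (simp add: insert_commute)
    qed
  qed
  show "c \<in> E \<rightarrow> {1..D}"
  proof
    fix e assume e: "e \<in> E"
    obtain u w where uw: "e = {u, w}" "u \<in> V" "w \<in> V" by (rule simple_graph_edge[OF fg e])
    then obtain v where v: "v \<in> V" "v \<noteq> r" "e = {par v, v}" using edge[of u w] e by (metis insert_commute)
    have "0 < card (?ch (par v))" using v fin by (auto simp: card_gt_0_iff)
    then have "D > 0" using ch[of "par v"] par'(1)[OF v(1,2)] by simp
    then show "c e \<in> {1..D}" using c[OF v(1,2)] smD[OF v(1)] v(3) by simp
  qed
qed

section \<open>Three colours\<close>

text \<open>Around a cycle consisting of the edge \<open>ab\<close> and a shortest path from \<open>a\<close> to \<open>b\<close> the path is coloured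
  alternately with 1 and 2 and \<open>ab\<close> with 3. At each vertex of the cycle, \<open>spoke\<close> is the colour missing
  there; trees attached to the cycle start with it.\<close>

definition spoke :: "'a \<Rightarrow> 'a \<Rightarrow> ('a \<Rightarrow> nat) \<Rightarrow> 'a \<Rightarrow> nat" where
  "spoke a b d x = (if x = a then 2 else if x = b then Suc (d b mod 2) else 3)"

text \<open>The colour of an edge ending at level \<open>m\<close> of an attached tree whose first
  colour is \<open>q\<close>; even levels use a colour different from \<open>q\<close>.\<close>

definition alternate :: "nat \<Rightarrow> nat \<Rightarrow> nat" where
  "alternate q m = (if odd m then q else if q = 1 then 2 else 1)"

definition cycle_colour ::
    "'a \<Rightarrow> 'a \<Rightarrow> ('a \<Rightarrow> nat) \<Rightarrow> ('a \<Rightarrow> nat) \<Rightarrow> ('a \<Rightarrow> 'a) \<Rightarrow> 'a \<Rightarrow> 'a \<Rightarrow> nat" where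
  "cycle_colour a b d D z x y =
     (if x = a \<and> y = b \<or> x = b \<and> y = a then 3
      else if D x = 0 \<and> D y = 0 then Suc (min (d x) (d y) mod 2)
      else if D x < D y then alternate (spoke a b d (z y)) (D y)
      else if D y < D x then alternate (spoke a b d (z x)) (D x)
      else 1)"

lemma cycle_colour_commute: "cycle_colour a b d D z x y = cycle_colour a b d D z y x"
  by (auto simp: cycle_colour_def min.commute)

lemma cycle_colour_range: "cycle_colour a b d D z x y \<in> {1..3}"
  by (auto simp: cycle_colour_def spoke_def alternate_def)

text \<open>All walks use the cycle in one direction: from \<open>u\<close> down its tree, along the
  path to \<open>b\<close>, over the edge \<open>ba\<close> to \<open>a\<close>, along the path
  again and up the tree of \<open>v\<close>. The spoke colour differs from the cycle edges at its
  vertex, so a walk may turn from a tree into the cycle and back.\<close>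

lemma three_colours_sufficient:
  assumes fg: "finite_simple_graph V E" and ab: "{a, b} \<in> E"
    and d: "bfs_dist V (E - {{a, b}}) {a} d" "is_parent V (E - {{a, b}}) {a} d pr"
    and Q: "Q = {(pr ^^ i) b | i. i \<le> d b}"
    and D: "bfs_dist V (E - {{a, b}}) Q D" "is_parent V (E - {{a, b}}) Q D par"
    and z: "\<And>v. v \<in> Q \<Longrightarrow> z v = v" "\<And>v. v \<in> V - Q \<Longrightarrow> z v = z (par v)"
    and c: "\<And>x y. {x, y} \<in> E \<Longrightarrow> c {x, y} = cycle_colour a b d D z x y"
  shows "connecting_colouring V E 3 c"
proof -
  let ?R = "(steps (colour_perms E c))\<^sup>*" and ?q = "spoke a b d" and ?l = "d b"
  have eV: "edges_in V E" by (rule simple_graph_edges_in[OF fg])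
  have V: "a \<in> V" "b \<in> V" using ab eV by (auto simp: edges_in_def)
  have ne: "a \<noteq> b" by (rule simple_graph_no_loop[OF fg ab])
  have d0: "d a = 0" using d(1) by (auto simp: bfs_dist_def)
  have pr: "pr v \<in> V" "{pr v, v} \<in> E" "d v = Suc (d (pr v))" "{pr v, v} \<noteq> {a, b}" if "v \<in> V" "v \<noteq> a" for v
    using d(2) that unfolding is_parent_def by auto
  have dpos: "d v = 0 \<longleftrightarrow> v = a" if "v \<in> V" for v using d0 pr(3)[of v] that by (cases "v = a") auto
  \<comment> \<open>The path numbered from \<open>a\<close>, whereas iterating \<open>pr\<close>
    runs from \<open>b\<close>.\<close>
  define pp where "pp j = (pr ^^ (?l - j)) b" for j
  have trail: "(pr ^^ i) b \<in> V \<and> d ((pr ^^ i) b) = ?l - i" if "i \<le> ?l" for i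
    using that
  proof (induction i)
    case 0
    show ?case using V by simp
  next
    case (Suc i)
    then have i: "(pr ^^ i) b \<in> V" "d ((pr ^^ i) b) = ?l - i" by auto
    then have "(pr ^^ i) b \<noteq> a" using Suc.prems d0 by auto
    from pr[OF i(1) this] show ?case using i(2) by simp
  qed
  have pp: "pp j \<in> V" "d (pp j) = j" "pp j \<in> Q" if "j \<le> ?l" for j
    using trail[of "?l - j"] that unfolding pp_def Q by auto
  have ppe: "{pp j, pp (Suc j)} \<in> E" "{pp j, pp (Suc j)} \<noteq> {a, b}" if "j < ?l" for j
  proof -
    have "?l - j = Suc (?l - Suc j)" using that by simp
    then have "pp j = pr (pp (Suc j))" unfolding pp_def by (simp del: diff_Suc_Suc)
    moreover have "pp (Suc j) \<noteq> a" using pp(2)[of "Suc j"] that d0 by auto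
    ultimately show "{pp j, pp (Suc j)} \<in> E" "{pp j, pp (Suc j)} \<noteq> {a, b}"
      using pr[OF pp(1)[of "Suc j"]] that by auto
  qed
  have ends: "pp 0 = a" "pp ?l = b" using dpos[of "pp 0"] pp[of 0] by (simp_all add: pp_def)
  have Qpp: "\<exists>j\<le>?l. x = pp j" if x: "x \<in> Q" for x
  proof -
    obtain i where "i \<le> ?l" "x = (pr ^^ i) b" using x unfolding Q by blast
    then show ?thesis unfolding pp_def by (intro exI[of _ "?l - i"]) simp
  qed
  have QV: "x \<in> V" if "x \<in> Q" for x using Qpp[OF that] pp(1) by auto
  have DQ: "D x = 0" if "x \<in> Q" for x using D(1) that by (auto simp: bfs_dist_def)
  have par: "par v \<in> V" "{par v, v} \<in> E" "D v = Suc (D (par v))" if "v \<in> V - Q" for v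
    using D(2) that unfolding is_parent_def by auto
  have abQ: "a \<in> Q" "b \<in> Q" using pp(3)[of 0] pp(3)[of ?l] ends by auto
  have cpp: "c {pp j, pp (Suc j)} = Suc (j mod 2)" if "j < ?l" for j
  proof -
    have "\<not> (pp j = a \<and> pp (Suc j) = b \<or> pp j = b \<and> pp (Suc j) = a)" using ppe(2)[OF that] by auto
    moreover have "D (pp j) = 0" "D (pp (Suc j)) = 0" "d (pp j) = j" "d (pp (Suc j)) = Suc j"
      using pp[of j] pp[of "Suc j"] that DQ by auto
    ultimately show ?thesis unfolding c[OF ppe(1)[OF that]] cycle_colour_def by (simp only: if_False) simp
  qed
  have cf: "c {a, b} = 3" using c[OF ab] by (simp add: cycle_colour_def)
  have cpar: "c {par v, v} = alternate (?q (z v)) (D v)" if v: "v \<in> V - Q" for v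
    using c[OF par(2)[OF v]] par(3)[OF v] abQ v by (auto simp: cycle_colour_def)
  have q0: "?q (pp j) \<noteq> Suc (j mod 2)" if "j < ?l" for j
  proof -
    have "pp j = a \<Longrightarrow> j = 0" "pp j = b \<Longrightarrow> j = ?l" using pp(2)[of j] that d0 by auto
    moreover have "j mod 2 < 2" by simp
    ultimately show ?thesis using that by (auto simp: spoke_def)
  qed
  have q1: "?q (pp (Suc j)) \<noteq> Suc (j mod 2)" if "j < ?l" for j
  proof -
    have "Suc j mod 2 \<noteq> j mod 2" "j mod 2 < 2" by presburger+
    moreover have "pp (Suc j) \<noteq> a" "pp (Suc j) = b \<Longrightarrow> Suc j = ?l" using pp(2)[of "Suc j"] that d0 by auto
    ultimately show ?thesis by (auto simp: spoke_def)
  qed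
  have step: "((x, k), (y, c {x, y})) \<in> ?R" if "{x, y} \<in> E" "k \<noteq> c {x, y}" for x y k
    by (rule r_into_rtrancl) (use that in \<open>auto simp: steps_def colour_perms_def\<close>)
  have fwd: "((pp i, k), (pp (Suc j), Suc (j mod 2))) \<in> ?R" if "i \<le> j" "j < ?l" "k \<noteq> Suc (i mod 2)" for i j k
    using that(1,2)
  proof (induction j rule: dec_induct)
    case base
    show ?case using step[OF ppe(1)[OF base], of k] cpp[OF base] that(3) by simp
  next
    case (step j)
    have "Suc j mod 2 \<noteq> j mod 2" by presburger
    then show ?case
      using step.IH \<open>\<And>x y k. {x, y} \<in> E \<Longrightarrow> k \<noteq> c {x, y} \<Longrightarrow> ((x, k), (y, c {x, y})) \<in> ?R\<close>[OF ppe(1)[OF step.prems], of "Suc (j mod 2)"]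
        cpp[OF step.prems] step.prems by (auto intro: rtrancl_trans)
  qed
  have to_a: "((x, ?q x), (a, 3)) \<in> ?R" if x: "x \<in> Q" for x
  proof -
    obtain i where i: "i \<le> ?l" "x = pp i" using Qpp[OF x] by blast
    have fin: "((b, k), (a, 3)) \<in> ?R" if "k \<noteq> 3" for k
      using step[of b a k] ab cf that by (simp add: insert_commute)
    show ?thesis
    proof (cases "i = ?l")
      case True
      then show ?thesis using i(2) ends fin[of "?q b"] ne by (auto simp: spoke_def)
    next
      case False
      then obtain j where j: "?l = Suc j" "i \<le> j" using i(1) by (cases ?l) auto
      have "((x, ?q x), (b, Suc (j mod 2))) \<in> ?R" using fwd[of i j "?q x"] q0[of i] i j ends by simp
      then show ?thesis using fin[of "Suc (j mod 2)"] by (auto intro: rtrancl_trans)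
    qed
  qed
  have from_a: "\<exists>k. k \<noteq> ?q y \<and> ((a, 3), (y, k)) \<in> ?R" if y: "y \<in> Q" for y
  proof -
    obtain i where i: "i \<le> ?l" "y = pp i" using Qpp[OF y] by blast
    show ?thesis
    proof (cases i)
      case 0
      then show ?thesis using i ends by (intro exI[of _ 3]) (simp add: spoke_def)
    next
      case (Suc j)
      then show ?thesis using fwd[of 0 j 3] q1[of j] i ends by (intro exI[of _ "Suc (j mod 2)"]) auto
    qed
  qed
  \<comment> \<open>The colour that edges from \<open>v\<close> to its children carry. A walk that
    has arrived at \<open>v\<close> with this colour may continue to the parent.\<close>
  define pend where "pend v = alternate (?q (z v)) (Suc (D v))" for v
  have alt: "alternate k m \<noteq> alternate k (Suc m)" for k m by (auto simp: alternate_def)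
  have tree: "z v \<in> Q \<and> ((v, pend v), (z v, ?q (z v))) \<in> ?R \<and>
      (\<forall>k. k \<noteq> ?q (z v) \<longrightarrow> (\<exists>k'. k' \<noteq> pend v \<and> ((z v, k), (v, k')) \<in> ?R))" if "v \<in> V" for v
    using that
  proof (induction "D v" arbitrary: v rule: less_induct)
    case less
    show ?case
    proof (cases "v \<in> Q")
      case True
      then show ?thesis using z(1) DQ by (auto simp: pend_def alternate_def)
    next
      case False
      then have v: "v \<in> V - Q" using less.prems by simp
      let ?u = "par v"
      note IH = less.hyps[OF _ par(1)[OF v]]
      have zu: "z ?u = z v" using z(2)[OF v] by simp
      have col: "c {?u, v} = pend ?u" "pend ?u \<noteq> pend v"
        using cpar[OF v] par(3)[OF v] alt[of "?q (z v)" "D v"] zu by (auto simp: pend_def)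
      have "((v, pend v), (?u, pend ?u)) \<in> ?R"
        using step[of v ?u "pend v"] par(2)[OF v] col by (simp add: insert_commute)
      then have 1: "((v, pend v), (z v, ?q (z v))) \<in> ?R" using IH par(3)[OF v] zu by (auto intro: rtrancl_trans)
      have "\<exists>k'. k' \<noteq> pend v \<and> ((z v, k), (v, k')) \<in> ?R" if k: "k \<noteq> ?q (z v)" for k
      proof -
        obtain k' where "k' \<noteq> pend ?u" "((z v, k), (?u, k')) \<in> ?R" using IH k par(3)[OF v] zu by auto
        then have "((z v, k), (v, pend ?u)) \<in> ?R"
          using step[OF par(2)[OF v], of k'] col by (auto intro: rtrancl_trans)
        then show ?thesis using col(2) by blast
      qed
      then show ?thesis using 1 IH par(3)[OF v] zu by auto
    qed
  qed
  show ?thesis unfolding connecting_colouring_def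
  proof (intro conjI ballI)
    show "c \<in> E \<rightarrow> {1..3}"
    proof
      fix e assume e: "e \<in> E"
      obtain x y where "e = {x, y}" by (rule simple_graph_edge[OF fg e])
      then show "c e \<in> {1..3}" using c[of x y] e cycle_colour_range[of a b d D z x y] by simp
    qed
    fix u v assume uv: "u \<in> V" "v \<in> V"
    obtain k where k: "k \<noteq> ?q (z v)" "((a, 3), (z v, k)) \<in> ?R" using from_a tree[OF uv(2)] by blast
    obtain k' where "((z v, k), (v, k')) \<in> ?R" using tree[OF uv(2)] k(1) by blast
    then have "((u, pend u), (v, k')) \<in> ?R"
      using tree[OF uv(1)] to_a[of "z u"] k(2) by (meson rtrancl_trans)
    then show "\<exists>p. walk_between V E u p v \<and> properly_coloured c p"
      using proper_walk_iff[of E c c V u v] eV uv by (metis n_not_Suc_n)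
  qed
qed

section \<open>The proper-walk connection number\<close>

theorem two_colouring_exists:
  assumes fg: "finite_simple_graph V E" and J: "joined V E"
    and cond: "\<not> has_odd E \<and> almost_two_edge_connected V E \<or>
      has_odd E \<and> (\<exists>K\<in>stubborn_free_components V E.
        V - K = {} \<or> almost_two_edge_connected (V - K) (induced_edges (V - K) E))"
  shows "\<exists>r\<in>V. \<exists>s\<in>V. (\<forall>v\<in>V. \<exists>x\<in>{r, s}. (x, v) \<in> (adj (kept V E r))\<^sup>*) \<and>
    (\<forall>G d. saturated (kept V E r) G \<longrightarrow> bfs_dist V (kept V E r) {r, s} d \<longrightarrow>
      (\<exists>i. \<forall>c. (\<forall>x y. {x, y} \<in> E \<longrightarrow> c {x, y} = (if two_colour G d (core V E r) i x y then 2 else 1)) \<longrightarrow>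
        connecting_colouring V E 2 c))"
proof -
  have eV: "edges_in V E" by (rule simple_graph_edges_in[OF fg])
  have con: "connecting_colouring V E 2 c"
    if "saturated (kept V E r) G" "\<And>g. matches V E r G d i g \<Longrightarrow> alternating_connected V (colour_perms E g)"
      "\<And>x y. {x, y} \<in> E \<Longrightarrow> c {x, y} = (if two_colour G d (core V E r) i x y then 2 else 1)" for r G d i c
  proof -
    have "c \<in> E \<rightarrow> {1..2}"
    proof
      fix e assume e: "e \<in> E"
      then obtain x y where "e = {x, y}" by (rule simple_graph_edge[OF fg])
      then show "c e \<in> {1..2}" using that(3)[of x y] e by simp
    qed
    moreover have "matches V E r G d i (\<lambda>e. c e = 2)"
      by (rule matches_two_colour[OF that(1)]) (simp add: that(3))
    ultimately show ?thesis using connecting_two_iff[OF eV] that(2) by blast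
  qed
  obtain r s where rs: "r \<in> V" "s \<in> V" "\<forall>v\<in>V. \<exists>x\<in>{r, s}. (x, v) \<in> (adj (kept V E r))\<^sup>*"
    and H: "\<forall>G d. saturated (kept V E r) G \<longrightarrow> bfs_dist V (kept V E r) {r, s} d \<longrightarrow>
      (\<exists>i. \<forall>g. matches V E r G d i g \<longrightarrow> alternating_connected V (colour_perms E g))"
    using two_colours_sufficient[OF assms] by blast
  show ?thesis
  proof (rule bexI[OF _ rs(1)], rule bexI[OF _ rs(2)], intro conjI allI impI rs(3))
    fix G d assume G: "saturated (kept V E r) G" and d: "bfs_dist V (kept V E r) {r, s} d"
    obtain i where "\<forall>g. matches V E r G d i g \<longrightarrow> alternating_connected V (colour_perms E g)"
      using H G d by blast
    then show "\<exists>i. \<forall>c. (\<forall>x y. {x, y} \<in> E \<longrightarrow> c {x, y} = (if two_colour G d (core V E r) i x y then 2 else 1)) \<longrightarrow>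
        connecting_colouring V E 2 c" using con[OF G] by (intro exI[of _ i] allI impI) blast
  qed
qed

theorem two_colouring_condition:
  assumes fg: "finite_simple_graph V E" and J: "joined V E" and con: "connecting_colouring V E 2 c"
  shows "\<not> has_odd E \<and> almost_two_edge_connected V E \<or>
      has_odd E \<and> (\<exists>K\<in>stubborn_free_components V E.
        V - K = {} \<or> almost_two_edge_connected (V - K) (induced_edges (V - K) E))"
proof -
  have "c \<in> E \<rightarrow> {1..2}" using con by (simp add: connecting_colouring_def)
  then have alt: "alternating_connected V (colour_perms E (\<lambda>e. c e = 2))"
    using connecting_two_iff[OF simple_graph_edges_in[OF fg]] con by blast
  have "V \<noteq> {}" using J by (simp add: joined_def)
  then show ?thesis
    using alternating_bipartite_almost[OF fg _ _ alt] alternating_stubborn_free[OF fg J _ alt] by blast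
qed

lemma symmetric_edge_function:
  assumes "\<And>x y. f x y = f y x"
  shows "\<exists>c. \<forall>x y. c {x, y} = f x y"
proof (intro exI[of _ "\<lambda>e. SOME k. \<exists>x y. e = {x, y} \<and> k = f x y"] allI)
  fix x y
  show "(SOME k. \<exists>x' y'. {x, y} = {x', y'} \<and> k = f x' y') = f x y"
    by (rule some_equality) (use assms in \<open>auto simp: doubleton_eq_iff\<close>)
qed

text \<open>With one colour a properly coloured walk has at most one edge.\<close>

lemma connecting_one_iff:
  assumes fg: "finite_simple_graph V E"
  shows "connecting_colouring V E 1 c \<longleftrightarrow> c \<in> E \<rightarrow> {1} \<and> complete_graph V E"
proof
  assume con: "connecting_colouring V E 1 c"
  then have c: "c \<in> E \<rightarrow> {1}" by (auto simp: connecting_colouring_def)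
  have "{u, v} \<in> E" if uv: "u \<in> V" "v \<in> V" "u \<noteq> v" for u v
  proof -
    obtain p where p: "is_walk V E p" "hd p = u" "last p = v" "properly_coloured c p"
      using con uv unfolding connecting_colouring_def walk_between_def by blast
    then obtain p' where p': "p = u # p'" by (cases p) (auto simp: is_walk_def)
    then obtain x q where q: "p = u # x # q" using p(3) uv(3) by (cases p') auto
    show ?thesis
    proof (cases q)
      case Nil
      then show ?thesis using p(1,3) q by simp
    next
      case (Cons y q')
      then have "{u, x} \<in> E" "{x, y} \<in> E" "c {u, x} \<noteq> c {x, y}" using p(1,4) q by auto
      then show ?thesis using c by (auto simp: Pi_iff)
    qed
  qed
  then show "c \<in> E \<rightarrow> {1} \<and> complete_graph V E" using c by (auto simp: complete_graph_def)
next
  assume *: "c \<in> E \<rightarrow> {1} \<and> complete_graph V E"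
  have "\<exists>p. walk_between V E u p v \<and> properly_coloured c p" if uv: "u \<in> V" "v \<in> V" for u v
  proof (cases "u = v")
    case True
    then show ?thesis using uv by (intro exI[of _ "[u]"]) (simp add: walk_between_def is_walk_def properly_coloured_def)
  next
    case False
    then have "{u, v} \<in> E" using * uv by (simp add: complete_graph_def)
    then show ?thesis using uv
      by (intro exI[of _ "[u, v]"]) (simp add: walk_between_def is_walk_def properly_coloured_def)
  qed
  then show "connecting_colouring V E 1 c" using * by (auto simp: connecting_colouring_def)
qed

lemma connecting_mono: "connecting_colouring V E k c \<Longrightarrow> k \<le> l \<Longrightarrow> connecting_colouring V E l c"
  unfolding connecting_colouring_def by fastforce

text \<open>A colouring with fewer colours is also one with more, so it is enough to exclude
  \<open>k - 1\<close>; for \<open>k = 1\<close> nothing is left to exclude.\<close>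

lemma connection_number_eqI:
  assumes "1 \<le> k" "connecting_colouring V E k c"
    and "\<And>c. 2 \<le> k \<Longrightarrow> \<not> connecting_colouring V E (k - 1) c"
  shows "proper_walk_connection_number V E = k"
  unfolding proper_walk_connection_number_def
proof (rule Least_equality)
  show "1 \<le> k \<and> (\<exists>c. connecting_colouring V E k c)" using assms by blast
  fix l assume l: "1 \<le> l \<and> (\<exists>c. connecting_colouring V E l c)"
  show "k \<le> l"
  proof (rule ccontr)
    assume "\<not> k \<le> l"
    then have "l \<le> k - 1" "2 \<le> k" using l by auto
    then show False using l assms(3) connecting_mono[of V E l _ "k - 1"] by blast
  qed
qed

lemma tree_iff_bridges:
  assumes fg: "finite_simple_graph V E" and J: "joined V E"
  shows "is_tree V E \<longleftrightarrow> (\<forall>u w. {u, w} \<in> E \<longrightarrow> (u, w) \<notin> (adj (E - {{u, w}}))\<^sup>*)"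
  unfolding is_tree_def using no_cycle_iff_bridges[OF fg] J connected_graph_iff[OF simple_graph_edges_in[OF fg]] by simp

lemma bfs_parent_exists:
  assumes "bfs_dist V F R d"
  shows "\<exists>par. is_parent V F R d par"
proof -
  have "\<forall>v. \<exists>u. v \<in> V - R \<longrightarrow> u \<in> V \<and> {u, v} \<in> F \<and> d v = Suc (d u)"
    using assms unfolding bfs_dist_def by blast
  from choice[OF this] show ?thesis unfolding is_parent_def by blast
qed

lemma bfs_single_exists:
  assumes "edges_in V F" "joined V F" "R \<subseteq> V" "R \<noteq> {}"
  obtains d par where "bfs_dist V F R d" "is_parent V F R d par"
proof -
  have "\<exists>r\<in>R. (r, v) \<in> (adj F)\<^sup>*" if "v \<in> V" for v using assms that by (auto simp: joined_def)
  from bfs_dist_exists[OF assms(1,3) this] obtain d where d: "bfs_dist V F R d" by blast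
  then show ?thesis using bfs_parent_exists[OF d] that by blast
qed

lemma joined_delete_cycle_edge:
  assumes "joined V E" "(a, b) \<in> (adj (E - {{a, b}}))\<^sup>*"
  shows "joined V (E - {{a, b}})"
proof -
  have "(u, v) \<in> (adj (E - {{a, b}}))\<^sup>*" if "(u, v) \<in> (adj E)\<^sup>*" for u v
    using that
  proof (induction rule: rtrancl_induct)
    case (step v w)
    have "(v, w) \<in> (adj (E - {{a, b}}))\<^sup>*"
    proof (cases "{v, w} = {a, b}")
      case True
      then show ?thesis using assms(2) adj_rtrancl_sym[OF assms(2)] by (auto simp: doubleton_eq_iff)
    next
      case False
      then show ?thesis using step(2) by (intro r_into_rtrancl) (auto simp: adj_def)
    qed
    with step.IH show ?case by (rule rtrancl_trans)
  qed simp
  then show ?thesis using assms(1) by (auto simp: joined_def)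
qed

lemma three_colouring_exists:
  assumes fg: "finite_simple_graph V E" and J: "joined V E"
    and ab: "{a, b} \<in> E" "(a, b) \<in> (adj (E - {{a, b}}))\<^sup>*"
  shows "\<exists>c. connecting_colouring V E 3 c"
proof -
  let ?F = "E - {{a, b}}"
  have JF: "joined V ?F" by (rule joined_delete_cycle_edge[OF J ab(2)])
  have eV: "edges_in V E" by (rule simple_graph_edges_in[OF fg])
  have eF: "edges_in V ?F" by (rule edges_in_subset[OF eV]) blast
  have V: "a \<in> V" "b \<in> V" using ab eV by (auto simp: edges_in_def)
  obtain d pr where d: "bfs_dist V ?F {a} d" "is_parent V ?F {a} d pr"
    by (rule bfs_single_exists[OF eF JF, of "{a}"]) (use V in auto)
  define Q where "Q = {(pr ^^ i) b | i. i \<le> d b}"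
  have trail: "(pr ^^ i) b \<in> V \<and> d ((pr ^^ i) b) = d b - i" if "i \<le> d b" for i
    using that
  proof (induction i)
    case 0
    show ?case using V by simp
  next
    case (Suc i)
    then have i: "(pr ^^ i) b \<in> V" "d ((pr ^^ i) b) = d b - i" by auto
    moreover have "(pr ^^ i) b \<noteq> a" using Suc.prems i d(1) by (auto simp: bfs_dist_def)
    ultimately show ?case using d(2) by (auto simp: is_parent_def)
  qed
  have Q: "Q \<subseteq> V" "Q \<noteq> {}" using trail by (auto simp: Q_def)
  obtain D par where D: "bfs_dist V ?F Q D" "is_parent V ?F Q D par"
    by (rule bfs_single_exists[OF eF JF Q])
  define z where "z v = (par ^^ D v) v" for v
  have z: "z v = v" if "v \<in> Q" for v using D(1) that by (simp add: z_def bfs_dist_def)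
  have z': "z v = z (par v)" if "v \<in> V - Q" for v
    using D(2) that by (simp add: z_def is_parent_def funpow_swap1)
  obtain c where "\<And>x y. c {x, y} = cycle_colour a b d D z x y"
    using symmetric_edge_function[of "cycle_colour a b d D z", OF cycle_colour_commute] by blast
  from three_colours_sufficient[OF fg ab(1) d Q_def D z z' this] show ?thesis by blast
qed

lemma tree_colouring_exists:
  assumes fg: "finite_simple_graph V E" and J: "joined V E"
    and br: "\<And>u w. {u, w} \<in> E \<Longrightarrow> (u, w) \<notin> (adj (E - {{u, w}}))\<^sup>*"
  shows "\<exists>c. connecting_colouring V E (max_degree V E) c"
proof -
  have eV: "edges_in V E" by (rule simple_graph_edges_in[OF fg])
  obtain r where r: "r \<in> V" using J by (auto simp: joined_def)
  obtain d par where d: "bfs_dist V E {r} d" "is_parent V E {r} d par"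
    by (rule bfs_single_exists[OF eV J, of "{r}"]) (use r in auto)
  obtain h :: "'a \<Rightarrow> nat" where h: "inj_on h V"
    using finite_imp_inj_to_nat_seg[of V] simple_graph_finite[OF fg] by blast
  define idx where "idx v = card {w \<in> V - {r}. par w = par v \<and> h w < h v}" for v
  define sm where "sm v = (\<Sum>i<d v. Suc (idx ((par ^^ i) v))) mod max_degree V E" for v
  have sm: "sm v = (sm (par v) + Suc (idx v)) mod max_degree V E" if v: "v \<in> V" "v \<noteq> r" for v
  proof -
    have "d v = Suc (d (par v))" using d(2) v by (auto simp: is_parent_def)
    then have "(\<Sum>i<d v. Suc (idx ((par ^^ i) v))) = (\<Sum>i<d (par v). Suc (idx ((par ^^ i) (par v)))) + Suc (idx v)"
      by (simp add: sum.lessThan_Suc_shift funpow_swap1 del: sum.lessThan_Suc)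
    then show ?thesis unfolding sm_def by (simp only: mod_add_left_eq)
  qed
  have sm0: "sm r = 0" using d(1) by (simp add: sm_def bfs_dist_def)
  define f where "f x y = (if d x < d y then Suc (sm y) else if d y < d x then Suc (sm x) else 1)" for x y
  obtain c where c: "\<And>x y. c {x, y} = f x y"
  proof -
    have "f x y = f y x" for x y by (auto simp: f_def)
    then show ?thesis using symmetric_edge_function[of f] that by blast
  qed
  have "c {par v, v} = Suc (sm v)" if "v \<in> V" "v \<noteq> r" for v
    using d(2) that unfolding c f_def by (auto simp: is_parent_def)
  from tree_colouring[OF fg J r br d(2) h idx_def refl sm sm0 this] show ?thesis by blast
qed

lemma tree_connection_number:
  assumes fg: "finite_simple_graph V E" and J: "joined V E"
    and br: "\<And>u w. {u, w} \<in> E \<Longrightarrow> (u, w) \<notin> (adj (E - {{u, w}}))\<^sup>*" and nc: "\<not> complete_graph V E"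
  shows "proper_walk_connection_number V E = max_degree V E"
proof -
  obtain c where c: "connecting_colouring V E (max_degree V E) c"
    using tree_colouring_exists[OF fg J br] by blast
  have ne: "V \<noteq> {}" using J by (simp add: joined_def)
  obtain u v where uv: "u \<in> V" "v \<in> V" "u \<noteq> v" using nc by (auto simp: complete_graph_def)
  then have "(u, v) \<in> (adj E)\<^sup>*" using J by (simp add: joined_def)
  then have "E \<noteq> {}" by (cases rule: rtranclE) (use uv in \<open>auto simp: adj_def\<close>)
  then obtain e where "e \<in> E" by blast
  then have "c e \<in> {1..max_degree V E}" using c by (auto simp: connecting_colouring_def)
  then have "1 \<le> max_degree V E" by simp
  then show ?thesis
  proof (rule connection_number_eqI[OF _ c])
    fix c' assume "2 \<le> max_degree V E"
    then show "\<not> connecting_colouring V E (max_degree V E - 1) c'"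
      using tree_max_degree_le[OF fg ne br, of "max_degree V E - 1" c'] by auto
  qed
qed

theorem connection_number:
  assumes fg: "finite_simple_graph V E" and con: "connected_graph V E"
  shows "proper_walk_connection_number V E =
        (if complete_graph V E then 1
         else if is_tree V E then max_degree V E
         else if bipartite_graph V E \<and> almost_two_edge_connected V E then 2
         else if \<not> bipartite_graph V E \<and>
                 (\<exists>K \<in> stubborn_free_components V E.
                    V - K = {} \<or>
                    almost_two_edge_connected (V - K) (induced_edges (V - K) E)) then 2
         else 3)"
proof -
  let ?cond = "\<not> has_odd E \<and> almost_two_edge_connected V E \<or>
      has_odd E \<and> (\<exists>K\<in>stubborn_free_components V E.
        V - K = {} \<or> almost_two_edge_connected (V - K) (induced_edges (V - K) E))"
  have eV: "edges_in V E" by (rule simple_graph_edges_in[OF fg])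
  have J: "joined V E" using con connected_graph_iff[OF eV] by simp
  have 1: "proper_walk_connection_number V E = 1" if "complete_graph V E"
    using connecting_one_iff[OF fg, of "\<lambda>_. 1"] that by (intro connection_number_eqI[of 1]) auto
  have 2: "proper_walk_connection_number V E = max_degree V E" if "\<not> complete_graph V E" "is_tree V E"
    using tree_connection_number[OF fg J _ that(1)] that(2) tree_iff_bridges[OF fg J] by simp
  have 3: "proper_walk_connection_number V E = 2" if nc: "\<not> complete_graph V E" and c: ?cond
  proof -
    obtain r s where rs: "r \<in> V" "s \<in> V" "\<forall>v\<in>V. \<exists>x\<in>{r, s}. (x, v) \<in> (adj (kept V E r))\<^sup>*"
      and H: "\<forall>G d. saturated (kept V E r) G \<longrightarrow> bfs_dist V (kept V E r) {r, s} d \<longrightarrow>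
      (\<exists>i. \<forall>c. (\<forall>x y. {x, y} \<in> E \<longrightarrow> c {x, y} = (if two_colour G d (core V E r) i x y then 2 else 1)) \<longrightarrow>
        connecting_colouring V E 2 c)"
      using two_colouring_exists[OF fg J c] by blast
    have kE: "kept V E r \<subseteq> E" by (rule kept_subset)
    have "finite (kept V E r)" using finite_subset[OF kE] simple_graph_finite[OF fg] by blast
    moreover have "finite e" if "e \<in> kept V E r" for e
      using kE that by (auto elim: simple_graph_edge[OF fg])
    ultimately obtain G where G: "saturated (kept V E r) G" using saturated_exists by blast
    obtain d where d: "bfs_dist V (kept V E r) {r, s} d"
      using bfs_dist_exists[OF edges_in_subset[OF eV kE], of "{r, s}"] rs by auto
    obtain i where i: "\<forall>c. (\<forall>x y. {x, y} \<in> E \<longrightarrow> c {x, y} = (if two_colour G d (core V E r) i x y then 2 else 1)) \<longrightarrow>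
        connecting_colouring V E 2 c" using H G d by blast
    have "sym_perms G" using G by (simp add: saturated_def)
    then obtain c :: "'a set \<Rightarrow> nat" where
      "\<And>x y. c {x, y} = (if two_colour G d (core V E r) i x y then 2 else 1)"
      using symmetric_edge_function[of "\<lambda>x y. if two_colour G d (core V E r) i x y then 2 else 1"]
        two_colour_commute[of G d _ i] by metis
    then have "connecting_colouring V E 2 c" using i by blast
    then show ?thesis using connecting_one_iff[OF fg] nc by (intro connection_number_eqI[of 2]) auto
  qed
  \<comment> \<open>A connected graph that is no tree has an edge that is no bridge; it closes the
    cycle for the three-colouring.\<close>
  have 4: "proper_walk_connection_number V E = 3" if nt: "\<not> is_tree V E" and c: "\<not> ?cond"
  proof -
    obtain a b where "{a, b} \<in> E" "(a, b) \<in> (adj (E - {{a, b}}))\<^sup>*"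
      using nt tree_iff_bridges[OF fg J] by blast
    from three_colouring_exists[OF fg J this] obtain c where "connecting_colouring V E 3 c" by blast
    then show ?thesis
      using two_colouring_condition[OF fg J] c by (intro connection_number_eqI[of 3]) auto
  qed
  have b: "bipartite_graph V E \<longleftrightarrow> \<not> has_odd E" by (rule bipartite_iff[OF fg J])
  show ?thesis
  proof (cases ?cond)
    case True
    then show ?thesis using 1 2 3 unfolding b by auto
  next
    case False
    then show ?thesis using 1 2 4 unfolding b by auto
  qed
qed

section \<open>Polynomial-time building blocks\<close>

text \<open>Polynomiality of a function of several arguments is shown once, on the tuple of its
  arguments, and then transferred to arbitrary argument functions.\<close>

lemma ptime_comp2:
  assumes "ptime (\<lambda>p. f (fst p) (snd p))" "ptime a" "ptime b"
  shows "ptime (\<lambda>x. f (a x) (b x))"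
  using ptime_comp[OF ptime_Pair[OF assms(2,3)] assms(1)] by simp

lemma ptime_comp3:
  assumes "ptime (\<lambda>p. f (fst p) (fst (snd p)) (snd (snd p)))" "ptime a" "ptime b" "ptime c"
  shows "ptime (\<lambda>x. f (a x) (b x) (c x))"
  using ptime_comp[OF ptime_Pair[OF assms(2) ptime_Pair[OF assms(3,4)]] assms(1)] by simp

lemma ptime_comp5:
  assumes "ptime (\<lambda>p. f (fst p) (fst (snd p)) (fst (snd (snd p))) (fst (snd (snd (snd p)))) (snd (snd (snd (snd p)))))"
    "ptime a" "ptime b" "ptime c" "ptime d" "ptime e"
  shows "ptime (\<lambda>x. f (a x) (b x) (c x) (d x) (e x))"
  using ptime_comp[OF ptime_Pair[OF assms(2) ptime_Pair[OF assms(3) ptime_Pair[OF assms(4)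
    ptime_Pair[OF assms(5,6)]]]] assms(1)] by simp

lemma ptime_imp [ptime_intros]: "ptime f \<Longrightarrow> ptime g \<Longrightarrow> ptime (\<lambda>x. f x \<longrightarrow> g x)"
  unfolding imp_conv_disj by (intro ptime_intros)

lemma ptime_min [ptime_intros]:
  fixes f g :: "'x::enc \<Rightarrow> nat"
  shows "ptime f \<Longrightarrow> ptime g \<Longrightarrow> ptime (\<lambda>x. min (f x) (g x))"
  unfolding min_def by (intro ptime_intros)

lemma ptime_tl: "ptime f \<Longrightarrow> ptime (\<lambda>x. tl (f x))"
proof -
  assume "ptime f"
  then have "computable_from UNIV enc (\<lambda>x. right (enc (f x)))" by (simp add: ptime_def computable_from_right)
  moreover have "right (enc xs) = enc (tl xs)" for xs :: "'b list" by (cases xs) (auto simp: enc_list_def)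
  ultimately show ?thesis by (simp add: ptime_def)
qed

lemma bsize_tl: "bsize (tl xs) \<le> bsize xs"
  by (cases xs) auto

text \<open>The appended element is a default, so \<open>hd\<close> is never taken of an empty
  list.\<close>

lemma ptime_hd [ptime_intros]: "ptime f \<Longrightarrow> ptime g \<Longrightarrow> ptime (\<lambda>x. hd (f x @ [g x]))"
proof -
  assume "ptime f" "ptime g"
  then have "ptime (\<lambda>x. f x @ [g x])" by (intro ptime_intros)
  then have "computable_from UNIV enc (\<lambda>x. left (enc (f x @ [g x])))"
    by (simp add: ptime_def computable_from_left)
  moreover have "left (enc (xs @ [y])) = enc (hd (xs @ [y]))" for xs and y :: 'b
    by (cases xs) (auto simp: enc_list_def)
  ultimately show ?thesis by (simp add: ptime_def)
qed

lemma ptime_drop [ptime_intros]: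
  assumes "ptime i" "ptime l" shows "ptime (\<lambda>x. drop (i x) (l x))"
proof -
  have "ptime (\<lambda>x. (tl ^^ i x) (l x))"
  proof (rule ptime_funpow[OF assms])
    show "pbound (\<lambda>_. 0)" by (intro poly_bounded_intros)
    show "bsize (tl acc) \<le> bsize acc + 0" for acc :: "'b list" using bsize_tl by simp
  qed (intro ptime_tl ptime_intros)
  moreover have "(tl ^^ k) xs = drop k xs" for k and xs :: "'b list"
    by (induction k) (simp_all add: drop_Suc tl_drop)
  ultimately show ?thesis by simp
qed

lemma bsize_map_snd: "bsize (map snd xs) \<le> bsize xs"
  by (induction xs) auto

text \<open>Duplicates are tolerated: a round appends at most the second components of all arcs, so
  the growth is additive, as \<open>ptime_funpow\<close> requires.\<close>

definition expand :: "('a \<times> 'a) list \<Rightarrow> 'a list \<Rightarrow> 'a list" where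
  "expand A R = R @ map snd (filter (\<lambda>e. fst e \<in> set R) A)"

definition ball :: "('a \<times> 'a) list \<Rightarrow> 'a list \<Rightarrow> nat \<Rightarrow> 'a list" where
  "ball A R k = (expand A ^^ k) R"

lemma ptime_ball [ptime_intros]:
  assumes "ptime A" "ptime R" "ptime k" shows "ptime (\<lambda>x. ball (A x) (R x) (k x))"
  unfolding ball_def
proof (rule ptime_funpow[OF assms(3,2)])
  have "ptime (\<lambda>p. expand (fst p) (snd p))" for type :: "('b \<times> 'b) list \<times> 'b list"
    unfolding expand_def by (intro ptime_intros)
  then show "ptime (\<lambda>p. expand (A (fst p)) (snd p))"
    by (rule ptime_comp2) (intro ptime_intros ptime_comp[OF _ assms(1)])+
  show "pbound (\<lambda>x. bsize (A x))" by (intro ptime_size assms)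
  show "bsize (expand (A x) acc) \<le> bsize acc + bsize (A x)" for x acc
    using order_trans[OF bsize_map_snd bsize_filter] by (simp add: expand_def)
qed

definition reachable :: "('a \<times> 'a) list \<Rightarrow> 'a \<Rightarrow> 'a \<Rightarrow> bool" where
  "reachable A x y \<longleftrightarrow> y \<in> set (ball A [x] (length A))"

lemma ptime_reachable [ptime_intros]:
  "ptime A \<Longrightarrow> ptime f \<Longrightarrow> ptime g \<Longrightarrow> ptime (\<lambda>x. reachable (A x) (f x) (g x))"
  unfolding reachable_def by (intro ptime_intros)

text \<open>Balls grow with the radius, so for a reached vertex the number of radii that miss it is
  its distance.\<close>

definition distance :: "('a \<times> 'a) list \<Rightarrow> 'a list \<Rightarrow> 'a \<Rightarrow> nat" where
  "distance A R v = length (filter (\<lambda>k. v \<notin> set (ball A R k)) [0..<length A])"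

lemma ptime_distance [ptime_intros]:
  "ptime A \<Longrightarrow> ptime R \<Longrightarrow> ptime f \<Longrightarrow> ptime (\<lambda>x. distance (A x) (R x) (f x))"
  by (rule ptime_comp3[of distance]; (assumption | (unfold distance_def, intro ptime_intros)))

definition parent :: "('a \<times> 'a) list \<Rightarrow> 'a list \<Rightarrow> 'a \<Rightarrow> 'a" where
  "parent A R v = hd (map fst (filter (\<lambda>e. snd e = v \<and> distance A R v = Suc (distance A R (fst e))) A) @ [v])"

lemma ptime_parent [ptime_intros]:
  "ptime A \<Longrightarrow> ptime R \<Longrightarrow> ptime f \<Longrightarrow> ptime (\<lambda>x. parent (A x) (R x) (f x))"
  by (rule ptime_comp3[of parent]; (assumption | (unfold parent_def, intro ptime_intros)))

definition ancestor :: "('a \<times> 'a) list \<Rightarrow> 'a list \<Rightarrow> nat \<Rightarrow> 'a \<Rightarrow> 'a" where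
  "ancestor A R k v = (parent A R ^^ k) v"

lemma bsize_parent: "bsize (parent A R v) \<le> bsize v + bsize A"
proof -
  let ?l = "map fst (filter (\<lambda>e. snd e = v \<and> distance A R v = Suc (distance A R (fst e))) A)"
  show ?thesis
  proof (cases ?l)
    case Nil
    then show ?thesis by (simp add: parent_def)
  next
    case (Cons y ys)
    then have "y \<in> set ?l" by simp
    then obtain e where "e \<in> set A" "y = fst e" by auto
    then have "bsize y \<le> bsize A" using bsize_le_list[of e A] bsize_Pair[of "fst e" "snd e"] by simp
    then show ?thesis unfolding parent_def Cons by simp
  qed
qed

lemma ptime_ancestor [ptime_intros]:
  assumes "ptime A" "ptime R" "ptime k" "ptime f"
  shows "ptime (\<lambda>x. ancestor (A x) (R x) (k x) (f x))"
  unfolding ancestor_def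
proof (rule ptime_funpow[OF assms(3,4)])
  show "ptime (\<lambda>p. parent (A (fst p)) (R (fst p)) (snd p))"
    by (intro ptime_intros ptime_comp[OF _ assms(1)] ptime_comp[OF _ assms(2)])
  show "pbound (\<lambda>x. bsize (A x))" by (intro ptime_size assms)
qed (rule bsize_parent)

section \<open>The algorithm\<close>

definition doubled :: "('a \<times> 'a) list \<Rightarrow> (('a \<times> bool) \<times> ('a \<times> bool)) list" where
  "doubled A = concat (map (\<lambda>e. [((fst e, True), (snd e, False)), ((fst e, False), (snd e, True))]) A)"

text \<open>A vertex on an odd closed walk has an arc, so trying the first components of the arcs is
  enough.\<close>

definition odd_list :: "('a \<times> 'a) list \<Rightarrow> bool" where
  "odd_list A \<longleftrightarrow> (\<exists>e\<in>set A. reachable (doubled A) (fst e, False) (fst e, True))"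

lemma ptime_odd_list [ptime_intros]: "ptime A \<Longrightarrow> ptime (\<lambda>x. odd_list (A x))"
  by (rule ptime_comp[of A odd_list]; (assumption | (unfold odd_list_def doubled_def, intro ptime_intros)))

definition delete_edge :: "('a \<times> 'a) \<Rightarrow> ('a \<times> 'a) list \<Rightarrow> ('a \<times> 'a) list" where
  "delete_edge f A = filter (\<lambda>e. e \<noteq> f \<and> e \<noteq> (snd f, fst f)) A"

lemma ptime_delete_edge [ptime_intros]:
  "ptime f \<Longrightarrow> ptime A \<Longrightarrow> ptime (\<lambda>x. delete_edge (f x) (A x))"
  by (rule ptime_comp2[of delete_edge]; (assumption | (unfold delete_edge_def, intro ptime_intros)))

definition critical_arc :: "('a \<times> 'a) list \<Rightarrow> ('a \<times> 'a) \<Rightarrow> bool" where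
  "critical_arc A e \<longleftrightarrow> odd_list A \<and> \<not> odd_list (delete_edge e A)"

definition in_core :: "('a \<times> 'a) list \<Rightarrow> 'a \<Rightarrow> 'a \<Rightarrow> bool" where
  "in_core A r v \<longleftrightarrow> reachable (filter (\<lambda>e. \<not> critical_arc A e) A) r v"

lemma ptime_in_core [ptime_intros]:
  "ptime A \<Longrightarrow> ptime f \<Longrightarrow> ptime g \<Longrightarrow> ptime (\<lambda>x. in_core (A x) (f x) (g x))"
  by (rule ptime_comp3[of in_core]; (assumption | (unfold in_core_def critical_arc_def, intro ptime_intros)))

definition kept_list :: "('a \<times> 'a) list \<Rightarrow> 'a \<Rightarrow> ('a \<times> 'a) list" where
  "kept_list A r = filter (\<lambda>e. if in_core A r (fst e) then in_core A r (snd e) \<and> \<not> critical_arc A e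
     else \<not> in_core A r (snd e)) A"

lemma ptime_kept_list [ptime_intros]:
  "ptime A \<Longrightarrow> ptime r \<Longrightarrow> ptime (\<lambda>x. kept_list (A x) (r x))"
  by (rule ptime_comp2[of kept_list]; (assumption | (unfold kept_list_def critical_arc_def, intro ptime_intros)))

definition all_perms :: "('a \<times> 'a) list \<Rightarrow> ('a \<times> 'a \<times> bool) list" where
  "all_perms A = concat (map (\<lambda>e. [(fst e, snd e, True), (fst e, snd e, False)]) A)"

definition arcs_list :: "('a \<times> 'a \<times> bool) list \<Rightarrow> (('a \<times> bool) \<times> ('a \<times> bool)) list" where
  "arcs_list G = map (\<lambda>t. ((fst t, \<not> snd (snd t)), (fst (snd t), snd (snd t)))) G"

definition remove_perm :: "('a \<times> 'a \<times> bool) \<Rightarrow> ('a \<times> 'a \<times> bool) list \<Rightarrow> ('a \<times> 'a \<times> bool) list" where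
  "remove_perm t G = filter (\<lambda>t'. t' \<noteq> t \<and> t' \<noteq> (fst (snd t), fst t, snd (snd t))) G"

definition try_remove :: "('a \<times> 'a \<times> bool) \<Rightarrow> ('a \<times> 'a \<times> bool) list \<Rightarrow> ('a \<times> 'a \<times> bool) list" where
  "try_remove t G =
     (if (fst t, fst (snd t), \<not> snd (snd t)) \<in> set G \<and>
         reachable (arcs_list (remove_perm t G)) (fst t, \<not> snd (snd t)) (fst (snd t), snd (snd t))
      then remove_perm t G else G)"

text \<open>One pass suffices: a permission that could not be spared when it was tried cannot be
  spared after further ones are gone.\<close>

definition saturate :: "('a \<times> 'a) list \<Rightarrow> ('a \<times> 'a \<times> bool) list" where
  "saturate A = fold try_remove (all_perms A) (all_perms A)"

lemma ptime_remove_perm: "ptime t \<Longrightarrow> ptime G \<Longrightarrow> ptime (\<lambda>x. remove_perm (t x) (G x))"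
  by (rule ptime_comp2[of remove_perm]; (assumption | (unfold remove_perm_def, intro ptime_intros)))

lemma ptime_saturate [ptime_intros]: "ptime A \<Longrightarrow> ptime (\<lambda>x. saturate (A x))"
proof (rule ptime_comp[of A saturate]; (assumption | unfold saturate_def)?)
  have P: "ptime (\<lambda>A :: ('b \<times> 'b) list. all_perms A)" unfolding all_perms_def by (intro ptime_intros)
  show "ptime (\<lambda>A :: ('b \<times> 'b) list. fold try_remove (all_perms A) (all_perms A))"
  proof (rule ptime_fold[OF P P])
    show "pbound (\<lambda>_. 0)" by (intro poly_bounded_intros)
    show "bsize (try_remove t G) \<le> bsize G + 0" for t G
      using bsize_filter[of "\<lambda>t'. t' \<noteq> t \<and> t' \<noteq> (fst (snd t), fst t, snd (snd t))" G]
      by (simp add: try_remove_def remove_perm_def)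
  qed (unfold try_remove_def arcs_list_def, intro ptime_intros ptime_remove_perm)
qed

definition two_colouring ::
    "('a \<times> 'a) list \<Rightarrow> 'a \<Rightarrow> 'a \<Rightarrow> bool \<Rightarrow> ('a \<times> 'a) \<Rightarrow> nat" where
  "two_colouring A r s i e =
     (if two_colour (set (saturate (kept_list A r))) (distance (kept_list A r) [r, s]) {v. in_core A r v} i
        (fst e) (snd e) then 2 else 1)"

lemma ptime_two_colouring [ptime_intros]:
  "ptime A \<Longrightarrow> ptime r \<Longrightarrow> ptime s \<Longrightarrow> ptime i \<Longrightarrow> ptime e \<Longrightarrow>
    ptime (\<lambda>x. two_colouring (A x) (r x) (s x) (i x) (e x))"
  by (rule ptime_comp5[of two_colouring]; (assumption |
    (unfold two_colouring_def two_colour_def level_bit_def Let_def mem_Collect_eq, intro ptime_intros)))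

definition cycle_list :: "('a \<times> 'a) list \<Rightarrow> ('a \<times> 'a) \<Rightarrow> 'a list" where
  "cycle_list A f = map (\<lambda>i. ancestor A [fst f] i (snd f)) [0..<Suc (distance A [fst f] (snd f))]"

lemma ptime_cycle_list [ptime_intros]:
  "ptime A \<Longrightarrow> ptime f \<Longrightarrow> ptime (\<lambda>x. cycle_list (A x) (f x))"
  by (rule ptime_comp2[of cycle_list]; (assumption | (unfold cycle_list_def, intro ptime_intros)))

definition three_colouring :: "('a \<times> 'a) list \<Rightarrow> ('a \<times> 'a) \<Rightarrow> ('a \<times> 'a) \<Rightarrow> nat" where
  "three_colouring A f e =
     (let B = delete_edge f A; Q = cycle_list B f in
      cycle_colour (fst f) (snd f) (distance B [fst f]) (distance B Q)
        (\<lambda>v. ancestor B Q (distance B Q v) v) (fst e) (snd e))"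

lemma ptime_three_colouring [ptime_intros]:
  "ptime A \<Longrightarrow> ptime f \<Longrightarrow> ptime e \<Longrightarrow> ptime (\<lambda>x. three_colouring (A x) (f x) (e x))"
  by (rule ptime_comp3[of three_colouring]; (assumption |
    (unfold three_colouring_def cycle_colour_def spoke_def alternate_def Let_def, intro ptime_intros)))

text \<open>The maximum degree, as the number of \<open>k\<close> that lie below some
  degree.\<close>

definition degree_bound :: "nat \<Rightarrow> (nat \<times> nat) list \<Rightarrow> nat" where
  "degree_bound n A = length (filter (\<lambda>k. \<exists>v\<in>set [0..<n]. k < length (filter (\<lambda>e. fst e = v) A)) [0..<n])"

definition child_index :: "nat \<Rightarrow> (nat \<times> nat) list \<Rightarrow> nat \<Rightarrow> nat" where
  "child_index n A v =
     length (filter (\<lambda>w. w \<noteq> 0 \<and> parent A [0] w = parent A [0] v \<and> w < v) [0..<n])"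

lemma ptime_child_index [ptime_intros]:
  "ptime n \<Longrightarrow> ptime A \<Longrightarrow> ptime f \<Longrightarrow> ptime (\<lambda>x. child_index (n x) (A x) (f x))"
  by (rule ptime_comp3[of child_index]; (assumption | (unfold child_index_def, intro ptime_intros)))

text \<open>Unrolls the recursion for \<open>sm\<close> in \<open>tree_colouring\<close>: the
  offsets along the way to the root are summed in unary, as the length of a concatenation.\<close>

definition tree_shift :: "nat \<Rightarrow> (nat \<times> nat) list \<Rightarrow> nat \<Rightarrow> nat" where
  "tree_shift n A v =
     length (concat (map (\<lambda>i. [0..<Suc (child_index n A (ancestor A [0] i v))]) [0..<distance A [0] v]))
     mod degree_bound n A"

lemma ptime_tree_shift [ptime_intros]:
  "ptime n \<Longrightarrow> ptime A \<Longrightarrow> ptime f \<Longrightarrow> ptime (\<lambda>x. tree_shift (n x) (A x) (f x))"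
  by (rule ptime_comp3[of tree_shift]; (assumption | (unfold tree_shift_def degree_bound_def, intro ptime_intros)))

definition tree_colour :: "nat \<Rightarrow> (nat \<times> nat) list \<Rightarrow> nat \<times> nat \<Rightarrow> nat" where
  "tree_colour n A e =
     (if distance A [0] (fst e) < distance A [0] (snd e) then Suc (tree_shift n A (snd e))
      else if distance A [0] (snd e) < distance A [0] (fst e) then Suc (tree_shift n A (fst e)) else 1)"

lemma ptime_tree_colour [ptime_intros]:
  "ptime n \<Longrightarrow> ptime A \<Longrightarrow> ptime f \<Longrightarrow> ptime (\<lambda>x. tree_colour (n x) (A x) (f x))"
  by (rule ptime_comp3[of tree_colour]; (assumption | (unfold tree_colour_def, intro ptime_intros)))

text \<open>A candidate colouring is a list of coloured arcs.\<close>

definition step_list :: "(('a \<times> 'a) \<times> nat) list \<Rightarrow> (('a \<times> nat) \<times> ('a \<times> nat)) list" where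
  "step_list C = concat (map (\<lambda>t. map (\<lambda>k. ((fst (fst t), k), (snd (fst t), snd t)))
     (filter (\<lambda>k. k \<noteq> snd t) (0 # map snd C))) C)"

text \<open>The colours of a candidate are positive, so the initial state \<open>(u, 0)\<close>
  blocks no edge.\<close>

definition connects :: "nat \<Rightarrow> ((nat \<times> nat) \<times> nat) list \<Rightarrow> bool" where
  "connects n C \<longleftrightarrow> (\<forall>u\<in>set [0..<n]. \<forall>v\<in>set [0..<n]. \<exists>k\<in>set (0 # map snd C).
     reachable (step_list C) (u, 0) (v, k))"

lemma ptime_connects [ptime_intros]:
  "ptime n \<Longrightarrow> ptime C \<Longrightarrow> ptime (\<lambda>x. connects (n x) (C x))"
  by (rule ptime_comp2[of connects]; (assumption | (unfold connects_def step_list_def, intro ptime_intros)))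

text \<open>Listed by number of colours, with the tree colouring last: it is reached only if no
  candidate before it connects, and then every edge is a bridge. The structural conditions of the
  case distinction are never tested.\<close>

definition candidates :: "nat \<Rightarrow> (nat \<times> nat) list \<Rightarrow> ((nat \<times> nat) \<times> nat) list list" where
  "candidates n A =
     [map (\<lambda>e. (e, 1)) A] @
     concat (map (\<lambda>r. concat (map (\<lambda>s. map (\<lambda>i. map (\<lambda>e. (e, two_colouring A r s i e)) A) [False, True])
       [0..<n])) [0..<n]) @
     map (\<lambda>f. map (\<lambda>e. (e, three_colouring A f e)) A) A @
     [map (\<lambda>e. (e, tree_colour n A e)) A]"

definition arc_list :: "nat list list \<Rightarrow> (nat \<times> nat) list" where
  "arc_list M = filter (\<lambda>e. hd (drop (snd e) (hd (drop (fst e) M @ [[]])) @ [0]) = 1)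
     (concat (map (\<lambda>u. map (\<lambda>v. (u, v)) [0..<length M]) [0..<length M]))"

definition colour_list :: "nat list list \<Rightarrow> ((nat \<times> nat) \<times> nat) list" where
  "colour_list M = hd (filter (connects (length M)) (candidates (length M) (arc_list M)) @ [[]])"

definition colour_matrix :: "nat list list \<Rightarrow> nat list list" where
  "colour_matrix M = map (\<lambda>u. map (\<lambda>v. hd (map snd (filter (\<lambda>t. fst t = (u, v)) (colour_list M)) @ [0]))
     [0..<length M]) [0..<length M]"

theorem ptime_colour_matrix: "ptime colour_matrix"
proof -
  have A: "ptime arc_list" unfolding arc_list_def by (intro ptime_intros)
  have C: "ptime (\<lambda>p. candidates (fst p) (snd p))" unfolding candidates_def by (intro ptime_intros)
  have L: "ptime colour_list" unfolding colour_list_def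
    by (intro ptime_intros ptime_comp2[OF C] ptime_comp[OF _ A])
  show ?thesis unfolding colour_matrix_def by (intro ptime_intros ptime_comp[OF _ L])
qed

section \<open>Correctness of the algorithm\<close>

lemma set_ball: "set (ball A R k) = {y. \<exists>x\<in>set R. \<exists>j\<le>k. (x, y) \<in> set A ^^ j}"
proof (induction k)
  case 0
  show ?case by (auto simp: ball_def)
next
  case (Suc k)
  have "set (ball A R (Suc k)) = set (ball A R k) \<union> {y. \<exists>z. z \<in> set (ball A R k) \<and> (z, y) \<in> set A}"
    by (force simp: ball_def expand_def)
  also have "\<dots> = {y. \<exists>x\<in>set R. \<exists>j\<le>Suc k. (x, y) \<in> set A ^^ j}" (is "?L = ?M")
  proof (intro equalityI subsetI)
    fix y assume "y \<in> ?L"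
    then consider "y \<in> set (ball A R k)" | z where "z \<in> set (ball A R k)" "(z, y) \<in> set A" by blast
    then show "y \<in> ?M"
    proof cases
      case 1
      then show ?thesis unfolding Suc by (auto intro: le_SucI)
    next
      case 2
      then obtain x j where "x \<in> set R" "j \<le> k" "(x, z) \<in> set A ^^ j" unfolding Suc by blast
      then have "x \<in> set R" "Suc j \<le> Suc k" "(x, y) \<in> set A ^^ Suc j" using 2(2) by auto
      then show ?thesis by blast
    qed
  next
    fix y assume "y \<in> ?M"
    then obtain x j where x: "x \<in> set R" "j \<le> Suc k" "(x, y) \<in> set A ^^ j" by blast
    show "y \<in> ?L"
    proof (cases "j \<le> k")
      case True
      then show ?thesis using x unfolding Suc by blast
    next
      case False
      then have "j = Suc k" using x(2) by simp
      then obtain z where "(x, z) \<in> set A ^^ k" "(z, y) \<in> set A" using x(3) by auto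
      then show ?thesis using x(1) unfolding Suc by blast
    qed
  qed
  finally show ?case .
qed

lemma rtrancl_list:
  assumes "(x, y) \<in> (set A)\<^sup>*" obtains j where "j \<le> length A" "(x, y) \<in> set A ^^ j"
proof -
  have "(x, y) \<in> (\<Union>n\<in>{n. n \<le> card (set A)}. set A ^^ n)"
    using assms rtrancl_finite_eq_relpow[of "set A"] by simp
  then obtain j where "j \<le> card (set A)" "(x, y) \<in> set A ^^ j" by blast
  then show ?thesis using that card_length[of A] by (meson order_trans)
qed

lemma reachable_iff: "reachable A x y \<longleftrightarrow> (x, y) \<in> (set A)\<^sup>*"
proof
  assume "reachable A x y"
  then show "(x, y) \<in> (set A)\<^sup>*" unfolding reachable_def set_ball by (auto intro: relpow_imp_rtrancl)
next
  assume "(x, y) \<in> (set A)\<^sup>*"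
  then obtain j where "j \<le> length A" "(x, y) \<in> set A ^^ j" by (rule rtrancl_list)
  then show "reachable A x y" unfolding reachable_def set_ball by auto
qed

text \<open>The radii that miss \<open>v\<close> form an initial segment, whose length is the least
  radius reaching \<open>v\<close>; the assumption keeps this radius within the range that is
  counted.\<close>

lemma distance_le_iff:
  assumes "\<exists>k\<le>length A. v \<in> set (ball A R k)"
  shows "distance A R v \<le> k \<longleftrightarrow> v \<in> set (ball A R k)"
proof -
  have mono: "v \<in> set (ball A R l)" if "v \<in> set (ball A R k)" "k \<le> l" for k l
    using that unfolding set_ball by (auto intro: order_trans)
  define m where "m = (LEAST k. v \<in> set (ball A R k))"
  obtain k0 where k0: "k0 \<le> length A" "v \<in> set (ball A R k0)" using assms by blast
  have m: "v \<in> set (ball A R m)" unfolding m_def using k0(2) by (rule LeastI)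
  have ml: "m \<le> k" if "v \<in> set (ball A R k)" for k unfolding m_def using that by (rule Least_le)
  have "m \<le> length A" using ml[OF k0(2)] k0(1) by simp
  have "distance A R v = card {k. k < length A \<and> v \<notin> set (ball A R k)}"
    unfolding distance_def by (simp add: length_filter_conv_card) (rule arg_cong[of _ _ card]; auto)
  also have "{k. k < length A \<and> v \<notin> set (ball A R k)} = {..<m}"
    using \<open>m \<le> length A\<close> ml mono[OF m] by (auto simp: not_less[symmetric])
  finally have "distance A R v = m" by simp
  then show ?thesis using ml mono[OF m] by auto
qed

lemma bfs_distance:
  assumes A: "set A = adj F" and FV: "edges_in V F"
    and reach: "\<And>v. v \<in> V \<Longrightarrow> \<exists>r\<in>set R. (r, v) \<in> (adj F)\<^sup>*"
  shows "bfs_dist V F (set R) (distance A R)"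
proof -
  have ball: "v \<in> set (ball A R k) \<longleftrightarrow> (\<exists>r\<in>set R. \<exists>j\<le>k. (r, v) \<in> set A ^^ j)" for v k
    by (simp add: set_ball)
  have le: "distance A R v \<le> k \<longleftrightarrow> (\<exists>r\<in>set R. \<exists>j\<le>k. (r, v) \<in> set A ^^ j)" if v: "v \<in> V" for v k
  proof -
    obtain r where r: "r \<in> set R" "(r, v) \<in> (set A)\<^sup>*" using reach[OF v] A by auto
    obtain j where j: "j \<le> length A" "(r, v) \<in> set A ^^ j" by (rule rtrancl_list[OF r(2)])
    then have "\<exists>k\<le>length A. v \<in> set (ball A R k)" unfolding ball using r(1) by blast
    then show ?thesis using distance_le_iff[of A v R k] ball by simp
  qed
  have edge: "distance A R w \<le> Suc (distance A R u)" if uw: "{u, w} \<in> F" for u w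
  proof -
    have V: "u \<in> V" "w \<in> V" using uw FV by (auto simp: edges_in_def)
    obtain r j where r: "r \<in> set R" "j \<le> distance A R u" "(r, u) \<in> set A ^^ j"
      using le[OF V(1), of "distance A R u"] by auto
    have "(u, w) \<in> set A" using uw A by (simp add: adj_def)
    then have "(r, w) \<in> set A ^^ Suc j" using r(3) by auto
    then show ?thesis unfolding le[OF V(2)] using r(1,2) by (intro bexI[of _ r] exI[of _ "Suc j"]) auto
  qed
  have root: "distance A R v = 0" if "v \<in> set R" for v
  proof -
    have "v \<in> set (ball A R k)" for k unfolding ball using that by (intro bexI[of _ v] exI[of _ 0]) auto
    then show ?thesis by (simp add: distance_def)
  qed
  have "\<exists>u\<in>V. {u, v} \<in> F \<and> distance A R v = Suc (distance A R u)" if v: "v \<in> V" "v \<notin> set R" for v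
  proof -
    obtain r j where r: "r \<in> set R" "j \<le> distance A R v" "(r, v) \<in> set A ^^ j"
      using le[OF v(1), of "distance A R v"] by auto
    then obtain i where i: "j = Suc i" using v(2) by (cases j) auto
    then obtain u where u: "(r, u) \<in> set A ^^ i" "(u, v) \<in> set A" using r(3) by auto
    have uv: "{u, v} \<in> F" using u(2) A by (simp add: adj_def)
    then have uV: "u \<in> V" using FV by (auto simp: edges_in_def)
    have "distance A R u \<le> i" unfolding le[OF uV] using r(1) u(1) by blast
    then show ?thesis using edge[OF uv] uv uV i r(2) by (intro bexI[of _ u]) auto
  qed
  then show ?thesis unfolding bfs_dist_def using edge root by blast
qed

lemma parent_is_parent:
  assumes A: "set A = adj F" and FV: "edges_in V F" and d: "bfs_dist V F (set R) (distance A R)"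
  shows "is_parent V F (set R) (distance A R) (parent A R)"
  unfolding is_parent_def
proof
  fix v assume v: "v \<in> V - set R"
  let ?l = "map fst (filter (\<lambda>e. snd e = v \<and> distance A R v = Suc (distance A R (fst e))) A)"
  have l: "u \<in> set ?l \<longleftrightarrow> {u, v} \<in> F \<and> distance A R v = Suc (distance A R u)" for u
  proof -
    have "{u, v} \<in> F \<longleftrightarrow> (u, v) \<in> set A" using A by (simp add: adj_def)
    then show ?thesis by force
  qed
  obtain u where "u \<in> set ?l" unfolding l using d v unfolding bfs_dist_def by blast
  then have "parent A R v = hd ?l" "hd ?l \<in> set ?l" unfolding parent_def by (cases ?l; simp)+
  then have "parent A R v \<in> set ?l" by simp
  then show "parent A R v \<in> V \<and> {parent A R v, v} \<in> F \<and> distance A R v = Suc (distance A R (parent A R v))"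
    unfolding l using FV by (auto simp: edges_in_def)
qed

section \<open>The computed double cover, core and saturation\<close>

lemma set_doubled: "set A = adj F \<Longrightarrow> set (doubled A) = arcs (free F)"
proof -
  assume A: "set A = adj F"
  have "((u, i), (v, j)) \<in> set (doubled A) \<longleftrightarrow> i = (\<not> j) \<and> (u, v) \<in> set A" for u i v j
    by (force simp: doubled_def)
  then show ?thesis using A by (auto simp: arcs_def adj_def)
qed

lemma odd_list_iff:
  assumes "set A = adj F"
  shows "odd_list A \<longleftrightarrow> has_odd F"
proof
  assume "odd_list A"
  then show "has_odd F"
    unfolding odd_list_def has_odd_def reachable_iff set_doubled[OF assms] linked_def by blast
next
  assume "has_odd F"
  then obtain u where u: "((u, False), (u, True)) \<in> (arcs (free F))\<^sup>*" by (auto simp: has_odd_def linked_def)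
  then obtain q where "((u, False), q) \<in> arcs (free F)" by (cases rule: converse_rtranclE) auto
  then obtain w where "(u, w) \<in> set A" using assms by (cases q) (auto simp: arcs_iff adj_def)
  then show "odd_list A"
    unfolding odd_list_def reachable_iff set_doubled[OF assms] using u by (intro bexI[of _ "(u, w)"]) simp_all
qed

lemma set_delete_edge: "set A = adj F \<Longrightarrow> set (delete_edge f A) = adj (F - {{fst f, snd f}})"
  by (cases f) (auto simp: delete_edge_def adj_def doubleton_eq_iff)

lemma critical_arc_iff:
  assumes "set A = adj E" "(u, v) \<in> set A"
  shows "critical_arc A (u, v) \<longleftrightarrow> {u, v} \<in> critical E"
  using assms odd_list_iff[OF assms(1)] odd_list_iff[OF set_delete_edge[OF assms(1)], of "(u, v)"]
  by (simp add: critical_arc_def critical_def adj_def)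

lemma in_core_iff:
  assumes "set A = adj E"
  shows "in_core A r v \<longleftrightarrow> (r, v) \<in> (adj (E - critical E))\<^sup>*"
proof -
  have "(u, v) \<in> set (filter (\<lambda>e. \<not> critical_arc A e) A) \<longleftrightarrow> (u, v) \<in> adj (E - critical E)" for u v
    using critical_arc_iff[OF assms, of u v] assms by (auto simp: adj_def)
  then have "set (filter (\<lambda>e. \<not> critical_arc A e) A) = adj (E - critical E)" by auto
  then show ?thesis by (simp only: in_core_def reachable_iff)
qed

lemma set_kept_list:
  assumes A: "set A = adj E" and EV: "edges_in V E"
  shows "set (kept_list A r) = adj (kept V E r)"
proof -
  have "(u, v) \<in> set (kept_list A r) \<longleftrightarrow> (u, v) \<in> adj (kept V E r)" for u v
  proof (cases "(u, v) \<in> set A")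
    case True
    then have "{u, v} \<in> E" "u \<in> V" "v \<in> V" using A EV by (auto simp: adj_def edges_in_def)
    then have "(u, v) \<in> adj (kept V E r) \<longleftrightarrow> (if in_core A r u then in_core A r v \<and> {u, v} \<notin> critical E
       else \<not> in_core A r v)"
      by (auto simp: adj_def kept_def core_def in_core_iff[OF A])
    then show ?thesis using True critical_arc_iff[OF A True] by (simp add: kept_list_def)
  next
    case False
    then show ?thesis using A kept_subset[of V E r] by (auto simp: kept_list_def adj_def)
  qed
  then show ?thesis by auto
qed

lemma set_all_perms: "set A = adj F \<Longrightarrow> set (all_perms A) = free F"
proof -
  assume A: "set A = adj F"
  have "(u, v, k) \<in> set (all_perms A) \<longleftrightarrow> (u, v) \<in> set A" for u v k
    by (cases k) (force simp: all_perms_def)+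
  then show ?thesis using A by (auto simp: free_def adj_def)
qed

lemma set_arcs_list: "set (arcs_list G) = arcs (set G)"
  by (force simp: arcs_list_def arcs_def)

lemma set_remove_perm: "set (remove_perm (u, w, k) G) = set G - {(u, w, k), (w, u, k)}"
  by (auto simp: remove_perm_def)

text \<open>For the last clause, the final set of permissions is contained in the one present when
  \<open>t\<close> was tried. A path showing \<open>t\<close> to be redundant at the end would have
  shown it then, and \<open>t\<close> would have been removed.\<close>

lemma fold_try_remove:
  assumes "sym_perms (set G)" "\<And>a b. {a, b} \<in> F \<Longrightarrow> \<exists>k. (a, b, k) \<in> set G"
  shows "set (fold try_remove ts G) \<subseteq> set G \<and> sym_perms (set (fold try_remove ts G)) \<and>
    (\<forall>a b. {a, b} \<in> F \<longrightarrow> (\<exists>k. (a, b, k) \<in> set (fold try_remove ts G))) \<and>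
    (arcs (set (fold try_remove ts G)))\<^sup>* = (arcs (set G))\<^sup>* \<and>
    (\<forall>u w k. (u, w, k) \<in> set ts \<longrightarrow> (u, w, k) \<in> set (fold try_remove ts G) \<longrightarrow>
      (u, w, \<not> k) \<in> set (fold try_remove ts G) \<longrightarrow>
      ((u, \<not> k), (w, k)) \<notin> (arcs (set (fold try_remove ts G) - {(u, w, k), (w, u, k)}))\<^sup>*)"
  using assms
proof (induction ts arbitrary: G)
  case (Cons t ts)
  obtain x y j where t: "t = (x, y, j)" by (cases t)
  let ?G = "try_remove t G" and ?H = "fold try_remove ts (try_remove t G)"
  have R: "set (remove_perm t G) = set G - {(x, y, j), (y, x, j)}" unfolding t by (rule set_remove_perm)
  have cond: "?G = (if (x, y, \<not> j) \<in> set G \<and> ((x, \<not> j), (y, j)) \<in> (arcs (set G - {(x, y, j), (y, x, j)}))\<^sup>*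
      then remove_perm t G else G)"
    unfolding try_remove_def reachable_iff set_arcs_list R by (simp add: t)
  have sym: "sym_perms (set ?G)" using Cons.prems(1) R unfolding cond by (auto simp: sym_perms_def)
  have edges: "\<exists>k. (a, b, k) \<in> set ?G" if "{a, b} \<in> F" for a b
  proof (cases "(x, y, \<not> j) \<in> set G \<and> ((a, b) = (x, y) \<or> (a, b) = (y, x))")
    case True
    then have "(a, b, \<not> j) \<in> set ?G" using R Cons.prems(1) unfolding cond by (auto simp: sym_perms_def)
    then show ?thesis by blast
  next
    case False
    then show ?thesis using R Cons.prems(2)[OF that] unfolding cond by auto
  qed
  have sub: "set ?G \<subseteq> set G" using R unfolding cond by auto
  have arcs: "(arcs (set ?G))\<^sup>* = (arcs (set G))\<^sup>*"
    using R arcs_remove_perm[OF Cons.prems(1), of x j y] unfolding cond by auto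
  note IH = Cons.IH[OF sym edges]
  have "((x, \<not> j), (y, j)) \<notin> (arcs (set ?H - {(x, y, j), (y, x, j)}))\<^sup>*"
    if in_H: "(x, y, j) \<in> set ?H" "(x, y, \<not> j) \<in> set ?H"
  proof
    assume path: "((x, \<not> j), (y, j)) \<in> (arcs (set ?H - {(x, y, j), (y, x, j)}))\<^sup>*"
    have HG: "set ?H \<subseteq> set ?G" using IH by blast
    then have "arcs (set ?H - {(x, y, j), (y, x, j)}) \<subseteq> arcs (set G - {(x, y, j), (y, x, j)})"
      using sub by (intro arcs_mono) blast
    then have "((x, \<not> j), (y, j)) \<in> (arcs (set G - {(x, y, j), (y, x, j)}))\<^sup>*" using path rtrancl_mono by blast
    then have "set ?G = set G - {(x, y, j), (y, x, j)}" using R in_H(2) HG sub unfolding cond by auto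
    then show False using in_H(1) HG by auto
  qed
  then show ?case using IH sub arcs unfolding t fold_simps(2) by auto
qed simp

lemma saturated_saturate:
  assumes A: "set A = adj F"
  shows "saturated F (set (saturate A))"
proof -
  have P: "set (all_perms A) = free F" by (rule set_all_perms[OF A])
  have "sym_perms (set (all_perms A))" "\<And>a b. {a, b} \<in> F \<Longrightarrow> \<exists>k. (a, b, k) \<in> set (all_perms A)"
    unfolding P by (rule sym_perms_free) simp
  from fold_try_remove[where F = F and ts = "all_perms A", OF this]
  show ?thesis unfolding saturated_def saturate_def linked_def P[symmetric] by blast
qed

section \<open>Connecting candidates\<close>

lemma two_colouring_commute: "set A = adj E \<Longrightarrow> edges_in V E \<Longrightarrow> two_colouring A r s i (x, y) = two_colouring A r s i (y, x)"
proof -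
  assume A: "set A = adj E" "edges_in V E"
  have "sym_perms (set (saturate (kept_list A r)))"
    using saturated_saturate[OF set_kept_list[OF A]] by (simp add: saturated_def)
  from two_colour_commute[OF this] show ?thesis unfolding two_colouring_def by (metis fst_conv snd_conv)
qed

text \<open>The existence of any connecting colouring with two colours gives the structural
  condition, and this in turn gives roots and a bit that work for the computed permissions and
  distances.\<close>

lemma two_colouring_connecting:
  assumes fg: "finite_simple_graph V E" and J: "joined V E" and A: "set A = adj E"
    and ex: "connecting_colouring V E 2 c0"
  shows "\<exists>r\<in>V. \<exists>s\<in>V. \<exists>i. \<forall>c. (\<forall>x y. {x, y} \<in> E \<longrightarrow> c {x, y} = two_colouring A r s i (x, y)) \<longrightarrow>
    connecting_colouring V E 2 c"
proof -
  have EV: "edges_in V E" by (rule simple_graph_edges_in[OF fg])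
  obtain r s where rs: "r \<in> V" "s \<in> V" "\<forall>v\<in>V. \<exists>x\<in>{r, s}. (x, v) \<in> (adj (kept V E r))\<^sup>*"
    and H: "\<forall>G d. saturated (kept V E r) G \<longrightarrow> bfs_dist V (kept V E r) {r, s} d \<longrightarrow>
      (\<exists>i. \<forall>c. (\<forall>x y. {x, y} \<in> E \<longrightarrow> c {x, y} = (if two_colour G d (core V E r) i x y then 2 else 1)) \<longrightarrow>
        connecting_colouring V E 2 c)"
    using two_colouring_exists[OF fg J two_colouring_condition[OF fg J ex]] by blast
  have B: "set (kept_list A r) = adj (kept V E r)" by (rule set_kept_list[OF A EV])
  have "bfs_dist V (kept V E r) (set [r, s]) (distance (kept_list A r) [r, s])"
    by (rule bfs_distance[OF B edges_in_subset[OF EV kept_subset]]) (use rs in auto)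
  then have "bfs_dist V (kept V E r) {r, s} (distance (kept_list A r) [r, s])" by simp
  then obtain i where i: "\<forall>c. (\<forall>x y. {x, y} \<in> E \<longrightarrow> c {x, y} =
      (if two_colour (set (saturate (kept_list A r))) (distance (kept_list A r) [r, s]) (core V E r) i x y then 2 else 1)) \<longrightarrow>
        connecting_colouring V E 2 c"
    using H saturated_saturate[OF B] by blast
  have core: "x \<in> core V E r \<longleftrightarrow> in_core A r x" if "x \<in> V" for x
    using that by (simp add: core_def in_core_iff[OF A])
  have "two_colouring A r s i (x, y) =
      (if two_colour (set (saturate (kept_list A r))) (distance (kept_list A r) [r, s]) (core V E r) i x y then 2 else 1)"
    if "{x, y} \<in> E" for x y
  proof -
    have "x \<in> V" "y \<in> V" using that EV by (auto simp: edges_in_def)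
    then show ?thesis unfolding two_colouring_def two_colour_def level_bit_def Let_def by (simp add: core)
  qed
  then show ?thesis using i rs(1,2) by (intro bexI[of _ r] bexI[of _ s] exI[of _ i]) simp_all
qed

lemma three_colouring_commute: "three_colouring A f (x, y) = three_colouring A f (y, x)"
  unfolding three_colouring_def Let_def by (simp add: cycle_colour_commute)

lemma three_colouring_connecting:
  assumes fg: "finite_simple_graph V E" and J: "joined V E" and A: "set A = adj E"
    and ab: "{a, b} \<in> E" "(a, b) \<in> (adj (E - {{a, b}}))\<^sup>*"
    and c: "\<And>x y. {x, y} \<in> E \<Longrightarrow> c {x, y} = three_colouring A (a, b) (x, y)"
  shows "connecting_colouring V E 3 c"
proof -
  let ?F = "E - {{a, b}}"
  define B where "B = delete_edge (a, b) A"
  define Q where "Q = cycle_list B (a, b)"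
  have EV: "edges_in V E" by (rule simple_graph_edges_in[OF fg])
  have FV: "edges_in V ?F" by (rule edges_in_subset[OF EV]) blast
  have JF: "joined V ?F" by (rule joined_delete_cycle_edge[OF J ab(2)])
  have V: "a \<in> V" "b \<in> V" using ab EV by (auto simp: edges_in_def)
  have B: "set B = adj ?F" unfolding B_def set_delete_edge[OF A] by simp
  have d: "bfs_dist V ?F {a} (distance B [a])"
    using bfs_distance[OF B FV, of "[a]"] JF V by (auto simp: joined_def)
  have pr: "is_parent V ?F {a} (distance B [a]) (parent B [a])"
    using parent_is_parent[OF B FV, of "[a]"] d by simp
  have Q: "set Q = {(parent B [a] ^^ i) b | i. i \<le> distance B [a] b}"
  proof -
    have "set [0..<Suc m] = {i. i \<le> m}" for m by auto
    then show ?thesis unfolding Q_def cycle_list_def ancestor_def set_map by (simp add: image_Collect del: upt_Suc)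
  qed
  have bQ: "b \<in> set Q" unfolding Q by (auto intro: exI[of _ 0])
  have D: "bfs_dist V ?F (set Q) (distance B Q)"
    using bfs_distance[OF B FV, of Q] JF V bQ by (auto simp: joined_def)
  have par: "is_parent V ?F (set Q) (distance B Q) (parent B Q)" by (rule parent_is_parent[OF B FV D])
  let ?z = "\<lambda>v. ancestor B Q (distance B Q v) v"
  have z: "?z v = v" if "v \<in> set Q" for v using D that by (simp add: bfs_dist_def ancestor_def)
  have z': "?z v = ?z (parent B Q v)" if "v \<in> V - set Q" for v
    using par that by (simp add: is_parent_def ancestor_def funpow_swap1)
  have "c {x, y} = cycle_colour a b (distance B [a]) (distance B Q) ?z x y" if "{x, y} \<in> E" for x y
    using c[OF that] unfolding three_colouring_def Let_def B_def Q_def by simp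
  from three_colours_sufficient[OF fg ab(1) d pr Q D par z z' this] show ?thesis by blast
qed

lemma tree_colour_commute: "tree_colour n A (x, y) = tree_colour n A (y, x)"
  by (simp add: tree_colour_def)

lemma filter_arcs_card:
  assumes fg: "finite_simple_graph V E" and A: "set A = adj E" "distinct A"
  shows "length (filter (\<lambda>e. fst e = v) A) = degree_of E v"
proof -
  have "length (filter (\<lambda>e. fst e = v) A) = card {e \<in> set A. fst e = v}"
    using A(2) by (metis distinct_card distinct_filter set_filter)
  also have "{e \<in> set A. fst e = v} = Pair v ` {w. {v, w} \<in> E}" using A(1) by (auto simp: adj_def)
  also have "card \<dots> = card {w. {v, w} \<in> E}" by (intro card_image) (auto simp: inj_on_def)
  finally show ?thesis by (simp add: degree_of_eq[OF fg])
qed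

text \<open>No degree exceeds \<open>n\<close>, so counting the \<open>k < n\<close> below some
  degree misses nothing.\<close>

lemma degree_bound_eq:
  assumes fg: "finite_simple_graph {..<n} E" and n: "n > 0" and A: "set A = adj E" "distinct A"
  shows "degree_bound n A = max_degree {..<n} E"
proof -
  have le: "degree_of E v \<le> n" for v
  proof -
    have "{e \<in> E. v \<in> e} \<subseteq> (\<lambda>w. {v, w}) ` {..<n}"
    proof
      fix e assume e: "e \<in> {e \<in> E. v \<in> e}"
      obtain x y where "e = {x, y}" "x \<in> {..<n}" "y \<in> {..<n}" using e by (auto elim: simple_graph_edge[OF fg])
      then show "e \<in> (\<lambda>w. {v, w}) ` {..<n}" using e by (auto simp: insert_commute)
    qed
    then have "degree_of E v \<le> card ((\<lambda>w. {v, w}) ` {..<n})" unfolding degree_of_def by (intro card_mono) auto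
    also have "\<dots> \<le> n" using card_image_le[of "{..<n}"] by fastforce
    finally show ?thesis .
  qed
  let ?D = "max_degree {..<n} E"
  have D: "k < ?D \<longleftrightarrow> (\<exists>v<n. k < degree_of E v)" for k
    unfolding max_degree_def using n by (subst Max_gr_iff) auto
  have "{k. k < n \<and> (\<exists>v<n. k < degree_of E v)} = {..<?D}"
    unfolding D[symmetric] using D le by (auto intro: less_le_trans)
  moreover have "degree_bound n A = card {k. k < n \<and> (\<exists>v<n. k < degree_of E v)}"
    unfolding degree_bound_def filter_arcs_card[OF fg A] length_filter_conv_card[of _ "[0..<n]"]
    by (rule arg_cong[of _ _ card]) auto
  ultimately show ?thesis by simp
qed

lemma tree_colour_connecting:
  assumes fg: "finite_simple_graph {..<n} E" and J: "joined {..<n} E" and A: "set A = adj E" "distinct A"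
    and br: "\<And>u w. {u, w} \<in> E \<Longrightarrow> (u, w) \<notin> (adj (E - {{u, w}}))\<^sup>*"
    and c: "\<And>x y. {x, y} \<in> E \<Longrightarrow> c {x, y} = tree_colour n A (x, y)"
  shows "connecting_colouring {..<n} E (max_degree {..<n} E) c"
proof -
  have EV: "edges_in {..<n} E" by (rule simple_graph_edges_in[OF fg])
  have n: "n > 0" using J by (auto simp: joined_def)
  then have r: "0 \<in> {..<n}" by simp
  define d where "d = distance A [0]"
  define par where "par = parent A [0]"
  have d: "bfs_dist {..<n} E {0} d"
    using bfs_distance[OF A(1) EV, of "[0]"] J r unfolding d_def by (auto simp: joined_def)
  have par: "is_parent {..<n} E {0} d par"
    using parent_is_parent[OF A(1) EV, of "[0]"] d unfolding d_def par_def by simp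
  have idx: "child_index n A v = card {w \<in> {..<n} - {0}. par w = par v \<and> id w < id v}" for v
    unfolding child_index_def par_def length_filter_conv_card
    by (rule arg_cong[of _ _ card]) auto
  have sm_eq: "tree_shift n A v = (\<Sum>i<d v. Suc (child_index n A ((par ^^ i) v))) mod max_degree {..<n} E" for v
    unfolding tree_shift_def degree_bound_eq[OF fg n A] d_def par_def ancestor_def
    by (simp add: length_concat comp_def interv_sum_list_conv_sum_set_nat atLeast0LessThan del: upt_Suc)
  have sm: "tree_shift n A v = (tree_shift n A (par v) + Suc (child_index n A v)) mod max_degree {..<n} E"
    if v: "v \<in> {..<n}" "v \<noteq> 0" for v
  proof -
    have "d v = Suc (d (par v))" using par v by (auto simp: is_parent_def)
    then have "(\<Sum>i<d v. Suc (child_index n A ((par ^^ i) v))) =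
        (\<Sum>i<d (par v). Suc (child_index n A ((par ^^ i) (par v)))) + Suc (child_index n A v)"
      by (simp add: sum.lessThan_Suc_shift funpow_swap1 del: sum.lessThan_Suc)
    then show ?thesis unfolding sm_eq by (simp only: mod_add_left_eq)
  qed
  have sm0: "tree_shift n A 0 = 0" using d by (simp add: sm_eq bfs_dist_def)
  have "c {par v, v} = Suc (tree_shift n A v)" if v: "v \<in> {..<n}" "v \<noteq> 0" for v
  proof -
    have "{par v, v} \<in> E" "d v = Suc (d (par v))" using par v by (auto simp: is_parent_def)
    then show ?thesis using c by (simp add: tree_colour_def d_def)
  qed
  from tree_colouring[OF fg J r br par inj_on_id idx refl sm sm0 this] show ?thesis by blast
qed

section \<open>The connectivity test\<close>

lemma step_list_iff:
  "((x, k), (y, j)) \<in> set (step_list C) \<longleftrightarrow> ((x, y), j) \<in> set C \<and> k \<noteq> j \<and> k \<in> insert 0 (snd ` set C)"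
proof -
  have "((x, k), (y, j)) \<in> (\<lambda>k. ((fst (fst t), k), (snd (fst t), snd t))) ` set (filter (\<lambda>k. k \<noteq> snd t) (0 # map snd C))
      \<longleftrightarrow> t = ((x, y), j) \<and> k \<noteq> j \<and> k \<in> insert 0 (snd ` set C)" for t
    by (cases t) (auto simp: image_iff)
  then show ?thesis unfolding step_list_def set_concat set_map by auto
qed

lemma connects_iff:
  fixes A :: "(nat \<times> nat) list"
  assumes fg: "finite_simple_graph {..<n} E" and A: "set A = adj E" and pos: "\<And>e. e \<in> E \<Longrightarrow> c e \<noteq> 0"
  shows "connects n (map (\<lambda>e. (e, c {fst e, snd e})) A) \<longleftrightarrow>
    (\<forall>u<n. \<forall>v<n. \<exists>p. walk_between {..<n} E u p v \<and> properly_coloured c p)"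
proof -
  let ?C = "map (\<lambda>e. (e, c {fst e, snd e})) A" and ?S = "steps (colour_perms E c)"
  let ?K = "insert 0 (snd ` set ?C)"
  have EV: "edges_in {..<n} E" by (rule simple_graph_edges_in[OF fg])
  have mem: "((x, y), j) \<in> set ?C \<longleftrightarrow> {x, y} \<in> E \<and> j = c {x, y}" for x y j
    using A by (auto simp: adj_def image_iff)
  have T: "((x, k), (y, j)) \<in> set (step_list ?C) \<longleftrightarrow> ((x, k), (y, j)) \<in> ?S \<and> k \<in> ?K" for x k y j
    unfolding step_list_iff using mem by (auto simp: steps_def colour_perms_def)
  have sub: "set (step_list ?C) \<subseteq> ?S" using T by auto
  have range: "j \<in> ?K" if S: "((x, k), (y, j)) \<in> ?S" for x k y j
  proof -
    have "((x, y), j) \<in> set ?C" using S unfolding mem by (auto simp: steps_def colour_perms_def)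
    then show ?thesis by force
  qed
  \<comment> \<open>\<open>step_list\<close> restricts the first state of a step to colours that
    occur, or 0; every state on a path from \<open>(u, 0)\<close> is of this kind.\<close>
  have from0: "snd q \<in> ?K \<and> ((u, 0), q) \<in> (set (step_list ?C))\<^sup>*" if "((u, 0), q) \<in> ?S\<^sup>*" for u q
    using that
  proof (induction rule: rtrancl_induct)
    case (step q q')
    then show ?case using T[of "fst q" "snd q" "fst q'" "snd q'"] range[of "fst q" "snd q" "fst q'" "snd q'"]
      by (auto intro: rtrancl_into_rtrancl)
  qed simp
  \<comment> \<open>The colour of the initial state constrains only the first edge, and 0 constrains
    nothing because \<open>c\<close> does not vanish on \<open>E\<close>.\<close>
  have start: "\<exists>j. ((u, 0), (v, j)) \<in> ?S\<^sup>*" if "((u, i), (v, j)) \<in> ?S\<^sup>*" for u i v j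
    using that
  proof (cases rule: converse_rtranclE)
    case (step q)
    then have "((u, 0), q) \<in> ?S" using pos by (fastforce simp: steps_def colour_perms_def)
    then have "((u, 0), (v, j)) \<in> ?S\<^sup>*" using step(2) by (rule converse_rtrancl_into_rtrancl)
    then show ?thesis by blast
  qed auto
  have two: "\<exists>k'. k' \<noteq> k" for k :: nat by (metis n_not_Suc_n)
  have "(\<exists>p. walk_between {..<n} E u p v \<and> properly_coloured c p) \<longleftrightarrow>
      (\<exists>k\<in>set (0 # map snd ?C). reachable (step_list ?C) (u, 0) (v, k))" if "u < n" for u v
  proof -
    have "(\<exists>p. walk_between {..<n} E u p v \<and> properly_coloured c p) \<longleftrightarrow> (\<exists>i j. ((u, i), (v, j)) \<in> ?S\<^sup>*)"
      using that by (intro proper_walk_iff[of E c c "{..<n}" u v] EV two) simp_all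
    also have "\<dots> \<longleftrightarrow> (\<exists>k\<in>?K. ((u, 0), (v, k)) \<in> (set (step_list ?C))\<^sup>*)"
    proof
      assume "\<exists>i j. ((u, i), (v, j)) \<in> ?S\<^sup>*"
      then obtain j where "((u, 0), (v, j)) \<in> ?S\<^sup>*" using start by blast
      then show "\<exists>k\<in>?K. ((u, 0), (v, k)) \<in> (set (step_list ?C))\<^sup>*" using from0[of u "(v, j)"] by (intro bexI[of _ j]) simp_all
    next
      assume "\<exists>k\<in>?K. ((u, 0), (v, k)) \<in> (set (step_list ?C))\<^sup>*"
      then show "\<exists>i j. ((u, i), (v, j)) \<in> ?S\<^sup>*" using rtrancl_mono[OF sub] by blast
    qed
    finally show ?thesis by (simp add: reachable_iff)
  qed
  then show ?thesis unfolding connects_def by (simp add: Ball_def)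
qed

section \<open>The first connecting candidate is optimal\<close>

lemma hd_filter_append:
  "hd (filter P (xs @ ys) @ [d]) = (if \<exists>x\<in>set xs. P x then hd (filter P xs) else hd (filter P ys @ [d]))"
proof (cases "\<exists>x\<in>set xs. P x")
  case True
  then have "filter P xs \<noteq> []" by (auto simp: filter_empty_conv)
  then show ?thesis using True by simp
next
  case False
  then have "filter P xs = []" by (auto simp: filter_empty_conv)
  then show ?thesis unfolding filter_append using False by simp
qed

lemma hd_filter_in:
  assumes "\<exists>x\<in>set xs. P x" shows "hd (filter P xs) \<in> set xs \<and> P (hd (filter P xs))"
proof -
  have "filter P xs \<noteq> []" using assms by (auto simp: filter_empty_conv)
  then have "hd (filter P xs) \<in> set (filter P xs)" by (rule hd_in_set)
  then show ?thesis by simp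
qed

definition adjacency :: "nat \<Rightarrow> nat set set \<Rightarrow> nat list list" where
  "adjacency n E = map (\<lambda>u. map (\<lambda>v. if {u, v} \<in> E then 1 else 0) [0..<n]) [0..<n]"

lemma enc_matrix_eq: "enc_matrix n a = enc (map (\<lambda>u. map (\<lambda>v. a u v) [0..<n]) [0..<n])"
  by (simp add: enc_matrix_def enc_list_def enc_nat_def comp_def)

lemma bsize_adjacency: "bsize (adjacency n E) \<le> n * (2 * n + 1)"
proof -
  have row: "bsize (map (\<lambda>v. if {u, v} \<in> E then 1 else 0 :: nat) vs) \<le> 2 * length vs" for u and vs :: "nat list"
    by (induction vs) auto
  have rows: "bsize (map (\<lambda>u. map (\<lambda>v. if {u, v} \<in> E then 1 else 0 :: nat) [0..<n]) us) \<le> length us * (2 * n + 1)"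
    for us :: "nat list"
  proof (induction us)
    case (Cons u us)
    then show ?case using row[of u "[0..<n]"] by simp
  qed simp
  then show ?thesis using rows[of "[0..<n]"] by (simp add: adjacency_def)
qed

lemma arc_list_adjacency:
  assumes fg: "finite_simple_graph {..<n} E"
  shows "set (arc_list (adjacency n E)) = adj E" "distinct (arc_list (adjacency n E))"
proof -
  have len: "length (adjacency n E) = n" by (simp add: adjacency_def)
  have entry: "hd (drop v (hd (drop u (adjacency n E) @ [[]])) @ [0]) = (if {u, v} \<in> E then 1 else 0)"
    if "u < n" "v < n" for u v
  proof -
    have "hd (drop u (adjacency n E) @ [[]]) = map (\<lambda>v. if {u, v} \<in> E then 1 else 0) [0..<n]"
      using that by (simp add: adjacency_def hd_append hd_drop_conv_nth)
    then show ?thesis using that by (simp add: hd_append hd_drop_conv_nth)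
  qed
  have EV: "edges_in {..<n} E" by (rule simple_graph_edges_in[OF fg])
  have "(u, v) \<in> set (arc_list (adjacency n E)) \<longleftrightarrow> {u, v} \<in> E" for u v
  proof -
    have "(u, v) \<in> set (concat (map (\<lambda>u. map (\<lambda>v. (u, v)) [0..<n]) [0..<n])) \<longleftrightarrow> u < n \<and> v < n"
      by (auto simp: image_iff)
    moreover have "{u, v} \<in> E \<Longrightarrow> u < n \<and> v < n" using EV by (auto simp: edges_in_def)
    moreover have "u < n \<Longrightarrow> v < n \<Longrightarrow> hd (drop v (hd (drop u (adjacency n E) @ [[]])) @ [0]) = 1 \<longleftrightarrow> {u, v} \<in> E"
      using entry[of u v] by simp
    ultimately show ?thesis unfolding arc_list_def len set_filter mem_Collect_eq fst_conv snd_conv by blast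
  qed
  then show "set (arc_list (adjacency n E)) = adj E" by (auto simp: adj_def)
  show "distinct (arc_list (adjacency n E))"
    unfolding arc_list_def product_concat_map[symmetric] by (intro distinct_filter distinct_product) auto
qed

text \<open>A connecting candidate is optimal once fewer colours are excluded. If no candidate with
  two colours connects, no two-colouring does, by \<open>two_colouring_connecting\<close>; if no
  candidate with three colours connects either, every edge is a bridge and the tree colouring is
  optimal.\<close>

lemma colour_list_optimal:
  assumes fg: "finite_simple_graph {..<n} E" and con: "connected_graph {..<n} E"
  shows "\<exists>c. optimal_connecting_colouring {..<n} E c \<and>
    colour_list (adjacency n E) = map (\<lambda>e. (e, c {fst e, snd e})) (arc_list (adjacency n E))"
proof -
  let ?V = "{..<n}" and ?A = "arc_list (adjacency n E)" and ?N = "proper_walk_connection_number {..<n} E"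
  have EV: "edges_in ?V E" by (rule simple_graph_edges_in[OF fg])
  have J: "joined ?V E" using con connected_graph_iff[OF EV] by simp
  note A = arc_list_adjacency[OF fg]
  have len: "length (adjacency n E) = n" by (simp add: adjacency_def)
  let ?P = "connects n" and ?L = "\<lambda>c. map (\<lambda>e. (e, c {fst e, snd e})) ?A"
  have P: "?P (?L c) \<longleftrightarrow> connecting_colouring ?V E k c" if "c \<in> E \<rightarrow> {1..k}" for c k
  proof -
    have "c e \<noteq> 0" if "e \<in> E" for e using funcset_mem[OF \<open>c \<in> E \<rightarrow> {1..k}\<close> that] by simp
    then show ?thesis using connects_iff[OF fg A(1), of c] that by (auto simp: connecting_colouring_def)
  qed
  have symL: "\<exists>c. (\<forall>x y. c {x, y} = f (x, y)) \<and> map (\<lambda>e. (e, f e)) ?A = ?L c"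
    if sym: "\<And>x y. f (x, y) = f (y, x)" for f :: "nat \<times> nat \<Rightarrow> nat"
  proof -
    obtain c where c: "\<forall>x y. c {x, y} = f (x, y)"
      using symmetric_edge_function[of "\<lambda>x y. f (x, y)", OF sym] by blast
    have "f e = c {fst e, snd e}" for e unfolding c[rule_format] by simp
    then have "map (\<lambda>e. (e, f e)) ?A = ?L c" by (simp only:)
    with c show ?thesis by blast
  qed
  have rangeE: "c \<in> E \<rightarrow> S" if "\<And>x y. c {x, y} \<in> S" for c :: "nat set \<Rightarrow> nat" and S
  proof
    fix e assume e: "e \<in> E"
    obtain x y where "e = {x, y}" by (rule simple_graph_edge[OF fg e])
    then show "c e \<in> S" using that by simp
  qed
  let ?L1 = "[map (\<lambda>e. (e, 1)) ?A]"
  let ?L2 = "concat (map (\<lambda>r. concat (map (\<lambda>s. map (\<lambda>i. map (\<lambda>e. (e, two_colouring ?A r s i e)) ?A) [False, True])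
       [0..<n])) [0..<n])"
  let ?L3 = "map (\<lambda>f. map (\<lambda>e. (e, three_colouring ?A f e)) ?A) ?A"
  let ?L4 = "[map (\<lambda>e. (e, tree_colour n ?A e)) ?A]"
  have two: "\<exists>c. (\<forall>x y. c {x, y} = two_colouring ?A r s i (x, y)) \<and> c \<in> E \<rightarrow> {1..2} \<and>
      map (\<lambda>e. (e, two_colouring ?A r s i e)) ?A = ?L c" for r s i
  proof -
    obtain c where c: "\<forall>x y. c {x, y} = two_colouring ?A r s i (x, y)" "map (\<lambda>e. (e, two_colouring ?A r s i e)) ?A = ?L c"
      using symL[of "two_colouring ?A r s i", OF two_colouring_commute[OF A(1) EV]] by blast
    moreover have "c \<in> E \<rightarrow> {1..2}" by (rule rangeE) (unfold c(1)[rule_format] two_colouring_def, simp)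
    ultimately show ?thesis by blast
  qed
  have three: "\<exists>c. (\<forall>x y. c {x, y} = three_colouring ?A f (x, y)) \<and> c \<in> E \<rightarrow> {1..3} \<and>
      map (\<lambda>e. (e, three_colouring ?A f e)) ?A = ?L c" for f
  proof -
    obtain c where c: "\<forall>x y. c {x, y} = three_colouring ?A f (x, y)" "map (\<lambda>e. (e, three_colouring ?A f e)) ?A = ?L c"
      using symL[of "three_colouring ?A f", OF three_colouring_commute] by blast
    moreover have "c \<in> E \<rightarrow> {1..3}"
      by (rule rangeE) (unfold c(1)[rule_format] three_colouring_def Let_def, rule cycle_colour_range)
    ultimately show ?thesis by blast
  qed
  have split: "colour_list (adjacency n E) = hd (filter ?P (?L1 @ ?L2 @ ?L3 @ ?L4) @ [[]])"
    unfolding colour_list_def len candidates_def ..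
  have one: "?P (?L (\<lambda>_. 1)) \<longleftrightarrow> complete_graph ?V E"
    using P[of "\<lambda>_. 1" 1] connecting_one_iff[OF fg, of "\<lambda>_. 1"] by simp
  show ?thesis
  proof (cases "complete_graph ?V E")
    case True
    then have "?N = 1" using connection_number[OF fg con] by simp
    moreover have "connecting_colouring ?V E 1 (\<lambda>_. 1)" using True connecting_one_iff[OF fg] by simp
    moreover have "colour_list (adjacency n E) = ?L (\<lambda>_. 1)"
      unfolding split hd_filter_append using one True by simp
    ultimately show ?thesis unfolding optimal_connecting_colouring_def by auto
  next
    case nc: False
    then have no1: "\<not> (\<exists>C\<in>set ?L1. ?P C)" using one by simp
    have not1: "\<not> connecting_colouring ?V E 1 c" for c using nc connecting_one_iff[OF fg] by simp
    show ?thesis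
    proof (cases "\<exists>C\<in>set ?L2. ?P C")
      case True
      then have cl: "colour_list (adjacency n E) = hd (filter ?P ?L2)"
        unfolding split by (simp only: hd_filter_append no1 if_False True if_True)
      have "\<exists>r s i. C = map (\<lambda>e. (e, two_colouring ?A r s i e)) ?A" if "C \<in> set ?L2" for C
        using that by auto
      from this[OF hd_filter_in[OF True, THEN conjunct1]] obtain r s i where rsi: "colour_list (adjacency n E) = map (\<lambda>e. (e, two_colouring ?A r s i e)) ?A"
        unfolding cl by blast
      obtain c where c: "c \<in> E \<rightarrow> {1..2}" "colour_list (adjacency n E) = ?L c"
        using two[of r s i] unfolding rsi by blast
      then have conn: "connecting_colouring ?V E 2 c" using P[OF c(1)] hd_filter_in[OF True] cl by simp
      have "?N = 2" by (rule connection_number_eqI[OF _ conn]) (use not1 in auto)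
      then show ?thesis using c conn unfolding optimal_connecting_colouring_def by auto
    next
      case no2: False
      have not2: "\<not> connecting_colouring ?V E 2 c0" for c0
      proof
        assume "connecting_colouring ?V E 2 c0"
        from two_colouring_connecting[OF fg J A(1) this] obtain r s i where
          rs: "r \<in> ?V" "s \<in> ?V" "\<And>c. (\<forall>x y. {x, y} \<in> E \<longrightarrow> c {x, y} = two_colouring ?A r s i (x, y)) \<Longrightarrow>
            connecting_colouring ?V E 2 c" by blast
        obtain c where c: "\<forall>x y. c {x, y} = two_colouring ?A r s i (x, y)" "c \<in> E \<rightarrow> {1..2}"
          "map (\<lambda>e. (e, two_colouring ?A r s i e)) ?A = ?L c" using two by blast
        have "?P (?L c)" using P[OF c(2)] rs(3) c(1) by simp
        moreover have "?L c \<in> set ?L2" unfolding c(3)[symmetric] using rs(1,2) by (cases i) force+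
        ultimately show False using no2 by blast
      qed
      show ?thesis
      proof (cases "\<exists>C\<in>set ?L3. ?P C")
        case True
        then have cl: "colour_list (adjacency n E) = hd (filter ?P ?L3)"
          unfolding split by (simp only: hd_filter_append no1 no2 if_False True if_True)
        obtain f where f: "colour_list (adjacency n E) = map (\<lambda>e. (e, three_colouring ?A f e)) ?A"
          using hd_filter_in[OF True] unfolding cl by auto
        obtain c where c: "c \<in> E \<rightarrow> {1..3}" "colour_list (adjacency n E) = ?L c"
          using three[of f] unfolding f by blast
        then have conn: "connecting_colouring ?V E 3 c" using P[OF c(1)] hd_filter_in[OF True] cl by simp
        have "?N = 3" by (rule connection_number_eqI[OF _ conn]) (use not2 in auto)
        then show ?thesis using c conn unfolding optimal_connecting_colouring_def by auto
      next
        case no3: False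
        \<comment> \<open>An edge that is no bridge would have made its candidate in
          \<open>?L3\<close> connecting.\<close>
        have br: "(a, b) \<notin> (adj (E - {{a, b}}))\<^sup>*" if ab: "{a, b} \<in> E" for a b
        proof
          assume path: "(a, b) \<in> (adj (E - {{a, b}}))\<^sup>*"
          obtain c where c: "\<forall>x y. c {x, y} = three_colouring ?A (a, b) (x, y)" "c \<in> E \<rightarrow> {1..3}"
            "map (\<lambda>e. (e, three_colouring ?A (a, b) e)) ?A = ?L c" using three by blast
          have "connecting_colouring ?V E 3 c"
            by (rule three_colouring_connecting[OF fg J A(1) ab path]) (simp add: c(1))
          then have "?P (?L c)" using P[OF c(2)] by simp
          moreover have "(a, b) \<in> set ?A" using A(1) ab by (simp add: adj_def)
          then have "?L c \<in> set ?L3" unfolding c(3)[symmetric] by auto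
          ultimately show False using no3 by blast
        qed
        obtain c where c: "\<forall>x y. c {x, y} = tree_colour n ?A (x, y)" "map (\<lambda>e. (e, tree_colour n ?A e)) ?A = ?L c"
          using symL[of "tree_colour n ?A", OF tree_colour_commute] by blast
        have conn: "connecting_colouring ?V E (max_degree ?V E) c"
          by (rule tree_colour_connecting[OF fg J A br]) (simp_all add: c(1))
        then have "c \<in> E \<rightarrow> {1..max_degree ?V E}" by (simp add: connecting_colouring_def)
        then have valid: "?P (?L c)" using P conn by blast
        have "colour_list (adjacency n E) = hd (filter ?P ?L4 @ [[]])"
          unfolding split by (simp only: hd_filter_append no1 no2 no3 if_False)
        then have "colour_list (adjacency n E) = ?L c" unfolding c(2) using valid by simp
        moreover have "?N = max_degree ?V E" by (rule tree_connection_number[OF fg J br nc])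
        ultimately show ?thesis using conn unfolding optimal_connecting_colouring_def by auto
      qed
    qed
  qed
qed

lemma colour_matrix_adjacency:
  assumes fg: "finite_simple_graph {..<n} E"
    and C: "colour_list (adjacency n E) = map (\<lambda>e. (e, c {fst e, snd e})) (arc_list (adjacency n E))"
  shows "enc (colour_matrix (adjacency n E)) = enc_colouring n E c"
proof -
  let ?A = "arc_list (adjacency n E)"
  have len: "length (adjacency n E) = n" by (simp add: adjacency_def)
  have "hd (map snd (filter (\<lambda>t. fst t = (u, v)) (colour_list (adjacency n E))) @ [0]) =
      (if {u, v} \<in> E then c {u, v} else 0)" for u v
  proof -
    have "map snd (filter (\<lambda>t. fst t = (u, v)) (colour_list (adjacency n E))) =
        map (\<lambda>e. c {fst e, snd e}) (filter (\<lambda>e. e = (u, v)) ?A)"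
      unfolding C by (simp add: filter_map comp_def)
    also have "\<dots> = map (\<lambda>e. c {u, v}) (filter (\<lambda>e. e = (u, v)) ?A)" by (intro map_cong) auto
    finally have eq: "map snd (filter (\<lambda>t. fst t = (u, v)) (colour_list (adjacency n E))) = \<dots>" .
    have mem: "(u, v) \<in> set ?A \<longleftrightarrow> {u, v} \<in> E" using arc_list_adjacency(1)[OF fg] by (simp add: adj_def)
    show ?thesis
    proof (cases "{u, v} \<in> E")
      case True
      then have "filter (\<lambda>e. e = (u, v)) ?A \<noteq> []" using mem by (auto simp: filter_empty_conv)
      then show ?thesis unfolding eq using True by (simp add: hd_append hd_map)
    next
      case False
      then have "filter (\<lambda>e. e = (u, v)) ?A = []" using mem by (auto simp: filter_empty_conv)
      then show ?thesis unfolding eq using False by simp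
    qed
  qed
  then show ?thesis unfolding colour_matrix_def len enc_colouring_def enc_matrix_eq by simp
qed

lemma optimal_colouring_polynomial_time:
  "\<exists>(prog :: com) (q :: nat poly).
      \<forall>(n :: nat) E. finite_simple_graph {..<n} E \<and> connected_graph {..<n} E \<longrightarrow>
        (\<exists>c t. optimal_connecting_colouring {..<n} E c \<and>
               computes_in_time prog (enc_graph n E) t (enc_colouring n E c) \<and>
               t \<le> poly q (n + card E))"
proof -
  obtain prog N T b where T: "\<And>M. T M \<le> (bsize M + 2) ^ b"
    and prog: "computes prog N UNIV enc (\<lambda>M. enc (colour_matrix M)) T"
    using ptime_colour_matrix unfolding ptime_def computable_from_def poly_bounded_def by auto
  \<comment> \<open>The encoded adjacency matrix has size at most \<open>2 * n * n + n\<close>. With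
    the offset 2 of \<open>poly_bounded\<close> this is at most \<open>2 + x + 2 * x * x\<close> for
    \<open>x = n + card E\<close>, which explains the polynomial.\<close>
  show ?thesis
  proof (rule exI[of _ prog], rule exI[of _ "[:2, 1, 2:] ^ b"], intro allI impI)
    fix n and E :: "nat set set" assume *: "finite_simple_graph {..<n} E \<and> connected_graph {..<n} E"
    let ?M = "adjacency n E"
    obtain c where c: "optimal_connecting_colouring {..<n} E c"
      "colour_list ?M = map (\<lambda>e. (e, c {fst e, snd e})) (arc_list ?M)"
      using colour_list_optimal * by blast
    have out: "enc (colour_matrix ?M) = enc_colouring n E c" using colour_matrix_adjacency[OF _ c(2)] * by blast
    have inp: "enc_graph n E = enc ?M" by (simp add: enc_graph_def enc_matrix_eq adjacency_def)
    let ?s = "(\<lambda>_. Leaf)(0 := enc ?M)"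
    obtain t where t: "t \<le> T ?M" "exec prog ?s t (?s(0 := enc (colour_matrix ?M)))"
      using prog unfolding computes_def by (metis UNIV_I fun_upd_apply not_less0)
    have run: "computes_in_time prog (enc_graph n E) t (enc_colouring n E c)"
      unfolding computes_in_time_def inp out[symmetric] using t(2) by (intro exI[of _ "?s(0 := enc (colour_matrix ?M))"]) simp
    have "bsize ?M + 2 \<le> 2 + (n + card E) + 2 * (n + card E) * (n + card E)"
    proof -
      have "n * n \<le> (n + card E) * (n + card E)" by (rule mult_mono) auto
      then show ?thesis using bsize_adjacency[of n E] by (simp add: algebra_simps)
    qed
    then have "(bsize ?M + 2) ^ b \<le> poly ([:2, 1, 2:] ^ b) (n + card E)"
      unfolding poly_power by (intro power_mono) (auto simp: algebra_simps)
    then have "t \<le> poly ([:2, 1, 2:] ^ b) (n + card E)" using t(1) T[of ?M] by linarith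
    then show "\<exists>c t. optimal_connecting_colouring {..<n} E c \<and>
        computes_in_time prog (enc_graph n E) t (enc_colouring n E c) \<and> t \<le> poly ([:2, 1, 2:] ^ b) (n + card E)"
      using c(1) run by blast
  qed
qed

theorem theorem7:
  "(\<forall>(V :: 'a set) E. finite_simple_graph V E \<and> connected_graph V E \<longrightarrow>
      proper_walk_connection_number V E =
        (if complete_graph V E then 1
         else if is_tree V E then max_degree V E
         else if bipartite_graph V E \<and> almost_two_edge_connected V E then 2
         else if \<not> bipartite_graph V E \<and>
                 (\<exists>K \<in> stubborn_free_components V E.
                    V - K = {} \<or>
                    almost_two_edge_connected (V - K) (induced_edges (V - K) E)) then 2
         else 3)) \<and>
   (\<exists>(prog :: com) (q :: nat poly).
      \<forall>(n :: nat) E. finite_simple_graph {..<n} E \<and> connected_graph {..<n} E \<longrightarrow>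
        (\<exists>c t. optimal_connecting_colouring {..<n} E c \<and>
               computes_in_time prog (enc_graph n E) t (enc_colouring n E c) \<and>
               t \<le> poly q (n + card E)))"
  using connection_number optimal_colouring_polynomial_time by blast

end
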